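(* Let $B$ be a bialgebra over a field $\Bbbk$, let $\mathcal{V}$ be the monoidal category of left $B$-comodules, and let $B\bullet B$ be the Hopf trimodule algebra with underlying space $B\otimes B$ described in the context. Then the monad $(B\bullet B)\square-$ on $\mathcal{V}$ is semisimple, and there is an equivalence of $\mathcal{V}$-module categories between the category $(B\bullet B)\text{-}\mathrm{Mod}$ of left $(B\bullet B)$-modules and the category $\mathbf{Vec}$ of $\Bbbk$-vector spaces, on which $\mathcal{V}$ acts through the fiber functor: $W\triangleright V=W\otimes V$.
   Context: A Hopf trimodule over $B$ is a $B$-$B$-bicomodule with a left $B$-action that is a morphism of left and right $B$-comodules (for the diagonal coactions on $B\otimes X$). Hopf trimodules form a monoidal category under the cotensor product $\square$ over $B$, with left action $b(x\otimes y)=b_{(1)}x\otimes b_{(2)}y$ and unit $B$; a Hopf trimodule algebra is an algebra object in it. For such an algebra $A$, $A\square-$ is a monad on $\mathcal{V}$, a left $A$-module is an object of its Eilenberg--Moore category (a left $B$-comodule $M$ with an associative unital comodule map $A\square M\to M$), and free modules are those of the form $A\square N$. $A\square-$ is a lax $\mathcal{V}$-module monad via $M\otimes(A\square N)\to A\square(M\otimes N)$, $m\otimes a\otimes n\mapsto m_{(-1)}a\otimes m_{(0)}\otimes n$. The Hopf trimodule algebra $B\bullet B$: underlying space $B\otimes B$; left coaction $b\otimes c\mapsto b_{(1)}\otimes b_{(2)}\otimes c$; right coaction $b\otimes c\mapsto b\otimes c_{(1)}\otimes c_{(2)}$; left action $x\otimes b\otimes c\mapsto x_{(1)}b\otimes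 x_{(2)}c$; unit $\eta=\Delta\colon B\to B\otimes B$; multiplication the restriction of $\mathrm{id}\otimes\varepsilon\otimes\varepsilon\otimes\mathrm{id}$ to $(B\bullet B)\square(B\bullet B)\subseteq B^{\otimes4}$, where $\varepsilon$ is the counit. The $\mathcal{V}$-module structure on $(B\bullet B)\text{-}\mathrm{Mod}$ is the one extended from free modules, i.e. such that the inclusion of the category of free modules, with action $W\triangleright((B\bullet B)\square N)=(B\bullet B)\square(W\otimes N)$, is a strong $\mathcal{V}$-module functor. A $\Bbbk$-linear category is semisimple if every object is a direct sum of simple objects, where an object is simple if each of its nonzero endomorphisms is an isomorphism. A monad on an abelian category is semisimple if its Eilenberg--Moore category is semisimple (equivalently, if the Cauchy completion of its Kleisli category is). *)

theory Defs
  imports "HOL-Algebra.Module"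
begin

section \<open>Linear categories\<close>

text \<open>Composition is written in the usual order: \<open>g \<cdot> f\<close> is \<open>g\<close> after \<open>f\<close>. The fields \<open>mult\<close> and \<open>one\<close>
  that HOL-Algebra's type of modules inherits from rings play no role in \<open>Hom C X Y\<close>.\<close>

record ('k, 'o, 'm) kcat =
  Obj :: "'o set"
  Dom :: "'m \<Rightarrow> 'o"
  Cod :: "'m \<Rightarrow> 'o"
  Hom :: "'o \<Rightarrow> 'o \<Rightarrow> ('k, 'm) module"
  Comp :: "'m \<Rightarrow> 'm \<Rightarrow> 'm"  (infixr \<open>\<cdot>\<index>\<close> 70)
  Ident :: "'o \<Rightarrow> 'm"

definition arr :: "('k, 'o, 'm, 'z) kcat_scheme \<Rightarrow> 'o \<Rightarrow> 'o \<Rightarrow> 'm set" where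
  "arr C X Y = carrier (Hom C X Y)"

locale linear_category =
  fixes K :: "('k, 'r) ring_scheme" and C :: "('k, 'o, 'm, 'z) kcat_scheme"
  assumes hom_module: "\<lbrakk>X \<in> Obj C; Y \<in> Obj C\<rbrakk> \<Longrightarrow> module K (Hom C X Y)"
    and dom_cod: "\<lbrakk>X \<in> Obj C; Y \<in> Obj C; f \<in> arr C X Y\<rbrakk> \<Longrightarrow> Dom C f = X \<and> Cod C f = Y"
    and ident_arr: "X \<in> Obj C \<Longrightarrow> Ident C X \<in> arr C X X"
    and comp_arr: "\<lbrakk>X \<in> Obj C; Y \<in> Obj C; Z \<in> Obj C; f \<in> arr C X Y; g \<in> arr C Y Z\<rbrakk>
          \<Longrightarrow> g \<cdot>\<^bsub>C\<^esub> f \<in> arr C X Z"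
    and comp_ident_left: "\<lbrakk>X \<in> Obj C; Y \<in> Obj C; f \<in> arr C X Y\<rbrakk> \<Longrightarrow> Ident C Y \<cdot>\<^bsub>C\<^esub> f = f"
    and comp_ident_right: "\<lbrakk>X \<in> Obj C; Y \<in> Obj C; f \<in> arr C X Y\<rbrakk> \<Longrightarrow> f \<cdot>\<^bsub>C\<^esub> Ident C X = f"
    and comp_assoc: "\<lbrakk>W \<in> Obj C; X \<in> Obj C; Y \<in> Obj C; Z \<in> Obj C;
            f \<in> arr C W X; g \<in> arr C X Y; h \<in> arr C Y Z\<rbrakk>
          \<Longrightarrow> (h \<cdot>\<^bsub>C\<^esub> g) \<cdot>\<^bsub>C\<^esub> f = h \<cdot>\<^bsub>C\<^esub> (g \<cdot>\<^bsub>C\<^esub> f)"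
    and comp_add_right: "\<lbrakk>X \<in> Obj C; Y \<in> Obj C; Z \<in> Obj C;
            f \<in> arr C X Y; f' \<in> arr C X Y; g \<in> arr C Y Z\<rbrakk>
          \<Longrightarrow> g \<cdot>\<^bsub>C\<^esub> (f \<oplus>\<^bsub>Hom C X Y\<^esub> f') = (g \<cdot>\<^bsub>C\<^esub> f) \<oplus>\<^bsub>Hom C X Z\<^esub> (g \<cdot>\<^bsub>C\<^esub> f')"
    and comp_add_left: "\<lbrakk>X \<in> Obj C; Y \<in> Obj C; Z \<in> Obj C;
            f \<in> arr C X Y; g \<in> arr C Y Z; g' \<in> arr C Y Z\<rbrakk>
          \<Longrightarrow> (g \<oplus>\<^bsub>Hom C Y Z\<^esub> g') \<cdot>\<^bsub>C\<^esub> f = (g \<cdot>\<^bsub>C\<^esub> f) \<oplus>\<^bsub>Hom C X Z\<^esub> (g' \<cdot>\<^bsub>C\<^esub> f)"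
    and comp_smult_right: "\<lbrakk>X \<in> Obj C; Y \<in> Obj C; Z \<in> Obj C; a \<in> carrier K;
            f \<in> arr C X Y; g \<in> arr C Y Z\<rbrakk>
          \<Longrightarrow> g \<cdot>\<^bsub>C\<^esub> (a \<odot>\<^bsub>Hom C X Y\<^esub> f) = a \<odot>\<^bsub>Hom C X Z\<^esub> (g \<cdot>\<^bsub>C\<^esub> f)"
    and comp_smult_left: "\<lbrakk>X \<in> Obj C; Y \<in> Obj C; Z \<in> Obj C; a \<in> carrier K;
            f \<in> arr C X Y; g \<in> arr C Y Z\<rbrakk>
          \<Longrightarrow> (a \<odot>\<^bsub>Hom C Y Z\<^esub> g) \<cdot>\<^bsub>C\<^esub> f = a \<odot>\<^bsub>Hom C X Z\<^esub> (g \<cdot>\<^bsub>C\<^esub> f)"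

definition is_iso :: "('k, 'o, 'm, 'z) kcat_scheme \<Rightarrow> 'o \<Rightarrow> 'o \<Rightarrow> 'm \<Rightarrow> bool" where
  "is_iso C X Y f \<longleftrightarrow> f \<in> arr C X Y \<and>
     (\<exists>g \<in> arr C Y X. g \<cdot>\<^bsub>C\<^esub> f = Ident C X \<and> f \<cdot>\<^bsub>C\<^esub> g = Ident C Y)"

record ('o, 'm, 'p, 'n) funct =
  FObj :: "'o \<Rightarrow> 'p"
  FArr :: "'m \<Rightarrow> 'n"

definition ident_funct :: "('o, 'm, 'o, 'm) funct" where
  "ident_funct = \<lparr>FObj = (\<lambda>X. X), FArr = (\<lambda>f. f)\<rparr>"

definition comp_funct ::
  "('p, 'n, 'q, 'l) funct \<Rightarrow> ('o, 'm, 'p, 'n) funct \<Rightarrow> ('o, 'm, 'q, 'l) funct" where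
  "comp_funct G F = \<lparr>FObj = (\<lambda>X. FObj G (FObj F X)), FArr = (\<lambda>f. FArr G (FArr F f))\<rparr>"

locale linear_functor =
  source: linear_category K C + target: linear_category K D
  for K :: "('k, 'r) ring_scheme" and C :: "('k, 'o, 'm, 'y) kcat_scheme"
    and D :: "('k, 'p, 'n, 'z) kcat_scheme" +
  fixes F :: "('o, 'm, 'p, 'n) funct"
  assumes fobj: "X \<in> Obj C \<Longrightarrow> FObj F X \<in> Obj D"
    and farr: "\<lbrakk>X \<in> Obj C; Y \<in> Obj C; f \<in> arr C X Y\<rbrakk> \<Longrightarrow> FArr F f \<in> arr D (FObj F X) (FObj F Y)"
    and fident: "X \<in> Obj C \<Longrightarrow> FArr F (Ident C X) = Ident D (FObj F X)"
    and fcomp: "\<lbrakk>X \<in> Obj C; Y \<in> Obj C; Z \<in> Obj C; f \<in> arr C X Y; g \<in> arr C Y Z\<rbrakk>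
          \<Longrightarrow> FArr F (g \<cdot>\<^bsub>C\<^esub> f) = FArr F g \<cdot>\<^bsub>D\<^esub> FArr F f"
    and fadd: "\<lbrakk>X \<in> Obj C; Y \<in> Obj C; f \<in> arr C X Y; g \<in> arr C X Y\<rbrakk>
          \<Longrightarrow> FArr F (f \<oplus>\<^bsub>Hom C X Y\<^esub> g) = FArr F f \<oplus>\<^bsub>Hom D (FObj F X) (FObj F Y)\<^esub> FArr F g"
    and fsmult: "\<lbrakk>X \<in> Obj C; Y \<in> Obj C; a \<in> carrier K; f \<in> arr C X Y\<rbrakk>
          \<Longrightarrow> FArr F (a \<odot>\<^bsub>Hom C X Y\<^esub> f) = a \<odot>\<^bsub>Hom D (FObj F X) (FObj F Y)\<^esub> FArr F f"

definition natural_trans :: "('k, 'o, 'm, 'y) kcat_scheme \<Rightarrow> ('k, 'p, 'n, 'z) kcat_scheme \<Rightarrow>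
    ('o, 'm, 'p, 'n) funct \<Rightarrow> ('o, 'm, 'p, 'n) funct \<Rightarrow> ('o \<Rightarrow> 'n) \<Rightarrow> bool" where
  "natural_trans C D F G t \<longleftrightarrow>
     (\<forall>X \<in> Obj C. t X \<in> arr D (FObj F X) (FObj G X)) \<and>
     (\<forall>X \<in> Obj C. \<forall>Y \<in> Obj C. \<forall>f \<in> arr C X Y. t Y \<cdot>\<^bsub>D\<^esub> FArr F f = FArr G f \<cdot>\<^bsub>D\<^esub> t X)"

definition natural_iso :: "('k, 'o, 'm, 'y) kcat_scheme \<Rightarrow> ('k, 'p, 'n, 'z) kcat_scheme \<Rightarrow>
    ('o, 'm, 'p, 'n) funct \<Rightarrow> ('o, 'm, 'p, 'n) funct \<Rightarrow> ('o \<Rightarrow> 'n) \<Rightarrow> bool" where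
  "natural_iso C D F G t \<longleftrightarrow>
     natural_trans C D F G t \<and> (\<forall>X \<in> Obj C. is_iso D (FObj F X) (FObj G X) (t X))"

definition equivalence_of_categories :: "('k, 'r) ring_scheme \<Rightarrow> ('k, 'o, 'm, 'y) kcat_scheme \<Rightarrow>
    ('k, 'p, 'n, 'z) kcat_scheme \<Rightarrow> ('o, 'm, 'p, 'n) funct \<Rightarrow> bool" where
  "equivalence_of_categories K C D F \<longleftrightarrow> linear_functor K C D F \<and>
     (\<exists>G s t. linear_functor K D C G \<and>
        natural_iso C C ident_funct (comp_funct G F) s \<and>
        natural_iso D D (comp_funct F G) ident_funct t)"

subsection \<open>Semisimplicity\<close>

definition simple_object :: "('k, 'o, 'm, 'z) kcat_scheme \<Rightarrow> 'o \<Rightarrow> bool" where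
  "simple_object C S \<longleftrightarrow> S \<in> Obj C \<and>
     (\<forall>f \<in> arr C S S. f \<noteq> \<zero>\<^bsub>Hom C S S\<^esub> \<longrightarrow> is_iso C S S f)"

text \<open>Possibly infinite direct sums are coproducts.\<close>

definition is_direct_sum :: "('k, 'o, 'm, 'z) kcat_scheme \<Rightarrow> 'i set \<Rightarrow> ('i \<Rightarrow> 'o) \<Rightarrow>
    ('i \<Rightarrow> 'm) \<Rightarrow> 'o \<Rightarrow> bool" where
  "is_direct_sum C I S inc X \<longleftrightarrow> X \<in> Obj C \<and>
     (\<forall>i \<in> I. S i \<in> Obj C \<and> inc i \<in> arr C (S i) X) \<and>
     (\<forall>Y \<in> Obj C. \<forall>f. (\<forall>i \<in> I. f i \<in> arr C (S i) Y) \<longrightarrow>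
        (\<exists>!g. g \<in> arr C X Y \<and> (\<forall>i \<in> I. g \<cdot>\<^bsub>C\<^esub> inc i = f i)))"

text \<open>Index sets are taken in the type of arrows. This is no restriction: zero summands may be
  dropped, and the injections of the nonzero summands are pairwise distinct, so that any
  decomposition can be indexed by its own injections.\<close>

definition semisimple :: "('k, 'o, 'm, 'z) kcat_scheme \<Rightarrow> bool" where
  "semisimple C \<longleftrightarrow> (\<forall>X \<in> Obj C. \<exists>(I :: 'm set) S inc.
     (\<forall>i \<in> I. simple_object C (S i)) \<and> is_direct_sum C I S inc X)"

section \<open>Monoidal categories and module categories\<close>

locale linear_bifunctor =
  left: linear_category K A + right: linear_category K C + target: linear_category K D
  for K :: "('k, 'r) ring_scheme" and A :: "('k, 'a, 'l, 'x) kcat_scheme"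
    and C :: "('k, 'o, 'm, 'y) kcat_scheme" and D :: "('k, 'p, 'n, 'z) kcat_scheme" +
  fixes BO :: "'a \<Rightarrow> 'o \<Rightarrow> 'p" and BA :: "'l \<Rightarrow> 'm \<Rightarrow> 'n"
  assumes bobj: "\<lbrakk>W \<in> Obj A; X \<in> Obj C\<rbrakk> \<Longrightarrow> BO W X \<in> Obj D"
    and barr: "\<lbrakk>W \<in> Obj A; W' \<in> Obj A; X \<in> Obj C; X' \<in> Obj C; g \<in> arr A W W'; f \<in> arr C X X'\<rbrakk>
          \<Longrightarrow> BA g f \<in> arr D (BO W X) (BO W' X')"
    and bident: "\<lbrakk>W \<in> Obj A; X \<in> Obj C\<rbrakk> \<Longrightarrow> BA (Ident A W) (Ident C X) = Ident D (BO W X)"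
    and bcomp: "\<lbrakk>W \<in> Obj A; W' \<in> Obj A; W'' \<in> Obj A; X \<in> Obj C; X' \<in> Obj C; X'' \<in> Obj C;
            g \<in> arr A W W'; g' \<in> arr A W' W''; f \<in> arr C X X'; f' \<in> arr C X' X''\<rbrakk>
          \<Longrightarrow> BA (g' \<cdot>\<^bsub>A\<^esub> g) (f' \<cdot>\<^bsub>C\<^esub> f) = BA g' f' \<cdot>\<^bsub>D\<^esub> BA g f"
    and badd_left: "\<lbrakk>W \<in> Obj A; W' \<in> Obj A; X \<in> Obj C; X' \<in> Obj C;
            g \<in> arr A W W'; g' \<in> arr A W W'; f \<in> arr C X X'\<rbrakk>
          \<Longrightarrow> BA (g \<oplus>\<^bsub>Hom A W W'\<^esub> g') f = BA g f \<oplus>\<^bsub>Hom D (BO W X) (BO W' X')\<^esub> BA g' f"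
    and badd_right: "\<lbrakk>W \<in> Obj A; W' \<in> Obj A; X \<in> Obj C; X' \<in> Obj C;
            g \<in> arr A W W'; f \<in> arr C X X'; f' \<in> arr C X X'\<rbrakk>
          \<Longrightarrow> BA g (f \<oplus>\<^bsub>Hom C X X'\<^esub> f') = BA g f \<oplus>\<^bsub>Hom D (BO W X) (BO W' X')\<^esub> BA g f'"
    and bsmult_left: "\<lbrakk>W \<in> Obj A; W' \<in> Obj A; X \<in> Obj C; X' \<in> Obj C; a \<in> carrier K;
            g \<in> arr A W W'; f \<in> arr C X X'\<rbrakk>
          \<Longrightarrow> BA (a \<odot>\<^bsub>Hom A W W'\<^esub> g) f = a \<odot>\<^bsub>Hom D (BO W X) (BO W' X')\<^esub> BA g f"
    and bsmult_right: "\<lbrakk>W \<in> Obj A; W' \<in> Obj A; X \<in> Obj C; X' \<in> Obj C; a \<in> carrier K;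
            g \<in> arr A W W'; f \<in> arr C X X'\<rbrakk>
          \<Longrightarrow> BA g (a \<odot>\<^bsub>Hom C X X'\<^esub> f) = a \<odot>\<^bsub>Hom D (BO W X) (BO W' X')\<^esub> BA g f"

record ('k, 'o, 'm) moncat = "('k, 'o, 'm) kcat" +
  Tens :: "'o \<Rightarrow> 'o \<Rightarrow> 'o"
  TensA :: "'m \<Rightarrow> 'm \<Rightarrow> 'm"
  Unit :: "'o"
  Assoc :: "'o \<Rightarrow> 'o \<Rightarrow> 'o \<Rightarrow> 'm"
  LUnit :: "'o \<Rightarrow> 'm"
  RUnit :: "'o \<Rightarrow> 'm"

locale monoidal_category =
  linear_bifunctor K V V V "Tens V" "TensA V"
  for K :: "('k, 'r) ring_scheme" and V :: "('k, 'o, 'm, 'z) moncat_scheme" +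
  assumes unit_obj: "Unit V \<in> Obj V"
    and assoc_iso: "\<lbrakk>X \<in> Obj V; Y \<in> Obj V; Z \<in> Obj V\<rbrakk>
          \<Longrightarrow> is_iso V (Tens V (Tens V X Y) Z) (Tens V X (Tens V Y Z)) (Assoc V X Y Z)"
    and lunit_iso: "X \<in> Obj V \<Longrightarrow> is_iso V (Tens V (Unit V) X) X (LUnit V X)"
    and runit_iso: "X \<in> Obj V \<Longrightarrow> is_iso V (Tens V X (Unit V)) X (RUnit V X)"
    and assoc_natural: "\<lbrakk>X \<in> Obj V; X' \<in> Obj V; Y \<in> Obj V; Y' \<in> Obj V; Z \<in> Obj V; Z' \<in> Obj V;
            f \<in> arr V X X'; g \<in> arr V Y Y'; h \<in> arr V Z Z'\<rbrakk>
          \<Longrightarrow> Assoc V X' Y' Z' \<cdot>\<^bsub>V\<^esub> TensA V (TensA V f g) h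
            = TensA V f (TensA V g h) \<cdot>\<^bsub>V\<^esub> Assoc V X Y Z"
    and lunit_natural: "\<lbrakk>X \<in> Obj V; X' \<in> Obj V; f \<in> arr V X X'\<rbrakk>
          \<Longrightarrow> LUnit V X' \<cdot>\<^bsub>V\<^esub> TensA V (Ident V (Unit V)) f = f \<cdot>\<^bsub>V\<^esub> LUnit V X"
    and runit_natural: "\<lbrakk>X \<in> Obj V; X' \<in> Obj V; f \<in> arr V X X'\<rbrakk>
          \<Longrightarrow> RUnit V X' \<cdot>\<^bsub>V\<^esub> TensA V f (Ident V (Unit V)) = f \<cdot>\<^bsub>V\<^esub> RUnit V X"
    and pentagon: "\<lbrakk>W \<in> Obj V; X \<in> Obj V; Y \<in> Obj V; Z \<in> Obj V\<rbrakk>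
          \<Longrightarrow> TensA V (Ident V W) (Assoc V X Y Z) \<cdot>\<^bsub>V\<^esub>
                (Assoc V W (Tens V X Y) Z \<cdot>\<^bsub>V\<^esub> TensA V (Assoc V W X Y) (Ident V Z))
            = Assoc V W X (Tens V Y Z) \<cdot>\<^bsub>V\<^esub> Assoc V (Tens V W X) Y Z"
    and triangle: "\<lbrakk>X \<in> Obj V; Y \<in> Obj V\<rbrakk>
          \<Longrightarrow> TensA V (Ident V X) (LUnit V Y) \<cdot>\<^bsub>V\<^esub> Assoc V X (Unit V) Y
            = TensA V (RUnit V X) (Ident V Y)"

text \<open>An action of \<open>V\<close> on \<open>C\<close>, with structure isomorphisms
  \<open>AAssoc W W' X : (W \<otimes> W') \<rhd> X \<rightarrow> W \<rhd> (W' \<rhd> X)\<close> and \<open>AUnit X : 1 \<rhd> X \<rightarrow> X\<close>.\<close>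

record ('v, 'w, 'o, 'm) action =
  Act :: "'v \<Rightarrow> 'o \<Rightarrow> 'o"
  ActA :: "'w \<Rightarrow> 'm \<Rightarrow> 'm"
  AAssoc :: "'v \<Rightarrow> 'v \<Rightarrow> 'o \<Rightarrow> 'm"
  AUnit :: "'o \<Rightarrow> 'm"

locale module_category =
  monoidal_category K V + linear_category K C +
  act: linear_bifunctor K V C C "Act L" "ActA L"
  for K :: "('k, 'r) ring_scheme" and V :: "('k, 'v, 'w, 'y) moncat_scheme"
    and C :: "('k, 'o, 'm, 'z) kcat_scheme" and L :: "('v, 'w, 'o, 'm) action" +
  assumes aassoc_iso: "\<lbrakk>W \<in> Obj V; W' \<in> Obj V; X \<in> Obj C\<rbrakk>
          \<Longrightarrow> is_iso C (Act L (Tens V W W') X) (Act L W (Act L W' X)) (AAssoc L W W' X)"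
    and aunit_iso: "X \<in> Obj C \<Longrightarrow> is_iso C (Act L (Unit V) X) X (AUnit L X)"
    and aassoc_natural: "\<lbrakk>U \<in> Obj V; U' \<in> Obj V; W \<in> Obj V; W' \<in> Obj V; X \<in> Obj C; X' \<in> Obj C;
            f \<in> arr V U U'; g \<in> arr V W W'; h \<in> arr C X X'\<rbrakk>
          \<Longrightarrow> AAssoc L U' W' X' \<cdot>\<^bsub>C\<^esub> ActA L (TensA V f g) h
            = ActA L f (ActA L g h) \<cdot>\<^bsub>C\<^esub> AAssoc L U W X"
    and aunit_natural: "\<lbrakk>X \<in> Obj C; X' \<in> Obj C; h \<in> arr C X X'\<rbrakk>
          \<Longrightarrow> AUnit L X' \<cdot>\<^bsub>C\<^esub> ActA L (Ident V (Unit V)) h = h \<cdot>\<^bsub>C\<^esub> AUnit L X"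
    and action_pentagon: "\<lbrakk>U \<in> Obj V; W \<in> Obj V; W' \<in> Obj V; X \<in> Obj C\<rbrakk>
          \<Longrightarrow> ActA L (Ident V U) (AAssoc L W W' X) \<cdot>\<^bsub>C\<^esub>
                (AAssoc L U (Tens V W W') X \<cdot>\<^bsub>C\<^esub> ActA L (Assoc V U W W') (Ident C X))
            = AAssoc L U W (Act L W' X) \<cdot>\<^bsub>C\<^esub> AAssoc L (Tens V U W) W' X"
    and action_triangle: "\<lbrakk>W \<in> Obj V; X \<in> Obj C\<rbrakk>
          \<Longrightarrow> ActA L (Ident V W) (AUnit L X) \<cdot>\<^bsub>C\<^esub> AAssoc L W (Unit V) X
            = ActA L (RUnit V W) (Ident C X)"

text \<open>The structure isomorphism of a strong module functor is
  \<open>s W X : W \<rhd> F X \<rightarrow> F (W \<rhd> X)\<close>.\<close>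

locale strong_module_functor =
  source_action: module_category K V C L + target_action: module_category K V D M +
  linear_functor K C D F
  for K :: "('k, 'r) ring_scheme" and V :: "('k, 'v, 'w, 'x) moncat_scheme"
    and C :: "('k, 'o, 'm, 'y) kcat_scheme" and L :: "('v, 'w, 'o, 'm) action"
    and D :: "('k, 'p, 'n, 'z) kcat_scheme" and M :: "('v, 'w, 'p, 'n) action"
    and F :: "('o, 'm, 'p, 'n) funct" +
  fixes s :: "'v \<Rightarrow> 'o \<Rightarrow> 'n"
  assumes strength_iso: "\<lbrakk>W \<in> Obj V; X \<in> Obj C\<rbrakk>
          \<Longrightarrow> is_iso D (Act M W (FObj F X)) (FObj F (Act L W X)) (s W X)"
    and strength_natural: "\<lbrakk>W \<in> Obj V; W' \<in> Obj V; X \<in> Obj C; X' \<in> Obj C;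
            g \<in> arr V W W'; f \<in> arr C X X'\<rbrakk>
          \<Longrightarrow> s W' X' \<cdot>\<^bsub>D\<^esub> ActA M g (FArr F f) = FArr F (ActA L g f) \<cdot>\<^bsub>D\<^esub> s W X"
    and strength_assoc: "\<lbrakk>W \<in> Obj V; W' \<in> Obj V; X \<in> Obj C\<rbrakk>
          \<Longrightarrow> FArr F (AAssoc L W W' X) \<cdot>\<^bsub>D\<^esub> s (Tens V W W') X
            = s W (Act L W' X) \<cdot>\<^bsub>D\<^esub>
                (ActA M (Ident V W) (s W' X) \<cdot>\<^bsub>D\<^esub> AAssoc M W W' (FObj F X))"
    and strength_unit: "X \<in> Obj C
          \<Longrightarrow> FArr F (AUnit L X) \<cdot>\<^bsub>D\<^esub> s (Unit V) X = AUnit M (FObj F X)"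

definition module_category_equivalence :: "('k, 'r) ring_scheme \<Rightarrow>
    ('k, 'v, 'w, 'x) moncat_scheme \<Rightarrow>
    ('k, 'o, 'm, 'y) kcat_scheme \<Rightarrow> ('v, 'w, 'o, 'm) action \<Rightarrow>
    ('k, 'p, 'n, 'z) kcat_scheme \<Rightarrow> ('v, 'w, 'p, 'n) action \<Rightarrow> bool" where
  "module_category_equivalence K V C L D M \<longleftrightarrow>
     (\<exists>F s. strong_module_functor K V C L D M F s \<and> equivalence_of_categories K C D F)"

section \<open>Monads\<close>

datatype ('o, 'f) arrow = Arrow (src: 'o) (tgt: 'o) (mor: 'f)

definition arrow_module :: "'o \<Rightarrow> 'o \<Rightarrow> ('k, 'f) module \<Rightarrow> ('k, ('o, 'f) arrow) module" where
  "arrow_module X Y H =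
    \<lparr>carrier = Arrow X Y ` carrier H,
     mult = undefined, one = undefined,
     zero = Arrow X Y \<zero>\<^bsub>H\<^esub>,
     add = (\<lambda>f g. Arrow X Y (mor f \<oplus>\<^bsub>H\<^esub> mor g)),
     smult = (\<lambda>a f. Arrow X Y (a \<odot>\<^bsub>H\<^esub> mor f))\<rparr>"

record ('o, 'm) monad =
  MFun :: "('o, 'm, 'o, 'm) funct"
  Eta :: "'o \<Rightarrow> 'm"
  Mu :: "'o \<Rightarrow> 'm"

locale linear_monad =
  linear_functor K C C "MFun T"
  for K :: "('k, 'r) ring_scheme" and C :: "('k, 'o, 'm, 'z) kcat_scheme"
    and T :: "('o, 'm) monad" +
  assumes eta_natural: "natural_trans C C ident_funct (MFun T) (Eta T)"
    and mu_natural: "natural_trans C C (comp_funct (MFun T) (MFun T)) (MFun T) (Mu T)"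
    and mu_eta_left: "X \<in> Obj C \<Longrightarrow> Mu T X \<cdot>\<^bsub>C\<^esub> Eta T (FObj (MFun T) X) = Ident C (FObj (MFun T) X)"
    and mu_eta_right: "X \<in> Obj C \<Longrightarrow> Mu T X \<cdot>\<^bsub>C\<^esub> FArr (MFun T) (Eta T X) = Ident C (FObj (MFun T) X)"
    and mu_assoc: "X \<in> Obj C
          \<Longrightarrow> Mu T X \<cdot>\<^bsub>C\<^esub> FArr (MFun T) (Mu T X) = Mu T X \<cdot>\<^bsub>C\<^esub> Mu T (FObj (MFun T) X)"

definition EM :: "('k, 'o, 'm, 'z) kcat_scheme \<Rightarrow> ('o, 'm) monad \<Rightarrow>
    ('k, 'o \<times> 'm, ('o \<times> 'm, 'm) arrow) kcat" where
  "EM C T =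
    \<lparr>Obj = {(X, h). X \<in> Obj C \<and> h \<in> arr C (FObj (MFun T) X) X \<and>
        h \<cdot>\<^bsub>C\<^esub> Eta T X = Ident C X \<and> h \<cdot>\<^bsub>C\<^esub> FArr (MFun T) h = h \<cdot>\<^bsub>C\<^esub> Mu T X},
     Dom = src, Cod = tgt,
     Hom = (\<lambda>P Q. arrow_module P Q ((Hom C (fst P) (fst Q))
        \<lparr>carrier := {f \<in> arr C (fst P) (fst Q). f \<cdot>\<^bsub>C\<^esub> snd P = snd Q \<cdot>\<^bsub>C\<^esub> FArr (MFun T) f}\<rparr>)),
     Comp = (\<lambda>g f. Arrow (src f) (tgt g) (mor g \<cdot>\<^bsub>C\<^esub> mor f)),
     Ident = (\<lambda>P. Arrow P P (Ident C (fst P)))\<rparr>"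

definition semisimple_monad :: "('k, 'r) ring_scheme \<Rightarrow> ('k, 'o, 'm, 'z) kcat_scheme \<Rightarrow>
    ('o, 'm) monad \<Rightarrow> bool" where
  "semisimple_monad K C T \<longleftrightarrow> linear_monad K C T \<and> semisimple (EM C T)"

definition free_module :: "('o, 'm) monad \<Rightarrow> 'o \<Rightarrow> 'o \<times> 'm" where
  "free_module T X = (FObj (MFun T) X, Mu T X)"

text \<open>The category of free modules: the object \<open>X\<close> stands for the free module on \<open>X\<close>, and the
  morphisms are all module morphisms between free modules.\<close>

definition Free :: "('k, 'o, 'm, 'z) kcat_scheme \<Rightarrow> ('o, 'm) monad \<Rightarrow>
    ('k, 'o, ('o, ('o \<times> 'm, 'm) arrow) arrow) kcat" where
  "Free C T =
    \<lparr>Obj = Obj C, Dom = src, Cod = tgt,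
     Hom = (\<lambda>X Y. arrow_module X Y (Hom (EM C T) (free_module T X) (free_module T Y))),
     Comp = (\<lambda>g f. Arrow (src f) (tgt g) (mor g \<cdot>\<^bsub>EM C T\<^esub> mor f)),
     Ident = (\<lambda>X. Arrow X X (Ident (EM C T) (free_module T X)))\<rparr>"

definition free_inclusion ::
  "('o, 'm) monad \<Rightarrow> ('o, ('o, ('o \<times> 'm, 'm) arrow) arrow, 'o \<times> 'm, ('o \<times> 'm, 'm) arrow) funct" where
  "free_inclusion T = \<lparr>FObj = free_module T, FArr = mor\<rparr>"

definition free_arrow :: "('o, 'm) monad \<Rightarrow> 'o \<Rightarrow> 'o \<Rightarrow> 'm \<Rightarrow> ('o, ('o \<times> 'm, 'm) arrow) arrow" where
  "free_arrow T X Y f = Arrow X Y (Arrow (free_module T X) (free_module T Y) f)"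

text \<open>For a lax module monad \<open>T\<close> on \<open>V\<close> with structure maps \<open>lax W X : W \<otimes> T X \<rightarrow> T (W \<otimes> X)\<close>, the
  action \<open>W \<rhd> T X = T (W \<otimes> X)\<close> on free modules. For \<open>g : W \<rightarrow> W'\<close> and a module morphism
  \<open>f : T X \<rightarrow> T X'\<close>, the morphism \<open>g \<rhd> f\<close> is the extension to \<open>T (W \<otimes> X)\<close> of
  \<open>lax \<cdot> (g \<otimes> (f \<cdot> \<eta>)) : W \<otimes> X \<rightarrow> W' \<otimes> T X' \<rightarrow> T (W' \<otimes> X')\<close>.\<close>

definition free_action :: "('k, 'o, 'm, 'z) moncat_scheme \<Rightarrow> ('o, 'm) monad \<Rightarrow> ('o \<Rightarrow> 'o \<Rightarrow> 'm) \<Rightarrow>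
    ('o, 'm, 'o, ('o, ('o \<times> 'm, 'm) arrow) arrow) action" where
  "free_action V T lax =
    \<lparr>Act = Tens V,
     ActA = (\<lambda>g f. free_arrow T (Tens V (Dom V g) (src f)) (Tens V (Cod V g) (tgt f))
        (Mu T (Tens V (Cod V g) (tgt f)) \<cdot>\<^bsub>V\<^esub>
          FArr (MFun T) (lax (Cod V g) (tgt f) \<cdot>\<^bsub>V\<^esub>
            TensA V g (mor (mor f) \<cdot>\<^bsub>V\<^esub> Eta T (src f))))),
     AAssoc = (\<lambda>W W' X. free_arrow T (Tens V (Tens V W W') X) (Tens V W (Tens V W' X))
        (FArr (MFun T) (Assoc V W W' X))),
     AUnit = (\<lambda>X. free_arrow T (Tens V (Unit V) X) X (FArr (MFun T) (LUnit V X)))\<rparr>"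

definition extends_free_action :: "('k, 'r) ring_scheme \<Rightarrow> ('k, 'o, 'm, 'z) moncat_scheme \<Rightarrow>
    ('o, 'm) monad \<Rightarrow> ('o \<Rightarrow> 'o \<Rightarrow> 'm) \<Rightarrow>
    ('o, 'm, 'o \<times> 'm, ('o \<times> 'm, 'm) arrow) action \<Rightarrow> bool" where
  "extends_free_action K V T lax L \<longleftrightarrow>
     module_category K V (EM V T) L \<and>
     (\<exists>s. strong_module_functor K V (Free V T) (free_action V T lax) (EM V T) L (free_inclusion T) s)"

section \<open>Vector spaces and tensor products\<close>

text \<open>Vector spaces have their carriers in a type that is closed under tensor products: \<open>Formal\<close>
  of a list of pairs \<open>(v, w)\<close> stands for the sum of the \<open>v \<otimes> w\<close>. The type \<open>'a\<close> is arbitrary, and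
  every structure with carrier in \<open>'a\<close> is available via \<open>Atom\<close>.\<close>

datatype 'a univ = Atom 'a | Formal (summands: "('a univ \<times> 'a univ) list")

type_synonym 'a space = "('a univ, 'a univ) module"
type_synonym 'a fn = "'a univ \<Rightarrow> 'a univ"

inductive tensor_eq :: "('a univ, 'r) ring_scheme \<Rightarrow> ('a univ, 'a univ, 'x) module_scheme \<Rightarrow>
    ('a univ, 'a univ, 'y) module_scheme \<Rightarrow> ('a univ \<times> 'a univ) list \<Rightarrow>
    ('a univ \<times> 'a univ) list \<Rightarrow> bool"
  for K V W where
  refl: "set l \<subseteq> carrier V \<times> carrier W \<Longrightarrow> tensor_eq K V W l l"
| sym: "tensor_eq K V W l l' \<Longrightarrow> tensor_eq K V W l' l"
| trans: "tensor_eq K V W l l' \<Longrightarrow> tensor_eq K V W l' l'' \<Longrightarrow> tensor_eq K V W l l''"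
| append: "tensor_eq K V W l l' \<Longrightarrow> tensor_eq K V W m m' \<Longrightarrow> tensor_eq K V W (l @ m) (l' @ m')"
| comm: "set l \<subseteq> carrier V \<times> carrier W \<Longrightarrow> set m \<subseteq> carrier V \<times> carrier W
    \<Longrightarrow> tensor_eq K V W (l @ m) (m @ l)"
| add_left: "\<lbrakk>v \<in> carrier V; v' \<in> carrier V; w \<in> carrier W\<rbrakk>
    \<Longrightarrow> tensor_eq K V W [(v \<oplus>\<^bsub>V\<^esub> v', w)] [(v, w), (v', w)]"
| add_right: "\<lbrakk>v \<in> carrier V; w \<in> carrier W; w' \<in> carrier W\<rbrakk>
    \<Longrightarrow> tensor_eq K V W [(v, w \<oplus>\<^bsub>W\<^esub> w')] [(v, w), (v, w')]"
| zero: "w \<in> carrier W \<Longrightarrow> tensor_eq K V W [(\<zero>\<^bsub>V\<^esub>, w)] []"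
| smult: "\<lbrakk>a \<in> carrier K; v \<in> carrier V; w \<in> carrier W\<rbrakk>
    \<Longrightarrow> tensor_eq K V W [(a \<odot>\<^bsub>V\<^esub> v, w)] [(v, a \<odot>\<^bsub>W\<^esub> w)]"

text \<open>An element of the tensor product is a class of formal sums modulo \<open>tensor_eq\<close>, encoded by a
  chosen member of that class.\<close>

definition tensor_class :: "('a univ, 'r) ring_scheme \<Rightarrow> ('a univ, 'a univ, 'x) module_scheme \<Rightarrow>
    ('a univ, 'a univ, 'y) module_scheme \<Rightarrow> ('a univ \<times> 'a univ) list \<Rightarrow> 'a univ" where
  "tensor_class K V W l = Formal (SOME l'. tensor_eq K V W l l')"

definition tensor :: "('a univ, 'r) ring_scheme \<Rightarrow> ('a univ, 'a univ, 'x) module_scheme \<Rightarrow>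
    ('a univ, 'a univ, 'y) module_scheme \<Rightarrow> 'a space" where
  "tensor K V W =
    \<lparr>carrier = tensor_class K V W ` {l. set l \<subseteq> carrier V \<times> carrier W},
     mult = undefined, one = undefined,
     zero = tensor_class K V W [],
     add = (\<lambda>x y. tensor_class K V W (summands x @ summands y)),
     smult = (\<lambda>a x. tensor_class K V W (map (\<lambda>(v, w). (a \<odot>\<^bsub>V\<^esub> v, w)) (summands x)))\<rparr>"

definition pure :: "('a univ, 'r) ring_scheme \<Rightarrow> ('a univ, 'a univ, 'x) module_scheme \<Rightarrow>
    ('a univ, 'a univ, 'y) module_scheme \<Rightarrow> 'a univ \<Rightarrow> 'a univ \<Rightarrow> 'a univ" where
  "pure K V W v w = tensor_class K V W [(v, w)]"

text \<open>The value at \<open>x\<close> of the linear map to \<open>U\<close> induced by a bilinear map \<open>\<beta>\<close>, that is, the sum of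
  the \<open>\<beta> v w\<close> in \<open>U\<close> if \<open>x\<close> is the sum of the \<open>v \<otimes> w\<close>. With \<open>x\<close> a coproduct or a coaction this is
  Sweedler notation.\<close>

definition tsum :: "('a univ, 'a univ, 'x) module_scheme \<Rightarrow> 'a univ \<Rightarrow>
    ('a univ \<Rightarrow> 'a univ \<Rightarrow> 'a univ) \<Rightarrow> 'a univ" where
  "tsum U x \<beta> = foldr (\<lambda>(v, w) s. \<beta> v w \<oplus>\<^bsub>U\<^esub> s) (summands x) \<zero>\<^bsub>U\<^esub>"

definition lin :: "('a univ, 'r) ring_scheme \<Rightarrow> ('a univ, 'a univ, 'x) module_scheme \<Rightarrow>
    ('a univ, 'a univ, 'y) module_scheme \<Rightarrow> 'a fn set" where
  "lin K V W = {f \<in> carrier V \<rightarrow> carrier W.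
     (\<forall>x \<in> carrier V. \<forall>y \<in> carrier V. f (x \<oplus>\<^bsub>V\<^esub> y) = f x \<oplus>\<^bsub>W\<^esub> f y) \<and>
     (\<forall>a \<in> carrier K. \<forall>x \<in> carrier V. f (a \<odot>\<^bsub>V\<^esub> x) = a \<odot>\<^bsub>W\<^esub> f x)}"

definition ground :: "'a univ ring \<Rightarrow> 'a space" where
  "ground K = ring.extend K (module.fields (mult K))"

definition tmap :: "('a univ, 'r) ring_scheme \<Rightarrow>
    ('a univ, 'a univ, 'x) module_scheme \<Rightarrow> ('a univ, 'a univ, 'y) module_scheme \<Rightarrow>
    ('a univ, 'a univ, 'x) module_scheme \<Rightarrow> ('a univ, 'a univ, 'y) module_scheme \<Rightarrow>
    'a fn \<Rightarrow> 'a fn \<Rightarrow> 'a fn" where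
  "tmap K V W V' W' f g =
     (\<lambda>x \<in> carrier (tensor K V W). tsum (tensor K V' W') x (\<lambda>v w. pure K V' W' (f v) (g w)))"

definition tassoc :: "('a univ, 'r) ring_scheme \<Rightarrow> ('a univ, 'a univ, 'x) module_scheme \<Rightarrow>
    ('a univ, 'a univ, 'y) module_scheme \<Rightarrow> ('a univ, 'a univ, 'z) module_scheme \<Rightarrow> 'a fn" where
  "tassoc K U V W = (let T = tensor K U (tensor K V W) in
     (\<lambda>x \<in> carrier (tensor K (tensor K U V) W).
        tsum T x (\<lambda>y w. tsum T y (\<lambda>u v. pure K U (tensor K V W) u (pure K V W v w)))))"

definition tlunit :: "'a univ ring \<Rightarrow> ('a univ, 'a univ, 'x) module_scheme \<Rightarrow> 'a fn" where
  "tlunit K V = (\<lambda>x \<in> carrier (tensor K (ground K) V). tsum V x (\<lambda>c v. c \<odot>\<^bsub>V\<^esub> v))"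

definition trunit :: "'a univ ring \<Rightarrow> ('a univ, 'a univ, 'x) module_scheme \<Rightarrow> 'a fn" where
  "trunit K V = (\<lambda>x \<in> carrier (tensor K V (ground K)). tsum V x (\<lambda>v c. c \<odot>\<^bsub>V\<^esub> v))"

text \<open>The category with the given class of vector spaces (possibly with extra structure) as objects
  and the given sets of linear maps as morphisms, with pointwise operations.\<close>

definition concrete_category :: "('a univ, 'a univ, 'x) module_scheme set \<Rightarrow>
    (('a univ, 'a univ, 'x) module_scheme \<Rightarrow> ('a univ, 'a univ, 'x) module_scheme \<Rightarrow> 'a fn set) \<Rightarrow>
    ('a univ, ('a univ, 'a univ, 'x) module_scheme,
      (('a univ, 'a univ, 'x) module_scheme, 'a fn) arrow) kcat" where
  "concrete_category Ob H =
    \<lparr>Obj = Ob, Dom = src, Cod = tgt,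
     Hom = (\<lambda>V W. arrow_module V W
        \<lparr>carrier = H V W \<inter> extensional (carrier V),
         mult = undefined, one = undefined,
         zero = (\<lambda>x \<in> carrier V. \<zero>\<^bsub>W\<^esub>),
         add = (\<lambda>f g. \<lambda>x \<in> carrier V. f x \<oplus>\<^bsub>W\<^esub> g x),
         smult = (\<lambda>a f. \<lambda>x \<in> carrier V. a \<odot>\<^bsub>W\<^esub> f x)\<rparr>),
     Comp = (\<lambda>g f. Arrow (src f) (tgt g) (compose (carrier (src f)) (mor g) (mor f))),
     Ident = (\<lambda>V. Arrow V V (\<lambda>x \<in> carrier V. x))\<rparr>"

definition Vec :: "'a univ ring \<Rightarrow> ('a univ, 'a space, ('a space, 'a fn) arrow) kcat" where
  "Vec K = concrete_category {V. module K V} (lin K)"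

section \<open>Bialgebras and comodules\<close>

record 'a bialg = "('a univ, 'a univ) module" +
  comult :: "'a fn"
  counit :: "'a fn"

locale bialgebra =
  fixes K :: "'a univ ring" and B :: "'a bialg"
  assumes base_field: "field K"
    and vector_space: "module K B"
    and mult_ring: "ring B"
    and smult_mult_left: "\<lbrakk>a \<in> carrier K; x \<in> carrier B; y \<in> carrier B\<rbrakk>
          \<Longrightarrow> (a \<odot>\<^bsub>B\<^esub> x) \<otimes>\<^bsub>B\<^esub> y = a \<odot>\<^bsub>B\<^esub> (x \<otimes>\<^bsub>B\<^esub> y)"
    and smult_mult_right: "\<lbrakk>a \<in> carrier K; x \<in> carrier B; y \<in> carrier B\<rbrakk>
          \<Longrightarrow> x \<otimes>\<^bsub>B\<^esub> (a \<odot>\<^bsub>B\<^esub> y) = a \<odot>\<^bsub>B\<^esub> (x \<otimes>\<^bsub>B\<^esub> y)"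
    and comult_lin: "comult B \<in> lin K B (tensor K B B)"
    and counit_lin: "counit B \<in> lin K B (ground K)"
    and coassoc: "b \<in> carrier B \<Longrightarrow>
          (let T = tensor K B (tensor K B B) in
            tsum T (comult B b) (\<lambda>x y. tsum T (comult B x)
              (\<lambda>x\<^sub>1 x\<^sub>2. pure K B (tensor K B B) x\<^sub>1 (pure K B B x\<^sub>2 y)))
          = tsum T (comult B b) (\<lambda>x y. pure K B (tensor K B B) x (comult B y)))"
    and counit_left: "b \<in> carrier B \<Longrightarrow> tsum B (comult B b) (\<lambda>x y. counit B x \<odot>\<^bsub>B\<^esub> y) = b"
    and counit_right: "b \<in> carrier B \<Longrightarrow> tsum B (comult B b) (\<lambda>x y. counit B y \<odot>\<^bsub>B\<^esub> x) = b"
    and comult_mult: "\<lbrakk>b \<in> carrier B; c \<in> carrier B\<rbrakk> \<Longrightarrow>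
          comult B (b \<otimes>\<^bsub>B\<^esub> c) =
            tsum (tensor K B B) (comult B b) (\<lambda>b\<^sub>1 b\<^sub>2. tsum (tensor K B B) (comult B c)
              (\<lambda>c\<^sub>1 c\<^sub>2. pure K B B (b\<^sub>1 \<otimes>\<^bsub>B\<^esub> c\<^sub>1) (b\<^sub>2 \<otimes>\<^bsub>B\<^esub> c\<^sub>2)))"
    and comult_one: "comult B \<one>\<^bsub>B\<^esub> = pure K B B \<one>\<^bsub>B\<^esub> \<one>\<^bsub>B\<^esub>"
    and counit_mult: "\<lbrakk>b \<in> carrier B; c \<in> carrier B\<rbrakk> \<Longrightarrow>
          counit B (b \<otimes>\<^bsub>B\<^esub> c) = counit B b \<otimes>\<^bsub>K\<^esub> counit B c"
    and counit_one: "counit B \<one>\<^bsub>B\<^esub> = \<one>\<^bsub>K\<^esub>"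

record 'a comod = "('a univ, 'a univ) module" +
  coact :: "'a fn"

definition with_coact :: "'a space \<Rightarrow> 'a fn \<Rightarrow> 'a comod" where
  "with_coact V \<rho> = module.extend V (comod.fields \<rho>)"

locale left_comodule =
  fixes K :: "'a univ ring" and B :: "'a bialg" and M :: "'a comod"
  assumes vector_space: "module K M"
    and coact_lin: "coact M \<in> lin K M (tensor K B M)"
    and coact_counit: "m \<in> carrier M \<Longrightarrow> tsum M (coact M m) (\<lambda>b n. counit B b \<odot>\<^bsub>M\<^esub> n) = m"
    and coact_coassoc: "m \<in> carrier M \<Longrightarrow>
          (let T = tensor K B (tensor K B M) in
            tsum T (coact M m) (\<lambda>b n. tsum T (comult B b)
              (\<lambda>b\<^sub>1 b\<^sub>2. pure K B (tensor K B M) b\<^sub>1 (pure K B M b\<^sub>2 n)))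
          = tsum T (coact M m) (\<lambda>b n. pure K B (tensor K B M) b (coact M n)))"

definition colin :: "'a univ ring \<Rightarrow> 'a bialg \<Rightarrow> 'a comod \<Rightarrow> 'a comod \<Rightarrow> 'a fn set" where
  "colin K B M N = {f \<in> lin K M N. \<forall>m \<in> carrier M.
     coact N (f m) = tsum (tensor K B N) (coact M m) (\<lambda>b n. pure K B N b (f n))}"

definition comod_tensor :: "'a univ ring \<Rightarrow> 'a bialg \<Rightarrow> 'a comod \<Rightarrow> 'a comod \<Rightarrow> 'a comod" where
  "comod_tensor K B M N = (let T = tensor K B (tensor K M N) in
     with_coact (tensor K M N)
       (\<lambda>x. tsum T x (\<lambda>m n. tsum T (coact M m) (\<lambda>b m\<^sub>0. tsum T (coact N n) (\<lambda>c n\<^sub>0.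
          pure K B (tensor K M N) (b \<otimes>\<^bsub>B\<^esub> c) (pure K M N m\<^sub>0 n\<^sub>0))))))"

definition comod_unit :: "'a univ ring \<Rightarrow> 'a bialg \<Rightarrow> 'a comod" where
  "comod_unit K B = with_coact (ground K) (\<lambda>c. pure K B (ground K) \<one>\<^bsub>B\<^esub> c)"

type_synonym 'a comod_arrow = "('a comod, 'a fn) arrow"

definition Comod :: "'a univ ring \<Rightarrow> 'a bialg \<Rightarrow> ('a univ, 'a comod, 'a comod_arrow) moncat" where
  "Comod K B =
     kcat.extend (concrete_category {M. left_comodule K B M} (colin K B))
      (moncat.fields
        (comod_tensor K B)
        (\<lambda>f g. Arrow (comod_tensor K B (src f) (src g)) (comod_tensor K B (tgt f) (tgt g))
          (tmap K (src f) (src g) (tgt f) (tgt g) (mor f) (mor g)))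
        (comod_unit K B)
        (\<lambda>M N P. Arrow (comod_tensor K B (comod_tensor K B M N) P)
          (comod_tensor K B M (comod_tensor K B N P)) (tassoc K M N P))
        (\<lambda>M. Arrow (comod_tensor K B (comod_unit K B) M) M (tlunit K M))
        (\<lambda>M. Arrow (comod_tensor K B M (comod_unit K B)) M (trunit K M)))"

definition fiber_action :: "'a univ ring \<Rightarrow>
    ('a comod, 'a comod_arrow, 'a space, ('a space, 'a fn) arrow) action" where
  "fiber_action K =
    \<lparr>Act = tensor K,
     ActA = (\<lambda>g f. Arrow (tensor K (src g) (src f)) (tensor K (tgt g) (tgt f))
        (tmap K (src g) (src f) (tgt g) (tgt f) (mor g) (mor f))),
     AAssoc = (\<lambda>W W' V. Arrow (tensor K (tensor K W W') V) (tensor K W (tensor K W' V))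
        (tassoc K W W' V)),
     AUnit = (\<lambda>V. Arrow (tensor K (ground K) V) V (tlunit K V))\<rparr>"

section \<open>The monad of a Hopf trimodule algebra\<close>

text \<open>The data of a Hopf trimodule algebra over \<open>B\<close>: \<open>coact\<close> is the left coaction, \<open>rcoact\<close> the right
  one, \<open>lact\<close> the left action of \<open>B\<close>, \<open>tunit\<close> the unit, a map from \<open>B\<close>, and \<open>tmult\<close> the
  multiplication, a map on the cotensor product of the underlying space with itself.\<close>

record 'a trialg = "'a comod" +
  rcoact :: "'a fn"
  lact :: "'a univ \<Rightarrow> 'a univ \<Rightarrow> 'a univ"
  tunit :: "'a fn"
  tmult :: "'a fn"

text \<open>The subspace of \<open>M \<otimes> N\<close> on which \<open>rcoact \<otimes> id\<close> and \<open>id \<otimes> coact\<close> agree.\<close>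

definition cotensor :: "'a univ ring \<Rightarrow> 'a bialg \<Rightarrow> 'a trialg \<Rightarrow> ('a, 'z) comod_scheme \<Rightarrow> 'a space" where
  "cotensor K B M N = (let T = tensor K M (tensor K B N) in
     (tensor K M N)\<lparr>carrier := {x \<in> carrier (tensor K M N).
        tsum T x (\<lambda>m n. tsum T (rcoact M m) (\<lambda>m\<^sub>0 b. pure K M (tensor K B N) m\<^sub>0 (pure K B N b n)))
      = tsum T x (\<lambda>m n. pure K M (tensor K B N) m (coact N n))}\<rparr>)"

text \<open>The left coaction of \<open>A \<box> N\<close> is the restriction of that of \<open>A\<close>, tensored with \<open>N\<close>. It has values
  in \<open>B \<otimes> (A \<box> N)\<close>, of which the inclusion into \<open>B \<otimes> (A \<otimes> N)\<close> is not a literal inclusion of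
  carriers; hence the definite description.\<close>

definition cotensor_comod :: "'a univ ring \<Rightarrow> 'a bialg \<Rightarrow> 'a trialg \<Rightarrow> 'a comod \<Rightarrow> 'a comod" where
  "cotensor_comod K B A N = (let T = tensor K B (tensor K A N) in
     with_coact (cotensor K B A N)
       (\<lambda>x. THE y. y \<in> carrier (tensor K B (cotensor K B A N)) \<and>
          tsum T y (\<lambda>b z. pure K B (tensor K A N) b z)
        = tsum T x (\<lambda>a n. tsum T (coact A a)
            (\<lambda>b a\<^sub>0. pure K B (tensor K A N) b (pure K A N a\<^sub>0 n)))))"

text \<open>The composite \<open>A \<box> (A \<box> N) \<cong> (A \<box> A) \<box> N \<rightarrow> A \<box> N\<close>. The isomorphism is the restriction of the
  associativity isomorphism of the ambient tensor products, so \<open>y\<close> is the element of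
  \<open>(A \<box> A) \<otimes> N\<close> with the same image as \<open>x\<close> in \<open>A \<otimes> (A \<otimes> N)\<close>.\<close>

definition cotensor_mult :: "'a univ ring \<Rightarrow> 'a bialg \<Rightarrow> 'a trialg \<Rightarrow> 'a comod \<Rightarrow> 'a fn" where
  "cotensor_mult K B A N = (let T = tensor K A (tensor K A N) in
     (\<lambda>x \<in> carrier (cotensor K B A (cotensor_comod K B A N)).
        tsum (tensor K A N)
         (THE y. y \<in> carrier (tensor K (cotensor K B A A) N) \<and>
            tsum T y (\<lambda>z n. tsum T z (\<lambda>a a'. pure K A (tensor K A N) a (pure K A N a' n)))
          = tsum T x (\<lambda>a z. pure K A (tensor K A N) a z))
         (\<lambda>z n. pure K A N (tmult A z) n)))"

definition cotensor_monad :: "'a univ ring \<Rightarrow> 'a bialg \<Rightarrow> 'a trialg \<Rightarrow> ('a comod, 'a comod_arrow) monad"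
  where
  "cotensor_monad K B A =
    \<lparr>MFun = \<lparr>FObj = cotensor_comod K B A,
        FArr = (\<lambda>f. Arrow (cotensor_comod K B A (src f)) (cotensor_comod K B A (tgt f))
          (\<lambda>x \<in> carrier (cotensor K B A (src f)).
             tsum (tensor K A (tgt f)) x (\<lambda>a n. pure K A (tgt f) a (mor f n))))\<rparr>,
     Eta = (\<lambda>N. Arrow N (cotensor_comod K B A N)
        (\<lambda>n \<in> carrier N. tsum (tensor K A N) (coact N n) (\<lambda>b n\<^sub>0. pure K A N (tunit A b) n\<^sub>0))),
     Mu = (\<lambda>N. Arrow (cotensor_comod K B A (cotensor_comod K B A N)) (cotensor_comod K B A N)
        (cotensor_mult K B A N))\<rparr>"

definition cotensor_lax :: "'a univ ring \<Rightarrow> 'a bialg \<Rightarrow> 'a trialg \<Rightarrow> 'a comod \<Rightarrow> 'a comod \<Rightarrow>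
    'a comod_arrow" where
  "cotensor_lax K B A M N =
     (let T = tensor K A (tensor K M N) in
       Arrow (comod_tensor K B M (cotensor_comod K B A N))
         (cotensor_comod K B A (comod_tensor K B M N))
         (\<lambda>x \<in> carrier (tensor K M (cotensor K B A N)).
            tsum T x (\<lambda>m z. tsum T z (\<lambda>a n. tsum T (coact M m)
              (\<lambda>b m\<^sub>0. pure K A (tensor K M N) (lact A b a) (pure K M N m\<^sub>0 n))))))"

text \<open>The Hopf trimodule algebra \<open>B \<bullet> B\<close> on the space \<open>B \<otimes> B\<close>. Its multiplication is the restriction of
  \<open>id \<otimes> \<epsilon> \<otimes> \<epsilon> \<otimes> id\<close>, here left defined on all of \<open>(B \<otimes> B) \<otimes> (B \<otimes> B)\<close>.\<close>

definition bullet :: "'a univ ring \<Rightarrow> 'a bialg \<Rightarrow> 'a trialg" where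
  "bullet K B = (let S = tensor K B B in
     comod.extend
      (with_coact S
        (\<lambda>x. tsum (tensor K B S) x (\<lambda>b c. tsum (tensor K B S) (comult B b)
          (\<lambda>b\<^sub>1 b\<^sub>2. pure K B S b\<^sub>1 (pure K B B b\<^sub>2 c)))))
      (trialg.fields
        (\<lambda>x. tsum (tensor K S B) x (\<lambda>b c. tsum (tensor K S B) (comult B c)
          (\<lambda>c\<^sub>1 c\<^sub>2. pure K S B (pure K B B b c\<^sub>1) c\<^sub>2)))
        (\<lambda>x z. tsum S z (\<lambda>b c. tsum S (comult B x)
          (\<lambda>x\<^sub>1 x\<^sub>2. pure K B B (x\<^sub>1 \<otimes>\<^bsub>B\<^esub> b) (x\<^sub>2 \<otimes>\<^bsub>B\<^esub> c))))
        (comult B)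
        (\<lambda>z. tsum S z (\<lambda>p q. tsum S p (\<lambda>b c. tsum S q
          (\<lambda>b' c'. (counit B c \<otimes>\<^bsub>K\<^esub> counit B b') \<odot>\<^bsub>S\<^esub> pure K B B b c'))))))"

end

theory Submission
  imports Defs
begin

text \<open>The right coaction of B \<bullet> B involves only the second tensor factor, where it is
  the comultiplication. Hence (B \<bullet> B) \<box> N is B \<otimes> (B \<box> N), that is, B
  \<otimes> N: the maps \<open>phi\<close>, b \<otimes> n \<mapsto> b \<otimes> n_{-1} \<otimes>
  n_0, and \<open>psi\<close>, b \<otimes> c \<otimes> n \<mapsto> \<epsilon>(c) b \<otimes> n, are
  mutually inverse (\<open>psi_phi\<close>, \<open>phi_psi\<close>). Under this identification the
  left coaction is \<Delta> \<otimes> id, so \<open>T N\<close> is the cofree comodule on the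
  underlying space of N: with \<open>eps\<close> = \<epsilon> \<otimes> id, the comodule maps from M
  to \<open>T N\<close> correspond to the linear maps from M to N by way of \<open>ext\<close>
  (\<open>eps_ext\<close>, \<open>cofree_unique\<close>). If U is the forgetful functor from
  comodules to vector spaces and R its right adjoint, the endofunctor is R U, and
  \<open>cotensor_map_ext\<close>, \<open>cotensor_unit_ext\<close> and
  \<open>cotensor_mult_ext\<close> identify the given monad with the monad of this adjunction.

  Consequently a module morphism between the free modules on N and N' is the same as a linear map
  from N to N' (\<open>arr_Free\<close>). The functor \<open>P\<close> from free modules to vector
  spaces is therefore full and faithful, and it hits every vector space because every space carries
  the trivial coaction v \<mapsto> 1 \<otimes> v (\<open>P_weak_equivalence\<close>).

  Moreover every module is free (\<open>free_essentially_surjective\<close>). For an action h on M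
  put e(m) = h(1 \<otimes> m). This is an idempotent linear map whose image V consists of elements
  with trivial coaction, and b \<otimes> v \<mapsto> h(b \<otimes> v) is an isomorphism from B
  \<otimes> V to M with inverse m \<mapsto> m_{-1} \<otimes> e(m_0). The argument has the shape of
  the structure theorem for Hopf modules. So the inclusion of the free modules into all modules is
  an equivalence as well.

  As for the action of comodules, the lax structure composed with \<open>eps\<close> is id \<otimes>
  \<open>eps\<close> (\<open>cotensor_lax_ext\<close>). It follows that a comodule map g acts on the
  morphism given by a linear map h as g \<otimes> h (\<open>ActA_free_map\<close>), and
  \<open>P\<close> preserves the action strictly (\<open>P_strong\<close>). An action on all modules
  that extends the one on free modules makes the inclusion a strong module functor; being an
  equivalence, it has a quasi-inverse that is strong too (\<open>G_strong\<close>), and the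
  composite of this quasi-inverse with \<open>P\<close> is the desired equivalence
  (\<open>extended_action_fiber\<close>). Such an extension exists by transport of structure
  (\<open>extended_action_exists\<close>). Finally, vector spaces form a semisimple category because
  they have bases (\<open>basis_exists\<close>, \<open>Vec_direct_sum\<close>), and semisimplicity
  is reflected by equivalences (\<open>semisimple_reflected\<close>).

  The algebra is done with Sweedler sums (\<open>sweedler\<close>) and the principle that linear
  maps on a tensor product agree as soon as they agree on pure tensors
  (\<open>lin_eq_on_tensor\<close>).\<close>

section \<open>Tensor products: module structure and universal property\<close>

definition lsum :: "('a univ, 'a univ, 'x) module_scheme \<Rightarrow> ('a univ \<Rightarrow> 'a univ \<Rightarrow> 'a univ) \<Rightarrow>
    ('a univ \<times> 'a univ) list \<Rightarrow> 'a univ" where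
  "lsum U \<beta> l = foldr (\<lambda>(v, w) s. \<beta> v w \<oplus>\<^bsub>U\<^esub> s) l \<zero>\<^bsub>U\<^esub>"

lemma lsum_Nil [simp]: "lsum U \<beta> [] = \<zero>\<^bsub>U\<^esub>"
  and lsum_Cons [simp]: "lsum U \<beta> ((v, w) # l) = \<beta> v w \<oplus>\<^bsub>U\<^esub> lsum U \<beta> l"
  by (simp_all add: lsum_def)

lemma tsum_lsum: "tsum U x \<beta> = lsum U \<beta> (summands x)"
  by (simp add: tsum_def lsum_def)

definition bilin where
  "bilin K V W U \<beta> \<longleftrightarrow> (\<forall>w \<in> carrier W. (\<lambda>v. \<beta> v w) \<in> lin K V U) \<and> (\<forall>v \<in> carrier V. \<beta> v \<in> lin K W U)"

lemma bilinI:
  assumes "\<And>w. w \<in> carrier W \<Longrightarrow> (\<lambda>v. \<beta> v w) \<in> lin K V U"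
    and "\<And>v. v \<in> carrier V \<Longrightarrow> (\<lambda>w. \<beta> v w) \<in> lin K W U"
  shows "bilin K V W U (\<lambda>v w. \<beta> v w)"
  using assms by (simp add: bilin_def)

locale scalars = cring K for K :: "'a univ ring"
begin

text \<open>Conditional on \<open>module K V\<close> instead of obtained by interpretation, so that
  later they can be simp rules for all modules at once, iterated tensor products included.\<close>

lemma module_facts:
  assumes "module K V"
  shows "\<And>x y. \<lbrakk>x \<in> carrier V; y \<in> carrier V\<rbrakk> \<Longrightarrow> x \<oplus>\<^bsub>V\<^esub> y \<in> carrier V"
    and "\<And>a x. \<lbrakk>a \<in> carrier K; x \<in> carrier V\<rbrakk> \<Longrightarrow> a \<odot>\<^bsub>V\<^esub> x \<in> carrier V"
    and "\<zero>\<^bsub>V\<^esub> \<in> carrier V"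
    and "\<And>x. x \<in> carrier V \<Longrightarrow> \<one>\<^bsub>K\<^esub> \<odot>\<^bsub>V\<^esub> x = x"
    and "\<And>x. x \<in> carrier V \<Longrightarrow> \<zero>\<^bsub>K\<^esub> \<odot>\<^bsub>V\<^esub> x = \<zero>\<^bsub>V\<^esub>"
    and "\<And>a. a \<in> carrier K \<Longrightarrow> a \<odot>\<^bsub>V\<^esub> \<zero>\<^bsub>V\<^esub> = \<zero>\<^bsub>V\<^esub>"
    and "\<And>x. x \<in> carrier V \<Longrightarrow> \<zero>\<^bsub>V\<^esub> \<oplus>\<^bsub>V\<^esub> x = x"
    and "\<And>x. x \<in> carrier V \<Longrightarrow> x \<oplus>\<^bsub>V\<^esub> \<zero>\<^bsub>V\<^esub> = x"
proof -
  interpret V: module K V by fact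
  show "\<And>x y. \<lbrakk>x \<in> carrier V; y \<in> carrier V\<rbrakk> \<Longrightarrow> x \<oplus>\<^bsub>V\<^esub> y \<in> carrier V"
    and "\<And>a x. \<lbrakk>a \<in> carrier K; x \<in> carrier V\<rbrakk> \<Longrightarrow> a \<odot>\<^bsub>V\<^esub> x \<in> carrier V"
    and "\<zero>\<^bsub>V\<^esub> \<in> carrier V"
    and "\<And>x. x \<in> carrier V \<Longrightarrow> \<one>\<^bsub>K\<^esub> \<odot>\<^bsub>V\<^esub> x = x"
    and "\<And>x. x \<in> carrier V \<Longrightarrow> \<zero>\<^bsub>K\<^esub> \<odot>\<^bsub>V\<^esub> x = \<zero>\<^bsub>V\<^esub>"
    and "\<And>a. a \<in> carrier K \<Longrightarrow> a \<odot>\<^bsub>V\<^esub> \<zero>\<^bsub>V\<^esub> = \<zero>\<^bsub>V\<^esub>"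
    and "\<And>x. x \<in> carrier V \<Longrightarrow> \<zero>\<^bsub>V\<^esub> \<oplus>\<^bsub>V\<^esub> x = x"
    and "\<And>x. x \<in> carrier V \<Longrightarrow> x \<oplus>\<^bsub>V\<^esub> \<zero>\<^bsub>V\<^esub> = x"
    by auto
qed

lemma linI:
  assumes "\<And>x. x \<in> carrier V \<Longrightarrow> f x \<in> carrier W"
    and "\<And>x y. \<lbrakk>x \<in> carrier V; y \<in> carrier V\<rbrakk> \<Longrightarrow> f (x \<oplus>\<^bsub>V\<^esub> y) = f x \<oplus>\<^bsub>W\<^esub> f y"
    and "\<And>a x. \<lbrakk>a \<in> carrier K; x \<in> carrier V\<rbrakk> \<Longrightarrow> f (a \<odot>\<^bsub>V\<^esub> x) = a \<odot>\<^bsub>W\<^esub> f x"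
  shows "f \<in> lin K V W"
  using assms by (auto simp: lin_def)

lemma lin_closed: "\<lbrakk>f \<in> lin K V W; x \<in> carrier V\<rbrakk> \<Longrightarrow> f x \<in> carrier W"
  and lin_add: "\<lbrakk>f \<in> lin K V W; x \<in> carrier V; y \<in> carrier V\<rbrakk> \<Longrightarrow> f (x \<oplus>\<^bsub>V\<^esub> y) = f x \<oplus>\<^bsub>W\<^esub> f y"
  and lin_smult: "\<lbrakk>f \<in> lin K V W; a \<in> carrier K; x \<in> carrier V\<rbrakk> \<Longrightarrow> f (a \<odot>\<^bsub>V\<^esub> x) = a \<odot>\<^bsub>W\<^esub> f x"
  by (auto simp: lin_def)

lemma lin_zero:
  assumes "f \<in> lin K V W" "module K V" "module K W"
  shows "f \<zero>\<^bsub>V\<^esub> = \<zero>\<^bsub>W\<^esub>"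
  using lin_smult[OF assms(1), of "\<zero>\<^bsub>K\<^esub>" "\<zero>\<^bsub>V\<^esub>"] lin_closed[OF assms(1)] module_facts[OF assms(2)]
    module_facts[OF assms(3)] by simp

lemma lin_cong:
  assumes "f \<in> lin K V W" "module K V" "\<And>x. x \<in> carrier V \<Longrightarrow> g x = f x"
  shows "g \<in> lin K V W"
  using assms module_facts[OF assms(2)] by (auto simp: lin_def)

lemma bilin_closed: "\<lbrakk>bilin K V W U \<beta>; v \<in> carrier V; w \<in> carrier W\<rbrakk> \<Longrightarrow> \<beta> v w \<in> carrier U"
  by (auto simp: bilin_def lin_def)

lemma lsum_closed:
  assumes "module K U" "set l \<subseteq> carrier V \<times> carrier W"
    and "\<And>v w. \<lbrakk>v \<in> carrier V; w \<in> carrier W\<rbrakk> \<Longrightarrow> \<beta> v w \<in> carrier U"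
  shows "lsum U \<beta> l \<in> carrier U"
  using assms(2) by (induction l) (auto simp: assms module_facts[OF assms(1)])

lemma lsum_append:
  assumes "module K U" "set (l @ m) \<subseteq> carrier V \<times> carrier W"
    and "\<And>v w. \<lbrakk>v \<in> carrier V; w \<in> carrier W\<rbrakk> \<Longrightarrow> \<beta> v w \<in> carrier U"
  shows "lsum U \<beta> (l @ m) = lsum U \<beta> l \<oplus>\<^bsub>U\<^esub> lsum U \<beta> m"
proof -
  interpret U: module K U by fact
  have m: "lsum U \<beta> m \<in> carrier U" by (rule lsum_closed) (use assms in auto)
  show ?thesis using assms(2)
  proof (induction l)
    case (Cons p l)
    obtain v w where p: "p = (v, w)" by (cases p)
    have "lsum U \<beta> l \<in> carrier U" "\<beta> v w \<in> carrier U"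
      using Cons.prems assms by (auto simp: p intro!: lsum_closed)
    then show ?case using Cons m by (simp add: p U.a_assoc)
  qed (simp add: m)
qed

context
  fixes V :: "('a univ, 'a univ, 'x) module_scheme" and W :: "('a univ, 'a univ, 'y) module_scheme"
  assumes mV: "module K V" and mW: "module K W"
begin

interpretation V: module K V by (rule mV)
interpretation W: module K W by (rule mW)

lemma tensor_eq_carrier:
  "tensor_eq K V W l l' \<Longrightarrow> set l \<subseteq> carrier V \<times> carrier W \<and> set l' \<subseteq> carrier V \<times> carrier W"
  by (induction rule: tensor_eq.induct) auto

text \<open>A bilinear map respects each generator of \<open>tensor_eq\<close>. This makes
  \<open>tsum\<close> well defined: the sum over a formal sum depends only on the tensor that the
  formal sum represents.\<close>

lemma lsum_tensor_eq:
  fixes U :: "('a univ, 'a univ, 'z) module_scheme"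
  assumes "tensor_eq K V W l l'" "bilin K V W U \<beta>" "module K U"
  shows "lsum U \<beta> l = lsum U \<beta> l'"
proof -
  interpret U: module K U by fact
  have cl [simp]: "\<lbrakk>v \<in> carrier V; w \<in> carrier W\<rbrakk> \<Longrightarrow> \<beta> v w \<in> carrier U" for v w
    by (rule bilin_closed[OF assms(2)])
  have L: "w \<in> carrier W \<Longrightarrow> (\<lambda>v. \<beta> v w) \<in> lin K V U" "v \<in> carrier V \<Longrightarrow> \<beta> v \<in> lin K W U" for v w
    using assms(2) by (auto simp: bilin_def)
  show ?thesis using assms(1)
  proof (induction rule: tensor_eq.induct)
    case (append l l' m m')
    then show ?case using tensor_eq_carrier[OF append.hyps(1)] tensor_eq_carrier[OF append.hyps(2)]
      by (simp add: lsum_append[OF assms(3), where V=V and W=W])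
  next
    case (comm l m)
    then show ?case
      by (simp add: lsum_append[OF assms(3), where V=V and W=W] U.a_comm lsum_closed[OF assms(3), where V=V and W=W])
  next
    case (add_left v v' w)
    then show ?case using lin_add[OF L(1), of w v v'] by simp
  next
    case (add_right v w w')
    then show ?case using lin_add[OF L(2), of v w w'] by simp
  next
    case (zero w)
    then show ?case using lin_zero[OF L(1) mV assms(3)] by simp
  next
    case (smult a v w)
    then show ?case using lin_smult[OF L(1), of w a v] lin_smult[OF L(2), of v a w] by simp
  qed simp_all
qed

text \<open>Equivalent lists have the same equivalence class as a predicate, so \<open>SOME\<close>
  picks the same member for both.\<close>

lemma tensor_class_eq:
  assumes "tensor_eq K V W l l'" shows "tensor_class K V W l = tensor_class K V W l'"
proof -
  have "tensor_eq K V W l = tensor_eq K V W l'"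
    using assms by (auto intro: tensor_eq.sym tensor_eq.trans)
  then show ?thesis by (simp add: tensor_class_def)
qed

lemma summands_tensor_class:
  assumes "set l \<subseteq> carrier V \<times> carrier W"
  shows "tensor_eq K V W l (summands (tensor_class K V W l))"
  using someI[of "tensor_eq K V W l", OF tensor_eq.refl[OF assms]] by (simp add: tensor_class_def)

lemma tensor_class_closed:
  "set l \<subseteq> carrier V \<times> carrier W \<Longrightarrow> tensor_class K V W l \<in> carrier (tensor K V W)"
  by (auto simp: tensor_def)

lemma tensor_zero: "\<zero>\<^bsub>tensor K V W\<^esub> = tensor_class K V W []"
  by (simp add: tensor_def)

lemma tensor_add:
  assumes "set l \<subseteq> carrier V \<times> carrier W" "set m \<subseteq> carrier V \<times> carrier W"
  shows "tensor_class K V W l \<oplus>\<^bsub>tensor K V W\<^esub> tensor_class K V W m = tensor_class K V W (l @ m)"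
  by (simp add: tensor_def)
    (intro tensor_class_eq tensor_eq.append tensor_eq.sym[OF summands_tensor_class] assms)

text \<open>Scaling the left factors maps each generator to an instance of a generator. For the
  generator \<open>smult\<close> this rests on the commutativity of \<open>K\<close>, which lets the
  two scalars change places.\<close>

lemma tensor_eq_map_smult:
  assumes "tensor_eq K V W l l'" and a: "a \<in> carrier K"
  shows "tensor_eq K V W (map (\<lambda>(v, w). (a \<odot>\<^bsub>V\<^esub> v, w)) l) (map (\<lambda>(v, w). (a \<odot>\<^bsub>V\<^esub> v, w)) l')"
  using assms(1)
proof (induction rule: tensor_eq.induct)
  case (refl l)
  then show ?case using a by (intro tensor_eq.refl) (auto dest: subsetD)
next
  case (comm l m)
  then show ?case using a unfolding map_append by (intro tensor_eq.comm) auto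
next
  case (smult b v w)
  then have "a \<odot>\<^bsub>V\<^esub> (b \<odot>\<^bsub>V\<^esub> v) = b \<odot>\<^bsub>V\<^esub> (a \<odot>\<^bsub>V\<^esub> v)"
    using a by (metis V.smult_assoc1 m_comm)
  then show ?case using smult a tensor_eq.smult[of b K "a \<odot>\<^bsub>V\<^esub> v" V w W] by simp
qed (use a in \<open>auto intro: tensor_eq.intros simp: V.smult_r_distr\<close>)

lemma tensor_smult:
  assumes "set l \<subseteq> carrier V \<times> carrier W" "a \<in> carrier K"
  shows "a \<odot>\<^bsub>tensor K V W\<^esub> tensor_class K V W l = tensor_class K V W (map (\<lambda>(v, w). (a \<odot>\<^bsub>V\<^esub> v, w)) l)"
  by (simp add: tensor_def)
    (intro tensor_class_eq tensor_eq_map_smult tensor_eq.sym[OF summands_tensor_class] assms)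

lemma tensor_carrier_cases:
  assumes "x \<in> carrier (tensor K V W)"
  obtains l where "set l \<subseteq> carrier V \<times> carrier W" "x = tensor_class K V W l"
  using assms by (auto simp: tensor_def)

text \<open>A preliminary stage: associativity and commutativity come from concatenation of lists.
  Negatives appear in \<open>tensor_module\<close>, as multiples by minus one.\<close>

lemma tensor_comm_monoid: "abelian_monoid (tensor K V W)"
proof (rule abelian_monoidI, goal_cases)
  case (1 x y)
  then show ?case
    by (elim tensor_carrier_cases) (simp add: tensor_add tensor_class_closed)
next
  case (3 x y z)
  then show ?case
    by (elim tensor_carrier_cases) (simp add: tensor_add)
next
  case (4 x)
  then show ?case
    by (elim tensor_carrier_cases) (use tensor_add[of "[]"] in \<open>simp add: tensor_zero\<close>)
next
  case (5 x y)
  then show ?case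
    by (elim tensor_carrier_cases) (simp add: tensor_add tensor_class_eq[OF tensor_eq.comm])
qed (simp add: tensor_zero tensor_class_closed)

interpretation T: abelian_monoid "tensor K V W" by (rule tensor_comm_monoid)

lemma pure_closed: "\<lbrakk>v \<in> carrier V; w \<in> carrier W\<rbrakk> \<Longrightarrow> pure K V W v w \<in> carrier (tensor K V W)"
  by (simp add: pure_def tensor_class_closed)

text \<open>Splits off one pure tensor at a time from a representing list.\<close>

lemma tensor_induct [consumes 1, case_names zero add]:
  assumes "x \<in> carrier (tensor K V W)" "P \<zero>\<^bsub>tensor K V W\<^esub>"
    and step: "\<And>v w y. \<lbrakk>v \<in> carrier V; w \<in> carrier W; y \<in> carrier (tensor K V W); P y\<rbrakk>
           \<Longrightarrow> P (pure K V W v w \<oplus>\<^bsub>tensor K V W\<^esub> y)"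
  shows "P x"
proof -
  obtain l where l: "set l \<subseteq> carrier V \<times> carrier W" "x = tensor_class K V W l"
    using assms(1) by (rule tensor_carrier_cases)
  have "P (tensor_class K V W l)" using l(1)
  proof (induction l)
    case (Cons p l)
    obtain v w where p: "p = (v, w)" by (cases p)
    show ?case using Cons step[of v w "tensor_class K V W l"] tensor_add[of "[(v, w)]" l]
      by (simp add: p pure_def tensor_class_closed)
  qed (use assms(2) in \<open>simp add: tensor_zero\<close>)
  then show ?thesis by (simp add: l(2))
qed

lemma pure_add_left: "\<lbrakk>v \<in> carrier V; v' \<in> carrier V; w \<in> carrier W\<rbrakk>
    \<Longrightarrow> pure K V W (v \<oplus>\<^bsub>V\<^esub> v') w = pure K V W v w \<oplus>\<^bsub>tensor K V W\<^esub> pure K V W v' w"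
  by (simp add: pure_def tensor_add tensor_class_eq[OF tensor_eq.add_left])

lemma pure_add_right: "\<lbrakk>v \<in> carrier V; w \<in> carrier W; w' \<in> carrier W\<rbrakk>
    \<Longrightarrow> pure K V W v (w \<oplus>\<^bsub>W\<^esub> w') = pure K V W v w \<oplus>\<^bsub>tensor K V W\<^esub> pure K V W v w'"
  by (simp add: pure_def tensor_add tensor_class_eq[OF tensor_eq.add_right])

lemma pure_smult_left: "\<lbrakk>a \<in> carrier K; v \<in> carrier V; w \<in> carrier W\<rbrakk>
    \<Longrightarrow> pure K V W (a \<odot>\<^bsub>V\<^esub> v) w = a \<odot>\<^bsub>tensor K V W\<^esub> pure K V W v w"
  by (simp add: pure_def tensor_smult)

lemma pure_smult_right: "\<lbrakk>a \<in> carrier K; v \<in> carrier V; w \<in> carrier W\<rbrakk>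
    \<Longrightarrow> pure K V W v (a \<odot>\<^bsub>W\<^esub> w) = a \<odot>\<^bsub>tensor K V W\<^esub> pure K V W v w"
  by (simp add: pure_def tensor_smult tensor_class_eq[OF tensor_eq.smult, symmetric])

lemma tensor_smult_closed:
  "\<lbrakk>a \<in> carrier K; x \<in> carrier (tensor K V W)\<rbrakk> \<Longrightarrow> a \<odot>\<^bsub>tensor K V W\<^esub> x \<in> carrier (tensor K V W)"
  by (elim tensor_carrier_cases, simp add: tensor_smult, rule tensor_class_closed) auto

lemma tensor_smult_zero: "a \<in> carrier K \<Longrightarrow> a \<odot>\<^bsub>tensor K V W\<^esub> \<zero>\<^bsub>tensor K V W\<^esub> = \<zero>\<^bsub>tensor K V W\<^esub>"
  using tensor_smult[of "[]" a] by (simp add: tensor_zero)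

lemma tensor_smult_r_distr:
  assumes "a \<in> carrier K" "x \<in> carrier (tensor K V W)" "y \<in> carrier (tensor K V W)"
  shows "a \<odot>\<^bsub>tensor K V W\<^esub> (x \<oplus>\<^bsub>tensor K V W\<^esub> y)
    = (a \<odot>\<^bsub>tensor K V W\<^esub> x) \<oplus>\<^bsub>tensor K V W\<^esub> (a \<odot>\<^bsub>tensor K V W\<^esub> y)"
proof -
  obtain l m where "set l \<subseteq> carrier V \<times> carrier W" "x = tensor_class K V W l"
    "set m \<subseteq> carrier V \<times> carrier W" "y = tensor_class K V W m"
    using assms by (elim tensor_carrier_cases)
  then show ?thesis using assms(1)
    by (simp add: tensor_smult tensor_add) (subst tensor_add; force)
qed

lemma tensor_module: "module K (tensor K V W)"
proof (rule moduleI)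
  let ?T = "tensor K V W"
  note facts = pure_closed tensor_smult_closed tensor_smult_zero tensor_smult_r_distr
    pure_smult_left[symmetric]
  have one: "\<one>\<^bsub>K\<^esub> \<odot>\<^bsub>?T\<^esub> x = x" if "x \<in> carrier ?T" for x
    using that by (induction x rule: tensor_induct) (simp_all add: facts)
  have distr: "(a \<oplus>\<^bsub>K\<^esub> b) \<odot>\<^bsub>?T\<^esub> x = a \<odot>\<^bsub>?T\<^esub> x \<oplus>\<^bsub>?T\<^esub> b \<odot>\<^bsub>?T\<^esub> x"
    if "x \<in> carrier ?T" "a \<in> carrier K" "b \<in> carrier K" for x a b
    using that
    by (induction x rule: tensor_induct)
      (simp_all add: facts V.smult_l_distr pure_add_left T.a_ac)
  \<comment> \<open>The generator \<open>zero\<close> of \<open>tensor_eq\<close> enters here: 0 (v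
    \<otimes> w) = 0 \<otimes> w = 0.\<close>
  have null: "\<zero>\<^bsub>K\<^esub> \<odot>\<^bsub>?T\<^esub> x = \<zero>\<^bsub>?T\<^esub>" if "x \<in> carrier ?T" for x
    using that
  proof (induction x rule: tensor_induct)
    case (add v w y)
    then show ?case
      using tensor_class_eq[OF tensor_eq.zero[of w W K V]]
      by (simp add: facts) (simp add: pure_def tensor_zero)
  qed (simp add: facts)
  show "cring K" by unfold_locales
  show "abelian_group ?T"
  proof (rule abelian_groupI)
    \<comment> \<open>Minus one times \<open>x\<close> is the additive inverse of \<open>x\<close>,
      by distributivity over -1 + 1 = 0.\<close>
    fix x assume x: "x \<in> carrier ?T"
    have "(\<ominus>\<^bsub>K\<^esub> \<one>\<^bsub>K\<^esub>) \<odot>\<^bsub>?T\<^esub> x \<oplus>\<^bsub>?T\<^esub> x = \<zero>\<^bsub>?T\<^esub>"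
      using distr[OF x, of "\<ominus>\<^bsub>K\<^esub> \<one>\<^bsub>K\<^esub>" "\<one>\<^bsub>K\<^esub>"] null[OF x] one[OF x] by (simp add: l_neg)
    then show "\<exists>y\<in>carrier ?T. y \<oplus>\<^bsub>?T\<^esub> x = \<zero>\<^bsub>?T\<^esub>"
      using x by (auto intro!: bexI[of _ "(\<ominus>\<^bsub>K\<^esub> \<one>\<^bsub>K\<^esub>) \<odot>\<^bsub>?T\<^esub> x"] simp: facts)
  qed (simp_all add: T.a_ac)
  show "a \<otimes>\<^bsub>K\<^esub> b \<odot>\<^bsub>?T\<^esub> x = a \<odot>\<^bsub>?T\<^esub> (b \<odot>\<^bsub>?T\<^esub> x)"
    if "a \<in> carrier K" "b \<in> carrier K" "x \<in> carrier ?T" for x a b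
    using that(3,1,2)
    by (induction x rule: tensor_induct) (simp_all add: facts V.smult_assoc1)
  show "(a \<oplus>\<^bsub>K\<^esub> b) \<odot>\<^bsub>?T\<^esub> x = a \<odot>\<^bsub>?T\<^esub> x \<oplus>\<^bsub>?T\<^esub> b \<odot>\<^bsub>?T\<^esub> x"
    if "a \<in> carrier K" "b \<in> carrier K" "x \<in> carrier ?T" for x a b
    using distr that by simp
  show "\<one>\<^bsub>K\<^esub> \<odot>\<^bsub>?T\<^esub> x = x" if "x \<in> carrier ?T" for x
    using one that by simp
qed (simp_all add: tensor_smult_closed tensor_smult_r_distr)

lemma tsum_tensor_class:
  fixes U :: "('a univ, 'a univ, 'z) module_scheme"
  assumes "bilin K V W U \<beta>" "module K U" "set l \<subseteq> carrier V \<times> carrier W"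
  shows "tsum U (tensor_class K V W l) \<beta> = lsum U \<beta> l"
  using lsum_tensor_eq[OF summands_tensor_class[OF assms(3)] assms(1,2)] by (simp add: tsum_lsum)

text \<open>Existence half of the universal property. Addition of tensors is concatenation of lists,
  and scalars act on the left factors, so linearity reduces to statements about
  \<open>lsum\<close>.\<close>

lemma tsum_lin:
  fixes U :: "('a univ, 'a univ, 'z) module_scheme"
  assumes "bilin K V W U \<beta>" "module K U"
  shows "(\<lambda>x. tsum U x \<beta>) \<in> lin K (tensor K V W) U"
proof -
  interpret U: module K U by fact
  note cl = bilin_closed[OF assms(1)]
  have L: "w \<in> carrier W \<Longrightarrow> (\<lambda>v. \<beta> v w) \<in> lin K V U" for w
    using assms(1) by (auto simp: bilin_def)
  show ?thesis
  proof (rule linI)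
    fix x assume "x \<in> carrier (tensor K V W)"
    then obtain l where l: "set l \<subseteq> carrier V \<times> carrier W" "x = tensor_class K V W l"
      by (elim tensor_carrier_cases)
    then show "tsum U x \<beta> \<in> carrier U"
      by (simp add: tsum_tensor_class[OF assms] lsum_closed[OF assms(2) _ cl, of _ V W])
    fix y assume "y \<in> carrier (tensor K V W)"
    then obtain m where m: "set m \<subseteq> carrier V \<times> carrier W" "y = tensor_class K V W m"
      by (elim tensor_carrier_cases)
    show "tsum U (x \<oplus>\<^bsub>tensor K V W\<^esub> y) \<beta> = tsum U x \<beta> \<oplus>\<^bsub>U\<^esub> tsum U y \<beta>"
      using l m cl by (simp add: tsum_tensor_class[OF assms] tensor_add lsum_append[OF assms(2), where V=V and W=W])
  next
    fix a x assume a: "a \<in> carrier K" and "x \<in> carrier (tensor K V W)"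
    then obtain l where l: "set l \<subseteq> carrier V \<times> carrier W" "x = tensor_class K V W l"
      by (elim tensor_carrier_cases)
    have "lsum U \<beta> (map (\<lambda>(v, w). (a \<odot>\<^bsub>V\<^esub> v, w)) l) = a \<odot>\<^bsub>U\<^esub> lsum U \<beta> l"
      using l(1)
    proof (induction l)
      case (Cons p l)
      then show ?case
        using a lin_smult[OF L] lsum_closed[OF assms(2) _ cl, of l V W]
        by (cases p) (auto simp: U.smult_r_distr cl)
    qed (simp add: a)
    moreover have "tsum U (a \<odot>\<^bsub>tensor K V W\<^esub> x) \<beta> = lsum U \<beta> (map (\<lambda>(v, w). (a \<odot>\<^bsub>V\<^esub> v, w)) l)"
      using l a unfolding l(2) tensor_smult[OF l(1) a] by (intro tsum_tensor_class[OF assms]) auto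
    ultimately show "tsum U (a \<odot>\<^bsub>tensor K V W\<^esub> x) \<beta> = a \<odot>\<^bsub>U\<^esub> tsum U x \<beta>"
      using l by (simp add: tsum_tensor_class[OF assms])
  qed
qed

lemma tsum_pure:
  fixes U :: "('a univ, 'a univ, 'z) module_scheme"
  assumes "bilin K V W U \<beta>" "module K U" "v \<in> carrier V" "w \<in> carrier W"
  shows "tsum U (pure K V W v w) \<beta> = \<beta> v w"
proof -
  interpret U: module K U by fact
  show ?thesis using bilin_closed[OF assms(1)] assms
    by (simp add: pure_def tsum_tensor_class[OF assms(1,2)])
qed

text \<open>Uniqueness half of the universal property. Nearly every identity between linear maps
  below is reduced by this rule to a computation with pure tensors.\<close>

lemma lin_eq_on_tensor:
  fixes U :: "('a univ, 'a univ, 'z) module_scheme"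
  assumes "f \<in> lin K (tensor K V W) U" "g \<in> lin K (tensor K V W) U" "module K U"
    and eq: "\<And>v w. \<lbrakk>v \<in> carrier V; w \<in> carrier W\<rbrakk> \<Longrightarrow> f (pure K V W v w) = g (pure K V W v w)"
    and x: "x \<in> carrier (tensor K V W)"
  shows "f x = g x"
  using x
proof (induction x rule: tensor_induct)
  case zero
  then show ?case using lin_zero[OF assms(1)] lin_zero[OF assms(2)] tensor_module assms(3) by simp
next
  case (add v w y)
  then show ?case using lin_add[OF assms(1)] lin_add[OF assms(2)] eq by (simp add: pure_closed)
qed

lemma summands_carrier:
  assumes "x \<in> carrier (tensor K V W)" shows "set (summands x) \<subseteq> carrier V \<times> carrier W"
  using assms tensor_eq_carrier[OF summands_tensor_class] by (elim tensor_carrier_cases) simp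

end

end

section \<open>Independence of tensor products from additional record fields\<close>

text \<open>Only the carriers and the vector space operations enter the relation. The records
  compared may have different types, so that a comodule or an algebra can be exchanged for its
  underlying space inside a tensor product.\<close>

lemma tensor_eq_cong:
  assumes "carrier V' = carrier V" "add V' = add V" "zero V' = zero V" "smult V' = smult V"
    and "carrier W' = carrier W" "add W' = add W" "zero W' = zero W" "smult W' = smult W"
    and "tensor_eq K V W l l'"
  shows "tensor_eq K V' W' l l'"
  using assms(9)
proof (induction rule: tensor_eq.induct)
  case (trans l l' l'')
  show ?case by (rule tensor_eq.trans[OF trans.IH])
next
  case (sym l l')
  show ?case by (rule tensor_eq.sym[OF sym.IH])
next
  case (append l l' m m')
  show ?case by (rule tensor_eq.append[OF append.IH])
next
  case (add_left v v' w)
  then show ?case using tensor_eq.add_left[of v V' v' w W'] by (simp add: assms)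
next
  case (add_right v w w')
  then show ?case using tensor_eq.add_right[of v V' w W' w'] by (simp add: assms)
next
  case (zero w)
  then show ?case using tensor_eq.zero[of w W' K V'] by (simp add: assms)
next
  case (smult a v w)
  then show ?case using tensor_eq.smult[of a K v V' w W'] by (simp add: assms)
next
  case (refl l)
  then show ?case by (intro tensor_eq.refl) (simp add: assms)
next
  case (comm l m)
  then show ?case by (intro tensor_eq.comm) (simp_all add: assms)
qed

lemma tensor_class_cong:
  assumes "carrier V' = carrier V" "add V' = add V" "zero V' = zero V" "smult V' = smult V"
    and "carrier W' = carrier W" "add W' = add W" "zero W' = zero W" "smult W' = smult W"
  shows "tensor_class K V' W' = tensor_class K V W"
proof
  fix l
  have "tensor_eq K V' W' l = tensor_eq K V W l"
    using tensor_eq_cong[OF assms] tensor_eq_cong[OF assms[symmetric]] by blast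
  then show "tensor_class K V' W' l = tensor_class K V W l" by (simp add: tensor_class_def)
qed

lemma tensor_cong:
  assumes "carrier V' = carrier V" "add V' = add V" "zero V' = zero V" "smult V' = smult V"
    and "carrier W' = carrier W" "add W' = add W" "zero W' = zero W" "smult W' = smult W"
  shows "tensor K V' W' = tensor K V W" and "pure K V' W' = pure K V W"
  by (simp_all add: tensor_def pure_def tensor_class_cong[OF assms] assms fun_eq_iff)

lemma lin_cong_module:
  assumes "carrier V' = carrier V" "add V' = add V" "zero V' = zero V" "smult V' = smult V"
    and "carrier W' = carrier W" "add W' = add W" "zero W' = zero W" "smult W' = smult W"
  shows "lin K V' W' = lin K V W"
  using assms by (simp add: lin_def)

lemma module_cong:
  assumes "carrier V' = carrier V" "add V' = add V" "zero V' = zero V" "smult V' = smult V"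
    and "module K V"
  shows "module K V'"
proof (rule moduleI)
  interpret V: module K V by fact
  show "cring K" by unfold_locales
  show "abelian_group V'"
  proof (rule abelian_groupI)
    fix x assume "x \<in> carrier V'"
    then show "\<exists>y\<in>carrier V'. y \<oplus>\<^bsub>V'\<^esub> x = \<zero>\<^bsub>V'\<^esub>"
      by (intro bexI[of _ "\<ominus>\<^bsub>V\<^esub> x"]) (simp_all add: assms(1-4) V.l_neg)
  qed (simp_all add: assms(1-4) V.a_ac)
qed (simp_all add: assms(1-4) module.smult_l_distr[OF assms(5)] module.smult_r_distr[OF assms(5)]
     module.smult_assoc1[OF assms(5)] module.smult_one[OF assms(5)] module.smult_closed[OF assms(5)])

lemma with_coact_simps [simp]:
  "carrier (with_coact V \<rho>) = carrier V" "add (with_coact V \<rho>) = add V"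
  "zero (with_coact V \<rho>) = zero V" "smult (with_coact V \<rho>) = smult V"
  "coact (with_coact V \<rho>) = \<rho>" "module.truncate (with_coact V \<rho>) = V"
  by (simp_all add: with_coact_def module.defs comod.defs)

lemma truncate_simps [simp]:
  "carrier (module.truncate V) = carrier V" "add (module.truncate V) = add V"
  "zero (module.truncate V) = zero V" "smult (module.truncate V) = smult V"
  by (simp_all add: module.defs)

lemma ground_simps [simp]:
  "carrier (ground K) = carrier K" "add (ground K) = add K"
  "zero (ground K) = zero K" "smult (ground K) = mult K"
  by (simp_all add: ground_def module.defs ring.defs)

lemma tensor_with_coact [simp]:
  "tensor K (with_coact V \<rho>) W = tensor K V W" "tensor K U (with_coact V \<rho>) = tensor K U V"
  "pure K (with_coact V \<rho>) W = pure K V W" "pure K U (with_coact V \<rho>) = pure K U V"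
  by (rule tensor_cong; simp)+

lemma tensor_truncate [simp]:
  "tensor K (module.truncate V) W = tensor K V W" "tensor K U (module.truncate V) = tensor K U V"
  "pure K (module.truncate V) W = pure K V W" "pure K U (module.truncate V) = pure K U V"
  by (rule tensor_cong; simp)+

lemma lin_with_coact [simp]:
  "lin K (with_coact V \<rho>) W = lin K V W" "lin K U (with_coact V \<rho>) = lin K U V"
  "lin K (module.truncate N) W = lin K N W" "lin K U (module.truncate N) = lin K U N"
  by (rule lin_cong_module; simp)+

lemma module_with_coact [simp]: "module K (with_coact V \<rho>) \<longleftrightarrow> module K V"
proof
  show "module K (with_coact V \<rho>) \<Longrightarrow> module K V" by (rule module_cong[of _ "with_coact V \<rho>"]) simp_all
  show "module K V \<Longrightarrow> module K (with_coact V \<rho>)" by (rule module_cong[of _ V]) simp_all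
qed

lemma module_truncate [simp]: "module K (module.truncate V) \<longleftrightarrow> module K V"
proof
  show "module K (module.truncate V) \<Longrightarrow> module K V" by (rule module_cong[of _ "module.truncate V"]) simp_all
  show "module K V \<Longrightarrow> module K (module.truncate V)" by (rule module_cong[of _ V]) simp_all
qed

lemma tsum_with_coact [simp]:
  "tsum (with_coact V \<rho>) x \<beta> = tsum V x \<beta>" "tsum (module.truncate N) x \<beta> = tsum N x \<beta>"
  by (simp_all add: tsum_def)

section \<open>Calculus of Sweedler sums\<close>

text \<open>Unlike \<open>tsum\<close>, this sum admits an unconditional congruence rule, so that the simplifier knows
  inside the sum that the tensor factors lie in the respective carriers.\<close>

definition sweedler :: "('a univ, 'a univ, 'x) module_scheme \<Rightarrow> ('a univ, 'a univ, 'y) module_scheme \<Rightarrow>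
    ('a univ, 'a univ, 'z) module_scheme \<Rightarrow> 'a univ \<Rightarrow> ('a univ \<Rightarrow> 'a univ \<Rightarrow> 'a univ) \<Rightarrow> 'a univ" where
  "sweedler V W U x \<beta> = tsum U x (\<lambda>v w. if v \<in> carrier V \<and> w \<in> carrier W then \<beta> v w else \<zero>\<^bsub>U\<^esub>)"

lemma sweedler_cong [cong]:
  assumes "V = V'" "W = W'" "U = U'" "x = x'"
    and "\<And>v w. \<lbrakk>v \<in> carrier V'; w \<in> carrier W'\<rbrakk> \<Longrightarrow> \<beta> v w = \<beta>' v w"
  shows "sweedler V W U x \<beta> = sweedler V' W' U' x' \<beta>'"
  unfolding assms(1-4) sweedler_def using assms(5) by (intro arg_cong2[where f="tsum U'"] ext) auto

lemma lsum_cong: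
  assumes "set l \<subseteq> carrier V \<times> carrier W"
    and "\<And>v w. \<lbrakk>v \<in> carrier V; w \<in> carrier W\<rbrakk> \<Longrightarrow> \<beta> v w = \<gamma> v w"
  shows "lsum U \<beta> l = lsum U \<gamma> l"
  using assms(1) by (induction l) (auto simp: assms(2))

lemma sweedler_with_coact [simp]:
  "sweedler (with_coact M \<rho>) W U x \<beta> = sweedler M W U x \<beta>"
  "sweedler V (with_coact M \<rho>) U x \<beta> = sweedler V M U x \<beta>"
  "sweedler V W (with_coact M \<rho>) x \<beta> = sweedler V W M x \<beta>"
  "sweedler (module.truncate N) W U x \<beta> = sweedler N W U x \<beta>"
  "sweedler V (module.truncate N) U x \<beta> = sweedler V N U x \<beta>"
  "sweedler V W (module.truncate N) x \<beta> = sweedler V W N x \<beta>"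
  by (simp_all add: sweedler_def cong: if_cong)

context scalars
begin

lemmas [simp] = module_facts pure_closed tensor_module

lemma abelian_group_ground: "abelian_group (ground K)"
proof (rule abelian_groupI)
  fix x assume "x \<in> carrier (ground K)"
  then show "\<exists>y\<in>carrier (ground K). y \<oplus>\<^bsub>ground K\<^esub> x = \<zero>\<^bsub>ground K\<^esub>"
    by (intro bexI[of _ "\<ominus>\<^bsub>K\<^esub> x"]) (simp_all add: l_neg)
qed (simp_all add: a_ac)

lemma module_ground [simp]: "module K (ground K)"
  by (rule moduleI)
    (simp_all add: is_cring l_distr r_distr m_assoc abelian_group_ground)

text \<open>Bilinearity looks at arguments in the carriers only, where the guard holds.\<close>

lemma bilin_guarded:
  assumes "bilin K V W U \<beta>" "module K V" "module K W"
  shows "bilin K V W U (\<lambda>v w. if v \<in> carrier V \<and> w \<in> carrier W then \<beta> v w else \<zero>\<^bsub>U\<^esub>)"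
  using assms unfolding bilin_def
  by (auto intro: lin_cong[where f="\<lambda>v. \<beta> v _"] lin_cong[where f="\<beta> _"])

text \<open>The chosen representative of a tensor has its factors in the carriers
  (\<open>summands_carrier\<close>), so the guard in \<open>sweedler\<close> is true for every
  summand.\<close>

lemma tsum_sweedler:
  assumes "x \<in> carrier (tensor K V W)" "module K V" "module K W"
  shows "tsum U x \<beta> = sweedler V W U x \<beta>"
  unfolding sweedler_def tsum_lsum by (rule lsum_cong[OF summands_carrier]) (use assms in auto)

text \<open>A summand with a factor outside the carriers contributes zero, so membership of the sum
  in \<open>U\<close> is decided by the values of \<open>\<beta>\<close> on the carriers.\<close>

lemma sweedler_closed [simp, intro]:
  assumes "module K U" "\<And>v w. \<lbrakk>v \<in> carrier V; w \<in> carrier W\<rbrakk> \<Longrightarrow> \<beta> v w \<in> carrier U"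
  shows "sweedler V W U x \<beta> \<in> carrier U"
proof -
  have "lsum U (\<lambda>v w. if v \<in> carrier V \<and> w \<in> carrier W then \<beta> v w else \<zero>\<^bsub>U\<^esub>) l \<in> carrier U" for l
    by (induction l) (auto simp: assms)
  then show ?thesis by (simp add: sweedler_def tsum_lsum)
qed

lemma sweedler_pure [simp]:
  assumes "bilin K V W U \<beta>" "module K V" "module K W" "module K U" "v \<in> carrier V" "w \<in> carrier W"
  shows "sweedler V W U (pure K V W v w) \<beta> = \<beta> v w"
  unfolding sweedler_def using assms by (subst tsum_pure[OF _ _ bilin_guarded]) auto

text \<open>A linear map commutes with finite sums. The instances for pure tensors, scalar
  multiples, products and coactions move every sum to the outside, where two Sweedler expressions
  can be compared term by term.\<close>

lemma lin_of_sweedler: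
  assumes "h \<in> lin K U U'" "module K U" "module K U'"
    and "\<And>v w. \<lbrakk>v \<in> carrier V; w \<in> carrier W\<rbrakk> \<Longrightarrow> \<beta> v w \<in> carrier U"
  shows "h (sweedler V W U x \<beta>) = sweedler V W U' x (\<lambda>v w. h (\<beta> v w))"
proof -
  let ?\<beta> = "\<lambda>v w. if v \<in> carrier V \<and> w \<in> carrier W then \<beta> v w else \<zero>\<^bsub>U\<^esub>"
  have cl: "lsum U ?\<beta> l \<in> carrier U" for l
    by (induction l) (auto simp: assms)
  have "h (lsum U ?\<beta> l) = lsum U' (\<lambda>v w. if v \<in> carrier V \<and> w \<in> carrier W then h (\<beta> v w) else \<zero>\<^bsub>U'\<^esub>) l" for l
    by (induction l) (use cl in \<open>auto simp: assms lin_zero[OF assms(1)] lin_add[OF assms(1)]\<close>)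
  then show ?thesis by (simp add: sweedler_def tsum_lsum)
qed

lemma lin_ident [simp]: "(\<lambda>x. x) \<in> lin K X X"
  by (simp add: lin_def)

lemma lin_compose: "\<lbrakk>g \<in> lin K Y Z; f \<in> lin K X Y\<rbrakk> \<Longrightarrow> (\<lambda>x. g (f x)) \<in> lin K X Z"
  by (intro linI) (simp_all add: lin_closed lin_add lin_smult)

lemma lin_sweedler_elem [simp]:
  assumes "f \<in> lin K X (tensor K V W)" "bilin K V W U \<beta>" "module K V" "module K W" "module K U"
  shows "(\<lambda>x. sweedler V W U (f x) \<beta>) \<in> lin K X U"
  unfolding sweedler_def using assms
  by (intro lin_compose[OF tsum_lin assms(1)] bilin_guarded)

text \<open>Linearity in a parameter of the summands, by induction on the representing list.
  Together with \<open>lin_sweedler_elem\<close> it lets the simplifier read off the linearity of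
  nested Sweedler expressions from their shape.\<close>

lemma lin_sweedler_body [simp]:
  assumes "\<And>v w. \<lbrakk>v \<in> carrier V; w \<in> carrier W\<rbrakk> \<Longrightarrow> (\<lambda>x. \<gamma> x v w) \<in> lin K X U" "module K U" "module K X"
  shows "(\<lambda>x. sweedler V W U t (\<lambda>v w. \<gamma> x v w)) \<in> lin K X U"
proof -
  interpret U: module K U by fact
  interpret X: module K X by fact
  let ?\<gamma> = "\<lambda>x v w. if v \<in> carrier V \<and> w \<in> carrier W then \<gamma> x v w else \<zero>\<^bsub>U\<^esub>"
  have "(\<lambda>x. lsum U (?\<gamma> x) l) \<in> lin K X U" for l
  proof (induction l)
    case (Cons p l)
    obtain v w where p: "p = (v, w)" by (cases p)
    have g: "(\<lambda>x. ?\<gamma> x v w) \<in> lin K X U"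
    proof (cases "v \<in> carrier V \<and> w \<in> carrier W")
      case True
      then show ?thesis using assms(1)[of v w] by simp
    qed (auto simp: assms lin_def)
    show ?case
      unfolding p lsum_Cons
    proof (rule linI, goal_cases)
      case (1 x) then show ?case using lin_closed[OF g] lin_closed[OF Cons] by simp
    next
      case (2 x y)
      then show ?case using lin_closed[OF g] lin_closed[OF Cons] lin_add[OF g 2] lin_add[OF Cons 2]
        by (simp add: U.a_ac)
    next
      case (3 a x)
      then show ?case
        using lin_closed[OF g 3(2)] lin_closed[OF Cons 3(2)] lin_smult[OF g 3] lin_smult[OF Cons 3]
        by (simp add: U.smult_r_distr)
    qed
  qed (auto simp: lin_def)
  then show ?thesis by (simp add: sweedler_def tsum_lsum)
qed

lemma lin_pure_left [simp]:
  assumes "f \<in> lin K X V" "w \<in> carrier W" "module K V" "module K W"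
  shows "(\<lambda>x. pure K V W (f x) w) \<in> lin K X (tensor K V W)"
  by (rule lin_compose[OF _ assms(1)]) (use assms in \<open>auto intro!: linI simp: pure_add_left pure_smult_left\<close>)

lemma lin_pure_right [simp]:
  assumes "f \<in> lin K X W" "v \<in> carrier V" "module K V" "module K W"
  shows "(\<lambda>x. pure K V W v (f x)) \<in> lin K X (tensor K V W)"
  by (rule lin_compose[OF _ assms(1)]) (use assms in \<open>auto intro!: linI simp: pure_add_right pure_smult_right\<close>)

lemma lin_smult_scalar [simp]:
  assumes "f \<in> lin K X (ground K)" "v \<in> carrier V" "module K V"
  shows "(\<lambda>x. f x \<odot>\<^bsub>V\<^esub> v) \<in> lin K X V"
  by (rule lin_compose[OF _ assms(1)])
    (use assms in \<open>auto intro!: linI simp: module.smult_l_distr module.smult_assoc1\<close>)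

lemma lin_smult_vector [simp]:
  assumes "f \<in> lin K X V" "a \<in> carrier K" "module K V"
  shows "(\<lambda>x. a \<odot>\<^bsub>V\<^esub> f x) \<in> lin K X V"
proof (rule lin_compose[OF _ assms(1)])
  interpret V: module K V by fact
  show "(\<lambda>x. a \<odot>\<^bsub>V\<^esub> x) \<in> lin K V V"
  proof (rule linI)
    fix b x assume "b \<in> carrier K" "x \<in> carrier V"
    then show "a \<odot>\<^bsub>V\<^esub> (b \<odot>\<^bsub>V\<^esub> x) = b \<odot>\<^bsub>V\<^esub> (a \<odot>\<^bsub>V\<^esub> x)"
      using assms(2) by (metis V.smult_assoc1 m_comm)
  qed (use assms(2) in \<open>simp_all add: V.smult_r_distr\<close>)
qed

declare bilin_def [simp]

lemma lin_sweedler [simp]: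
  assumes "bilin K V W U \<beta>" "module K V" "module K W" "module K U"
  shows "(\<lambda>x. sweedler V W U x \<beta>) \<in> lin K (tensor K V W) U"
  by (rule lin_sweedler_elem) (use assms in auto)

lemma sweedler_sweedler [simp]:
  assumes "bilin K P Q U \<Phi>" "module K P" "module K Q" "module K U"
    and "\<And>v w. \<lbrakk>v \<in> carrier V; w \<in> carrier W\<rbrakk> \<Longrightarrow> \<beta> v w \<in> carrier (tensor K P Q)"
  shows "sweedler P Q U (sweedler V W (tensor K P Q) x \<beta>) \<Phi>
    = sweedler V W U x (\<lambda>v w. sweedler P Q U (\<beta> v w) \<Phi>)"
  using assms by (intro lin_of_sweedler) auto

lemma pure_sweedler_left [simp]:
  assumes "module K P" "module K Q" "q \<in> carrier Q"
    and "\<And>v w. \<lbrakk>v \<in> carrier V; w \<in> carrier W\<rbrakk> \<Longrightarrow> \<beta> v w \<in> carrier P"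
  shows "pure K P Q (sweedler V W P x \<beta>) q = sweedler V W (tensor K P Q) x (\<lambda>v w. pure K P Q (\<beta> v w) q)"
  using assms by (intro lin_of_sweedler) auto

lemma pure_sweedler_right [simp]:
  assumes "module K P" "module K Q" "p \<in> carrier P"
    and "\<And>v w. \<lbrakk>v \<in> carrier V; w \<in> carrier W\<rbrakk> \<Longrightarrow> \<beta> v w \<in> carrier Q"
  shows "pure K P Q p (sweedler V W Q x \<beta>) = sweedler V W (tensor K P Q) x (\<lambda>v w. pure K P Q p (\<beta> v w))"
  using assms by (intro lin_of_sweedler) auto

lemma smult_sweedler_left [simp]:
  assumes "module K U" "u \<in> carrier U"
    and "\<And>v w. \<lbrakk>v \<in> carrier V; w \<in> carrier W\<rbrakk> \<Longrightarrow> \<beta> v w \<in> carrier K"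
  shows "sweedler V W (ground K) x \<beta> \<odot>\<^bsub>U\<^esub> u = sweedler V W U x (\<lambda>v w. \<beta> v w \<odot>\<^bsub>U\<^esub> u)"
  using assms by (intro lin_of_sweedler[where U="ground K"]) auto

lemma smult_sweedler_right [simp]:
  assumes "module K U" "a \<in> carrier K"
    and "\<And>v w. \<lbrakk>v \<in> carrier V; w \<in> carrier W\<rbrakk> \<Longrightarrow> \<beta> v w \<in> carrier U"
  shows "a \<odot>\<^bsub>U\<^esub> sweedler V W U x \<beta> = sweedler V W U x (\<lambda>v w. a \<odot>\<^bsub>U\<^esub> \<beta> v w)"
  using assms by (intro lin_of_sweedler) auto

lemma sweedler_add_body:
  assumes "module K U" and f: "\<And>v w. \<lbrakk>v \<in> carrier V; w \<in> carrier W\<rbrakk> \<Longrightarrow> f v w \<in> carrier U"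
    and g: "\<And>v w. \<lbrakk>v \<in> carrier V; w \<in> carrier W\<rbrakk> \<Longrightarrow> g v w \<in> carrier U"
  shows "sweedler V W U x (\<lambda>v w. f v w \<oplus>\<^bsub>U\<^esub> g v w) = sweedler V W U x f \<oplus>\<^bsub>U\<^esub> sweedler V W U x g"
proof -
  interpret U: module K U by fact
  let ?g = "\<lambda>h v w. if v \<in> carrier V \<and> w \<in> carrier W then h v w else \<zero>\<^bsub>U\<^esub>"
  have cl: "lsum U (?g h) l \<in> carrier U" if "\<And>v w. \<lbrakk>v \<in> carrier V; w \<in> carrier W\<rbrakk> \<Longrightarrow> h v w \<in> carrier U" for h l
    by (induction l) (auto simp: that)
  have "lsum U (?g (\<lambda>v w. f v w \<oplus>\<^bsub>U\<^esub> g v w)) l = lsum U (?g f) l \<oplus>\<^bsub>U\<^esub> lsum U (?g g) l" for l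
    by (induction l) (use f g cl[OF f] cl[OF g] in \<open>auto simp: U.a_ac\<close>)
  then show ?thesis by (simp add: sweedler_def tsum_lsum)
qed

lemma sweedler_zero_body [simp]:
  assumes "module K U" shows "sweedler V W U x (\<lambda>v w. \<zero>\<^bsub>U\<^esub>) = \<zero>\<^bsub>U\<^esub>"
proof -
  have "lsum U (\<lambda>v w. \<zero>\<^bsub>U\<^esub>) l = \<zero>\<^bsub>U\<^esub>" for l
    by (induction l) (auto simp: assms)
  then show ?thesis by (simp add: sweedler_def tsum_lsum)
qed

text \<open>Interchange of two independent finite sums. It serves to bring two expansions of the
  same element next to each other, so that coassociativity can be applied.\<close>

lemma sweedler_swap:
  assumes "module K U"
    and "\<And>v w p q. \<lbrakk>v \<in> carrier V; w \<in> carrier W; p \<in> carrier P; q \<in> carrier Q\<rbrakk> \<Longrightarrow> \<beta> v w p q \<in> carrier U"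
  shows "sweedler V W U x (\<lambda>v w. sweedler P Q U y (\<lambda>p q. \<beta> v w p q))
    = sweedler P Q U y (\<lambda>p q. sweedler V W U x (\<lambda>v w. \<beta> v w p q))"
proof -
  let ?g = "\<lambda>h v w. if v \<in> carrier V \<and> w \<in> carrier W then h v w else \<zero>\<^bsub>U\<^esub>"
  have cl: "lsum U (?g h) l \<in> carrier U" if "\<And>v w. \<lbrakk>v \<in> carrier V; w \<in> carrier W\<rbrakk> \<Longrightarrow> h v w \<in> carrier U" for h l
    by (induction l) (auto simp: that assms)
  have "lsum U (?g (\<lambda>v w. sweedler P Q U y (\<lambda>p q. \<beta> v w p q))) l
    = sweedler P Q U y (\<lambda>p q. lsum U (?g (\<lambda>v w. \<beta> v w p q)) l)" for l
  proof (induction l)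
    case (Cons i l)
    obtain v w where i: "i = (v, w)" by (cases i)
    show ?case
    proof (cases "v \<in> carrier V \<and> w \<in> carrier W")
      case True
      have "lsum U (?g (\<lambda>v w. \<beta> v w p q)) l \<in> carrier U" if "p \<in> carrier P" "q \<in> carrier Q" for p q
        by (rule cl) (use that assms in auto)
      then show ?thesis
        by (simp only: i lsum_Cons Cons True if_True simp_thms)
          (rule sweedler_add_body[symmetric]; use True assms in simp)
    next
      \<comment> \<open>The guard turns this summand into zero on the left, and a zero added inside
        the sum on the right changes nothing.\<close>
      case False
      have "lsum U (?g (\<lambda>v w. \<beta> v w p q)) l \<in> carrier U" if "p \<in> carrier P" "q \<in> carrier Q" for p q
        by (rule cl) (use that assms in auto)
      note L = this
      have "sweedler P Q U y (\<lambda>p q. \<zero>\<^bsub>U\<^esub> \<oplus>\<^bsub>U\<^esub> lsum U (?g (\<lambda>v w. \<beta> v w p q)) l)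
        = sweedler P Q U y (\<lambda>p q. lsum U (?g (\<lambda>v w. \<beta> v w p q)) l)"
        by (intro sweedler_cong refl) (simp_all add: L assms(1))
      moreover have "sweedler P Q U y (\<lambda>p q. lsum U (?g (\<lambda>v w. \<beta> v w p q)) l) \<in> carrier U"
        by (rule sweedler_closed[OF assms(1) L])
      ultimately show ?thesis
        by (simp only: i lsum_Cons Cons False if_False) (simp add: assms(1))
    qed
  qed (simp add: assms)
  then show ?thesis by (simp add: sweedler_def[of V W] tsum_lsum)
qed

text \<open>The endomorphism induced by \<open>pure\<close> is the identity, since it fixes pure
  tensors.\<close>

lemma sweedler_self [simp]:
  assumes "x \<in> carrier (tensor K V W)" "module K V" "module K W"
  shows "sweedler V W (tensor K V W) x (pure K V W) = x"
  by (rule lin_eq_on_tensor[where f="\<lambda>x. sweedler V W (tensor K V W) x (pure K V W)" and g="\<lambda>x. x" and U="tensor K V W", OF assms(2,3) _ _ _ _ assms(1)])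
    (use assms in simp_all)

end

context scalars
begin

lemmas [simp] = pure_smult_left pure_smult_right

lemma lin_comp_simp:
  assumes "g \<in> lin K Y Z"
  shows "f \<in> lin K X Y \<Longrightarrow> (\<lambda>x. g (f x)) \<in> lin K X Z"
  using lin_compose[OF assms] .

text \<open>The uniqueness half of the universal property, applied once for each tensor sign. The
  primed variant is for the other bracketing.\<close>

lemma lin_eq_on_tensor3:
  assumes "f \<in> lin K (tensor K P (tensor K Q R)) U" "g \<in> lin K (tensor K P (tensor K Q R)) U"
    and mods [simp]: "module K P" "module K Q" "module K R" "module K U"
    and eq: "\<And>p q r. \<lbrakk>p \<in> carrier P; q \<in> carrier Q; r \<in> carrier R\<rbrakk>
          \<Longrightarrow> f (pure K P (tensor K Q R) p (pure K Q R q r)) = g (pure K P (tensor K Q R) p (pure K Q R q r))"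
    and x: "x \<in> carrier (tensor K P (tensor K Q R))"
  shows "f x = g x"
proof (rule lin_eq_on_tensor[OF _ _ assms(1,2) _ _ x])
  fix p y assume p: "p \<in> carrier P" and y: "y \<in> carrier (tensor K Q R)"
  show "f (pure K P (tensor K Q R) p y) = g (pure K P (tensor K Q R) p y)"
    by (rule lin_eq_on_tensor[where f="\<lambda>y. f (pure K P (tensor K Q R) p y)"
          and g="\<lambda>y. g (pure K P (tensor K Q R) p y)" and U=U, OF _ _ _ _ _ _ y])
      (use p eq in \<open>auto intro!: lin_compose[OF assms(1)] lin_compose[OF assms(2)]\<close>)
qed simp_all

lemma lin_eq_on_tensor3':
  assumes "f \<in> lin K (tensor K (tensor K P Q) R) U" "g \<in> lin K (tensor K (tensor K P Q) R) U"
    and mods [simp]: "module K P" "module K Q" "module K R" "module K U"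
    and eq: "\<And>p q r. \<lbrakk>p \<in> carrier P; q \<in> carrier Q; r \<in> carrier R\<rbrakk>
          \<Longrightarrow> f (pure K (tensor K P Q) R (pure K P Q p q) r) = g (pure K (tensor K P Q) R (pure K P Q p q) r)"
    and x: "x \<in> carrier (tensor K (tensor K P Q) R)"
  shows "f x = g x"
proof (rule lin_eq_on_tensor[OF _ _ assms(1,2) _ _ x])
  fix y r assume r: "r \<in> carrier R" and y: "y \<in> carrier (tensor K P Q)"
  show "f (pure K (tensor K P Q) R y r) = g (pure K (tensor K P Q) R y r)"
    by (rule lin_eq_on_tensor[where f="\<lambda>y. f (pure K (tensor K P Q) R y r)"
          and g="\<lambda>y. g (pure K (tensor K P Q) R y r)" and U=U, OF _ _ _ _ _ _ y])
      (use r eq in \<open>auto intro!: lin_compose[OF assms(1)] lin_compose[OF assms(2)]\<close>)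
qed simp_all

end

section \<open>Sweedler identities in bialgebras and comodules\<close>

sublocale bialgebra \<subseteq> scalars K
  using base_field by (simp add: scalars_def field.axioms(1) domain.axioms(1))

context bialgebra
begin

interpretation R: ring B by (rule mult_ring)

lemmas mult_facts [simp] = R.m_closed R.one_closed R.l_one R.r_one

declare vector_space [simp] comult_lin [simp] counit_lin [simp]

lemma mult_assoc: "\<lbrakk>x \<in> carrier B; y \<in> carrier B; z \<in> carrier B\<rbrakk>
    \<Longrightarrow> (x \<otimes>\<^bsub>B\<^esub> y) \<otimes>\<^bsub>B\<^esub> z = x \<otimes>\<^bsub>B\<^esub> (y \<otimes>\<^bsub>B\<^esub> z)"
  by (rule R.m_assoc)

lemma comult_closed [simp]: "b \<in> carrier B \<Longrightarrow> comult B b \<in> carrier (tensor K B B)"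
  using lin_closed[OF comult_lin] .

lemma counit_closed [simp]: "b \<in> carrier B \<Longrightarrow> counit B b \<in> carrier K"
  using lin_closed[OF counit_lin] by simp

lemmas [simp] = lin_comp_simp[OF comult_lin] lin_comp_simp[OF counit_lin]

lemma lin_mult_left [simp]: "\<lbrakk>f \<in> lin K X B; b \<in> carrier B\<rbrakk> \<Longrightarrow> (\<lambda>x. f x \<otimes>\<^bsub>B\<^esub> b) \<in> lin K X B"
  by (rule lin_compose) (auto intro!: linI simp: R.l_distr smult_mult_left)

lemma lin_mult_right [simp]: "\<lbrakk>f \<in> lin K X B; b \<in> carrier B\<rbrakk> \<Longrightarrow> (\<lambda>x. b \<otimes>\<^bsub>B\<^esub> f x) \<in> lin K X B"
  by (rule lin_compose[of "\<lambda>x. b \<otimes>\<^bsub>B\<^esub> x"]) (auto intro!: linI simp: R.r_distr smult_mult_right)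

lemma lin_app_sweedler [simp]:
  assumes "\<And>v w. \<lbrakk>v \<in> carrier V; w \<in> carrier W\<rbrakk> \<Longrightarrow> \<beta> v w \<in> carrier B"
  shows "comult B (sweedler V W B x \<beta>) = sweedler V W (tensor K B B) x (\<lambda>v w. comult B (\<beta> v w))"
    and "counit B (sweedler V W B x \<beta>) = sweedler V W (ground K) x (\<lambda>v w. counit B (\<beta> v w))"
    and "b \<in> carrier B \<Longrightarrow> sweedler V W B x \<beta> \<otimes>\<^bsub>B\<^esub> b = sweedler V W B x (\<lambda>v w. \<beta> v w \<otimes>\<^bsub>B\<^esub> b)"
    and "b \<in> carrier B \<Longrightarrow> b \<otimes>\<^bsub>B\<^esub> sweedler V W B x \<beta> = sweedler V W B x (\<lambda>v w. b \<otimes>\<^bsub>B\<^esub> \<beta> v w)"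
  using assms by (auto intro!: lin_of_sweedler)

lemma counit_smult [simp]:
  "\<lbrakk>a \<in> carrier K; b \<in> carrier B\<rbrakk> \<Longrightarrow> counit B (a \<odot>\<^bsub>B\<^esub> b) = a \<otimes>\<^bsub>K\<^esub> counit B b"
  using lin_smult[OF counit_lin] by simp

declare counit_mult [simp] counit_one [simp] comult_one [simp]

lemma comult_mult_sweedler:
  assumes [simp]: "b \<in> carrier B" "c \<in> carrier B"
  shows "comult B (b \<otimes>\<^bsub>B\<^esub> c) =
    sweedler B B (tensor K B B) (comult B b) (\<lambda>b\<^sub>1 b\<^sub>2. sweedler B B (tensor K B B) (comult B c)
      (\<lambda>c\<^sub>1 c\<^sub>2. pure K B B (b\<^sub>1 \<otimes>\<^bsub>B\<^esub> c\<^sub>1) (b\<^sub>2 \<otimes>\<^bsub>B\<^esub> c\<^sub>2)))"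
  by (simp add: comult_mult tsum_sweedler[where V=B and W=B])

text \<open>A trilinear \<open>\<Psi>\<close> induces a linear map on B \<otimes> (B \<otimes> B),
  and that map is applied to the coassociativity axiom. The result is the usual licence to write
  b_1, b_2, b_3 without saying which factor was split again.\<close>

lemma coassoc_sweedler:
  assumes [simp]: "b \<in> carrier B" "module K U"
    and "\<And>y z. \<lbrakk>y \<in> carrier B; z \<in> carrier B\<rbrakk> \<Longrightarrow> (\<lambda>x. \<Psi> x y z) \<in> lin K B U"
    and "\<And>x z. \<lbrakk>x \<in> carrier B; z \<in> carrier B\<rbrakk> \<Longrightarrow> (\<lambda>y. \<Psi> x y z) \<in> lin K B U"
    and "\<And>x y. \<lbrakk>x \<in> carrier B; y \<in> carrier B\<rbrakk> \<Longrightarrow> (\<lambda>z. \<Psi> x y z) \<in> lin K B U"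
  shows "sweedler B B U (comult B b) (\<lambda>x y. sweedler B B U (comult B x) (\<lambda>x\<^sub>1 x\<^sub>2. \<Psi> x\<^sub>1 x\<^sub>2 y))
    = sweedler B B U (comult B b) (\<lambda>x y. sweedler B B U (comult B y) (\<lambda>y\<^sub>1 y\<^sub>2. \<Psi> x y\<^sub>1 y\<^sub>2))"
proof -
  let ?h = "\<lambda>t. sweedler B (tensor K B B) U t (\<lambda>x s. sweedler B B U s (\<lambda>y z. \<Psi> x y z))"
  let ?T = "tensor K B (tensor K B B)"
  note [simp] = assms(3-5) lin_closed[OF assms(3)]
  have "sweedler B B ?T (comult B b) (\<lambda>x y. sweedler B B ?T (comult B x)
        (\<lambda>x\<^sub>1 x\<^sub>2. pure K B (tensor K B B) x\<^sub>1 (pure K B B x\<^sub>2 y)))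
    = sweedler B B ?T (comult B b) (\<lambda>x y. pure K B (tensor K B B) x (comult B y))"
    using coassoc[of b] by (simp add: Let_def tsum_sweedler[where V=B and W=B])
  from arg_cong[OF this, of ?h] show ?thesis by simp
qed

text \<open>The counit axioms with a linear map \<open>f\<close> applied to them. In this form they
  match sums that occur below another linear expression.\<close>

lemma counit_sweedler:
  assumes [simp]: "b \<in> carrier B" "f \<in> lin K B U" "module K U"
  shows "sweedler B B U (comult B b) (\<lambda>x y. counit B x \<odot>\<^bsub>U\<^esub> f y) = f b"
    and "sweedler B B U (comult B b) (\<lambda>x y. counit B y \<odot>\<^bsub>U\<^esub> f x) = f b"
proof -
  have [simp]: "a \<in> carrier K \<Longrightarrow> x \<in> carrier B \<Longrightarrow> f (a \<odot>\<^bsub>B\<^esub> x) = a \<odot>\<^bsub>U\<^esub> f x" for a x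
    using lin_smult[OF assms(2)] .
  have "sweedler B B B (comult B b) (\<lambda>x y. counit B x \<odot>\<^bsub>B\<^esub> y) = b"
    using counit_left[of b] by (simp add: tsum_sweedler[where V=B and W=B])
  from arg_cong[OF this, of f]
  show "sweedler B B U (comult B b) (\<lambda>x y. counit B x \<odot>\<^bsub>U\<^esub> f y) = f b"
    by (subst (asm) lin_of_sweedler[OF assms(2)]) simp_all
  have "sweedler B B B (comult B b) (\<lambda>x y. counit B y \<odot>\<^bsub>B\<^esub> x) = b"
    using counit_right[of b] by (simp add: tsum_sweedler[where V=B and W=B])
  from arg_cong[OF this, of f]
  show "sweedler B B U (comult B b) (\<lambda>x y. counit B y \<odot>\<^bsub>U\<^esub> f x) = f b"
    by (subst (asm) lin_of_sweedler[OF assms(2)]) simp_all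
qed

abbreviation comodule :: "'a comod \<Rightarrow> bool" where "comodule M \<equiv> left_comodule K B M"

lemma comodule_module [simp]: "comodule M \<Longrightarrow> module K M"
  by (rule left_comodule.vector_space)

lemma coact_lin [simp]: "comodule M \<Longrightarrow> coact M \<in> lin K M (tensor K B M)"
  by (rule left_comodule.coact_lin)

lemma lin_coact [simp]:
  "\<lbrakk>comodule M; f \<in> lin K X M\<rbrakk> \<Longrightarrow> (\<lambda>x. coact M (f x)) \<in> lin K X (tensor K B M)"
  by (rule lin_compose[OF coact_lin])

lemma coact_closed [simp]: "\<lbrakk>comodule M; m \<in> carrier M\<rbrakk> \<Longrightarrow> coact M m \<in> carrier (tensor K B M)"
  using lin_closed[OF coact_lin] .

lemma coact_of_sweedler [simp]:
  assumes "comodule M" "\<And>v w. \<lbrakk>v \<in> carrier V; w \<in> carrier W\<rbrakk> \<Longrightarrow> \<beta> v w \<in> carrier M"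
  shows "coact M (sweedler V W M x \<beta>) = sweedler V W (tensor K B M) x (\<lambda>v w. coact M (\<beta> v w))"
  using assms by (auto intro!: lin_of_sweedler)

text \<open>The device of \<open>coassoc_sweedler\<close> for a coaction: acting twice on m or
  splitting m_{-1} gives the same value of any trilinear map.\<close>

lemma coact_coassoc_sweedler:
  assumes [simp]: "comodule M" "m \<in> carrier M" "module K U"
    and "\<And>y n. \<lbrakk>y \<in> carrier B; n \<in> carrier M\<rbrakk> \<Longrightarrow> (\<lambda>x. \<Psi> x y n) \<in> lin K B U"
    and "\<And>x n. \<lbrakk>x \<in> carrier B; n \<in> carrier M\<rbrakk> \<Longrightarrow> (\<lambda>y. \<Psi> x y n) \<in> lin K B U"
    and "\<And>x y. \<lbrakk>x \<in> carrier B; y \<in> carrier B\<rbrakk> \<Longrightarrow> (\<lambda>n. \<Psi> x y n) \<in> lin K M U"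
  shows "sweedler B M U (coact M m) (\<lambda>b n. sweedler B M U (coact M n) (\<lambda>c n'. \<Psi> b c n'))
    = sweedler B M U (coact M m) (\<lambda>b n. sweedler B B U (comult B b) (\<lambda>b\<^sub>1 b\<^sub>2. \<Psi> b\<^sub>1 b\<^sub>2 n))"
proof -
  let ?h = "\<lambda>t. sweedler B (tensor K B M) U t (\<lambda>x s. sweedler B M U s (\<lambda>y z. \<Psi> x y z))"
  let ?T = "tensor K B (tensor K B M)"
  note [simp] = assms(4-6) lin_closed[OF assms(4)]
  have "sweedler B M ?T (coact M m) (\<lambda>b n. sweedler B B ?T (comult B b)
        (\<lambda>b\<^sub>1 b\<^sub>2. pure K B (tensor K B M) b\<^sub>1 (pure K B M b\<^sub>2 n)))
    = sweedler B M ?T (coact M m) (\<lambda>b n. pure K B (tensor K B M) b (coact M n))"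
    using left_comodule.coact_coassoc[of K B M m]
    by (simp add: Let_def tsum_sweedler[where V=B and W=B] tsum_sweedler[where V=B and W=M])
  from arg_cong[OF this, of ?h] show ?thesis by simp
qed

lemma coact_counit_sweedler:
  assumes [simp]: "comodule M" "m \<in> carrier M" "f \<in> lin K M U" "module K U"
  shows "sweedler B M U (coact M m) (\<lambda>b n. counit B b \<odot>\<^bsub>U\<^esub> f n) = f m"
proof -
  have [simp]: "a \<in> carrier K \<Longrightarrow> x \<in> carrier M \<Longrightarrow> f (a \<odot>\<^bsub>M\<^esub> x) = a \<odot>\<^bsub>U\<^esub> f x" for a x
    using lin_smult[OF assms(3)] .
  have "sweedler B M M (coact M m) (\<lambda>b n. counit B b \<odot>\<^bsub>M\<^esub> n) = m"
    using left_comodule.coact_counit[of K B M m] by (simp add: tsum_sweedler[where V=B and W=M])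
  from arg_cong[OF this, of f] show ?thesis
    by (subst (asm) lin_of_sweedler[OF assms(3)]) simp_all
qed

text \<open>The comodule axioms restated with \<open>sweedler\<close>, for a space that is given a
  coaction by \<open>with_coact\<close>.\<close>

lemma comodI:
  assumes [simp]: "module K M" "\<rho> \<in> lin K M (tensor K B M)"
    and "\<And>m. m \<in> carrier M \<Longrightarrow> sweedler B M M (\<rho> m) (\<lambda>b n. counit B b \<odot>\<^bsub>M\<^esub> n) = m"
    and "\<And>m. m \<in> carrier M \<Longrightarrow>
          sweedler B M (tensor K B (tensor K B M)) (\<rho> m) (\<lambda>b n. sweedler B B (tensor K B (tensor K B M)) (comult B b)
              (\<lambda>b\<^sub>1 b\<^sub>2. pure K B (tensor K B M) b\<^sub>1 (pure K B M b\<^sub>2 n)))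
          = sweedler B M (tensor K B (tensor K B M)) (\<rho> m) (\<lambda>b n. pure K B (tensor K B M) b (\<rho> n))"
  shows "comodule (with_coact M \<rho>)"
proof (rule left_comodule.intro)
  have [simp]: "m \<in> carrier M \<Longrightarrow> \<rho> m \<in> carrier (tensor K B M)" for m
    by (rule lin_closed[OF assms(2)])
  fix m assume m: "m \<in> carrier (with_coact M \<rho>)"
  then show "tsum (with_coact M \<rho>) (coact (with_coact M \<rho>) m) (\<lambda>b n. counit B b \<odot>\<^bsub>with_coact M \<rho>\<^esub> n) = m"
    using assms(3)[of m] by (simp add: tsum_sweedler[where V=B and W=M])
  show "let T = tensor K B (tensor K B (with_coact M \<rho>)) in
            tsum T (coact (with_coact M \<rho>) m) (\<lambda>b n. tsum T (comult B b)
              (\<lambda>b\<^sub>1 b\<^sub>2. pure K B (tensor K B (with_coact M \<rho>)) b\<^sub>1 (pure K B (with_coact M \<rho>) b\<^sub>2 n)))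
          = tsum T (coact (with_coact M \<rho>) m) (\<lambda>b n. pure K B (tensor K B (with_coact M \<rho>)) b (coact (with_coact M \<rho>) n))"
    using assms(4)[of m] m by (simp add: Let_def tsum_sweedler[where V=B and W=M] tsum_sweedler[where V=B and W=B])
qed simp_all

lemma colin_iff:
  assumes [simp]: "comodule M" "comodule N"
  shows "f \<in> colin K B M N \<longleftrightarrow> f \<in> lin K M N \<and> (\<forall>m \<in> carrier M.
     coact N (f m) = sweedler B M (tensor K B N) (coact M m) (\<lambda>b n. pure K B N b (f n)))"
  by (auto simp: colin_def tsum_sweedler[where V=B and W=M])

end

section \<open>Tensor products of linear maps and of comodules\<close>

lemma comod_tensor_simps [simp]:
  "carrier (comod_tensor K B M N) = carrier (tensor K M N)" "add (comod_tensor K B M N) = add (tensor K M N)"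
  "zero (comod_tensor K B M N) = zero (tensor K M N)" "smult (comod_tensor K B M N) = smult (tensor K M N)"
  "module.truncate (comod_tensor K B M N) = tensor K M N"
  by (simp_all add: comod_tensor_def Let_def)

lemma comod_unit_simps [simp]:
  "carrier (comod_unit K B) = carrier K" "add (comod_unit K B) = add K"
  "zero (comod_unit K B) = zero K" "smult (comod_unit K B) = mult K"
  "module.truncate (comod_unit K B) = ground K"
  by (simp_all add: comod_unit_def)

lemma tensor_comod_tensor [simp]:
  "tensor K (comod_tensor K B M N) W = tensor K (tensor K M N) W"
  "tensor K U (comod_tensor K B M N) = tensor K U (tensor K M N)"
  "pure K (comod_tensor K B M N) W = pure K (tensor K M N) W"
  "pure K U (comod_tensor K B M N) = pure K U (tensor K M N)"
  "lin K (comod_tensor K B M N) W = lin K (tensor K M N) W"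
  "lin K U (comod_tensor K B M N) = lin K U (tensor K M N)"
  "module K (comod_tensor K B M N) = module K (tensor K M N)"
  "sweedler (comod_tensor K B M N) V U x \<beta> = sweedler (tensor K M N) V U x \<beta>"
  "sweedler V (comod_tensor K B M N) U x \<beta> = sweedler V (tensor K M N) U x \<beta>"
  "sweedler V W (comod_tensor K B M N) x \<beta> = sweedler V W (tensor K M N) x \<beta>"
  unfolding comod_tensor_def Let_def by simp_all

lemma tensor_comod_unit [simp]:
  "tensor K (comod_unit K B) W = tensor K (ground K) W"
  "tensor K U (comod_unit K B) = tensor K U (ground K)"
  "pure K (comod_unit K B) W = pure K (ground K) W"
  "pure K U (comod_unit K B) = pure K U (ground K)"
  "lin K (comod_unit K B) W = lin K (ground K) W"
  "lin K U (comod_unit K B) = lin K U (ground K)"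
  "module K (comod_unit K B) = module K (ground K)"
  "sweedler (comod_unit K B) V U x \<beta> = sweedler (ground K) V U x \<beta>"
  "sweedler V (comod_unit K B) U x \<beta> = sweedler V (ground K) U x \<beta>"
  "sweedler V W (comod_unit K B) x \<beta> = sweedler V W (ground K) x \<beta>"
  unfolding comod_unit_def by simp_all

context scalars
begin

lemma tmap_sweedler:
  assumes "x \<in> carrier (tensor K V W)" "module K V" "module K W"
  shows "tmap K V W V' W' f g x = sweedler V W (tensor K V' W') x (\<lambda>v w. pure K V' W' (f v) (g w))"
  using assms by (simp add: tmap_def tsum_sweedler[where V=V and W=W])

lemma lin_apply_pure:
  "f \<in> lin K V V' \<Longrightarrow> module K V' \<Longrightarrow> module K V \<Longrightarrow> module K W' \<Longrightarrow> w \<in> carrier W'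
    \<Longrightarrow> (\<lambda>v. pure K V' W' (f v) w) \<in> lin K V (tensor K V' W')"
  by simp

lemma tmap_pure [simp]:
  assumes "f \<in> lin K V V'" "g \<in> lin K W W'" "module K V" "module K W" "module K V'" "module K W'"
    "v \<in> carrier V" "w \<in> carrier W"
  shows "tmap K V W V' W' f g (pure K V W v w) = pure K V' W' (f v) (g w)"
  using assms by (simp add: tmap_sweedler lin_closed[OF assms(1)] lin_closed[OF assms(2)])

lemma tmap_lin [simp]:
  assumes "f \<in> lin K V V'" "g \<in> lin K W W'" "module K V" "module K W" "module K V'" "module K W'"
  shows "tmap K V W V' W' f g \<in> lin K (tensor K V W) (tensor K V' W')"
  by (rule lin_cong[where f="\<lambda>x. sweedler V W (tensor K V' W') x (\<lambda>v w. pure K V' W' (f v) (g w))"])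
    (use assms in \<open>auto simp: tmap_sweedler lin_closed[OF assms(1)] lin_closed[OF assms(2)]\<close>)

lemma tassoc_sweedler:
  assumes "x \<in> carrier (tensor K (tensor K U V) W)" "module K U" "module K V" "module K W"
  shows "tassoc K U V W x = sweedler (tensor K U V) W (tensor K U (tensor K V W)) x
    (\<lambda>y w. sweedler U V (tensor K U (tensor K V W)) y (\<lambda>u v. pure K U (tensor K V W) u (pure K V W v w)))"
  using assms by (simp add: tassoc_def Let_def tsum_sweedler[where V=U and W=V] tsum_sweedler[where V="tensor K U V" and W=W])

lemma tassoc_pure [simp]:
  assumes "module K U" "module K V" "module K W" "u \<in> carrier U" "v \<in> carrier V" "w \<in> carrier W"
  shows "tassoc K U V W (pure K (tensor K U V) W (pure K U V u v) w) = pure K U (tensor K V W) u (pure K V W v w)"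
  using assms by (simp add: tassoc_sweedler)

lemma tassoc_lin [simp]:
  assumes "module K U" "module K V" "module K W"
  shows "tassoc K U V W \<in> lin K (tensor K (tensor K U V) W) (tensor K U (tensor K V W))"
  by (rule lin_cong[where f="\<lambda>x. sweedler (tensor K U V) W (tensor K U (tensor K V W)) x
    (\<lambda>y w. sweedler U V (tensor K U (tensor K V W)) y (\<lambda>u v. pure K U (tensor K V W) u (pure K V W v w)))"])
    (use assms in \<open>auto simp: tassoc_sweedler\<close>)

definition tassoc_inv where
  "tassoc_inv U V W = (\<lambda>x \<in> carrier (tensor K U (tensor K V W)).
     sweedler U (tensor K V W) (tensor K (tensor K U V) W) x
    (\<lambda>u y. sweedler V W (tensor K (tensor K U V) W) y (\<lambda>v w. pure K (tensor K U V) W (pure K U V u v) w)))"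

lemma tassoc_inv_pure [simp]:
  assumes "module K U" "module K V" "module K W" "u \<in> carrier U" "v \<in> carrier V" "w \<in> carrier W"
  shows "tassoc_inv U V W (pure K U (tensor K V W) u (pure K V W v w)) = pure K (tensor K U V) W (pure K U V u v) w"
  using assms by (simp add: tassoc_inv_def)

lemma tassoc_inv_lin [simp]:
  assumes "module K U" "module K V" "module K W"
  shows "tassoc_inv U V W \<in> lin K (tensor K U (tensor K V W)) (tensor K (tensor K U V) W)"
  by (rule lin_cong[where f="\<lambda>x. sweedler U (tensor K V W) (tensor K (tensor K U V) W) x
    (\<lambda>u y. sweedler V W (tensor K (tensor K U V) W) y (\<lambda>v w. pure K (tensor K U V) W (pure K U V u v) w))"])
    (use assms in \<open>auto simp: tassoc_inv_def\<close>)

lemma tassoc_inverse: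
  assumes "module K U" "module K V" "module K W"
  shows "x \<in> carrier (tensor K (tensor K U V) W) \<Longrightarrow> tassoc_inv U V W (tassoc K U V W x) = x"
    and "y \<in> carrier (tensor K U (tensor K V W)) \<Longrightarrow> tassoc K U V W (tassoc_inv U V W y) = y"
proof -
  show "x \<in> carrier (tensor K (tensor K U V) W) \<Longrightarrow> tassoc_inv U V W (tassoc K U V W x) = x"
    by (rule lin_eq_on_tensor3'[where f="\<lambda>x. tassoc_inv U V W (tassoc K U V W x)" and g="\<lambda>x. x"
        and U="tensor K (tensor K U V) W", OF lin_compose[OF tassoc_inv_lin tassoc_lin]])
      (simp_all add: assms)
  show "y \<in> carrier (tensor K U (tensor K V W)) \<Longrightarrow> tassoc K U V W (tassoc_inv U V W y) = y"
    by (rule lin_eq_on_tensor3[where f="\<lambda>x. tassoc K U V W (tassoc_inv U V W x)" and g="\<lambda>x. x"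
        and U="tensor K U (tensor K V W)", OF lin_compose[OF tassoc_lin tassoc_inv_lin]])
      (simp_all add: assms)
qed

lemma tlunit_sweedler:
  assumes "x \<in> carrier (tensor K (ground K) V)" "module K V"
  shows "tlunit K V x = sweedler (ground K) V V x (\<lambda>c v. c \<odot>\<^bsub>V\<^esub> v)"
  using assms by (simp add: tlunit_def tsum_sweedler[where V="ground K" and W=V])

lemma tlunit_pure [simp]:
  assumes "module K V" "c \<in> carrier K" "v \<in> carrier V"
  shows "tlunit K V (pure K (ground K) V c v) = c \<odot>\<^bsub>V\<^esub> v"
  using assms by (simp add: tlunit_sweedler)

lemma tlunit_lin [simp]:
  assumes "module K V" shows "tlunit K V \<in> lin K (tensor K (ground K) V) V"
  by (rule lin_cong[where f="\<lambda>x. sweedler (ground K) V V x (\<lambda>c v. c \<odot>\<^bsub>V\<^esub> v)"])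
    (use assms in \<open>auto simp: tlunit_sweedler\<close>)

lemma trunit_sweedler:
  assumes "x \<in> carrier (tensor K V (ground K))" "module K V"
  shows "trunit K V x = sweedler V (ground K) V x (\<lambda>v c. c \<odot>\<^bsub>V\<^esub> v)"
  using assms by (simp add: trunit_def tsum_sweedler[where V=V and W="ground K"])

lemma trunit_pure [simp]:
  assumes "module K V" "c \<in> carrier K" "v \<in> carrier V"
  shows "trunit K V (pure K V (ground K) v c) = c \<odot>\<^bsub>V\<^esub> v"
  using assms by (simp add: trunit_sweedler)

lemma trunit_lin [simp]:
  assumes "module K V" shows "trunit K V \<in> lin K (tensor K V (ground K)) V"
  by (rule lin_cong[where f="\<lambda>x. sweedler V (ground K) V x (\<lambda>v c. c \<odot>\<^bsub>V\<^esub> v)"])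
    (use assms in \<open>auto simp: trunit_sweedler\<close>)

text \<open>In a tensor product with the ground field, c \<otimes> v = c (1 \<otimes> v). So v
  \<mapsto> 1 \<otimes> v inverts the unit map, and likewise on the other side.\<close>

lemma unit_inverse:
  assumes "module K V"
  shows "x \<in> carrier (tensor K (ground K) V) \<Longrightarrow> pure K (ground K) V \<one>\<^bsub>K\<^esub> (tlunit K V x) = x"
    and "y \<in> carrier (tensor K V (ground K)) \<Longrightarrow> pure K V (ground K) (trunit K V y) \<one>\<^bsub>K\<^esub> = y"
proof -
  have sm: "pure K (ground K) V c v = c \<odot>\<^bsub>tensor K (ground K) V\<^esub> pure K (ground K) V \<one>\<^bsub>K\<^esub> v"
    "pure K V (ground K) v c = c \<odot>\<^bsub>tensor K V (ground K)\<^esub> pure K V (ground K) v \<one>\<^bsub>K\<^esub>"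
    if "c \<in> carrier K" "v \<in> carrier V" for c v
    using that assms pure_smult_left[of "ground K" V c "\<one>\<^bsub>K\<^esub>" v] pure_smult_right[of V "ground K" c v "\<one>\<^bsub>K\<^esub>"]
    by simp_all
  show "x \<in> carrier (tensor K (ground K) V) \<Longrightarrow> pure K (ground K) V \<one>\<^bsub>K\<^esub> (tlunit K V x) = x"
    by (rule lin_eq_on_tensor[where f="\<lambda>x. pure K (ground K) V \<one>\<^bsub>K\<^esub> (tlunit K V x)" and g="\<lambda>x. x" and U="tensor K (ground K) V"])
      (use assms in \<open>simp_all flip: sm\<close>)
  show "y \<in> carrier (tensor K V (ground K)) \<Longrightarrow> pure K V (ground K) (trunit K V y) \<one>\<^bsub>K\<^esub> = y"
    by (rule lin_eq_on_tensor[where f="\<lambda>x. pure K V (ground K) (trunit K V x) \<one>\<^bsub>K\<^esub>" and g="\<lambda>x. x" and U="tensor K V (ground K)"])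
      (use assms in \<open>simp_all flip: sm\<close>)
qed

end

context bialgebra
begin

lemma coact_comod_tensor:
  assumes "comodule M" "comodule N" "x \<in> carrier (tensor K M N)"
  shows "coact (comod_tensor K B M N) x =
    sweedler M N (tensor K B (tensor K M N)) x (\<lambda>m n.
      sweedler B M (tensor K B (tensor K M N)) (coact M m) (\<lambda>b m\<^sub>0.
        sweedler B N (tensor K B (tensor K M N)) (coact N n) (\<lambda>c n\<^sub>0.
          pure K B (tensor K M N) (b \<otimes>\<^bsub>B\<^esub> c) (pure K M N m\<^sub>0 n\<^sub>0))))"
  using assms by (simp add: comod_tensor_def Let_def tsum_sweedler[where V=M and W=N]
     tsum_sweedler[where V=B and W=M] tsum_sweedler[where V=B and W=N])

lemma coact_comod_tensor_pure [simp]: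
  assumes "comodule M" "comodule N" "m \<in> carrier M" "n \<in> carrier N"
  shows "coact (comod_tensor K B M N) (pure K M N m n) =
      sweedler B M (tensor K B (tensor K M N)) (coact M m) (\<lambda>b m\<^sub>0.
        sweedler B N (tensor K B (tensor K M N)) (coact N n) (\<lambda>c n\<^sub>0.
          pure K B (tensor K M N) (b \<otimes>\<^bsub>B\<^esub> c) (pure K M N m\<^sub>0 n\<^sub>0)))"
  using assms by (simp add: coact_comod_tensor)

lemma smult_assoc_K: "\<lbrakk>module K U; a \<in> carrier K; b \<in> carrier K; u \<in> carrier U\<rbrakk>
    \<Longrightarrow> (a \<otimes>\<^bsub>K\<^esub> b) \<odot>\<^bsub>U\<^esub> u = a \<odot>\<^bsub>U\<^esub> (b \<odot>\<^bsub>U\<^esub> u)"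
  by (rule module.smult_assoc1)

text \<open>The counit law of the diagonal coaction is the multiplicativity of \<epsilon>, and its
  coassociativity is the multiplicativity of \<Delta>.\<close>

lemma comodule_tensor [simp]:
  assumes M [simp]: "comodule M" and N [simp]: "comodule N"
  shows "comodule (comod_tensor K B M N)"
proof -
  define \<rho> where "\<rho> = coact (comod_tensor K B M N)"
  let ?T = "tensor K B (tensor K M N)"
  let ?T3 = "tensor K B (tensor K B (tensor K M N))"
  note \<rho>_eq = coact_comod_tensor[OF M N, folded \<rho>_def]
  have \<rho>_pure [simp]: "\<rho> (pure K M N m n) =
      sweedler B M ?T (coact M m) (\<lambda>b m\<^sub>0. sweedler B N ?T (coact N n) (\<lambda>c n\<^sub>0.
          pure K B (tensor K M N) (b \<otimes>\<^bsub>B\<^esub> c) (pure K M N m\<^sub>0 n\<^sub>0)))"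
    if "m \<in> carrier M" "n \<in> carrier N" for m n
    using that by (simp add: \<rho>_def)
  have \<rho>_lin [simp]: "\<rho> \<in> lin K (tensor K M N) ?T"
    by (rule lin_cong[where f="\<lambda>x. sweedler M N ?T x (\<lambda>m n.
      sweedler B M ?T (coact M m) (\<lambda>b m\<^sub>0. sweedler B N ?T (coact N n) (\<lambda>c n\<^sub>0.
          pure K B (tensor K M N) (b \<otimes>\<^bsub>B\<^esub> c) (pure K M N m\<^sub>0 n\<^sub>0))))"])
      (simp_all add: \<rho>_eq)
  note [simp] = lin_comp_simp[OF \<rho>_lin] lin_closed[OF \<rho>_lin]
  have "comodule (with_coact (tensor K M N) \<rho>)"
  proof (rule comodI)
    fix x assume x: "x \<in> carrier (tensor K M N)"
    show "sweedler B (tensor K M N) (tensor K M N) (\<rho> x) (\<lambda>b n. counit B b \<odot>\<^bsub>tensor K M N\<^esub> n) = x"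
    proof (rule lin_eq_on_tensor[where g="\<lambda>x. x" and U="tensor K M N", OF _ _ _ _ _ _ x])
      fix m n assume [simp]: "m \<in> carrier M" "n \<in> carrier N"
      show "sweedler B (tensor K M N) (tensor K M N) (\<rho> (pure K M N m n)) (\<lambda>b n. counit B b \<odot>\<^bsub>tensor K M N\<^esub> n)
        = pure K M N m n"
        by (simp add: smult_assoc_K coact_counit_sweedler flip: smult_sweedler_right)
    qed simp_all
    show "sweedler B (tensor K M N) ?T3 (\<rho> x) (\<lambda>b n. sweedler B B ?T3 (comult B b)
          (\<lambda>b\<^sub>1 b\<^sub>2. pure K B ?T b\<^sub>1 (pure K B (tensor K M N) b\<^sub>2 n)))
        = sweedler B (tensor K M N) ?T3 (\<rho> x) (\<lambda>b n. pure K B ?T b (\<rho> n))"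
    proof (rule lin_eq_on_tensor[where U="?T3", OF _ _ _ _ _ _ x])
      fix m n assume [simp]: "m \<in> carrier M" "n \<in> carrier N"
      let ?p = "\<lambda>b c m n. pure K B ?T b (pure K B (tensor K M N) c (pure K M N m n))"
      have "sweedler B (tensor K M N) ?T3 (\<rho> (pure K M N m n)) (\<lambda>b n. pure K B ?T b (\<rho> n))
        = sweedler B M ?T3 (coact M m) (\<lambda>b m\<^sub>0. sweedler B N ?T3 (coact N n) (\<lambda>c n\<^sub>0.
            sweedler B M ?T3 (coact M m\<^sub>0) (\<lambda>b' m'. sweedler B N ?T3 (coact N n\<^sub>0) (\<lambda>c' n'.
             ?p (b \<otimes>\<^bsub>B\<^esub> c) (b' \<otimes>\<^bsub>B\<^esub> c') m' n'))))"
        by simp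
      \<comment> \<open>Moves the second coaction on \<open>M\<close> in front of the first coaction
        on \<open>N\<close>. Now the two coactions on each comodule are nested directly, and
        coassociativity applies to both.\<close>
      also have "\<dots> = sweedler B M ?T3 (coact M m) (\<lambda>b m\<^sub>0. sweedler B M ?T3 (coact M m\<^sub>0) (\<lambda>b' m'. 
          sweedler B N ?T3 (coact N n) (\<lambda>c n\<^sub>0. sweedler B N ?T3 (coact N n\<^sub>0) (\<lambda>c' n'.
             ?p (b \<otimes>\<^bsub>B\<^esub> c) (b' \<otimes>\<^bsub>B\<^esub> c') m' n'))))"
        by (rule sweedler_cong[OF HOL.refl HOL.refl HOL.refl HOL.refl], rule sweedler_swap; simp)
      also have "\<dots> = sweedler B M ?T3 (coact M m) (\<lambda>b m\<^sub>0. sweedler B B ?T3 (comult B b) (\<lambda>b\<^sub>1 b\<^sub>2. 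
          sweedler B N ?T3 (coact N n) (\<lambda>c n\<^sub>0. sweedler B B ?T3 (comult B c) (\<lambda>c\<^sub>1 c\<^sub>2.
             ?p (b\<^sub>1 \<otimes>\<^bsub>B\<^esub> c\<^sub>1) (b\<^sub>2 \<otimes>\<^bsub>B\<^esub> c\<^sub>2) m\<^sub>0 n\<^sub>0))))"
        by (simp add: coact_coassoc_sweedler)
      also have "\<dots> = sweedler B M ?T3 (coact M m) (\<lambda>b m\<^sub>0. sweedler B N ?T3 (coact N n) (\<lambda>c n\<^sub>0.
          sweedler B B ?T3 (comult B b) (\<lambda>b\<^sub>1 b\<^sub>2. sweedler B B ?T3 (comult B c) (\<lambda>c\<^sub>1 c\<^sub>2.
             ?p (b\<^sub>1 \<otimes>\<^bsub>B\<^esub> c\<^sub>1) (b\<^sub>2 \<otimes>\<^bsub>B\<^esub> c\<^sub>2) m\<^sub>0 n\<^sub>0))))"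
        by (rule sweedler_cong[OF HOL.refl HOL.refl HOL.refl HOL.refl], rule sweedler_swap; simp)
      \<comment> \<open>The product of \<Delta>(b) and \<Delta>(c) is recombined to \<Delta>(b
        c).\<close>
      also have "\<dots> = sweedler B (tensor K M N) ?T3 (\<rho> (pure K M N m n)) (\<lambda>b n. sweedler B B ?T3 (comult B b)
          (\<lambda>b\<^sub>1 b\<^sub>2. pure K B ?T b\<^sub>1 (pure K B (tensor K M N) b\<^sub>2 n)))"
        by (simp add: comult_mult_sweedler)
      finally show "sweedler B (tensor K M N) ?T3 (\<rho> (pure K M N m n)) (\<lambda>b n. sweedler B B ?T3 (comult B b)
          (\<lambda>b\<^sub>1 b\<^sub>2. pure K B ?T b\<^sub>1 (pure K B (tensor K M N) b\<^sub>2 n)))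
        = sweedler B (tensor K M N) ?T3 (\<rho> (pure K M N m n)) (\<lambda>b n. pure K B ?T b (\<rho> n))" by simp
    qed simp_all
  qed simp_all
  moreover have "comod_tensor K B M N = with_coact (tensor K M N) \<rho>"
    by (simp add: \<rho>_def comod_tensor_def Let_def)
  ultimately show ?thesis by simp
qed

lemma coact_comod_tensor_lin [simp]:
  assumes "comodule M" "comodule N"
  shows "coact (comod_tensor K B M N) \<in> lin K (tensor K M N) (tensor K B (tensor K M N))"
    and "f \<in> lin K X (tensor K M N)
      \<Longrightarrow> (\<lambda>x. coact (comod_tensor K B M N) (f x)) \<in> lin K X (tensor K B (tensor K M N))"
proof -
  show 1: "coact (comod_tensor K B M N) \<in> lin K (tensor K M N) (tensor K B (tensor K M N))"
    using coact_lin[OF comodule_tensor[OF assms]] by simp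
  then show "f \<in> lin K X (tensor K M N)
      \<Longrightarrow> (\<lambda>x. coact (comod_tensor K B M N) (f x)) \<in> lin K X (tensor K B (tensor K M N))"
    by (rule lin_compose)
qed

text \<open>The element 1 is grouplike with \<epsilon>(1) = 1. These comodules show that every
  vector space underlies some comodule, and one of them will carry the generators of an arbitrary
  module.\<close>

lemma comodule_trivial:
  assumes [simp]: "module K V"
  shows "comodule (with_coact V (\<lambda>v. pure K B V \<one>\<^bsub>B\<^esub> v))"
  by (rule comodI) simp_all

lemma comodule_unit [simp]: "comodule (comod_unit K B)"
  unfolding comod_unit_def by (rule comodule_trivial) simp

lemma coact_unit [simp]: "coact (comod_unit K B) c = pure K B (ground K) \<one>\<^bsub>B\<^esub> c"
  by (simp add: comod_unit_def)

lemma colinI: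
  assumes "comodule M" "comodule N" "f \<in> lin K M N"
    and "\<And>m. m \<in> carrier M \<Longrightarrow> coact N (f m) = sweedler B M (tensor K B N) (coact M m) (\<lambda>b n. pure K B N b (f n))"
  shows "f \<in> colin K B M N"
  using assms by (simp add: colin_iff)

lemma tmap_colin:
  assumes [simp]: "comodule M" "comodule N" "comodule M'" "comodule N'"
    and f: "f \<in> colin K B M M'" and g: "g \<in> colin K B N N'"
  shows "tmap K M N M' N' f g \<in> colin K B (comod_tensor K B M N) (comod_tensor K B M' N')"
proof (rule colinI)
  have lins [simp]: "f \<in> lin K M M'" "g \<in> lin K N N'" using f g by (simp_all add: colin_iff)
  have co: "m \<in> carrier M \<Longrightarrow> coact M' (f m) = sweedler B M (tensor K B M') (coact M m) (\<lambda>b n. pure K B M' b (f n))"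
    "n \<in> carrier N \<Longrightarrow> coact N' (g n) = sweedler B N (tensor K B N') (coact N n) (\<lambda>b n. pure K B N' b (g n))" for m n
    using f g by (simp_all add: colin_iff)
  note [simp] = lin_closed[OF lins(1)] lin_closed[OF lins(2)] lin_comp_simp[OF lins(1)] lin_comp_simp[OF lins(2)]
  have tl: "tmap K M N M' N' f g \<in> lin K (tensor K M N) (tensor K M' N')" by simp
  note [simp] = lin_comp_simp[OF tl] lin_closed[OF tl]
  fix x assume "x \<in> carrier (comod_tensor K B M N)"
  then have x: "x \<in> carrier (tensor K M N)" by simp
  show "coact (comod_tensor K B M' N') (tmap K M N M' N' f g x)
    = sweedler B (comod_tensor K B M N) (tensor K B (comod_tensor K B M' N')) (coact (comod_tensor K B M N) x)
       (\<lambda>b n. pure K B (comod_tensor K B M' N') b (tmap K M N M' N' f g n))"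
    by (simp, rule lin_eq_on_tensor[where U="tensor K B (tensor K M' N')", OF _ _ _ _ _ _ x]) (simp_all add: co)
qed (use f g in \<open>simp_all add: colin_iff\<close>)


text \<open>On pure tensors the two coactions differ only in the bracketing of a product of three
  elements of B.\<close>

lemma tassoc_colin:
  assumes [simp]: "comodule L" "comodule M" "comodule N"
  shows "tassoc K L M N \<in> colin K B (comod_tensor K B (comod_tensor K B L M) N)
    (comod_tensor K B L (comod_tensor K B M N))"
proof (rule colinI)
  have t: "tassoc K L M N \<in> lin K (tensor K (tensor K L M) N) (tensor K L (tensor K M N))" by simp
  note [simp] = lin_closed[OF t] lin_comp_simp[OF t] coact_comod_tensor_lin[of "comod_tensor K B L M" N, simplified]
    coact_comod_tensor_lin[of L "comod_tensor K B M N", simplified]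
  fix x assume "x \<in> carrier (comod_tensor K B (comod_tensor K B L M) N)"
  then have x: "x \<in> carrier (tensor K (tensor K L M) N)" by simp
  show "coact (comod_tensor K B L (comod_tensor K B M N)) (tassoc K L M N x)
    = sweedler B (comod_tensor K B (comod_tensor K B L M) N) (tensor K B (comod_tensor K B L (comod_tensor K B M N)))
       (coact (comod_tensor K B (comod_tensor K B L M) N) x)
       (\<lambda>b n. pure K B (comod_tensor K B L (comod_tensor K B M N)) b (tassoc K L M N n))"
  proof (simp, rule lin_eq_on_tensor3'[where U="tensor K B (tensor K L (tensor K M N))", OF _ _ _ _ _ _ _ x])
    fix l m n assume [simp]: "l \<in> carrier L" "m \<in> carrier M" "n \<in> carrier N"
    have "coact (comod_tensor K B L (comod_tensor K B M N)) (pure K L (comod_tensor K B M N) l (pure K M N m n))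
      = sweedler B L (tensor K B (tensor K L (tensor K M N))) (coact L l) (\<lambda>b l.
         sweedler B M (tensor K B (tensor K L (tensor K M N))) (coact M m) (\<lambda>c m.
         sweedler B N (tensor K B (tensor K L (tensor K M N))) (coact N n) (\<lambda>d n.
           pure K B (tensor K L (tensor K M N)) (b \<otimes>\<^bsub>B\<^esub> (c \<otimes>\<^bsub>B\<^esub> d)) (pure K L (tensor K M N) l (pure K M N m n)))))"
      by (subst coact_comod_tensor_pure) simp_all
    moreover have "coact (comod_tensor K B (comod_tensor K B L M) N) (pure K (comod_tensor K B L M) N (pure K L M l m) n)
      = sweedler B L (tensor K B (tensor K (tensor K L M) N)) (coact L l) (\<lambda>b l.
         sweedler B M (tensor K B (tensor K (tensor K L M) N)) (coact M m) (\<lambda>c m.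
         sweedler B N (tensor K B (tensor K (tensor K L M) N)) (coact N n) (\<lambda>d n.
           pure K B (tensor K (tensor K L M) N) ((b \<otimes>\<^bsub>B\<^esub> c) \<otimes>\<^bsub>B\<^esub> d) (pure K (tensor K L M) N (pure K L M l m) n))))"
      by (subst coact_comod_tensor_pure) simp_all
    ultimately show "coact (comod_tensor K B L (comod_tensor K B M N))
        (tassoc K L M N (pure K (tensor K L M) N (pure K L M l m) n))
      = sweedler B (tensor K (tensor K L M) N) (tensor K B (tensor K L (tensor K M N)))
       (coact (comod_tensor K B (comod_tensor K B L M) N) (pure K (tensor K L M) N (pure K L M l m) n))
       (\<lambda>b n. pure K B (tensor K L (tensor K M N)) b (tassoc K L M N n))"
      by (simp add: mult_assoc)
  qed simp_all
qed simp_all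

lemma tlunit_colin:
  assumes [simp]: "comodule M"
  shows "tlunit K M \<in> colin K B (comod_tensor K B (comod_unit K B) M) M"
proof (rule colinI)
  have t: "tlunit K M \<in> lin K (tensor K (ground K) M) M" by simp
  note [simp] = lin_closed[OF t] lin_comp_simp[OF t] coact_comod_tensor_lin[of "comod_unit K B" M, simplified]
    coact_comod_tensor_pure[where M="comod_unit K B", simplified]
  have [simp]: "coact M (c \<odot>\<^bsub>M\<^esub> m) = c \<odot>\<^bsub>tensor K B M\<^esub> coact M m" if "c \<in> carrier K" "m \<in> carrier M" for c m
    by (rule lin_smult[OF coact_lin]) (use that in simp_all)
  fix x assume "x \<in> carrier (comod_tensor K B (comod_unit K B) M)"
  then have x: "x \<in> carrier (tensor K (ground K) M)" by simp
  show "coact M (tlunit K M x) = sweedler B (comod_tensor K B (comod_unit K B) M) (tensor K B M)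
       (coact (comod_tensor K B (comod_unit K B) M) x) (\<lambda>b n. pure K B M b (tlunit K M n))"
    by (simp, rule lin_eq_on_tensor[where U="tensor K B M", OF _ _ _ _ _ _ x])
      (simp_all flip: smult_sweedler_right)
qed simp_all

lemma trunit_colin:
  assumes [simp]: "comodule M"
  shows "trunit K M \<in> colin K B (comod_tensor K B M (comod_unit K B)) M"
proof (rule colinI)
  have t: "trunit K M \<in> lin K (tensor K M (ground K)) M" by simp
  note [simp] = lin_closed[OF t] lin_comp_simp[OF t] coact_comod_tensor_lin[of M "comod_unit K B", simplified]
    coact_comod_tensor_pure[where N="comod_unit K B", simplified]
  have [simp]: "coact M (c \<odot>\<^bsub>M\<^esub> m) = c \<odot>\<^bsub>tensor K B M\<^esub> coact M m" if "c \<in> carrier K" "m \<in> carrier M" for c m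
    by (rule lin_smult[OF coact_lin]) (use that in simp_all)
  fix x assume "x \<in> carrier (comod_tensor K B M (comod_unit K B))"
  then have x: "x \<in> carrier (tensor K M (ground K))" by simp
  show "coact M (trunit K M x) = sweedler B (comod_tensor K B M (comod_unit K B)) (tensor K B M)
       (coact (comod_tensor K B M (comod_unit K B)) x) (\<lambda>b n. pure K B M b (trunit K M n))"
    by (simp, rule lin_eq_on_tensor[where U="tensor K B M", OF _ _ _ _ _ _ x])
      (simp_all flip: smult_sweedler_right)
qed simp_all

lemma colin_lin: "f \<in> colin K B M N \<Longrightarrow> f \<in> lin K M N"
  by (simp add: colin_def)

lemma colin_coact:
  "\<lbrakk>f \<in> colin K B M N; comodule M; comodule N; m \<in> carrier M\<rbrakk>
    \<Longrightarrow> coact N (f m) = sweedler B M (tensor K B N) (coact M m) (\<lambda>b n. pure K B N b (f n))"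
  by (simp add: colin_iff)

lemma colin_ident: "comodule M \<Longrightarrow> (\<lambda>x. x) \<in> colin K B M M"
  by (simp add: colin_iff)

lemma colin_compose:
  assumes [simp]: "comodule L" "comodule M" "comodule N" and f: "f \<in> colin K B L M" and g: "g \<in> colin K B M N"
  shows "(\<lambda>x. g (f x)) \<in> colin K B L N"
proof (rule colinI)
  have [simp]: "f \<in> lin K L M" "g \<in> lin K M N" using f g by (simp_all add: colin_lin)
  note [simp] = lin_closed[OF colin_lin[OF f]] lin_closed[OF colin_lin[OF g]]
     lin_comp_simp[OF colin_lin[OF g]]
  show "(\<lambda>x. g (f x)) \<in> lin K L N" by simp
  show "coact N (g (f m)) = sweedler B L (tensor K B N) (coact L m) (\<lambda>b n. pure K B N b (g (f n)))"
    if "m \<in> carrier L" for m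
    using that by (simp add: colin_coact[OF g] colin_coact[OF f])
qed simp_all

text \<open>Apply id \<otimes> \<open>g\<close> to the colinearity of \<open>f\<close> at
  \<open>g y\<close>.\<close>

lemma colin_inverse:
  assumes [simp]: "comodule M" "comodule N" and f: "f \<in> colin K B M N" and g [simp]: "g \<in> lin K N M"
    and inv: "\<And>x. x \<in> carrier M \<Longrightarrow> g (f x) = x" "\<And>y. y \<in> carrier N \<Longrightarrow> f (g y) = y"
  shows "g \<in> colin K B N M"
proof (rule colinI)
  note [simp] = lin_closed[OF colin_lin[OF f]] lin_closed[OF g] lin_comp_simp[OF g]
  fix y assume [simp]: "y \<in> carrier N"
  have "coact N y = sweedler B M (tensor K B N) (coact M (g y)) (\<lambda>b n. pure K B N b (f n))"
    using colin_coact[OF f, of "g y"] inv(2) by simp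
  then have "sweedler B N (tensor K B M) (coact N y) (\<lambda>b n. pure K B M b (g n)) = 
    sweedler B M (tensor K B M) (coact M (g y)) (\<lambda>b n. pure K B M b n)"
    by (simp add: inv)
  then show "coact M (g y) = sweedler B N (tensor K B M) (coact N y) (\<lambda>b n. pure K B M b (g n))"
    by simp
qed simp_all

end

section \<open>The cotensor product with B \<bullet> B as B \<otimes> N\<close>

lemma bullet_simps [simp]:
  "carrier (bullet K B) = carrier (tensor K B B)" "add (bullet K B) = add (tensor K B B)"
  "zero (bullet K B) = zero (tensor K B B)" "smult (bullet K B) = smult (tensor K B B)"
  "tunit (bullet K B) = comult B"
  by (simp_all add: bullet_def Let_def comod.defs trialg.defs)

lemma tensor_bullet [simp]:
  "tensor K (bullet K B) W = tensor K (tensor K B B) W" "tensor K U (bullet K B) = tensor K U (tensor K B B)"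
  "pure K (bullet K B) W = pure K (tensor K B B) W" "pure K U (bullet K B) = pure K U (tensor K B B)"
  by (rule tensor_cong; simp)+

context scalars
begin

text \<open>Used for two subspaces: the cotensor product, where two coactions agree, and later the
  fixed points of an idempotent.\<close>

lemma equalizer_module:
  assumes V: "module K V" and W: "module K W" and f: "f \<in> lin K V W" and g: "g \<in> lin K V W"
  shows "module K (V\<lparr>carrier := {x \<in> carrier V. f x = g x}\<rparr>)" (is "module K ?E")
proof (rule moduleI)
  interpret V: module K V by fact
  show "cring K" by unfold_locales
  note [simp] = lin_add[OF f] lin_add[OF g] lin_smult[OF f] lin_smult[OF g] lin_zero[OF f V W] lin_zero[OF g V W]
  show "abelian_group ?E"
  proof (rule abelian_groupI)
    fix x assume x: "x \<in> carrier ?E"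
    then have "(\<ominus>\<^bsub>K\<^esub> \<one>\<^bsub>K\<^esub>) \<odot>\<^bsub>V\<^esub> x \<oplus>\<^bsub>V\<^esub> x = \<zero>\<^bsub>V\<^esub>"
      using V.smult_l_distr[of "\<ominus>\<^bsub>K\<^esub> \<one>\<^bsub>K\<^esub>" "\<one>\<^bsub>K\<^esub>" x] by (simp add: l_neg)
    then show "\<exists>y\<in>carrier ?E. y \<oplus>\<^bsub>?E\<^esub> x = \<zero>\<^bsub>?E\<^esub>"
      using x by (intro bexI[of _ "(\<ominus>\<^bsub>K\<^esub> \<one>\<^bsub>K\<^esub>) \<odot>\<^bsub>V\<^esub> x"]) auto
  qed (simp_all add: V.a_ac V)
qed (simp_all add: V lin_smult[OF f] lin_smult[OF g] lin_add[OF f] lin_add[OF g]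
    module.smult_l_distr[OF V] module.smult_r_distr[OF V] module.smult_assoc1[OF V])

end

context bialgebra
begin

abbreviation BB :: "'a space" where "BB \<equiv> tensor K B B"

abbreviation C :: "'a comod \<Rightarrow> 'a space" where "C N \<equiv> cotensor K B (bullet K B) N"

abbreviation T :: "'a comod \<Rightarrow> 'a comod" where "T N \<equiv> cotensor_comod K B (bullet K B) N"

lemma coact_bullet:
  "z \<in> carrier BB \<Longrightarrow> coact (bullet K B) z =
    sweedler B B (tensor K B BB) z (\<lambda>b c. sweedler B B (tensor K B BB) (comult B b)
      (\<lambda>b\<^sub>1 b\<^sub>2. pure K B BB b\<^sub>1 (pure K B B b\<^sub>2 c)))"
  by (simp add: bullet_def Let_def comod.defs trialg.defs tsum_sweedler[where V=B and W=B] with_coact_def module.defs)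

lemma rcoact_bullet:
  "z \<in> carrier BB \<Longrightarrow> rcoact (bullet K B) z =
    sweedler B B (tensor K BB B) z (\<lambda>b c. sweedler B B (tensor K BB B) (comult B c)
      (\<lambda>c\<^sub>1 c\<^sub>2. pure K BB B (pure K B B b c\<^sub>1) c\<^sub>2))"
  by (simp add: bullet_def Let_def comod.defs trialg.defs tsum_sweedler[where V=B and W=B])

lemma lact_bullet:
  "\<lbrakk>b \<in> carrier B; z \<in> carrier BB\<rbrakk> \<Longrightarrow> lact (bullet K B) b z =
    sweedler B B BB z (\<lambda>c d. sweedler B B BB (comult B b)
      (\<lambda>b\<^sub>1 b\<^sub>2. pure K B B (b\<^sub>1 \<otimes>\<^bsub>B\<^esub> c) (b\<^sub>2 \<otimes>\<^bsub>B\<^esub> d)))"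
  by (simp add: bullet_def Let_def comod.defs trialg.defs tsum_sweedler[where V=B and W=B])

lemma tmult_bullet:
  "z \<in> carrier (tensor K BB BB) \<Longrightarrow> tmult (bullet K B) z =
    sweedler BB BB BB z (\<lambda>p q. sweedler B B BB p (\<lambda>b c. sweedler B B BB q (\<lambda>b' c'.
      (counit B c \<otimes>\<^bsub>K\<^esub> counit B b') \<odot>\<^bsub>BB\<^esub> pure K B B b c')))"
  by (simp add: bullet_def Let_def comod.defs trialg.defs tsum_sweedler[where V=B and W=B]
      tsum_sweedler[where V=BB and W=BB])

text \<open>The map id \<otimes> coaction of \<open>N\<close>, with the two copies of B bracketed
  together. It is the isomorphism from B \<otimes> N onto (B \<bullet> B) \<box> N.\<close>

definition phi :: "'a comod \<Rightarrow> 'a fn" where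
  "phi N x = sweedler B N (tensor K BB N) x (\<lambda>b n. sweedler B N (tensor K BB N) (coact N n)
     (\<lambda>c n\<^sub>0. pure K BB N (pure K B B b c) n\<^sub>0))"

text \<open>The map id \<otimes> \<epsilon> \<otimes> id. It is given by this formula on all of (B
  \<otimes> B) \<otimes> N, and its restriction to the cotensor product inverts
  \<open>phi\<close>.\<close>

definition psi :: "'a comod \<Rightarrow> 'a fn" where
  "psi N z = sweedler BB N (tensor K B N) z (\<lambda>s n. sweedler B B (tensor K B N) s
     (\<lambda>b c. counit B c \<odot>\<^bsub>tensor K B N\<^esub> pure K B N b n))"

context
  fixes N :: "'a comod" assumes N [simp]: "comodule N"
begin

lemma phi_pure: "\<lbrakk>b \<in> carrier B; n \<in> carrier N\<rbrakk> \<Longrightarrow> phi N (pure K B N b n) =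
    sweedler B N (tensor K BB N) (coact N n) (\<lambda>c n\<^sub>0. pure K BB N (pure K B B b c) n\<^sub>0)"
  by (simp add: phi_def)

lemma phi_lin0 [simp]: "phi N \<in> lin K (tensor K B N) (tensor K BB N)"
  by (rule lin_cong[OF lin_sweedler]) (simp_all add: phi_def)

lemma psi_lin0 [simp]: "psi N \<in> lin K (tensor K BB N) (tensor K B N)"
  by (rule lin_cong[OF lin_sweedler]) (simp_all add: psi_def)

lemma psi_pure: "\<lbrakk>b \<in> carrier B; c \<in> carrier B; n \<in> carrier N\<rbrakk>
   \<Longrightarrow> psi N (pure K BB N (pure K B B b c) n) = counit B c \<odot>\<^bsub>tensor K B N\<^esub> pure K B N b n"
  by (simp add: psi_def)

private lemmas simps0 = lin_closed[OF phi_lin0] lin_closed[OF psi_lin0] lin_comp_simp[OF phi_lin0] lin_comp_simp[OF psi_lin0]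

text \<open>The counit law of \<open>N\<close>: b \<otimes> \<epsilon>(n_{-1}) n_0 = b \<otimes>
  n.\<close>

lemma psi_phi [simp]:
  assumes "x \<in> carrier (tensor K B N)" shows "psi N (phi N x) = x"
proof (rule lin_eq_on_tensor[where U="tensor K B N" and g="\<lambda>x. x", OF _ _ _ _ _ _ assms])
  fix b n assume [simp]: "b \<in> carrier B" "n \<in> carrier N"
  show "psi N (phi N (pure K B N b n)) = pure K B N b n"
    by (simp add: phi_pure lin_of_sweedler[OF psi_lin0] psi_pure coact_counit_sweedler)
qed (simp_all add: simps0)

text \<open>This map and \<open>coact_right\<close> are the parallel pair whose equalizer is the
  cotensor product, with the right coaction of B \<bullet> B written out.\<close>

definition coact_left :: "'a fn" where
  "coact_left z = sweedler BB N (tensor K BB (tensor K B N)) z (\<lambda>s n. sweedler B B (tensor K BB (tensor K B N)) s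
     (\<lambda>b c. sweedler B B (tensor K BB (tensor K B N)) (comult B c)
       (\<lambda>c\<^sub>1 c\<^sub>2. pure K BB (tensor K B N) (pure K B B b c\<^sub>1) (pure K B N c\<^sub>2 n))))"

definition coact_right :: "'a fn" where
  "coact_right z = sweedler BB N (tensor K BB (tensor K B N)) z (\<lambda>s n. pure K BB (tensor K B N) s (coact N n))"

lemma cotensor_bullet: "C N = (tensor K BB N)\<lparr>carrier := {x \<in> carrier (tensor K BB N). coact_left x = coact_right x}\<rparr>"
  by (simp add: cotensor_def Let_def coact_left_def coact_right_def rcoact_bullet
      tsum_sweedler[where V=BB and W=N] tsum_sweedler[where V=BB and W=B] tsum_sweedler[where V=B and W=B]
      cong: conj_cong)

lemma coact_left_lin [simp]: "coact_left \<in> lin K (tensor K BB N) (tensor K BB (tensor K B N))"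
  by (rule lin_cong[OF lin_sweedler]) (simp_all add: coact_left_def)

lemma coact_right_lin [simp]: "coact_right \<in> lin K (tensor K BB N) (tensor K BB (tensor K B N))"
  by (rule lin_cong[OF lin_sweedler]) (simp_all add: coact_right_def)

lemma cotensor_module [simp]: "module K (C N)"
  unfolding cotensor_bullet by (rule equalizer_module[where W="tensor K BB (tensor K B N)"]) simp_all

lemma cotensor_simps [simp]:
  "add (C N) = add (tensor K BB N)" "zero (C N) = zero (tensor K BB N)" "smult (C N) = smult (tensor K BB N)"
  by (simp_all add: cotensor_bullet)

lemma cotensor_carrier: "carrier (C N) = {x \<in> carrier (tensor K BB N). coact_left x = coact_right x}"
  by (simp add: cotensor_bullet)

lemma cotensor_subset [simp]: "z \<in> carrier (C N) \<Longrightarrow> z \<in> carrier (tensor K BB N)"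
  by (simp add: cotensor_carrier)

lemma cotensor_incl_lin [simp]: "(\<lambda>z. z) \<in> lin K (C N) (tensor K BB N)"
  by (rule linI) simp_all

text \<open>Coassociativity of \<open>N\<close>: applied to \<open>phi N (pure K B N b n)\<close>,
  both maps of the pair give b \<otimes> n_{-2} \<otimes> n_{-1} \<otimes> n_0.\<close>

lemma phi_closed [simp]:
  assumes "x \<in> carrier (tensor K B N)" shows "phi N x \<in> carrier (C N)"
proof -
  note [simp] = simps0 lin_comp_simp[OF coact_left_lin] lin_comp_simp[OF coact_right_lin]
  have "coact_left (phi N x) = coact_right (phi N x)"
  proof (rule lin_eq_on_tensor[where U="tensor K BB (tensor K B N)", OF _ _ _ _ _ _ assms])
    fix b n assume [simp]: "b \<in> carrier B" "n \<in> carrier N"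
    show "coact_left (phi N (pure K B N b n)) = coact_right (phi N (pure K B N b n))"
    proof -
      have "coact_right (phi N (pure K B N b n)) =
        sweedler B N (tensor K BB (tensor K B N)) (coact N n) (\<lambda>c n\<^sub>0.
          pure K BB (tensor K B N) (pure K B B b c) (sweedler B N (tensor K B N) (coact N n\<^sub>0) (pure K B N)))"
        by (simp add: phi_pure lin_of_sweedler[OF coact_right_lin] coact_right_def del: pure_sweedler_right)
      also have "\<dots> = sweedler B N (tensor K BB (tensor K B N)) (coact N n) (\<lambda>c n\<^sub>0.
          sweedler B N (tensor K BB (tensor K B N)) (coact N n\<^sub>0) (\<lambda>c' n'.
            pure K BB (tensor K B N) (pure K B B b c) (pure K B N c' n')))"
        by (simp del: sweedler_self)
      also have "\<dots> = sweedler B N (tensor K BB (tensor K B N)) (coact N n) (\<lambda>c n\<^sub>0.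
          sweedler B B (tensor K BB (tensor K B N)) (comult B c) (\<lambda>c\<^sub>1 c\<^sub>2.
            pure K BB (tensor K B N) (pure K B B b c\<^sub>1) (pure K B N c\<^sub>2 n\<^sub>0)))"
        by (rule coact_coassoc_sweedler) simp_all
      also have "\<dots> = coact_left (phi N (pure K B N b n))"
        by (simp add: phi_pure lin_of_sweedler[OF coact_left_lin]) (simp add: coact_left_def)
      finally show ?thesis by simp
    qed
  qed simp_all
  then show ?thesis using assms by (simp add: cotensor_carrier simps0 del: cotensor_subset)
qed

text \<open>Apply \<epsilon> to the second factor of the equation that defines the cotensor product.
  The side with \<Delta> returns \<open>z\<close> by the counit law of B, and the side with the
  coaction of \<open>N\<close> returns \<open>phi N (psi N z)\<close>. The map \<open>?h\<close> is
  this application of \<epsilon>.\<close>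

lemma phi_psi [simp]:
  assumes "z \<in> carrier (C N)" shows "phi N (psi N z) = z"
proof -
  let ?h = "\<lambda>t. sweedler BB (tensor K B N) (tensor K BB N) t (\<lambda>s y. sweedler B B (tensor K BB N) s
     (\<lambda>b c. sweedler B N (tensor K BB N) y
       (\<lambda>d n. counit B c \<odot>\<^bsub>tensor K BB N\<^esub> pure K BB N (pure K B B b d) n)))"
  have h: "?h \<in> lin K (tensor K BB (tensor K B N)) (tensor K BB N)" by simp
  note [simp] = simps0 lin_comp_simp[OF coact_left_lin] lin_comp_simp[OF coact_right_lin]
  have z: "z \<in> carrier (tensor K BB N)" using assms by simp
  have 1: "?h (coact_left z) = z"
  proof (rule lin_eq_on_tensor3'[where f="\<lambda>z. ?h (coact_left z)" and U="tensor K BB N" and g="\<lambda>x. x", OF _ _ _ _ _ _ _ z])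
    fix b c n assume [simp]: "b \<in> carrier B" "c \<in> carrier B" "n \<in> carrier N"
    show "?h (coact_left (pure K BB N (pure K B B b c) n)) = pure K BB N (pure K B B b c) n"
      by (simp add: coact_left_def counit_sweedler)
  qed simp_all
  have 2: "?h (coact_right z) = phi N (psi N z)"
  proof (rule lin_eq_on_tensor3'[where f="\<lambda>z. ?h (coact_right z)" and g="\<lambda>z. phi N (psi N z)" and U="tensor K BB N", OF _ _ _ _ _ _ _ z])
    fix b c n assume [simp]: "b \<in> carrier B" "c \<in> carrier B" "n \<in> carrier N"
    show "?h (coact_right (pure K BB N (pure K B B b c) n)) = phi N (psi N (pure K BB N (pure K B B b c) n))"
      by (simp add: coact_right_def psi_pure lin_smult[OF phi_lin0] phi_pure)
  qed simp_all
  show ?thesis using 1 2 assms by (simp add: cotensor_carrier del: cotensor_subset)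
qed

lemma phi_lin [simp]: "phi N \<in> lin K (tensor K B N) (C N)"
  by (rule linI) (simp_all add: lin_add[OF phi_lin0] lin_smult[OF phi_lin0])

lemma psi_lin [simp]: "psi N \<in> lin K (C N) (tensor K B N)"
  by (rule linI) (simp_all add: simps0 lin_add[OF psi_lin0] lin_smult[OF psi_lin0])

lemmas [simp] = lin_comp_simp[OF phi_lin] lin_comp_simp[OF psi_lin] lin_closed[OF psi_lin0]

lemma phi_sweedler [simp]:
  "(\<And>v w. \<lbrakk>v \<in> carrier V; w \<in> carrier W\<rbrakk> \<Longrightarrow> \<beta> v w \<in> carrier (tensor K B N))
   \<Longrightarrow> phi N (sweedler V W (tensor K B N) x \<beta>) = sweedler V W (C N) x (\<lambda>v w. phi N (\<beta> v w))"
  by (rule lin_of_sweedler) simp_all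

lemma psi_sweedler [simp]:
  "(\<And>v w. \<lbrakk>v \<in> carrier V; w \<in> carrier W\<rbrakk> \<Longrightarrow> \<beta> v w \<in> carrier (C N))
   \<Longrightarrow> psi N (sweedler V W (C N) x \<beta>) = sweedler V W (tensor K B N) x (\<lambda>v w. psi N (\<beta> v w))"
  by (rule lin_of_sweedler) simp_all

lemma phi_smult [simp]: "\<lbrakk>a \<in> carrier K; x \<in> carrier (tensor K B N)\<rbrakk>
    \<Longrightarrow> phi N (a \<odot>\<^bsub>tensor K B N\<^esub> x) = a \<odot>\<^bsub>tensor K BB N\<^esub> phi N x"
  by (rule lin_smult[OF phi_lin0])

text \<open>As \<open>phi\<close> is onto, the images of pure tensors under it span the cotensor
  product. From here on they play the part of pure tensors.\<close>

lemma lin_eq_on_cotensor: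
  fixes U :: "('a univ, 'a univ, 'z) module_scheme"
  assumes f: "f \<in> lin K (C N) U" and g: "g \<in> lin K (C N) U" and U: "module K U"
    and eq: "\<And>b n. \<lbrakk>b \<in> carrier B; n \<in> carrier N\<rbrakk> \<Longrightarrow> f (phi N (pure K B N b n)) = g (phi N (pure K B N b n))"
    and z: "z \<in> carrier (C N)"
  shows "f z = g z"
proof -
  have "f (phi N x) = g (phi N x)" if "x \<in> carrier (tensor K B N)" for x
    by (rule lin_eq_on_tensor[where f="\<lambda>x. f (phi N x)" and g="\<lambda>x. g (phi N x)" and U=U, OF _ _ _ _ U _ that])
      (simp_all add: eq lin_compose[OF f] lin_compose[OF g])
  from this[of "psi N z"] show ?thesis using z by simp
qed

text \<open>The coaction \<Delta> \<otimes> id of the cofree comodule B \<otimes> N, carried over by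
  \<open>phi\<close>.\<close>

definition delta :: "'a fn" where
  "delta z = sweedler B N (tensor K B (C N)) (psi N z) (\<lambda>b n. sweedler B B (tensor K B (C N)) (comult B b)
     (\<lambda>b\<^sub>1 b\<^sub>2. pure K B (C N) b\<^sub>1 (phi N (pure K B N b\<^sub>2 n))))"

lemma delta_lin [simp]: "delta \<in> lin K (C N) (tensor K B (C N))"
  by (rule lin_cong[where f="\<lambda>z. sweedler B N (tensor K B (C N)) (psi N z) (\<lambda>b n. sweedler B B (tensor K B (C N)) (comult B b)
     (\<lambda>b\<^sub>1 b\<^sub>2. pure K B (C N) b\<^sub>1 (phi N (pure K B N b\<^sub>2 n))))"]) (simp_all add: delta_def)

lemma delta_phi: "\<lbrakk>b \<in> carrier B; n \<in> carrier N\<rbrakk> \<Longrightarrow> delta (phi N (pure K B N b n)) =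
   sweedler B B (tensor K B (C N)) (comult B b) (\<lambda>b\<^sub>1 b\<^sub>2. pure K B (C N) b\<^sub>1 (phi N (pure K B N b\<^sub>2 n)))"
  by (simp add: delta_def)

text \<open>The definite description asks for the preimage of an element under the inclusion of B
  \<otimes> (A \<box> N) into B \<otimes> (A \<otimes> N), where A = B \<bullet> B. One preimage is
  \<open>delta z\<close>. It is the only one because \<open>phi N\<close> after \<open>psi N\<close>
  restricts to the identity on A \<box> N, which yields a left inverse \<open>?r\<close> of the
  inclusion \<open>?i\<close>.\<close>

lemma coact_cotensor_comod:
  assumes z: "z \<in> carrier (C N)"
  shows "coact (T N) z = delta z"
proof -
  let ?U = "tensor K B (tensor K BB N)"
  let ?i = "\<lambda>y. sweedler B (C N) ?U y (\<lambda>b z. pure K B (tensor K BB N) b z)"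
  let ?r = "\<lambda>y. sweedler B (tensor K BB N) (tensor K B (C N)) y (\<lambda>b z. pure K B (C N) b (phi N (psi N z)))"
  let ?c = "\<lambda>z. sweedler BB N ?U z (\<lambda>a n. sweedler B BB ?U (coact (bullet K B) a)
            (\<lambda>b a\<^sub>0. pure K B (tensor K BB N) b (pure K BB N a\<^sub>0 n)))"
  note [simp] = lin_comp_simp[OF delta_lin] lin_closed[OF delta_lin] lin_comp_simp[OF psi_lin0]
  have A: "coact (bullet K B) \<in> lin K BB (tensor K B BB)"
    by (rule lin_cong[OF lin_sweedler]) (simp_all add: coact_bullet)
  note [simp] = A lin_closed[OF A] lin_comp_simp[OF A]
  have c: "?c \<in> lin K (tensor K BB N) ?U" by simp
  have c': "?c \<in> lin K (C N) ?U"
    using lin_compose[OF c cotensor_incl_lin] by simp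
  have i: "?i (delta z) = ?c z"
  proof (rule lin_eq_on_cotensor[where f="\<lambda>z. ?i (delta z)" and g="?c" and U="?U", OF _ c' _ _ z])
    fix b n assume [simp]: "b \<in> carrier B" "n \<in> carrier N"
    show "?i (delta (phi N (pure K B N b n))) = ?c (phi N (pure K B N b n))"
      by (simp add: delta_phi) (simp add: phi_pure coact_bullet sweedler_swap[where x="comult B b"])
  qed simp_all
  have r: "?r (?i y) = y" if "y \<in> carrier (tensor K B (C N))" for y
    by (rule lin_eq_on_tensor[where f="\<lambda>y. ?r (?i y)" and U="tensor K B (C N)" and g="\<lambda>x. x", OF _ _ _ _ _ _ that])
      simp_all
  have "coact (T N) z = (THE y. y \<in> carrier (tensor K B (C N)) \<and>
          tsum ?U y (\<lambda>b z. pure K B (tensor K BB N) b z)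
        = tsum ?U z (\<lambda>a n. tsum ?U (coact (bullet K B) a)
            (\<lambda>b a\<^sub>0. pure K B (tensor K BB N) b (pure K BB N a\<^sub>0 n))))"
    by (simp add: cotensor_comod_def Let_def)
  also have "\<dots> = (THE y. y \<in> carrier (tensor K B (C N)) \<and> ?i y = ?c z)"
    using z by (simp add: tsum_sweedler[where V=B and W="C N"] tsum_sweedler[where V=BB and W=N]
      tsum_sweedler[where V=B and W=BB] cong: conj_cong)
  also have "\<dots> = delta z"
  proof (rule the_equality)
    show "delta z \<in> carrier (tensor K B (C N)) \<and> ?i (delta z) = ?c z" using i z by simp
    fix y assume "y \<in> carrier (tensor K B (C N)) \<and> ?i y = ?c z"
    then have y: "y \<in> carrier (tensor K B (C N))" and eq: "?i y = ?c z" by auto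
    have "y = ?r (?i y)" by (rule r[OF y, symmetric])
    also have "\<dots> = ?r (?i (delta z))" by (simp only: eq i)
    also have "\<dots> = delta z" by (rule r) (use z in simp)
    finally show "y = delta z" .
  qed
  finally show ?thesis .
qed

end

end

section \<open>Cofreeness of (B \<bullet> B) \<box> N\<close>

context bialgebra
begin

text \<open>\<open>T N\<close> is \<open>C N\<close> with a coaction attached, so the two are
  interchangeable as spaces but not as terms. All facts about \<open>C N\<close> are rewritten to
  \<open>T N\<close> once, to give the simplifier a single form.\<close>

lemma cotensor_comod_simps:
  "carrier (C N) = carrier (T N)" "tensor K U (C N) = tensor K U (T N)" "tensor K (C N) W = tensor K (T N) W"
  "pure K U (C N) = pure K U (T N)" "pure K (C N) W = pure K (T N) W"
  "lin K U (C N) = lin K U (T N)" "lin K (C N) W = lin K (T N) W" "module K (C N) = module K (T N)"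
  "sweedler (C N) V U x \<beta> = sweedler (T N) V U x \<beta>" "sweedler V (C N) U x \<beta> = sweedler V (T N) U x \<beta>"
  "sweedler V W (C N) x \<beta> = sweedler V W (T N) x \<beta>"
  "smult (C N) = smult (T N)" "add (C N) = add (T N)" "zero (C N) = zero (T N)"
  unfolding cotensor_comod_def Let_def by simp_all

declare phi_sweedler [simp del] psi_sweedler [simp del] phi_smult [simp del] cotensor_simps [simp del]

lemmas [simp] = cotensor_module[unfolded cotensor_comod_simps] cotensor_subset[unfolded cotensor_comod_simps]
  cotensor_incl_lin[unfolded cotensor_comod_simps] phi_closed[unfolded cotensor_comod_simps]
  phi_psi[unfolded cotensor_comod_simps] phi_lin[unfolded cotensor_comod_simps] psi_lin[unfolded cotensor_comod_simps]
  lin_comp_simp[OF phi_lin[unfolded cotensor_comod_simps]] lin_comp_simp[OF psi_lin[unfolded cotensor_comod_simps]]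
  psi_sweedler[unfolded cotensor_comod_simps]
  lin_smult[OF phi_lin[unfolded cotensor_comod_simps]]

lemmas phi_sweedler_T [simp] = phi_sweedler[unfolded cotensor_comod_simps]

lemmas lin_eq_on_T = lin_eq_on_cotensor[unfolded cotensor_comod_simps]

lemma psi_closed [simp]: "\<lbrakk>comodule N; z \<in> carrier (T N)\<rbrakk> \<Longrightarrow> psi N z \<in> carrier (tensor K B N)"
  by (rule lin_closed[OF psi_lin[unfolded cotensor_comod_simps]])

lemma sweedler_T: "comodule N \<Longrightarrow> sweedler V W (T N) x \<beta> = sweedler V W (tensor K BB N) x \<beta>"
  unfolding cotensor_comod_simps[symmetric] by (simp add: sweedler_def tsum_def cotensor_simps cong: if_cong)

lemma coact_T_lin: "comodule N \<Longrightarrow> coact (T N) \<in> lin K (T N) (tensor K B (T N))"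
  unfolding cotensor_comod_simps[symmetric]
  by (rule lin_cong[OF delta_lin]) (simp_all add: coact_cotensor_comod)

lemma coact_T_phi [simp]:
  "\<lbrakk>comodule N; b \<in> carrier B; n \<in> carrier N\<rbrakk> \<Longrightarrow> coact (T N) (phi N (pure K B N b n)) =
     sweedler B B (tensor K B (T N)) (comult B b) (\<lambda>b\<^sub>1 b\<^sub>2. pure K B (T N) b\<^sub>1 (phi N (pure K B N b\<^sub>2 n)))"
  by (simp add: coact_cotensor_comod delta_phi) (simp add: cotensor_comod_simps)

text \<open>On the generators from \<open>phi\<close> the comodule laws of \<open>T N\<close> are
  the counit law and the coassociativity of B.\<close>

lemma comodule_T [simp]:
  assumes N [simp]: "comodule N"
  shows "comodule (T N)"
proof -
  define \<rho> where "\<rho> = coact (T N)"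
  have T: "T N = with_coact (C N) \<rho>" by (simp add: \<rho>_def cotensor_comod_def Let_def)
  have \<rho>_lin [simp]: "\<rho> \<in> lin K (T N) (tensor K B (T N))" by (simp add: \<rho>_def coact_T_lin)
  note [simp] = lin_comp_simp[OF \<rho>_lin] lin_closed[OF \<rho>_lin]
  have \<rho>_phi [simp]: "\<lbrakk>b \<in> carrier B; n \<in> carrier N\<rbrakk> \<Longrightarrow> \<rho> (phi N (pure K B N b n)) =
     sweedler B B (tensor K B (T N)) (comult B b) (\<lambda>b\<^sub>1 b\<^sub>2. pure K B (T N) b\<^sub>1 (phi N (pure K B N b\<^sub>2 n)))" for b n
    by (simp add: \<rho>_def)
  have "comodule (with_coact (C N) \<rho>)"
  proof (rule comodI; unfold cotensor_comod_simps)
    show "module K (T N)" "\<rho> \<in> lin K (T N) (tensor K B (T N))" by simp_all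
    fix z assume z: "z \<in> carrier (T N)"
    show "sweedler B (T N) (T N) (\<rho> z) (\<lambda>b n. counit B b \<odot>\<^bsub>T N\<^esub> n) = z"
      by (rule lin_eq_on_T[where f="\<lambda>z. sweedler B (T N) (T N) (\<rho> z) (\<lambda>b n. counit B b \<odot>\<^bsub>T N\<^esub> n)"
          and g="\<lambda>z. z" and U="T N", OF N _ _ _ _ z]) (simp_all add: counit_sweedler)
    show "sweedler B (T N) (tensor K B (tensor K B (T N))) (\<rho> z) (\<lambda>b n. sweedler B B (tensor K B (tensor K B (T N))) (comult B b)
              (\<lambda>b\<^sub>1 b\<^sub>2. pure K B (tensor K B (T N)) b\<^sub>1 (pure K B (T N) b\<^sub>2 n)))
          = sweedler B (T N) (tensor K B (tensor K B (T N))) (\<rho> z) (\<lambda>b n. pure K B (tensor K B (T N)) b (\<rho> n))"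
      by (rule lin_eq_on_T[where U="tensor K B (tensor K B (T N))", OF N _ _ _ _ z]) (simp_all add: coassoc_sweedler)
  qed
  then show ?thesis by (simp add: T)
qed

text \<open>On B \<otimes> N this is \<epsilon> \<otimes> id, the universal linear map from the
  cofree comodule to the space on which it is cofree.\<close>

definition eps :: "'a comod \<Rightarrow> 'a fn" where
  "eps N z = sweedler B N N (psi N z) (\<lambda>b n. counit B b \<odot>\<^bsub>N\<^esub> n)"

lemma eps_lin [simp]: "comodule N \<Longrightarrow> eps N \<in> lin K (T N) N"
  by (rule lin_cong[where f="\<lambda>z. sweedler B N N (psi N z) (\<lambda>b n. counit B b \<odot>\<^bsub>N\<^esub> n)"]) (simp_all add: eps_def)

lemmas [simp] = lin_comp_simp[OF eps_lin] lin_closed[OF eps_lin] lin_smult[OF eps_lin]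

lemma eps_phi [simp]:
  "\<lbrakk>comodule N; b \<in> carrier B; n \<in> carrier N\<rbrakk> \<Longrightarrow> eps N (phi N (pure K B N b n)) = counit B b \<odot>\<^bsub>N\<^esub> n"
  by (simp add: eps_def)

lemma eps_sweedler [simp]:
  "\<lbrakk>comodule N; \<And>v w. \<lbrakk>v \<in> carrier V; w \<in> carrier W\<rbrakk> \<Longrightarrow> \<beta> v w \<in> carrier (T N)\<rbrakk>
   \<Longrightarrow> eps N (sweedler V W (T N) x \<beta>) = sweedler V W N x (\<lambda>v w. eps N (\<beta> v w))"
  by (rule lin_of_sweedler) simp_all

text \<open>On B \<otimes> N this is m \<mapsto> m_{-1} \<otimes> g(m_0), the comodule map that
  corresponds to the linear map \<open>g\<close> under cofreeness.\<close>

definition ext :: "'a comod \<Rightarrow> 'a comod \<Rightarrow> 'a fn \<Rightarrow> 'a fn" where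
  "ext M N g = (\<lambda>m \<in> carrier M. phi N (sweedler B M (tensor K B N) (coact M m) (\<lambda>b x. pure K B N b (g x))))"

text \<open>On generators, b_1 \<otimes> \<epsilon>(b_2) n = b \<otimes> n. An element is thus
  recovered from its coaction followed by \<open>eps\<close>, which gives the uniqueness in
  cofreeness.\<close>

lemma cofree_decomposition:
  assumes N [simp]: "comodule N" and z: "z \<in> carrier (T N)"
  shows "phi N (sweedler B (T N) (tensor K B N) (coact (T N) z) (\<lambda>b z. pure K B N b (eps N z))) = z"
  by (rule lin_eq_on_T[where g="\<lambda>z. z" and U="T N", OF N _ _ _ _ z])
    (simp_all add: counit_sweedler del: phi_sweedler_T)

context
  fixes M N :: "'a comod" and g :: "'a fn"
  assumes M: "comodule M" and N: "comodule N" and g: "g \<in> lin K M N"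
begin

private lemmas g_simps = lin_closed[OF g] lin_comp_simp[OF g] M N g

lemma ext_lin [simp]: "ext M N g \<in> lin K M (T N)"
  by (rule lin_cong[where f="\<lambda>m. phi N (sweedler B M (tensor K B N) (coact M m) (\<lambda>b x. pure K B N b (g x)))"])
    (simp_all add: g_simps ext_def del: phi_sweedler_T)

lemma eps_ext [simp]: "m \<in> carrier M \<Longrightarrow> eps N (ext M N g m) = g m"
  by (simp add: g_simps ext_def coact_counit_sweedler)

text \<open>Coassociativity of \<open>M\<close>, as \<Delta>(m_{-1}) \<otimes> m_0 is m_{-1}
  \<otimes> coaction of m_0.\<close>

lemma ext_colin: "ext M N g \<in> colin K B M (T N)"
proof (rule colinI)
  note [simp] = g_simps
  fix m assume m [simp]: "m \<in> carrier M"
  have "coact (T N) (ext M N g m) = sweedler B M (tensor K B (T N)) (coact M m) (\<lambda>b n.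
     sweedler B B (tensor K B (T N)) (comult B b) (\<lambda>b\<^sub>1 b\<^sub>2. pure K B (T N) b\<^sub>1 (phi N (pure K B N b\<^sub>2 (g n)))))"
    by (simp add: ext_def)
  also have "\<dots> = sweedler B M (tensor K B (T N)) (coact M m) (\<lambda>b n.
     sweedler B M (tensor K B (T N)) (coact M n) (\<lambda>c n'. pure K B (T N) b (phi N (pure K B N c (g n')))))"
    by (rule coact_coassoc_sweedler[symmetric]) simp_all
  also have "\<dots> = sweedler B M (tensor K B (T N)) (coact M m) (\<lambda>b n. pure K B (T N) b (ext M N g n))"
    by (simp add: ext_def)
  finally show "coact (T N) (ext M N g m)
    = sweedler B M (tensor K B (T N)) (coact M m) (\<lambda>b n. pure K B (T N) b (ext M N g n))" .
qed (simp_all add: g_simps)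

end

text \<open>In \<open>cofree_decomposition\<close> for the element \<open>f m\<close>, colinearity
  of \<open>f\<close> replaces the coaction of \<open>T N\<close> by that of
  \<open>M\<close>.\<close>

lemma cofree_unique:
  assumes M [simp]: "comodule M" and N [simp]: "comodule N" and f: "f \<in> colin K B M (T N)" and [simp]: "m \<in> carrier M"
  shows "f m = ext M N (\<lambda>m. eps N (f m)) m"
proof -
  note [simp] = lin_closed[OF colin_lin[OF f]] lin_comp_simp[OF colin_lin[OF f]] colin_lin[OF f]
  have "f m = phi N (sweedler B (T N) (tensor K B N) (coact (T N) (f m)) (\<lambda>b z. pure K B N b (eps N z)))"
    by (rule cofree_decomposition[symmetric]) simp_all
  then show ?thesis by (simp add: colin_coact[OF f] ext_def del: phi_sweedler_T)
qed

text \<open>The way in which equations between comodule maps into \<open>T N\<close> are proved from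
  now on: they are compared after \<open>eps\<close>, where they usually become trivial.\<close>

lemma cofree_eqI:
  assumes "comodule M" "comodule N" "f \<in> colin K B M (T N)" "f' \<in> colin K B M (T N)"
    and "\<And>m. m \<in> carrier M \<Longrightarrow> eps N (f m) = eps N (f' m)" and m: "m \<in> carrier M"
  shows "f m = f' m"
  using cofree_unique[OF assms(1-3) m] cofree_unique[OF assms(1,2,4) m] assms(5) m
  by (simp add: ext_def cong: sweedler_cong)

section \<open>The structure maps of the monad in terms of cofreeness\<close>

text \<open>Both sides send the generator of b \<otimes> m to that of b \<otimes> f(m): the left one
  because \<open>f\<close> is colinear, the right one by the counit law of B. So id \<box>
  \<open>f\<close> is the comodule map that becomes \<open>f\<close> after
  \<open>eps\<close>.\<close>

lemma cotensor_map_ext: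
  assumes M [simp]: "comodule M" and N [simp]: "comodule N" and f: "f \<in> colin K B M N" and z: "z \<in> carrier (T M)"
  shows "tsum (tensor K BB N) z (\<lambda>a n. pure K BB N a (f n)) = ext (T M) N (\<lambda>z. f (eps M z)) z"
proof -
  note [simp] = lin_closed[OF colin_lin[OF f]] lin_comp_simp[OF colin_lin[OF f]] colin_lin[OF f] lin_smult[OF colin_lin[OF f]]
  have "sweedler BB M (tensor K BB N) z (\<lambda>a n. pure K BB N a (f n)) = ext (T M) N (\<lambda>z. f (eps M z)) z"
  proof (rule lin_eq_on_T[where U="tensor K BB N" and f="\<lambda>z. sweedler BB M (tensor K BB N) z (\<lambda>a n. pure K BB N a (f n))", OF M _ _ _ _ z])
    show "ext (T M) N (\<lambda>z. f (eps M z)) \<in> lin K (T M) (tensor K BB N)"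
      using lin_compose[OF cotensor_incl_lin[unfolded cotensor_comod_simps] ext_lin] by simp
    fix b m assume [simp]: "b \<in> carrier B" "m \<in> carrier M"
    have "ext (T M) N (\<lambda>z. f (eps M z)) (phi M (pure K B M b m)) = phi N (pure K B N b (f m))"
      by (simp add: ext_def counit_sweedler del: phi_sweedler_T)
    also have "\<dots> = sweedler B M (tensor K BB N) (coact M m) (\<lambda>c n. pure K BB N (pure K B B b c) (f n))"
      by (simp add: phi_pure colin_coact[OF f])
    also have "\<dots> = sweedler BB M (tensor K BB N) (phi M (pure K B M b m)) (\<lambda>a n. pure K BB N a (f n))"
      by (simp add: phi_pure)
    finally show "sweedler BB M (tensor K BB N) (phi M (pure K B M b m)) (\<lambda>a n. pure K BB N a (f n))
      = ext (T M) N (\<lambda>z. f (eps M z)) (phi M (pure K B M b m))" by simp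
  qed simp_all
  then show ?thesis using z by (simp add: tsum_sweedler[where V=BB and W=M])
qed

text \<open>Coassociativity turns \<Delta>(n_{-1}) \<otimes> n_0 into the image of n_{-1} \<otimes>
  n_0 under \<open>phi\<close>. So the unit of the monad corresponds to the identity under
  cofreeness.\<close>

lemma cotensor_unit_ext:
  assumes N [simp]: "comodule N" and n [simp]: "n \<in> carrier N"
  shows "tsum (tensor K BB N) (coact N n) (\<lambda>b n\<^sub>0. pure K BB N (comult B b) n\<^sub>0) = ext N N (\<lambda>n. n) n"
proof -
  have "ext N N (\<lambda>n. n) n = sweedler B N (tensor K BB N) (coact N n) (\<lambda>b n\<^sub>0.
      sweedler B N (tensor K BB N) (coact N n\<^sub>0) (\<lambda>c n'. pure K BB N (pure K B B b c) n'))"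
    by (simp add: ext_def phi_def)
  also have "\<dots> = sweedler B N (tensor K BB N) (coact N n) (\<lambda>b n\<^sub>0.
      sweedler B B (tensor K BB N) (comult B b) (\<lambda>b\<^sub>1 b\<^sub>2. pure K BB N (pure K B B b\<^sub>1 b\<^sub>2) n\<^sub>0))"
    by (rule coact_coassoc_sweedler) simp_all
  also have "\<dots> = sweedler B N (tensor K BB N) (coact N n) (\<lambda>b n\<^sub>0.
      pure K BB N (sweedler B B BB (comult B b) (pure K B B)) n\<^sub>0)"
    by (simp del: sweedler_self)
  finally show ?thesis by (simp add: tsum_sweedler[where V=B and W=N])
qed


text \<open>B \<bullet> B as a left comodule only. This makes (B \<bullet> B) \<box> (B \<bullet> B)
  an instance of \<open>C\<close>, whose argument is a comodule.\<close>

abbreviation BBc :: "'a comod" where "BBc \<equiv> with_coact BB (coact (bullet K B))"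

lemma coact_bullet_pure [simp]: "\<lbrakk>b \<in> carrier B; c \<in> carrier B\<rbrakk> \<Longrightarrow> coact (bullet K B) (pure K B B b c) =
    sweedler B B (tensor K B BB) (comult B b) (\<lambda>b\<^sub>1 b\<^sub>2. pure K B BB b\<^sub>1 (pure K B B b\<^sub>2 c))"
  by (simp add: coact_bullet)

lemma coact_bullet_lin [simp]: "coact (bullet K B) \<in> lin K BB (tensor K B BB)"
  by (rule lin_cong[OF lin_sweedler]) (simp_all add: coact_bullet)

lemmas [simp] = lin_closed[OF coact_bullet_lin] lin_comp_simp[OF coact_bullet_lin]

lemma comodule_bullet [simp]: "comodule BBc"
proof (rule comodI)
  fix z assume z: "z \<in> carrier BB"
  show "sweedler B BB BB (coact (bullet K B) z) (\<lambda>b n. counit B b \<odot>\<^bsub>BB\<^esub> n) = z"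
    by (rule lin_eq_on_tensor[where g="\<lambda>z. z" and U=BB, OF _ _ _ _ _ _ z])
      (simp_all add: counit_sweedler)
  show "sweedler B BB (tensor K B (tensor K B BB)) (coact (bullet K B) z) (\<lambda>b n. sweedler B B (tensor K B (tensor K B BB)) (comult B b)
              (\<lambda>b\<^sub>1 b\<^sub>2. pure K B (tensor K B BB) b\<^sub>1 (pure K B BB b\<^sub>2 n)))
          = sweedler B BB (tensor K B (tensor K B BB)) (coact (bullet K B) z) (\<lambda>b n. pure K B (tensor K B BB) b (coact (bullet K B) n))"
    by (rule lin_eq_on_tensor[where U="tensor K B (tensor K B BB)", OF _ _ _ _ _ _ z])
      (simp_all add: coassoc_sweedler)
qed simp_all

lemma cotensor_bullet_bullet: "cotensor K B (bullet K B) (bullet K B) = C BBc"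
  by (simp add: cotensor_def Let_def)

lemma tmult_bullet_lin: "tmult (bullet K B) \<in> lin K (tensor K BB BB) BB"
  by (rule lin_cong[OF lin_sweedler]) (simp_all add: tmult_bullet smult_assoc_K)

lemma phi_bullet_pure:
  "\<lbrakk>b \<in> carrier B; c \<in> carrier B; d \<in> carrier B\<rbrakk> \<Longrightarrow> phi BBc (pure K B BB b (pure K B B c d)) =
    sweedler B B (tensor K BB BB) (comult B c) (\<lambda>c\<^sub>1 c\<^sub>2. pure K BB BB (pure K B B b c\<^sub>1) (pure K B B c\<^sub>2 d))"
  using phi_pure[of BBc b "pure K B B c d"] by simp

text \<open>The element is b \<otimes> c_1 \<otimes> c_2 \<otimes> d, and \<epsilon>(c_1)
  \<epsilon>(c_2) sums to \<epsilon>(c).\<close>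

lemma tmult_phi:
  assumes [simp]: "b \<in> carrier B" "c \<in> carrier B" "d \<in> carrier B"
  shows "tmult (bullet K B) (phi BBc (pure K B BB b (pure K B B c d))) = counit B c \<odot>\<^bsub>BB\<^esub> pure K B B b d"
  by (simp add: phi_bullet_pure lin_of_sweedler[OF tmult_bullet_lin])
    (simp add: tmult_bullet smult_assoc_K counit_sweedler)

context
  fixes N :: "'a comod" assumes N [simp]: "comodule N"
begin

text \<open>By \<open>phi\<close>, \<open>T (T N)\<close> is B \<otimes> (B \<otimes> N), and there
  both sides are b \<otimes> (c \<otimes> n) \<mapsto> \<epsilon>(c) b \<otimes> n. The definite
  description in \<open>cotensor_mult\<close> is resolved as in \<open>coact_cotensor_comod\<close>:
  an explicit solution \<open>Y z\<close>, and a left inverse \<open>?r\<close> of the comparison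
  map \<open>?i\<close> for uniqueness.\<close>

lemma cotensor_mult_ext:
  assumes z [simp]: "z \<in> carrier (T (T N))"
  shows "cotensor_mult K B (bullet K B) N z = ext (T (T N)) N (\<lambda>z. eps N (eps (T N) z)) z"
proof -
  let ?S = "tensor K BB (tensor K BB N)"
  let ?Y = "tensor K (T BBc) N"
  \<comment> \<open>For t the image of c \<otimes> n under \<open>phi\<close>, \<open>y b t\<close>
    is b \<otimes> c_1 \<otimes> c_2 \<otimes> n_{-1} \<otimes> n_0 as an element of (A \<box> A)
    \<otimes> N with A = B \<bullet> B. It corresponds to b \<otimes> t in
    \<open>T (T N)\<close>.\<close>
  define y where "y b t = sweedler B N ?Y (psi N t) (\<lambda>c n. sweedler B N ?Y (coact N n)
     (\<lambda>d n\<^sub>0. pure K (T BBc) N (phi BBc (pure K B BB b (pure K B B c d))) n\<^sub>0))" for b t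
  define Y where "Y z = sweedler B (T N) ?Y (psi (T N) z) (\<lambda>b t. y b t)" for z
  let ?i = "\<lambda>y. sweedler (T BBc) N ?S y (\<lambda>z n. sweedler BB BB ?S z (\<lambda>a a'. pure K BB (tensor K BB N) a (pure K BB N a' n)))"
  let ?j = "\<lambda>x. sweedler BB (T N) ?S x (\<lambda>a z. pure K BB (tensor K BB N) a z)"
  \<comment> \<open>Rebrackets to (A \<otimes> A) \<otimes> N and retracts the first factor onto A
    \<box> A by \<open>phi\<close> after \<open>psi\<close>, which is the identity on elements that
    already lie there.\<close>
  let ?r = "\<lambda>x. sweedler BB (tensor K BB N) ?Y x (\<lambda>a w. sweedler BB N ?Y w
     (\<lambda>a' n. pure K (T BBc) N (phi BBc (psi BBc (pure K BB BB a a'))) n))"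
  note bullet_facts = phi_lin[OF comodule_bullet] psi_lin0[OF comodule_bullet] cotensor_subset[OF comodule_bullet]
    cotensor_incl_lin[OF comodule_bullet]
  have phi_BB [simp]: "phi BBc \<in> lin K (tensor K B BB) (T BBc)"
    and psi_BB [simp]: "psi BBc \<in> lin K (tensor K BB BB) (tensor K B BB)"
    and [simp]: "(\<lambda>z. z) \<in> lin K (T BBc) (tensor K BB BB)"
    using bullet_facts(1,2,4) by (simp_all only: cotensor_comod_simps tensor_with_coact)
  have [simp]: "z \<in> carrier (tensor K BB BB)" if "z \<in> carrier (T BBc)" for z
    using bullet_facts(3)[of z] that by (simp only: cotensor_comod_simps tensor_with_coact)
  note [simp] = lin_closed[OF psi_BB] lin_comp_simp[OF psi_BB] lin_comp_simp[OF phi_lin0[OF comodule_T[OF N]]]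
  have y_phi: "y b (phi N (pure K B N c n)) = sweedler B N ?Y (coact N n)
     (\<lambda>d n\<^sub>0. pure K (T BBc) N (phi BBc (pure K B BB b (pure K B B c d))) n\<^sub>0)"
    if "b \<in> carrier B" "c \<in> carrier B" "n \<in> carrier N" for b c n
    using that by (simp add: y_def)
  have y_lin1 [simp]: "y b \<in> lin K (T N) ?Y" if "b \<in> carrier B" for b
    by (rule lin_cong[where f="\<lambda>t. sweedler B N ?Y (psi N t) (\<lambda>c n. sweedler B N ?Y (coact N n)
     (\<lambda>d n\<^sub>0. pure K (T BBc) N (phi BBc (pure K B BB b (pure K B B c d))) n\<^sub>0))"]) (use that in \<open>simp_all add: y_def\<close>)
  have y_lin2 [simp]: "(\<lambda>b. y b t) \<in> lin K B ?Y" if "t \<in> carrier (T N)" for t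
    using that by (simp add: y_def)
  note [simp] = lin_closed[OF y_lin1]
  have Y_lin [simp]: "Y \<in> lin K (T (T N)) ?Y"
    by (rule lin_cong[where f="\<lambda>z. sweedler B (T N) ?Y (psi (T N) z) (\<lambda>b t. y b t)"]) (simp_all add: Y_def)
  note [simp] = lin_closed[OF Y_lin] lin_comp_simp[OF Y_lin]
  have Y_phi [simp]: "Y (phi (T N) (pure K B (T N) b t)) = y b t" if "b \<in> carrier B" "t \<in> carrier (T N)" for b t
    using that by (simp add: Y_def)
  have iY: "?i (Y z) = ?j z"
  proof (rule lin_eq_on_T[where f="\<lambda>z. ?i (Y z)" and g="?j" and U="?S" and N="T N", OF _ _ _ _ _ z])
    fix b t assume [simp]: "b \<in> carrier B" and t [simp]: "t \<in> carrier (T N)"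
    have "?i (y b t) = ?j (phi (T N) (pure K B (T N) b t))"
    proof (rule lin_eq_on_T[where f="\<lambda>t. ?i (y b t)" and g="\<lambda>t. ?j (phi (T N) (pure K B (T N) b t))" and U="?S", OF N _ _ _ _ t])
      fix c n assume [simp]: "c \<in> carrier B" "n \<in> carrier N"
      show "?i (y b (phi N (pure K B N c n))) = ?j (phi (T N) (pure K B (T N) b (phi N (pure K B N c n))))"
        by (simp add: y_phi phi_pure[OF comodule_T[OF N]])
          (simp add: phi_bullet_pure phi_pure[OF N], rule sweedler_swap; simp)
    qed simp_all
    then show "?i (Y (phi (T N) (pure K B (T N) b t))) = ?j (phi (T N) (pure K B (T N) b t))" by simp
  qed simp_all
  have ri: "?r (?i y') = y'" if "y' \<in> carrier ?Y" for y'
  proof (rule lin_eq_on_tensor[where f="\<lambda>y. ?r (?i y)" and g="\<lambda>y. y" and U="?Y", OF _ _ _ _ _ _ that])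
    fix z n assume [simp]: "z \<in> carrier (T BBc)" "n \<in> carrier N"
    have "sweedler BB BB ?Y z (\<lambda>a a'. pure K (T BBc) N (phi BBc (psi BBc (pure K BB BB a a'))) n)
      = pure K (T BBc) N (phi BBc (psi BBc z)) n"
      by (rule lin_eq_on_tensor[where g="\<lambda>z. pure K (T BBc) N (phi BBc (psi BBc z)) n" and x=z and V=BB and W=BB and U="?Y"]) simp_all
    then show "?r (?i (pure K (T BBc) N z n)) = pure K (T BBc) N z n" by simp
  qed simp_all
  have "cotensor_mult K B (bullet K B) N z = tsum (tensor K BB N) (THE y'. y' \<in> carrier ?Y \<and> ?i y' = ?j z)
         (\<lambda>z n. pure K BB N (tmult (bullet K B) z) n)"
    unfolding cotensor_mult_def Let_def cotensor_bullet_bullet cotensor_comod_simps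
    by (simp add: tsum_sweedler[where V="T BBc" and W=N] tsum_sweedler[where V=BB and W=BB]
        tsum_sweedler[where V=BB and W="T N"] cong: conj_cong)
  also have "(THE y'. y' \<in> carrier ?Y \<and> ?i y' = ?j z) = Y z"
  proof (rule the_equality)
    show "Y z \<in> carrier ?Y \<and> ?i (Y z) = ?j z" using iY by simp
    fix y' assume "y' \<in> carrier ?Y \<and> ?i y' = ?j z"
    then have y': "y' \<in> carrier ?Y" and eq: "?i y' = ?j z" by auto
    have "y' = ?r (?i y')" by (rule ri[OF y', symmetric])
    also have "\<dots> = ?r (?i (Y z))" by (simp only: eq iY)
    also have "\<dots> = Y z" by (rule ri) simp
    finally show "y' = Y z" .
  qed
  also have "tsum (tensor K BB N) (Y z) (\<lambda>z n. pure K BB N (tmult (bullet K B) z) n) = ext (T (T N)) N (\<lambda>z. eps N (eps (T N) z)) z"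
  proof -
    note tl = tmult_bullet_lin
    have [simp]: "tmult (bullet K B) \<in> lin K (T BBc) BB"
      using lin_compose[OF tl, of "\<lambda>z. z" "T BBc"] by simp
    note [simp] = lin_closed[OF tl]
    let ?m = "\<lambda>y. sweedler (T BBc) N (tensor K BB N) y (\<lambda>z n. pure K BB N (tmult (bullet K B) z) n)"
    have "?m (Y z) = ext (T (T N)) N (\<lambda>z. eps N (eps (T N) z)) z"
    proof (rule lin_eq_on_T[where f="\<lambda>z. ?m (Y z)" and U="tensor K BB N" and N="T N", OF _ _ _ _ _ z])
      show "ext (T (T N)) N (\<lambda>z. eps N (eps (T N) z)) \<in> lin K (T (T N)) (tensor K BB N)"
        using lin_compose[OF cotensor_incl_lin[unfolded cotensor_comod_simps] ext_lin] by simp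
      fix b t assume [simp]: "b \<in> carrier B" and t [simp]: "t \<in> carrier (T N)"
      have "ext (T (T N)) N (\<lambda>z. eps N (eps (T N) z)) (phi (T N) (pure K B (T N) b t)) = phi N (pure K B N b (eps N t))"
        by (simp add: ext_def counit_sweedler del: phi_sweedler_T)
      also have "\<dots> = ?m (y b t)"
      proof (rule lin_eq_on_T[where g="\<lambda>t. ?m (y b t)"
          and f="\<lambda>t. phi N (pure K B N b (eps N t))" and U="tensor K BB N", OF N _ _ _ _ t])
        show "(\<lambda>t. phi N (pure K B N b (eps N t))) \<in> lin K (T N) (tensor K BB N)"
          by (rule lin_compose[OF phi_lin0]) simp_all
        fix c n assume [simp]: "c \<in> carrier B" "n \<in> carrier N"
        have "phi N (pure K B N b (eps N (phi N (pure K B N c n)))) = counit B c \<odot>\<^bsub>tensor K BB N\<^esub> phi N (pure K B N b n)"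
          using phi_smult[OF N, of "counit B c" "pure K B N b n"] by simp
        then show "phi N (pure K B N b (eps N (phi N (pure K B N c n)))) = ?m (y b (phi N (pure K B N c n)))"
          by (simp add: y_phi tmult_phi) (simp add: phi_pure)
      qed simp_all
      finally show "?m (Y (phi (T N) (pure K B (T N) b t)))
        = ext (T (T N)) N (\<lambda>z. eps N (eps (T N) z)) (phi (T N) (pure K B (T N) b t))" by simp
    qed simp_all
    then show ?thesis by (simp add: tsum_sweedler[where V="T BBc" and W=N])
  qed
  finally show ?thesis .
qed

end

text \<open>Both sides send m \<otimes> \<open>phi N (pure K B N b n)\<close> to the image under
  \<open>phi\<close> of m_{-1} b \<otimes> (m_0 \<otimes> n). So the lax structure is the comodule
  map that corresponds to id \<otimes> \<open>eps\<close>.\<close>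

lemma cotensor_lax_ext:
  assumes M [simp]: "comodule M" and N [simp]: "comodule N" and x: "x \<in> carrier (tensor K M (T N))"
  shows "tsum (tensor K BB (tensor K M N)) x (\<lambda>m z. tsum (tensor K BB (tensor K M N)) z (\<lambda>a n.
      tsum (tensor K BB (tensor K M N)) (coact M m)
              (\<lambda>b m\<^sub>0. pure K BB (tensor K M N) (lact (bullet K B) b a) (pure K M N m\<^sub>0 n))))
    = ext (comod_tensor K B M (T N)) (comod_tensor K B M N) (tmap K M (T N) M N (\<lambda>m. m) (eps N)) x"
proof -
  let ?U = "tensor K BB (tensor K M N)"
  let ?W = "comod_tensor K B M N"
  let ?l = "\<lambda>x. sweedler M (T N) ?U x (\<lambda>m z. sweedler BB N ?U z (\<lambda>a n. sweedler B M ?U (coact M m)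
              (\<lambda>b m\<^sub>0. pure K BB (tensor K M N) (lact (bullet K B) b a) (pure K M N m\<^sub>0 n))))"
  let ?t = "tmap K M (T N) M N (\<lambda>m. m) (eps N)"
  have t [simp]: "?t \<in> lin K (tensor K M (T N)) (tensor K M N)" by simp
  note [simp] = lin_closed[OF t] lin_comp_simp[OF t]
  have l1: "(\<lambda>a. lact (bullet K B) b a) \<in> lin K BB BB" if "b \<in> carrier B" for b
    by (rule lin_cong[OF lin_sweedler]) (use that in \<open>simp_all add: lact_bullet\<close>)
  have l2 [simp]: "f \<in> lin K X B \<Longrightarrow> (\<lambda>x. lact (bullet K B) (f x) a) \<in> lin K X BB" if "a \<in> carrier BB" for a f
    and X :: "('a univ, 'a univ, 'x) module_scheme"
  proof (rule lin_compose[where f=f])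
    show "(\<lambda>b. lact (bullet K B) b a) \<in> lin K B BB"
      by (rule lin_cong[where f="\<lambda>b. sweedler B B BB a (\<lambda>c d. sweedler B B BB (comult B b)
      (\<lambda>b\<^sub>1 b\<^sub>2. pure K B B (b\<^sub>1 \<otimes>\<^bsub>B\<^esub> c) (b\<^sub>2 \<otimes>\<^bsub>B\<^esub> d)))"]) (use that in \<open>simp_all add: lact_bullet\<close>)
  qed
  note [simp] = lin_compose[OF l1] lin_closed[OF l1] l1[simplified]
  have phi_W: "phi ?W \<in> lin K (tensor K B (tensor K M N)) (T ?W)"
    using phi_lin[of ?W] by (simp add: cotensor_comod_simps)
  have "?l x = ext (comod_tensor K B M (T N)) ?W ?t x"
  proof (rule lin_eq_on_tensor[where f="?l" and U="?U", OF _ _ _ _ _ _ x])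
    have "(\<lambda>z. z) \<in> lin K (T ?W) ?U" using cotensor_incl_lin[of ?W] by (simp add: cotensor_comod_simps)
    moreover have "ext (comod_tensor K B M (T N)) ?W ?t \<in> lin K (tensor K M (T N)) (T ?W)"
      using ext_lin[of "comod_tensor K B M (T N)" ?W ?t] by simp
    ultimately show ext_U: "ext (comod_tensor K B M (T N)) ?W ?t \<in> lin K (tensor K M (T N)) ?U"
      using lin_compose by fastforce
    fix m z assume m [simp]: "m \<in> carrier M" and z: "z \<in> carrier (T N)"
    show "?l (pure K M (T N) m z) = ext (comod_tensor K B M (T N)) ?W ?t (pure K M (T N) m z)"
    proof (rule lin_eq_on_T[where f="\<lambda>z. ?l (pure K M (T N) m z)"
          and g="\<lambda>z. ext (comod_tensor K B M (T N)) ?W ?t (pure K M (T N) m z)" and U="?U", OF N _ _ _ _ z])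
      show "(\<lambda>z. ext (comod_tensor K B M (T N)) ?W ?t (pure K M (T N) m z)) \<in> lin K (T N) ?U"
        by (rule lin_compose[OF ext_U]) simp
      fix b n assume [simp]: "b \<in> carrier B" "n \<in> carrier N"
      let ?z = "phi N (pure K B N b n)"
      have "ext (comod_tensor K B M (T N)) ?W ?t (pure K M (T N) m ?z)
        = phi ?W (sweedler B M (tensor K B (tensor K M N)) (coact M m) (\<lambda>d m\<^sub>0. pure K B (tensor K M N) (d \<otimes>\<^bsub>B\<^esub> b) (pure K M N m\<^sub>0 n)))"
        by (simp add: ext_def counit_sweedler)
      also have "\<dots> = sweedler B M ?U (coact M m) (\<lambda>d m\<^sub>0. sweedler B M ?U (coact M m\<^sub>0) (\<lambda>e m'. 
           sweedler B N ?U (coact N n) (\<lambda>c n\<^sub>0. pure K BB (tensor K M N) (pure K B B (d \<otimes>\<^bsub>B\<^esub> b) (e \<otimes>\<^bsub>B\<^esub> c)) (pure K M N m' n\<^sub>0))))"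
        by (simp add: phi_def)
      \<comment> \<open>Coassociativity of \<open>M\<close>: one coaction on m comes from
        \<open>ext\<close>, the other from \<open>phi\<close>, and together they form
        \<Delta>(m_{-1}), as in the diagonal left action on B \<bullet> B.\<close>
      also have "\<dots> = sweedler B M ?U (coact M m) (\<lambda>d m\<^sub>0. sweedler B B ?U (comult B d) (\<lambda>d\<^sub>1 d\<^sub>2. 
           sweedler B N ?U (coact N n) (\<lambda>c n\<^sub>0. pure K BB (tensor K M N) (pure K B B (d\<^sub>1 \<otimes>\<^bsub>B\<^esub> b) (d\<^sub>2 \<otimes>\<^bsub>B\<^esub> c)) (pure K M N m\<^sub>0 n\<^sub>0))))"
        by (rule coact_coassoc_sweedler) simp_all
      also have "\<dots> = sweedler B M ?U (coact M m) (\<lambda>d m\<^sub>0. sweedler B N ?U (coact N n) (\<lambda>c n\<^sub>0. 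
           sweedler B B ?U (comult B d) (\<lambda>d\<^sub>1 d\<^sub>2. pure K BB (tensor K M N) (pure K B B (d\<^sub>1 \<otimes>\<^bsub>B\<^esub> b) (d\<^sub>2 \<otimes>\<^bsub>B\<^esub> c)) (pure K M N m\<^sub>0 n\<^sub>0))))"
        by (rule sweedler_cong[OF HOL.refl HOL.refl HOL.refl HOL.refl], rule sweedler_swap; simp)
      also have "\<dots> = sweedler B N ?U (coact N n) (\<lambda>c n\<^sub>0. sweedler B M ?U (coact M m) (\<lambda>d m\<^sub>0.
           sweedler B B ?U (comult B d) (\<lambda>d\<^sub>1 d\<^sub>2. pure K BB (tensor K M N) (pure K B B (d\<^sub>1 \<otimes>\<^bsub>B\<^esub> b) (d\<^sub>2 \<otimes>\<^bsub>B\<^esub> c)) (pure K M N m\<^sub>0 n\<^sub>0))))"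
        by (rule sweedler_swap; simp)
      also have "\<dots> = ?l (pure K M (T N) m ?z)"
        by simp (simp add: phi_pure lact_bullet)
      finally show "?l (pure K M (T N) m ?z) = ext (comod_tensor K B M (T N)) ?W ?t (pure K M (T N) m ?z)" by simp
    qed simp_all
  qed simp_all
  then show ?thesis using x by (simp add: tsum_sweedler[where V=M and W="T N"] tsum_sweedler[where V=BB and W=N] tsum_sweedler[where V=B and W=M])
qed

end

section \<open>Arrows, isomorphisms and functors in linear categories\<close>

text \<open>\<open>arr\<close> takes the end points as arguments. With \<open>is_arr\<close> the
  typing conditions become equations between values of \<open>Dom\<close> and \<open>Cod\<close>,
  which the simplifier can solve without guessing objects.\<close>

definition is_arr :: "('k, 'o, 'm, 'z) kcat_scheme \<Rightarrow> 'm \<Rightarrow> bool" where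
  "is_arr C f \<longleftrightarrow> Dom C f \<in> Obj C \<and> Cod C f \<in> Obj C \<and> f \<in> arr C (Dom C f) (Cod C f)"

definition inverse_arrs :: "('k, 'o, 'm, 'z) kcat_scheme \<Rightarrow> 'm \<Rightarrow> 'm \<Rightarrow> bool" where
  "inverse_arrs C f g \<longleftrightarrow> is_arr C f \<and> is_arr C g \<and> Dom C g = Cod C f \<and> Cod C g = Dom C f \<and>
     g \<cdot>\<^bsub>C\<^esub> f = Ident C (Dom C f) \<and> f \<cdot>\<^bsub>C\<^esub> g = Ident C (Cod C f)"

definition iso_arr :: "('k, 'o, 'm, 'z) kcat_scheme \<Rightarrow> 'm \<Rightarrow> bool" where
  "iso_arr C f \<longleftrightarrow> (\<exists>g. inverse_arrs C f g)"

definition inv_arr :: "('k, 'o, 'm, 'z) kcat_scheme \<Rightarrow> 'm \<Rightarrow> 'm" where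
  "inv_arr C f = (SOME g. inverse_arrs C f g)"

context linear_category
begin

lemma is_arrI:
  assumes "f \<in> arr C X Y" "X \<in> Obj C" "Y \<in> Obj C"
  shows "is_arr C f" "Dom C f = X" "Cod C f = Y"
  using assms dom_cod[of X Y f] by (simp_all add: is_arr_def)

lemma arr_iff: "\<lbrakk>X \<in> Obj C; Y \<in> Obj C\<rbrakk> \<Longrightarrow> f \<in> arr C X Y \<longleftrightarrow> is_arr C f \<and> Dom C f = X \<and> Cod C f = Y"
  by (auto intro: is_arrI simp: is_arr_def dest: dom_cod)

lemma is_arr_obj [simp]: "is_arr C f \<Longrightarrow> Dom C f \<in> Obj C" "is_arr C f \<Longrightarrow> Cod C f \<in> Obj C"
  by (simp_all add: is_arr_def)

lemma is_arrD: "is_arr C f \<Longrightarrow> f \<in> arr C (Dom C f) (Cod C f)"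
  unfolding is_arr_def by blast

lemma is_arr_comp [simp]:
  assumes "is_arr C f" "is_arr C g" "Dom C g = Cod C f"
  shows "is_arr C (g \<cdot>\<^bsub>C\<^esub> f)" "Dom C (g \<cdot>\<^bsub>C\<^esub> f) = Dom C f" "Cod C (g \<cdot>\<^bsub>C\<^esub> f) = Cod C g"
proof -
  have "g \<cdot>\<^bsub>C\<^esub> f \<in> arr C (Dom C f) (Cod C g)"
    by (rule comp_arr[where Y="Cod C f"]) (use assms is_arrD[of f] is_arrD[of g] in simp_all)
  from is_arrI[OF this is_arr_obj(1)[OF assms(1)] is_arr_obj(2)[OF assms(2)]]
  show "is_arr C (g \<cdot>\<^bsub>C\<^esub> f)" "Dom C (g \<cdot>\<^bsub>C\<^esub> f) = Dom C f" "Cod C (g \<cdot>\<^bsub>C\<^esub> f) = Cod C g" .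
qed

lemma is_arr_ident [simp]:
  assumes "X \<in> Obj C"
  shows "is_arr C (Ident C X)" "Dom C (Ident C X) = X" "Cod C (Ident C X) = X"
  using is_arrI[OF ident_arr] assms by simp_all

lemma comp_ident [simp]:
  "\<lbrakk>is_arr C f; Cod C f = Y\<rbrakk> \<Longrightarrow> Ident C Y \<cdot>\<^bsub>C\<^esub> f = f"
  "\<lbrakk>is_arr C f; Dom C f = X\<rbrakk> \<Longrightarrow> f \<cdot>\<^bsub>C\<^esub> Ident C X = f"
  using comp_ident_left[of "Dom C f" "Cod C f" f] comp_ident_right[of "Dom C f" "Cod C f" f]
    is_arrD[of f] by auto

lemma assoc [simp]:
  "\<lbrakk>is_arr C f; is_arr C g; is_arr C h; Dom C g = Cod C f; Dom C h = Cod C g\<rbrakk>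
    \<Longrightarrow> (h \<cdot>\<^bsub>C\<^esub> g) \<cdot>\<^bsub>C\<^esub> f = h \<cdot>\<^bsub>C\<^esub> (g \<cdot>\<^bsub>C\<^esub> f)"
  using comp_assoc[of "Dom C f" "Cod C f" "Cod C g" "Cod C h" f g h] is_arrD[of f] is_arrD[of g] is_arrD[of h] by simp

lemma inverse_inv_arr: "iso_arr C f \<Longrightarrow> inverse_arrs C f (inv_arr C f)"
  unfolding iso_arr_def inv_arr_def by (rule someI_ex)

lemma iso_arr_simps [simp]:
  assumes "iso_arr C f"
  shows "is_arr C f" "is_arr C (inv_arr C f)" "Dom C (inv_arr C f) = Cod C f" "Cod C (inv_arr C f) = Dom C f"
    "inv_arr C f \<cdot>\<^bsub>C\<^esub> f = Ident C (Dom C f)" "f \<cdot>\<^bsub>C\<^esub> inv_arr C f = Ident C (Cod C f)"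
  using inverse_inv_arr[OF assms] by (simp_all add: inverse_arrs_def)

lemma iso_arr_cancel [simp]:
  assumes "iso_arr C f"
  shows "\<lbrakk>is_arr C h; Cod C h = Dom C f\<rbrakk> \<Longrightarrow> inv_arr C f \<cdot>\<^bsub>C\<^esub> (f \<cdot>\<^bsub>C\<^esub> h) = h"
    and "\<lbrakk>is_arr C k; Cod C k = Cod C f\<rbrakk> \<Longrightarrow> f \<cdot>\<^bsub>C\<^esub> (inv_arr C f \<cdot>\<^bsub>C\<^esub> k) = k"
  using assms by (simp_all flip: assoc)

lemma iso_arrI:
  "\<lbrakk>is_arr C f; is_arr C g; Dom C g = Cod C f; Cod C g = Dom C f;
     g \<cdot>\<^bsub>C\<^esub> f = Ident C (Dom C f); f \<cdot>\<^bsub>C\<^esub> g = Ident C (Cod C f)\<rbrakk> \<Longrightarrow> iso_arr C f"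
  unfolding iso_arr_def inverse_arrs_def by blast

lemma is_iso_iff:
  assumes "X \<in> Obj C" "Y \<in> Obj C"
  shows "is_iso C X Y f \<longleftrightarrow> iso_arr C f \<and> Dom C f = X \<and> Cod C f = Y"
proof
  assume "is_iso C X Y f"
  then obtain g where "f \<in> arr C X Y" "g \<in> arr C Y X" "g \<cdot>\<^bsub>C\<^esub> f = Ident C X" "f \<cdot>\<^bsub>C\<^esub> g = Ident C Y"
    by (auto simp: is_iso_def)
  then show "iso_arr C f \<and> Dom C f = X \<and> Cod C f = Y"
    using assms by (intro conjI iso_arrI[where g=g]) (simp_all add: arr_iff)
next
  assume "iso_arr C f \<and> Dom C f = X \<and> Cod C f = Y"
  then show "is_iso C X Y f"
    unfolding is_iso_def using assms by (intro conjI bexI[of _ "inv_arr C f"]) (simp_all add: arr_iff)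
qed

lemma iso_arr_ident [simp]: "X \<in> Obj C \<Longrightarrow> iso_arr C (Ident C X)"
  by (rule iso_arrI[where g="Ident C X"]) simp_all

lemma iso_arr_inv [simp]: "iso_arr C f \<Longrightarrow> iso_arr C (inv_arr C f)"
  by (rule iso_arrI[where g=f]) simp_all

lemma iso_arr_comp [simp]: "\<lbrakk>iso_arr C f; iso_arr C g; Dom C g = Cod C f\<rbrakk> \<Longrightarrow> iso_arr C (g \<cdot>\<^bsub>C\<^esub> f)"
  by (rule iso_arrI[where g="inv_arr C f \<cdot>\<^bsub>C\<^esub> inv_arr C g"]) simp_all

lemma iso_cancel_right:
  assumes "iso_arr C p" "is_arr C f" "is_arr C g" "Dom C f = Cod C p" "Dom C g = Cod C p" "f \<cdot>\<^bsub>C\<^esub> p = g \<cdot>\<^bsub>C\<^esub> p"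
  shows "f = g"
proof -
  have "(f \<cdot>\<^bsub>C\<^esub> p) \<cdot>\<^bsub>C\<^esub> inv_arr C p = (g \<cdot>\<^bsub>C\<^esub> p) \<cdot>\<^bsub>C\<^esub> inv_arr C p" using assms(6) by simp
  then show ?thesis using assms(1-5) by simp
qed

lemma iso_cancel_left:
  assumes "iso_arr C p" "is_arr C f" "is_arr C g" "Cod C f = Dom C p" "Cod C g = Dom C p" "p \<cdot>\<^bsub>C\<^esub> f = p \<cdot>\<^bsub>C\<^esub> g"
  shows "f = g"
  using arg_cong[OF assms(6), of "\<lambda>h. inv_arr C p \<cdot>\<^bsub>C\<^esub> h"] assms(1-5) by simp

end

context linear_functor
begin

lemma functor_simps [simp]:
  "X \<in> Obj C \<Longrightarrow> FObj F X \<in> Obj D"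
  "is_arr C f \<Longrightarrow> is_arr D (FArr F f)"
  "is_arr C f \<Longrightarrow> Dom D (FArr F f) = FObj F (Dom C f)"
  "is_arr C f \<Longrightarrow> Cod D (FArr F f) = FObj F (Cod C f)"
  "X \<in> Obj C \<Longrightarrow> FArr F (Ident C X) = Ident D (FObj F X)"
  using fobj[of X] target.is_arrI[OF farr[OF _ _ source.is_arrD[of f]]] fident[of X]
  by (auto simp: fobj)

lemma functor_comp:
  "\<lbrakk>is_arr C f; is_arr C g; Dom C g = Cod C f\<rbrakk> \<Longrightarrow> FArr F (g \<cdot>\<^bsub>C\<^esub> f) = FArr F g \<cdot>\<^bsub>D\<^esub> FArr F f"
  using fcomp[of "Dom C f" "Cod C f" "Cod C g" f g] source.is_arrD[of f] source.is_arrD[of g] by simp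

lemma functor_iso [simp]: "iso_arr C f \<Longrightarrow> iso_arr D (FArr F f)"
  by (rule target.iso_arrI[where g="FArr F (inv_arr C f)"]) (simp_all flip: functor_comp)

lemma functor_merge:
  "\<lbrakk>is_arr C f; is_arr C g; Dom C g = Cod C f\<rbrakk> \<Longrightarrow> FArr F g \<cdot>\<^bsub>D\<^esub> FArr F f = FArr F (g \<cdot>\<^bsub>C\<^esub> f)"
  "\<lbrakk>is_arr C f; is_arr C g; Dom C g = Cod C f; is_arr D h; Cod D h = FObj F (Dom C f)\<rbrakk>
     \<Longrightarrow> FArr F g \<cdot>\<^bsub>D\<^esub> (FArr F f \<cdot>\<^bsub>D\<^esub> h) = FArr F (g \<cdot>\<^bsub>C\<^esub> f) \<cdot>\<^bsub>D\<^esub> h"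
  by (simp_all add: functor_comp)

end

lemma linear_functorI:
  assumes C: "linear_category K C" and D: "linear_category K D"
    and "\<And>X. X \<in> Obj C \<Longrightarrow> FObj F X \<in> Obj D"
    and a: "\<And>f. is_arr C f \<Longrightarrow> is_arr D (FArr F f) \<and> Dom D (FArr F f) = FObj F (Dom C f) \<and> Cod D (FArr F f) = FObj F (Cod C f)"
    and "\<And>X. X \<in> Obj C \<Longrightarrow> FArr F (Ident C X) = Ident D (FObj F X)"
    and c: "\<And>f g. \<lbrakk>is_arr C f; is_arr C g; Dom C g = Cod C f\<rbrakk> \<Longrightarrow> FArr F (g \<cdot>\<^bsub>C\<^esub> f) = FArr F g \<cdot>\<^bsub>D\<^esub> FArr F f"
    and "\<And>X Y f g. \<lbrakk>X \<in> Obj C; Y \<in> Obj C; f \<in> arr C X Y; g \<in> arr C X Y\<rbrakk>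
          \<Longrightarrow> FArr F (f \<oplus>\<^bsub>Hom C X Y\<^esub> g) = FArr F f \<oplus>\<^bsub>Hom D (FObj F X) (FObj F Y)\<^esub> FArr F g"
    and "\<And>X Y a f. \<lbrakk>X \<in> Obj C; Y \<in> Obj C; a \<in> carrier K; f \<in> arr C X Y\<rbrakk>
          \<Longrightarrow> FArr F (a \<odot>\<^bsub>Hom C X Y\<^esub> f) = a \<odot>\<^bsub>Hom D (FObj F X) (FObj F Y)\<^esub> FArr F f"
  shows "linear_functor K C D F"
proof -
  interpret C: linear_category K C by fact
  interpret D: linear_category K D by fact
  show ?thesis
  proof
    fix X Y f assume XY: "X \<in> Obj C" "Y \<in> Obj C" and f: "f \<in> arr C X Y"
    then show "FArr F f \<in> arr D (FObj F X) (FObj F Y)"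
      using a[of f] C.is_arrI[OF f XY] assms(3) by (simp add: D.arr_iff)
    fix Z g assume "Z \<in> Obj C" "g \<in> arr C Y Z"
    then show "FArr F (g \<cdot>\<^bsub>C\<^esub> f) = FArr F g \<cdot>\<^bsub>D\<^esub> FArr F f"
      using c[of f g] C.is_arrI[OF f XY] C.is_arrI[of g Y Z] XY by simp
  qed (use assms in auto)
qed

section \<open>Weak equivalences and their quasi-inverses\<close>

context linear_category
begin

lemma add_arr: "\<lbrakk>X \<in> Obj C; Y \<in> Obj C; f \<in> arr C X Y; g \<in> arr C X Y\<rbrakk> \<Longrightarrow> f \<oplus>\<^bsub>Hom C X Y\<^esub> g \<in> arr C X Y"
  and smult_arr: "\<lbrakk>X \<in> Obj C; Y \<in> Obj C; a \<in> carrier K; f \<in> arr C X Y\<rbrakk> \<Longrightarrow> a \<odot>\<^bsub>Hom C X Y\<^esub> f \<in> arr C X Y"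
  and zero_arr: "\<lbrakk>X \<in> Obj C; Y \<in> Obj C\<rbrakk> \<Longrightarrow> \<zero>\<^bsub>Hom C X Y\<^esub> \<in> arr C X Y"
proof -
  assume XY: "X \<in> Obj C" "Y \<in> Obj C"
  interpret H: module K "Hom C X Y" using hom_module XY .
  show "\<lbrakk>f \<in> arr C X Y; g \<in> arr C X Y\<rbrakk> \<Longrightarrow> f \<oplus>\<^bsub>Hom C X Y\<^esub> g \<in> arr C X Y"
    "\<lbrakk>a \<in> carrier K; f \<in> arr C X Y\<rbrakk> \<Longrightarrow> a \<odot>\<^bsub>Hom C X Y\<^esub> f \<in> arr C X Y" "\<zero>\<^bsub>Hom C X Y\<^esub> \<in> arr C X Y"
    by (simp_all add: arr_def)
qed

end

text \<open>Full, faithful and essentially surjective.\<close>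

locale weak_equivalence = linear_functor K C D J
  for K :: "('k, 'r) ring_scheme" and C :: "('k, 'o, 'm, 'y) kcat_scheme"
    and D :: "('k, 'p, 'n, 'z) kcat_scheme" and J :: "('o, 'm, 'p, 'n) funct" +
  assumes full: "\<lbrakk>X \<in> Obj C; Y \<in> Obj C; h \<in> arr D (FObj J X) (FObj J Y)\<rbrakk> \<Longrightarrow> \<exists>f \<in> arr C X Y. FArr J f = h"
    and faithful: "\<lbrakk>X \<in> Obj C; Y \<in> Obj C; f \<in> arr C X Y; g \<in> arr C X Y; FArr J f = FArr J g\<rbrakk> \<Longrightarrow> f = g"
    and ess_surj: "Z \<in> Obj D \<Longrightarrow> \<exists>X \<in> Obj C. \<exists>q. is_iso D (FObj J X) Z q"
begin

lemma faithful_eqI: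
  "\<lbrakk>FArr J f = FArr J g; is_arr C f; is_arr C g; Dom C f = Dom C g; Cod C f = Cod C g\<rbrakk> \<Longrightarrow> f = g"
  using faithful[of "Dom C f" "Cod C f" f g] by (simp add: source.arr_iff)

definition lift_arr where
  "lift_arr X Y h = (SOME f. is_arr C f \<and> Dom C f = X \<and> Cod C f = Y \<and> FArr J f = h)"

lemma lift_arr [simp]:
  assumes "X \<in> Obj C" "Y \<in> Obj C" "is_arr D h" "Dom D h = FObj J X" "Cod D h = FObj J Y"
  shows "is_arr C (lift_arr X Y h)" "Dom C (lift_arr X Y h) = X" "Cod C (lift_arr X Y h) = Y"
    "FArr J (lift_arr X Y h) = h"
proof -
  have "\<exists>f. is_arr C f \<and> Dom C f = X \<and> Cod C f = Y \<and> FArr J f = h"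
    using full[of X Y h] assms by (auto simp: source.arr_iff target.arr_iff)
  from someI_ex[OF this] show "is_arr C (lift_arr X Y h)" "Dom C (lift_arr X Y h) = X" "Cod C (lift_arr X Y h) = Y"
    "FArr J (lift_arr X Y h) = h" by (simp_all add: lift_arr_def)
qed

definition pre where "pre Y = (SOME X. X \<in> Obj C \<and> (\<exists>q. iso_arr D q \<and> Dom D q = FObj J X \<and> Cod D q = Y))"

text \<open>The chosen isomorphism from the image of \<open>pre Y\<close> to \<open>Y\<close>; its
  existence is essential surjectivity.\<close>

definition qi where "qi Y = (SOME q. iso_arr D q \<and> Dom D q = FObj J (pre Y) \<and> Cod D q = Y)"

lemma pre_qi [simp]:
  assumes "Y \<in> Obj D"
  shows "pre Y \<in> Obj C" "iso_arr D (qi Y)" "Dom D (qi Y) = FObj J (pre Y)" "Cod D (qi Y) = Y"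
proof -
  have "\<exists>X. X \<in> Obj C \<and> (\<exists>q. iso_arr D q \<and> Dom D q = FObj J X \<and> Cod D q = Y)"
    using ess_surj[OF assms] assms by (metis functor_simps(1) target.is_iso_iff)
  from someI_ex[OF this] have 1: "pre Y \<in> Obj C" "\<exists>q. iso_arr D q \<and> Dom D q = FObj J (pre Y) \<and> Cod D q = Y"
    by (simp_all add: pre_def)
  from 1(1) someI_ex[OF 1(2)]
  show "pre Y \<in> Obj C" "iso_arr D (qi Y)" "Dom D (qi Y) = FObj J (pre Y)" "Cod D (qi Y) = Y"
    by (simp_all add: qi_def)
qed

text \<open>The quasi-inverse: an arrow is conjugated by the chosen isomorphisms, so that it runs
  between images of \<open>J\<close>, and then lifted along the full functor
  \<open>J\<close>.\<close>

definition G :: "('p, 'n, 'o, 'm) funct" where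
  "G = \<lparr>FObj = pre, FArr = (\<lambda>f. lift_arr (pre (Dom D f)) (pre (Cod D f)) (inv_arr D (qi (Cod D f)) \<cdot>\<^bsub>D\<^esub> f \<cdot>\<^bsub>D\<^esub> qi (Dom D f)))\<rparr>"

lemma FObj_G [simp]: "FObj G = pre"
  by (simp add: G_def)

lemma G_arr [simp]:
  assumes "is_arr D f"
  shows "is_arr C (FArr G f)" "Dom C (FArr G f) = pre (Dom D f)" "Cod C (FArr G f) = pre (Cod D f)"
    "FArr J (FArr G f) = inv_arr D (qi (Cod D f)) \<cdot>\<^bsub>D\<^esub> f \<cdot>\<^bsub>D\<^esub> qi (Dom D f)"
  using assms by (simp_all add: G_def)

text \<open>As \<open>J\<close> is faithful, functoriality and linearity may be checked after
  \<open>J\<close>, where the arrow is just a conjugate of the original one.\<close>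

lemma G_functor: "linear_functor K D C G"
proof (rule linear_functorI)
  show "linear_category K D" "linear_category K C" by unfold_locales
  show "FArr G (g \<cdot>\<^bsub>D\<^esub> f) = FArr G g \<cdot>\<^bsub>C\<^esub> FArr G f" if "is_arr D f" "is_arr D g" "Dom D g = Cod D f" for f g
    by (rule faithful_eqI) (use that in \<open>simp_all add: functor_comp\<close>)
  show "FArr G (Ident D X) = Ident C (FObj G X)" if "X \<in> Obj D" for X
    by (rule faithful_eqI) (use that in simp_all)
next
  fix X Y f g assume XY: "X \<in> Obj D" "Y \<in> Obj D" and f: "f \<in> arr D X Y" and g: "g \<in> arr D X Y"
  note fs = target.is_arrI[OF f XY] and gs = target.is_arrI[OF g XY]
    and as = target.is_arrI[OF target.add_arr[OF XY f g] XY]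
  have ar: "FArr G f \<in> arr C (pre X) (pre Y)" "FArr G g \<in> arr C (pre X) (pre Y)"
    using XY fs gs by (simp_all add: source.arr_iff)
  note ss = source.is_arrI[OF source.add_arr[OF _ _ ar]]
  have J: "FArr J (FArr G f \<oplus>\<^bsub>Hom C (pre X) (pre Y)\<^esub> FArr G g) =
    FArr J (FArr G f) \<oplus>\<^bsub>Hom D (FObj J (pre X)) (FObj J (pre Y))\<^esub> FArr J (FArr G g)"
    using XY ar by (simp add: fadd)
  have fq: "f \<cdot>\<^bsub>D\<^esub> qi X \<in> arr D (FObj J (pre X)) Y" "g \<cdot>\<^bsub>D\<^esub> qi X \<in> arr D (FObj J (pre X)) Y"
    using XY fs gs by (simp_all add: target.arr_iff)
  have "(f \<oplus>\<^bsub>Hom D X Y\<^esub> g) \<cdot>\<^bsub>D\<^esub> qi X = (f \<cdot>\<^bsub>D\<^esub> qi X) \<oplus>\<^bsub>Hom D (FObj J (pre X)) Y\<^esub> (g \<cdot>\<^bsub>D\<^esub> qi X)"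
    using XY f g by (intro target.comp_add_left) (simp_all add: target.arr_iff)
  moreover have "inv_arr D (qi Y) \<cdot>\<^bsub>D\<^esub> ((f \<cdot>\<^bsub>D\<^esub> qi X) \<oplus>\<^bsub>Hom D (FObj J (pre X)) Y\<^esub> (g \<cdot>\<^bsub>D\<^esub> qi X))
    = (inv_arr D (qi Y) \<cdot>\<^bsub>D\<^esub> f \<cdot>\<^bsub>D\<^esub> qi X) \<oplus>\<^bsub>Hom D (FObj J (pre X)) (FObj J (pre Y))\<^esub> (inv_arr D (qi Y) \<cdot>\<^bsub>D\<^esub> g \<cdot>\<^bsub>D\<^esub> qi X)"
    using XY fq by (intro target.comp_add_right) (simp_all add: target.arr_iff)
  ultimately show "FArr G (f \<oplus>\<^bsub>Hom D X Y\<^esub> g) = FArr G f \<oplus>\<^bsub>Hom C (FObj G X) (FObj G Y)\<^esub> FArr G g"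
    by (intro faithful_eqI) (use XY J fs gs as ss in simp_all)
next
  fix X Y a f assume XY: "X \<in> Obj D" "Y \<in> Obj D" and a: "a \<in> carrier K" and f: "f \<in> arr D X Y"
  note fs = target.is_arrI[OF f XY] and as = target.is_arrI[OF target.smult_arr[OF XY a f] XY]
  have ar: "FArr G f \<in> arr C (pre X) (pre Y)"
    using XY fs by (simp_all add: source.arr_iff)
  note ss = source.is_arrI[OF source.smult_arr[OF _ _ a ar]]
  have J: "FArr J (a \<odot>\<^bsub>Hom C (pre X) (pre Y)\<^esub> FArr G f) =
    a \<odot>\<^bsub>Hom D (FObj J (pre X)) (FObj J (pre Y))\<^esub> FArr J (FArr G f)"
    using XY a ar by (simp add: fsmult)
  have fq: "f \<cdot>\<^bsub>D\<^esub> qi X \<in> arr D (FObj J (pre X)) Y"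
    using XY fs by (simp_all add: target.arr_iff)
  have "(a \<odot>\<^bsub>Hom D X Y\<^esub> f) \<cdot>\<^bsub>D\<^esub> qi X = a \<odot>\<^bsub>Hom D (FObj J (pre X)) Y\<^esub> (f \<cdot>\<^bsub>D\<^esub> qi X)"
    using XY a f by (intro target.comp_smult_left) (simp_all add: target.arr_iff)
  moreover have "inv_arr D (qi Y) \<cdot>\<^bsub>D\<^esub> (a \<odot>\<^bsub>Hom D (FObj J (pre X)) Y\<^esub> (f \<cdot>\<^bsub>D\<^esub> qi X))
    = a \<odot>\<^bsub>Hom D (FObj J (pre X)) (FObj J (pre Y))\<^esub> (inv_arr D (qi Y) \<cdot>\<^bsub>D\<^esub> f \<cdot>\<^bsub>D\<^esub> qi X)"
    using XY a fq by (intro target.comp_smult_right) (simp_all add: target.arr_iff)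
  ultimately show "FArr G (a \<odot>\<^bsub>Hom D X Y\<^esub> f) = a \<odot>\<^bsub>Hom C (FObj G X) (FObj G Y)\<^esub> FArr G f"
    by (intro faithful_eqI) (use XY J fs as ss in simp_all)
qed simp_all

sublocale G: linear_functor K D C G by (rule G_functor)

text \<open>The natural isomorphism from \<open>pre (FObj J X)\<close> to \<open>X\<close>, the lift
  of the chosen isomorphism at \<open>FObj J X\<close>. The pair of \<open>th\<close> and
  \<open>qi\<close> satisfies a triangle identity (\<open>G_qi\<close>).\<close>

definition th where "th X = lift_arr (pre (FObj J X)) X (qi (FObj J X))"

lemma th [simp]:
  assumes "X \<in> Obj C"
  shows "Dom C (th X) = pre (FObj J X)" "Cod C (th X) = X" "FArr J (th X) = qi (FObj J X)" "iso_arr C (th X)"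
proof -
  show th: "Dom C (th X) = pre (FObj J X)" "Cod C (th X) = X" "FArr J (th X) = qi (FObj J X)"
    using assms by (simp_all add: th_def)
  show "iso_arr C (th X)"
    by (rule source.iso_arrI[where g="lift_arr X (pre (FObj J X)) (inv_arr D (qi (FObj J X)))"]; (rule faithful_eqI)?)
      (use assms in \<open>simp_all add: th_def functor_comp\<close>)
qed

text \<open>The inverse of the image lifts by fullness, and faithfulness makes the lift an
  inverse.\<close>

lemma reflects_iso:
  assumes "is_arr C f" "iso_arr D (FArr J f)"
  shows "iso_arr C f"
  by (rule source.iso_arrI[where g="lift_arr (Cod C f) (Dom C f) (inv_arr D (FArr J f))"]; (rule faithful_eqI)?)
    (use assms in \<open>simp_all add: functor_comp\<close>)

lemma J_inv_th: "X \<in> Obj C \<Longrightarrow> FArr J (inv_arr C (th X)) = inv_arr D (qi (FObj J X))"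
  by (rule target.iso_cancel_left[where p="qi (FObj J X)"]) (simp_all flip: functor_comp th(3))

lemma G_J [simp]: "is_arr C f \<Longrightarrow> FArr G (FArr J f) = inv_arr C (th (Cod C f)) \<cdot>\<^bsub>C\<^esub> f \<cdot>\<^bsub>C\<^esub> th (Dom C f)"
  by (rule faithful_eqI) (simp_all add: functor_comp J_inv_th)

lemma G_qi [simp]: "Y \<in> Obj D \<Longrightarrow> FArr G (qi Y) = th (pre Y)"
  by (rule faithful_eqI) simp_all

lemma equivalence: "equivalence_of_categories K C D J"
  unfolding equivalence_of_categories_def
proof (intro conjI exI)
  show "natural_iso C C ident_funct (comp_funct G J) (\<lambda>X. inv_arr C (th X))"
    by (auto simp: natural_iso_def natural_trans_def ident_funct_def comp_funct_def source.arr_iff source.is_iso_iff)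
  show "natural_iso D D (comp_funct J G) ident_funct qi"
    by (auto simp: natural_iso_def natural_trans_def ident_funct_def comp_funct_def target.arr_iff target.is_iso_iff)
qed unfold_locales

lemma G_weak_equivalence: "weak_equivalence K D C G"
proof (rule weak_equivalence.intro[OF G_functor], unfold_locales)
  fix X Y f g assume XY: "X \<in> Obj D" "Y \<in> Obj D" and "f \<in> arr D X Y" "g \<in> arr D X Y" and eq: "FArr G f = FArr G g"
  then have fg: "is_arr D f" "Dom D f = X" "Cod D f = Y" "is_arr D g" "Dom D g = X" "Cod D g = Y"
    by (simp_all add: target.arr_iff)
  have "inv_arr D (qi Y) \<cdot>\<^bsub>D\<^esub> f \<cdot>\<^bsub>D\<^esub> qi X = inv_arr D (qi Y) \<cdot>\<^bsub>D\<^esub> g \<cdot>\<^bsub>D\<^esub> qi X"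
    using arg_cong[OF eq, of "FArr J"] fg by simp
  then have "f \<cdot>\<^bsub>D\<^esub> qi X = g \<cdot>\<^bsub>D\<^esub> qi X"
    by (rule target.iso_cancel_left[rotated -1]) (use fg XY in simp_all)
  then show "f = g"
    by (rule target.iso_cancel_right[rotated -1]) (use fg XY in simp_all)
next
  fix X Y h assume XY: "X \<in> Obj D" "Y \<in> Obj D" and "h \<in> arr C (FObj G X) (FObj G Y)"
  then have h: "is_arr C h" "Dom C h = pre X" "Cod C h = pre Y" by (simp_all add: source.arr_iff)
  let ?f = "qi Y \<cdot>\<^bsub>D\<^esub> FArr J h \<cdot>\<^bsub>D\<^esub> inv_arr D (qi X)"
  have "FArr G ?f = h" by (rule faithful_eqI) (use XY h in simp_all)
  then show "\<exists>f\<in>arr D X Y. FArr G f = h"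
    by (intro bexI[of _ ?f]) (use XY h in \<open>simp_all add: target.arr_iff\<close>)
next
  fix X assume "X \<in> Obj C"
  then show "\<exists>Y\<in>Obj D. \<exists>q. is_iso C (FObj G Y) X q"
    by (intro bexI[of _ "FObj J X"] exI[of _ "th X"]) (simp_all add: source.is_iso_iff)
qed

end

section \<open>Bifunctors, monoidal categories and module categories\<close>

text \<open>Composites are normalised to bracketing on the right, where an equation between
  composites of two arrows matches only at the end. This form applies it at the head of a longer
  composite.\<close>

lemma (in linear_category) comp_reassoc:
  assumes "a \<cdot>\<^bsub>C\<^esub> b = c \<cdot>\<^bsub>C\<^esub> d" "is_arr C a" "is_arr C b" "is_arr C c" "is_arr C d" "is_arr C k"
    "Dom C a = Cod C b" "Dom C c = Cod C d" "Cod C k = Dom C b" "Cod C k = Dom C d"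
  shows "a \<cdot>\<^bsub>C\<^esub> b \<cdot>\<^bsub>C\<^esub> k = c \<cdot>\<^bsub>C\<^esub> d \<cdot>\<^bsub>C\<^esub> k"
  using assoc[of k b a] assoc[of k d c] assms by simp

context linear_bifunctor
begin

lemma bifunctor_simps [simp]:
  "\<lbrakk>W \<in> Obj A; X \<in> Obj C\<rbrakk> \<Longrightarrow> BO W X \<in> Obj D"
  "\<lbrakk>is_arr A g; is_arr C f\<rbrakk> \<Longrightarrow> is_arr D (BA g f)"
  "\<lbrakk>is_arr A g; is_arr C f\<rbrakk> \<Longrightarrow> Dom D (BA g f) = BO (Dom A g) (Dom C f)"
  "\<lbrakk>is_arr A g; is_arr C f\<rbrakk> \<Longrightarrow> Cod D (BA g f) = BO (Cod A g) (Cod C f)"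
  "\<lbrakk>W \<in> Obj A; X \<in> Obj C\<rbrakk> \<Longrightarrow> BA (Ident A W) (Ident C X) = Ident D (BO W X)"
  using bobj[of W X] bident[of W X]
    target.is_arrI[OF barr[of "Dom A g" "Cod A g" "Dom C f" "Cod C f" g f]]
    left.is_arrD[of g] right.is_arrD[of f]
  by (simp_all add: bobj)

lemma bifunctor_merge [simp]:
  assumes "is_arr A g" "is_arr A g'" "is_arr C f" "is_arr C f'" "Dom A g' = Cod A g" "Dom C f' = Cod C f"
  shows "BA g' f' \<cdot>\<^bsub>D\<^esub> BA g f = BA (g' \<cdot>\<^bsub>A\<^esub> g) (f' \<cdot>\<^bsub>C\<^esub> f)"
    and "\<lbrakk>is_arr D h; Cod D h = BO (Dom A g) (Dom C f)\<rbrakk>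
      \<Longrightarrow> BA g' f' \<cdot>\<^bsub>D\<^esub> BA g f \<cdot>\<^bsub>D\<^esub> h = BA (g' \<cdot>\<^bsub>A\<^esub> g) (f' \<cdot>\<^bsub>C\<^esub> f) \<cdot>\<^bsub>D\<^esub> h"
proof -
  show *: "BA g' f' \<cdot>\<^bsub>D\<^esub> BA g f = BA (g' \<cdot>\<^bsub>A\<^esub> g) (f' \<cdot>\<^bsub>C\<^esub> f)"
    using bcomp[of "Dom A g" "Cod A g" "Cod A g'" "Dom C f" "Cod C f" "Cod C f'" g g' f f'] assms
      left.is_arrD[of g] left.is_arrD[of g'] right.is_arrD[of f] right.is_arrD[of f'] by simp
  show "\<lbrakk>is_arr D h; Cod D h = BO (Dom A g) (Dom C f)\<rbrakk>
      \<Longrightarrow> BA g' f' \<cdot>\<^bsub>D\<^esub> BA g f \<cdot>\<^bsub>D\<^esub> h = BA (g' \<cdot>\<^bsub>A\<^esub> g) (f' \<cdot>\<^bsub>C\<^esub> f) \<cdot>\<^bsub>D\<^esub> h"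
    using assms target.assoc[of h "BA g f" "BA g' f'"] * by simp
qed

lemma bifunctor_iso [simp]: "\<lbrakk>iso_arr A g; iso_arr C f\<rbrakk> \<Longrightarrow> iso_arr D (BA g f)"
  by (rule target.iso_arrI[where g="BA (inv_arr A g) (inv_arr C f)"]) simp_all

end

lemma linear_bifunctorI:
  assumes "linear_category K A" "linear_category K C" "linear_category K D"
    and o: "\<And>W X. \<lbrakk>W \<in> Obj A; X \<in> Obj C\<rbrakk> \<Longrightarrow> BO W X \<in> Obj D"
    and a: "\<And>g f. \<lbrakk>is_arr A g; is_arr C f\<rbrakk> \<Longrightarrow> is_arr D (BA g f) \<and> Dom D (BA g f) = BO (Dom A g) (Dom C f) \<and>
          Cod D (BA g f) = BO (Cod A g) (Cod C f)"
    and i: "\<And>W X. \<lbrakk>W \<in> Obj A; X \<in> Obj C\<rbrakk> \<Longrightarrow> BA (Ident A W) (Ident C X) = Ident D (BO W X)"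
    and c: "\<And>g g' f f'. \<lbrakk>is_arr A g; is_arr A g'; is_arr C f; is_arr C f'; Dom A g' = Cod A g; Dom C f' = Cod C f\<rbrakk>
      \<Longrightarrow> BA (g' \<cdot>\<^bsub>A\<^esub> g) (f' \<cdot>\<^bsub>C\<^esub> f) = BA g' f' \<cdot>\<^bsub>D\<^esub> BA g f"
    and "\<And>W W' X X' g g' f. \<lbrakk>W \<in> Obj A; W' \<in> Obj A; X \<in> Obj C; X' \<in> Obj C;
            g \<in> arr A W W'; g' \<in> arr A W W'; f \<in> arr C X X'\<rbrakk>
          \<Longrightarrow> BA (g \<oplus>\<^bsub>Hom A W W'\<^esub> g') f = BA g f \<oplus>\<^bsub>Hom D (BO W X) (BO W' X')\<^esub> BA g' f"
    and "\<And>W W' X X' g f f'. \<lbrakk>W \<in> Obj A; W' \<in> Obj A; X \<in> Obj C; X' \<in> Obj C;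
            g \<in> arr A W W'; f \<in> arr C X X'; f' \<in> arr C X X'\<rbrakk>
          \<Longrightarrow> BA g (f \<oplus>\<^bsub>Hom C X X'\<^esub> f') = BA g f \<oplus>\<^bsub>Hom D (BO W X) (BO W' X')\<^esub> BA g f'"
    and "\<And>W W' X X' a g f. \<lbrakk>W \<in> Obj A; W' \<in> Obj A; X \<in> Obj C; X' \<in> Obj C; a \<in> carrier K;
            g \<in> arr A W W'; f \<in> arr C X X'\<rbrakk>
          \<Longrightarrow> BA (a \<odot>\<^bsub>Hom A W W'\<^esub> g) f = a \<odot>\<^bsub>Hom D (BO W X) (BO W' X')\<^esub> BA g f"
    and "\<And>W W' X X' a g f. \<lbrakk>W \<in> Obj A; W' \<in> Obj A; X \<in> Obj C; X' \<in> Obj C; a \<in> carrier K;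
            g \<in> arr A W W'; f \<in> arr C X X'\<rbrakk>
          \<Longrightarrow> BA g (a \<odot>\<^bsub>Hom C X X'\<^esub> f) = a \<odot>\<^bsub>Hom D (BO W X) (BO W' X')\<^esub> BA g f"
  shows "linear_bifunctor K A C D BO BA"
proof -
  interpret A: linear_category K A by fact
  interpret C: linear_category K C by fact
  interpret D: linear_category K D by fact
  show ?thesis
  proof
    fix W W' X X' g f
    assume O: "W \<in> Obj A" "W' \<in> Obj A" "X \<in> Obj C" "X' \<in> Obj C" and g: "g \<in> arr A W W'" and f: "f \<in> arr C X X'"
    note gs = A.is_arrI[OF g O(1,2)] and fs = C.is_arrI[OF f O(3,4)]
    show "BA g f \<in> arr D (BO W X) (BO W' X')"
      using a[of g f] gs fs O o by (simp add: D.arr_iff)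
    fix W'' X'' g' f' assume "W'' \<in> Obj A" "X'' \<in> Obj C" "g' \<in> arr A W' W''" "f' \<in> arr C X' X''"
    then show "BA (g' \<cdot>\<^bsub>A\<^esub> g) (f' \<cdot>\<^bsub>C\<^esub> f) = BA g' f' \<cdot>\<^bsub>D\<^esub> BA g f"
      using c[of g g' f f'] gs fs O A.is_arrI[of g' W' W''] C.is_arrI[of f' X' X''] by simp
  qed (use assms in auto)
qed

context monoidal_category
begin

lemma monoidal_simps [simp]:
  "Unit V \<in> Obj V"
  "\<lbrakk>X \<in> Obj V; Y \<in> Obj V; Z \<in> Obj V\<rbrakk> \<Longrightarrow> iso_arr V (Assoc V X Y Z)"
  "\<lbrakk>X \<in> Obj V; Y \<in> Obj V; Z \<in> Obj V\<rbrakk> \<Longrightarrow> Dom V (Assoc V X Y Z) = Tens V (Tens V X Y) Z"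
  "\<lbrakk>X \<in> Obj V; Y \<in> Obj V; Z \<in> Obj V\<rbrakk> \<Longrightarrow> Cod V (Assoc V X Y Z) = Tens V X (Tens V Y Z)"
  "X \<in> Obj V \<Longrightarrow> iso_arr V (RUnit V X)"
  "X \<in> Obj V \<Longrightarrow> Dom V (RUnit V X) = Tens V X (Unit V)"
  "X \<in> Obj V \<Longrightarrow> Cod V (RUnit V X) = X"
  using assoc_iso[of X Y Z] runit_iso[of X] unit_obj by (simp_all add: left.is_iso_iff)

end

context module_category
begin

lemma action_iso [simp]:
  "\<lbrakk>W \<in> Obj V; W' \<in> Obj V; X \<in> Obj C\<rbrakk> \<Longrightarrow> iso_arr C (AAssoc L W W' X)"
  "\<lbrakk>W \<in> Obj V; W' \<in> Obj V; X \<in> Obj C\<rbrakk> \<Longrightarrow> Dom C (AAssoc L W W' X) = Act L (Tens V W W') X"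
  "\<lbrakk>W \<in> Obj V; W' \<in> Obj V; X \<in> Obj C\<rbrakk> \<Longrightarrow> Cod C (AAssoc L W W' X) = Act L W (Act L W' X)"
  "X \<in> Obj C \<Longrightarrow> iso_arr C (AUnit L X)"
  "X \<in> Obj C \<Longrightarrow> Dom C (AUnit L X) = Act L (Unit V) X"
  "X \<in> Obj C \<Longrightarrow> Cod C (AUnit L X) = X"
  using aassoc_iso[of W W' X] aunit_iso[of X] by (simp_all add: is_iso_iff)

lemma action_natural [simp]:
  assumes "is_arr C h"
  shows "\<lbrakk>is_arr V f; is_arr V g; Cod V f = U'; Cod V g = W'; Cod C h = X'\<rbrakk>
      \<Longrightarrow> AAssoc L U' W' X' \<cdot>\<^bsub>C\<^esub> ActA L (TensA V f g) h
       = ActA L f (ActA L g h) \<cdot>\<^bsub>C\<^esub> AAssoc L (Dom V f) (Dom V g) (Dom C h)"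
    and "\<lbrakk>U \<in> Obj V; W \<in> Obj V; Cod C h = X'\<rbrakk> \<Longrightarrow> AAssoc L U W X' \<cdot>\<^bsub>C\<^esub> ActA L (Ident V (Tens V U W)) h
       = ActA L (Ident V U) (ActA L (Ident V W) h) \<cdot>\<^bsub>C\<^esub> AAssoc L U W (Dom C h)"
    and "Cod C h = X' \<Longrightarrow> AUnit L X' \<cdot>\<^bsub>C\<^esub> ActA L (Ident V (Unit V)) h = h \<cdot>\<^bsub>C\<^esub> AUnit L (Dom C h)"
proof -
  have *: "AAssoc L (Cod V f) (Cod V g) (Cod C h) \<cdot>\<^bsub>C\<^esub> ActA L (TensA V f g) h
       = ActA L f (ActA L g h) \<cdot>\<^bsub>C\<^esub> AAssoc L (Dom V f) (Dom V g) (Dom C h)" if "is_arr V f" "is_arr V g" for f g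
    using that assms by (intro aassoc_natural) (auto intro: left.is_arrD is_arrD)
  then show "\<lbrakk>is_arr V f; is_arr V g; Cod V f = U'; Cod V g = W'; Cod C h = X'\<rbrakk>
      \<Longrightarrow> AAssoc L U' W' X' \<cdot>\<^bsub>C\<^esub> ActA L (TensA V f g) h
       = ActA L f (ActA L g h) \<cdot>\<^bsub>C\<^esub> AAssoc L (Dom V f) (Dom V g) (Dom C h)" by blast
  show "\<lbrakk>U \<in> Obj V; W \<in> Obj V; Cod C h = X'\<rbrakk> \<Longrightarrow> AAssoc L U W X' \<cdot>\<^bsub>C\<^esub> ActA L (Ident V (Tens V U W)) h
       = ActA L (Ident V U) (ActA L (Ident V W) h) \<cdot>\<^bsub>C\<^esub> AAssoc L U W (Dom C h)"
    using *[of "Ident V U" "Ident V W"] by simp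
  show "Cod C h = X' \<Longrightarrow> AUnit L X' \<cdot>\<^bsub>C\<^esub> ActA L (Ident V (Unit V)) h = h \<cdot>\<^bsub>C\<^esub> AUnit L (Dom C h)"
    using aunit_natural[of "Dom C h" "Cod C h" h] assms is_arrD[of h] by auto
qed

lemma action_natural_comp [simp]:
  assumes "is_arr C h" "is_arr C k"
  shows "\<lbrakk>is_arr V f; is_arr V g; Cod V f = U'; Cod V g = W'; Cod C h = X'; Cod C k = Act L (Tens V (Dom V f) (Dom V g)) (Dom C h)\<rbrakk>
      \<Longrightarrow> AAssoc L U' W' X' \<cdot>\<^bsub>C\<^esub> ActA L (TensA V f g) h \<cdot>\<^bsub>C\<^esub> k
       = ActA L f (ActA L g h) \<cdot>\<^bsub>C\<^esub> AAssoc L (Dom V f) (Dom V g) (Dom C h) \<cdot>\<^bsub>C\<^esub> k"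
    and "\<lbrakk>U \<in> Obj V; W \<in> Obj V; Cod C h = X'; Cod C k = Act L (Tens V U W) (Dom C h)\<rbrakk>
      \<Longrightarrow> AAssoc L U W X' \<cdot>\<^bsub>C\<^esub> ActA L (Ident V (Tens V U W)) h \<cdot>\<^bsub>C\<^esub> k
       = ActA L (Ident V U) (ActA L (Ident V W) h) \<cdot>\<^bsub>C\<^esub> AAssoc L U W (Dom C h) \<cdot>\<^bsub>C\<^esub> k"
    and "\<lbrakk>Cod C h = X'; Cod C k = Act L (Unit V) (Dom C h)\<rbrakk>
      \<Longrightarrow> AUnit L X' \<cdot>\<^bsub>C\<^esub> ActA L (Ident V (Unit V)) h \<cdot>\<^bsub>C\<^esub> k = h \<cdot>\<^bsub>C\<^esub> AUnit L (Dom C h) \<cdot>\<^bsub>C\<^esub> k"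
proof -
  show "\<lbrakk>is_arr V f; is_arr V g; Cod V f = U'; Cod V g = W'; Cod C h = X'; Cod C k = Act L (Tens V (Dom V f) (Dom V g)) (Dom C h)\<rbrakk>
      \<Longrightarrow> AAssoc L U' W' X' \<cdot>\<^bsub>C\<^esub> ActA L (TensA V f g) h \<cdot>\<^bsub>C\<^esub> k
       = ActA L f (ActA L g h) \<cdot>\<^bsub>C\<^esub> AAssoc L (Dom V f) (Dom V g) (Dom C h) \<cdot>\<^bsub>C\<^esub> k"
    using assms by (intro comp_reassoc) auto
  show "\<lbrakk>U \<in> Obj V; W \<in> Obj V; Cod C h = X'; Cod C k = Act L (Tens V U W) (Dom C h)\<rbrakk>
      \<Longrightarrow> AAssoc L U W X' \<cdot>\<^bsub>C\<^esub> ActA L (Ident V (Tens V U W)) h \<cdot>\<^bsub>C\<^esub> k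
       = ActA L (Ident V U) (ActA L (Ident V W) h) \<cdot>\<^bsub>C\<^esub> AAssoc L U W (Dom C h) \<cdot>\<^bsub>C\<^esub> k"
    using assms by (intro comp_reassoc) auto
  show "\<lbrakk>Cod C h = X'; Cod C k = Act L (Unit V) (Dom C h)\<rbrakk>
      \<Longrightarrow> AUnit L X' \<cdot>\<^bsub>C\<^esub> ActA L (Ident V (Unit V)) h \<cdot>\<^bsub>C\<^esub> k = h \<cdot>\<^bsub>C\<^esub> AUnit L (Dom C h) \<cdot>\<^bsub>C\<^esub> k"
    using assms by (intro comp_reassoc) auto
qed

end

lemma module_categoryI:
  assumes V: "monoidal_category K V" and C: "linear_category K C"
    and act: "linear_bifunctor K V C C (Act L) (ActA L)"
    and "\<And>W W' X. \<lbrakk>W \<in> Obj V; W' \<in> Obj V; X \<in> Obj C\<rbrakk> \<Longrightarrow> iso_arr C (AAssoc L W W' X) \<and>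
          Dom C (AAssoc L W W' X) = Act L (Tens V W W') X \<and> Cod C (AAssoc L W W' X) = Act L W (Act L W' X)"
    and "\<And>X. X \<in> Obj C \<Longrightarrow> iso_arr C (AUnit L X) \<and> Dom C (AUnit L X) = Act L (Unit V) X \<and> Cod C (AUnit L X) = X"
    and n: "\<And>f g h. \<lbrakk>is_arr V f; is_arr V g; is_arr C h\<rbrakk>
          \<Longrightarrow> AAssoc L (Cod V f) (Cod V g) (Cod C h) \<cdot>\<^bsub>C\<^esub> ActA L (TensA V f g) h
            = ActA L f (ActA L g h) \<cdot>\<^bsub>C\<^esub> AAssoc L (Dom V f) (Dom V g) (Dom C h)"
    and u: "\<And>h. is_arr C h \<Longrightarrow> AUnit L (Cod C h) \<cdot>\<^bsub>C\<^esub> ActA L (Ident V (Unit V)) h = h \<cdot>\<^bsub>C\<^esub> AUnit L (Dom C h)"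
    and "\<And>U W W' X. \<lbrakk>U \<in> Obj V; W \<in> Obj V; W' \<in> Obj V; X \<in> Obj C\<rbrakk>
          \<Longrightarrow> ActA L (Ident V U) (AAssoc L W W' X) \<cdot>\<^bsub>C\<^esub>
                (AAssoc L U (Tens V W W') X \<cdot>\<^bsub>C\<^esub> ActA L (Assoc V U W W') (Ident C X))
            = AAssoc L U W (Act L W' X) \<cdot>\<^bsub>C\<^esub> AAssoc L (Tens V U W) W' X"
    and "\<And>W X. \<lbrakk>W \<in> Obj V; X \<in> Obj C\<rbrakk>
          \<Longrightarrow> ActA L (Ident V W) (AUnit L X) \<cdot>\<^bsub>C\<^esub> AAssoc L W (Unit V) X = ActA L (RUnit V W) (Ident C X)"
  shows "module_category K V C L"
proof -
  interpret V: monoidal_category K V by fact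
  interpret C: linear_category K C by fact
  interpret act: linear_bifunctor K V C C "Act L" "ActA L" by fact
  show ?thesis
  proof
    fix U U' W W' X X' f g h
    assume O: "U \<in> Obj V" "U' \<in> Obj V" "W \<in> Obj V" "W' \<in> Obj V" "X \<in> Obj C" "X' \<in> Obj C"
      and f: "f \<in> arr V U U'" and g: "g \<in> arr V W W'" and h: "h \<in> arr C X X'"
    show "AAssoc L U' W' X' \<cdot>\<^bsub>C\<^esub> ActA L (TensA V f g) h = ActA L f (ActA L g h) \<cdot>\<^bsub>C\<^esub> AAssoc L U W X"
      using n[of f g h] V.left.is_arrI[OF f O(1,2)] V.left.is_arrI[OF g O(3,4)] C.is_arrI[OF h O(5,6)] by simp
  next
    fix X X' h assume O: "X \<in> Obj C" "X' \<in> Obj C" and h: "h \<in> arr C X X'"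
    show "AUnit L X' \<cdot>\<^bsub>C\<^esub> ActA L (Ident V (Unit V)) h = h \<cdot>\<^bsub>C\<^esub> AUnit L X"
      using u[of h] C.is_arrI[OF h O] by simp
  qed (use assms in \<open>auto simp: C.is_iso_iff\<close>)
qed

lemma strong_module_functorI:
  assumes C: "module_category K V C L" and D: "module_category K V D M" and F: "linear_functor K C D F"
    and i: "\<And>W X. \<lbrakk>W \<in> Obj V; X \<in> Obj C\<rbrakk> \<Longrightarrow> iso_arr D (s W X) \<and> Dom D (s W X) = Act M W (FObj F X) \<and>
        Cod D (s W X) = FObj F (Act L W X)"
    and n: "\<And>g f. \<lbrakk>is_arr V g; is_arr C f\<rbrakk>
        \<Longrightarrow> s (Cod V g) (Cod C f) \<cdot>\<^bsub>D\<^esub> ActA M g (FArr F f) = FArr F (ActA L g f) \<cdot>\<^bsub>D\<^esub> s (Dom V g) (Dom C f)"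
    and "\<And>W W' X. \<lbrakk>W \<in> Obj V; W' \<in> Obj V; X \<in> Obj C\<rbrakk>
          \<Longrightarrow> FArr F (AAssoc L W W' X) \<cdot>\<^bsub>D\<^esub> s (Tens V W W') X
            = s W (Act L W' X) \<cdot>\<^bsub>D\<^esub> (ActA M (Ident V W) (s W' X) \<cdot>\<^bsub>D\<^esub> AAssoc M W W' (FObj F X))"
    and "\<And>X. X \<in> Obj C \<Longrightarrow> FArr F (AUnit L X) \<cdot>\<^bsub>D\<^esub> s (Unit V) X = AUnit M (FObj F X)"
  shows "strong_module_functor K V C L D M F s"
proof -
  interpret C: module_category K V C L by fact
  interpret D: module_category K V D M by fact
  interpret F: linear_functor K C D F by fact
  show ?thesis
  proof
    fix W X assume "W \<in> Obj V" "X \<in> Obj C"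
    then show "is_iso D (Act M W (FObj F X)) (FObj F (Act L W X)) (s W X)"
      using i by (simp add: D.is_iso_iff)
  next
    fix W W' X X' g f assume O: "W \<in> Obj V" "W' \<in> Obj V" "X \<in> Obj C" "X' \<in> Obj C"
      and g: "g \<in> arr V W W'" and f: "f \<in> arr C X X'"
    show "s W' X' \<cdot>\<^bsub>D\<^esub> ActA M g (FArr F f) = FArr F (ActA L g f) \<cdot>\<^bsub>D\<^esub> s W X"
      using n[of g f] C.left.is_arrI[OF g O(1,2)] C.is_arrI[OF f O(3,4)] by simp
  qed (use assms in auto)
qed

section \<open>Strong module functors: quasi-inverses and composition\<close>

context strong_module_functor
begin

lemma strength_simps [simp]:
  "\<lbrakk>W \<in> Obj V; X \<in> Obj C\<rbrakk> \<Longrightarrow> iso_arr D (s W X)"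
  "\<lbrakk>W \<in> Obj V; X \<in> Obj C\<rbrakk> \<Longrightarrow> Dom D (s W X) = Act M W (FObj F X)"
  "\<lbrakk>W \<in> Obj V; X \<in> Obj C\<rbrakk> \<Longrightarrow> Cod D (s W X) = FObj F (Act L W X)"
  using strength_iso[of W X] by (simp_all add: target_action.is_iso_iff)

lemma strength_natural':
  assumes "is_arr V g" "is_arr C f" "Cod V g = W'" "Cod C f = X'"
  shows "s W' X' \<cdot>\<^bsub>D\<^esub> ActA M g (FArr F f) = FArr F (ActA L g f) \<cdot>\<^bsub>D\<^esub> s (Dom V g) (Dom C f)"
    and "\<lbrakk>is_arr D k; Cod D k = Act M (Dom V g) (FObj F (Dom C f))\<rbrakk>
      \<Longrightarrow> s W' X' \<cdot>\<^bsub>D\<^esub> ActA M g (FArr F f) \<cdot>\<^bsub>D\<^esub> k = FArr F (ActA L g f) \<cdot>\<^bsub>D\<^esub> s (Dom V g) (Dom C f) \<cdot>\<^bsub>D\<^esub> k"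
proof -
  show *: "s W' X' \<cdot>\<^bsub>D\<^esub> ActA M g (FArr F f) = FArr F (ActA L g f) \<cdot>\<^bsub>D\<^esub> s (Dom V g) (Dom C f)"
    using strength_natural[of "Dom V g" "Cod V g" "Dom C f" "Cod C f" g f] assms
      source_action.left.is_arrD[of g] source_action.is_arrD[of f] by auto
  show "\<lbrakk>is_arr D k; Cod D k = Act M (Dom V g) (FObj F (Dom C f))\<rbrakk>
      \<Longrightarrow> s W' X' \<cdot>\<^bsub>D\<^esub> ActA M g (FArr F f) \<cdot>\<^bsub>D\<^esub> k = FArr F (ActA L g f) \<cdot>\<^bsub>D\<^esub> s (Dom V g) (Dom C f) \<cdot>\<^bsub>D\<^esub> k"
    using assms * by (intro target_action.comp_reassoc) auto
qed

end

locale weak_module_equivalence = strong_module_functor K V C L D M J s + weak_equivalence K C D J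
  for K :: "('k, 'r) ring_scheme" and V :: "('k, 'v, 'w, 'x) moncat_scheme"
    and C :: "('k, 'o, 'm, 'y) kcat_scheme" and L :: "('v, 'w, 'o, 'm) action"
    and D :: "('k, 'p, 'n, 'z) kcat_scheme" and M :: "('v, 'w, 'p, 'n) action"
    and J :: "('o, 'm, 'p, 'n) funct" and s :: "'v \<Rightarrow> 'o \<Rightarrow> 'n"
begin

text \<open>The lift of the composite J (W \<rhd> pre Y) \<rightarrow> W \<rhd> J (pre Y)
  \<rightarrow> W \<rhd> Y \<rightarrow> J (pre (W \<rhd> Y)) of an inverse strength of
  \<open>J\<close>, the action on the chosen isomorphism at \<open>Y\<close>, and the inverse of the
  chosen isomorphism at W \<rhd> Y.\<close>

definition inverse_strength :: "'v \<Rightarrow> 'p \<Rightarrow> 'm" where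
  "inverse_strength W Y = lift_arr (Act L W (pre Y)) (pre (Act M W Y))
     (inv_arr D (qi (Act M W Y)) \<cdot>\<^bsub>D\<^esub> ActA M (Ident V W) (qi Y) \<cdot>\<^bsub>D\<^esub> inv_arr D (s W (pre Y)))"

lemma inverse_strength [simp]:
  assumes "W \<in> Obj V" "Y \<in> Obj D"
  shows "is_arr C (inverse_strength W Y)" "Dom C (inverse_strength W Y) = Act L W (pre Y)"
    "Cod C (inverse_strength W Y) = pre (Act M W Y)"
    "FArr J (inverse_strength W Y) =
       inv_arr D (qi (Act M W Y)) \<cdot>\<^bsub>D\<^esub> ActA M (Ident V W) (qi Y) \<cdot>\<^bsub>D\<^esub> inv_arr D (s W (pre Y))"
    "iso_arr C (inverse_strength W Y)"
proof -
  show 1: "is_arr C (inverse_strength W Y)" "Dom C (inverse_strength W Y) = Act L W (pre Y)"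
    "Cod C (inverse_strength W Y) = pre (Act M W Y)"
    "FArr J (inverse_strength W Y) =
       inv_arr D (qi (Act M W Y)) \<cdot>\<^bsub>D\<^esub> ActA M (Ident V W) (qi Y) \<cdot>\<^bsub>D\<^esub> inv_arr D (s W (pre Y))"
    using assms by (simp_all add: inverse_strength_def)
  show "iso_arr C (inverse_strength W Y)"
    by (rule reflects_iso) (use assms 1 in simp_all)
qed

text \<open>Each coherence law is checked after applying the faithful functor \<open>J\<close> and
  precomposing with a strength of \<open>J\<close>, which is an isomorphism. There it turns into the
  corresponding law for \<open>J\<close>.\<close>

lemma G_strong: "strong_module_functor K V D M C L G inverse_strength"
proof (rule strong_module_functorI)
  show "module_category K V D M" "module_category K V C L" "linear_functor K D C G" by unfold_locales
next
  fix W X assume "W \<in> Obj V" "X \<in> Obj D"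
  then show "iso_arr C (inverse_strength W X) \<and> Dom C (inverse_strength W X) = Act L W (FObj G X) \<and>
     Cod C (inverse_strength W X) = FObj G (Act M W X)"
    by simp
next
  fix g f assume [simp]: "is_arr V g" "is_arr D f"
  show "inverse_strength (Cod V g) (Cod D f) \<cdot>\<^bsub>C\<^esub> ActA L g (FArr G f) =
      FArr G (ActA M g f) \<cdot>\<^bsub>C\<^esub> inverse_strength (Dom V g) (Dom D f)"
  proof (rule faithful_eqI)
    let ?s = "s (Dom V g) (pre (Dom D f))"
    have J: "FArr J (ActA L g (FArr G f)) \<cdot>\<^bsub>D\<^esub> ?s = s (Cod V g) (pre (Cod D f)) \<cdot>\<^bsub>D\<^esub> ActA M g (FArr J (FArr G f))"
      using strength_natural'(1)[of g "FArr G f"] by simp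
    show "FArr J (inverse_strength (Cod V g) (Cod D f) \<cdot>\<^bsub>C\<^esub> ActA L g (FArr G f)) =
      FArr J (FArr G (ActA M g f) \<cdot>\<^bsub>C\<^esub> inverse_strength (Dom V g) (Dom D f))"
      by (rule target_action.iso_cancel_right[where p="?s"]) (simp_all add: functor_comp J)
  qed simp_all
next
  fix W W' Y assume [simp]: "W \<in> Obj V" "W' \<in> Obj V" "Y \<in> Obj D"
  show "FArr G (AAssoc M W W' Y) \<cdot>\<^bsub>C\<^esub> inverse_strength (Tens V W W') Y
      = inverse_strength W (Act M W' Y) \<cdot>\<^bsub>C\<^esub> ActA L (Ident V W) (inverse_strength W' Y) \<cdot>\<^bsub>C\<^esub> AAssoc L W W' (FObj G Y)"
  proof (rule faithful_eqI)
    let ?s = "s (Tens V W W') (pre Y)"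
    have J1: "FArr J (AAssoc L W W' (pre Y)) \<cdot>\<^bsub>D\<^esub> ?s = s W (Act L W' (pre Y)) \<cdot>\<^bsub>D\<^esub>
        ActA M (Ident V W) (s W' (pre Y)) \<cdot>\<^bsub>D\<^esub> AAssoc M W W' (FObj J (pre Y))"
      using strength_assoc[of W W' "pre Y"] by simp
    have J2: "FArr J (ActA L (Ident V W) (inverse_strength W' Y)) \<cdot>\<^bsub>D\<^esub> s W (Act L W' (pre Y)) \<cdot>\<^bsub>D\<^esub> k
       = s W (pre (Act M W' Y)) \<cdot>\<^bsub>D\<^esub> ActA M (Ident V W) (FArr J (inverse_strength W' Y)) \<cdot>\<^bsub>D\<^esub> k"
      if "is_arr D k" "Cod D k = Act M W (FObj J (Act L W' (pre Y)))" for k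
      using strength_natural'(2)[of "Ident V W" "inverse_strength W' Y" W _ k] that by simp
    show "FArr J (FArr G (AAssoc M W W' Y) \<cdot>\<^bsub>C\<^esub> inverse_strength (Tens V W W') Y)
      = FArr J (inverse_strength W (Act M W' Y) \<cdot>\<^bsub>C\<^esub> ActA L (Ident V W) (inverse_strength W' Y) \<cdot>\<^bsub>C\<^esub> AAssoc L W W' (FObj G Y))"
      by (rule target_action.iso_cancel_right[where p="?s"]) (simp_all add: functor_comp J1 J2)
  qed simp_all
next
  fix Y assume [simp]: "Y \<in> Obj D"
  show "FArr G (AUnit M Y) \<cdot>\<^bsub>C\<^esub> inverse_strength (Unit V) Y = AUnit L (FObj G Y)"
  proof (rule faithful_eqI)
    have J: "FArr J (AUnit L (pre Y)) \<cdot>\<^bsub>D\<^esub> s (Unit V) (pre Y) = AUnit M (FObj J (pre Y))"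
      using strength_unit[of "pre Y"] by simp
    show "FArr J (FArr G (AUnit M Y) \<cdot>\<^bsub>C\<^esub> inverse_strength (Unit V) Y) = FArr J (AUnit L (FObj G Y))"
      by (rule target_action.iso_cancel_right[where p="s (Unit V) (pre Y)"]) (simp_all add: functor_comp J)
  qed simp_all
qed

end

text \<open>Each law is the image under \<open>G\<close> of the law for \<open>F\<close>, pasted
  with the law for \<open>G\<close>. The auxiliary equations in the proof are these two laws and
  naturality, with a further arrow composed on the right where needed.\<close>

lemma strong_module_functor_comp:
  assumes F: "strong_module_functor K V C L D M F s" and G: "strong_module_functor K V D M E N G t"
  shows "strong_module_functor K V C L E N (comp_funct G F)
    (\<lambda>W X. FArr G (s W X) \<cdot>\<^bsub>E\<^esub> t W (FObj F X))"
proof -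
  interpret F: strong_module_functor K V C L D M F s by fact
  interpret G: strong_module_functor K V D M E N G t by fact
  note [simp] = comp_funct_def F.strength_natural' G.strength_natural'
  show ?thesis
  proof (rule strong_module_functorI)
    show "module_category K V C L" "module_category K V E N" by unfold_locales
    show "linear_functor K C E (comp_funct G F)"
    proof (rule linear_functorI)
      show "linear_category K C" "linear_category K E" by unfold_locales
    qed (simp_all add: F.functor_comp G.functor_comp F.fadd G.fadd F.fsmult G.fsmult F.fobj F.farr)
  next
    fix g f assume [simp]: "is_arr V g" "is_arr C f"
    have "FArr G (s (Cod V g) (Cod C f)) \<cdot>\<^bsub>E\<^esub> FArr G (ActA M g (FArr F f)) =
      FArr G (FArr F (ActA L g f)) \<cdot>\<^bsub>E\<^esub> FArr G (s (Dom V g) (Dom C f))"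
      by (simp flip: G.functor_comp)
    then have "FArr G (s (Cod V g) (Cod C f)) \<cdot>\<^bsub>E\<^esub> FArr G (ActA M g (FArr F f)) \<cdot>\<^bsub>E\<^esub> k =
      FArr G (FArr F (ActA L g f)) \<cdot>\<^bsub>E\<^esub> FArr G (s (Dom V g) (Dom C f)) \<cdot>\<^bsub>E\<^esub> k"
      if "is_arr E k" "Cod E k = FObj G (Act M (Dom V g) (FObj F (Dom C f)))" for k
      by (rule G.target_action.comp_reassoc) (use that in simp_all)
    then show "(FArr G (s (Cod V g) (Cod C f)) \<cdot>\<^bsub>E\<^esub> t (Cod V g) (FObj F (Cod C f))) \<cdot>\<^bsub>E\<^esub> ActA N g (FArr (comp_funct G F) f)
      = FArr (comp_funct G F) (ActA L g f) \<cdot>\<^bsub>E\<^esub> FArr G (s (Dom V g) (Dom C f)) \<cdot>\<^bsub>E\<^esub> t (Dom V g) (FObj F (Dom C f))"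
      by simp
  next
    fix W W' X assume [simp]: "W \<in> Obj V" "W' \<in> Obj V" "X \<in> Obj C"
    have "FArr G (FArr F (AAssoc L W W' X) \<cdot>\<^bsub>D\<^esub> s (Tens V W W') X) =
      FArr G (s W (Act L W' X) \<cdot>\<^bsub>D\<^esub> (ActA M (Ident V W) (s W' X) \<cdot>\<^bsub>D\<^esub> AAssoc M W W' (FObj F X)))"
      by (simp only: F.strength_assoc[of W W' X] \<open>W \<in> Obj V\<close> \<open>W' \<in> Obj V\<close> \<open>X \<in> Obj C\<close>)
    then have 1: "FArr G (FArr F (AAssoc L W W' X)) \<cdot>\<^bsub>E\<^esub> FArr G (s (Tens V W W') X) =
      FArr G (s W (Act L W' X)) \<cdot>\<^bsub>E\<^esub> FArr G (ActA M (Ident V W) (s W' X)) \<cdot>\<^bsub>E\<^esub> FArr G (AAssoc M W W' (FObj F X))"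
      by (simp add: G.functor_comp)
    have 2: "FArr G (FArr F (AAssoc L W W' X)) \<cdot>\<^bsub>E\<^esub> FArr G (s (Tens V W W') X) \<cdot>\<^bsub>E\<^esub> k =
      FArr G (s W (Act L W' X)) \<cdot>\<^bsub>E\<^esub> FArr G (ActA M (Ident V W) (s W' X)) \<cdot>\<^bsub>E\<^esub> FArr G (AAssoc M W W' (FObj F X)) \<cdot>\<^bsub>E\<^esub> k"
      if "is_arr E k" "Cod E k = FObj G (Act M (Tens V W W') (FObj F X))" for k
      using G.target_action.comp_reassoc[OF 1, of k] that by simp
    have 3: "t W (FObj F (Act L W' X)) \<cdot>\<^bsub>E\<^esub> ActA N (Ident V W) (FArr G (s W' X) \<cdot>\<^bsub>E\<^esub> k)
      = FArr G (ActA M (Ident V W) (s W' X)) \<cdot>\<^bsub>E\<^esub> t W (Act M W' (FObj F X)) \<cdot>\<^bsub>E\<^esub> ActA N (Ident V W) k"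
      if "is_arr E k" "Cod E k = FObj G (Act M W' (FObj F X))" for k
      using G.strength_natural'(2)[of "Ident V W" "s W' X" W _ "ActA N (Ident V W) k"] that by simp
    have 4: "t W (FObj F (Act L W' X)) \<cdot>\<^bsub>E\<^esub> ActA N (Ident V W) (FArr G (s W' X) \<cdot>\<^bsub>E\<^esub> k) \<cdot>\<^bsub>E\<^esub> l
      = FArr G (ActA M (Ident V W) (s W' X)) \<cdot>\<^bsub>E\<^esub> t W (Act M W' (FObj F X)) \<cdot>\<^bsub>E\<^esub> ActA N (Ident V W) k \<cdot>\<^bsub>E\<^esub> l"
      if "is_arr E k" "Cod E k = FObj G (Act M W' (FObj F X))" "is_arr E l" "Cod E l = Act N W (Dom E k)" for k l
      using G.target_action.comp_reassoc[OF 3, of k l] that by simp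
    have 5: "FArr G (AAssoc M W W' (FObj F X)) \<cdot>\<^bsub>E\<^esub> t (Tens V W W') (FObj F X) =
      t W (Act M W' (FObj F X)) \<cdot>\<^bsub>E\<^esub> ActA N (Ident V W) (t W' (FObj F X)) \<cdot>\<^bsub>E\<^esub> AAssoc N W W' (FObj G (FObj F X))"
      using G.strength_assoc[of W W' "FObj F X"] by simp
    show "FArr (comp_funct G F) (AAssoc L W W' X) \<cdot>\<^bsub>E\<^esub> (FArr G (s (Tens V W W') X) \<cdot>\<^bsub>E\<^esub> t (Tens V W W') (FObj F X))
      = (FArr G (s W (Act L W' X)) \<cdot>\<^bsub>E\<^esub> t W (FObj F (Act L W' X))) \<cdot>\<^bsub>E\<^esub>
        (ActA N (Ident V W) (FArr G (s W' X) \<cdot>\<^bsub>E\<^esub> t W' (FObj F X)) \<cdot>\<^bsub>E\<^esub> AAssoc N W W' (FObj (comp_funct G F) X))"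
      by (simp add: 2 4 5)
  next
    fix X assume [simp]: "X \<in> Obj C"
    have "FArr G (FArr F (AUnit L X)) \<cdot>\<^bsub>E\<^esub> FArr G (s (Unit V) X) = FArr G (AUnit M (FObj F X))"
      using F.strength_unit[of X] by (simp flip: G.functor_comp)
    then have "(FArr G (FArr F (AUnit L X)) \<cdot>\<^bsub>E\<^esub> FArr G (s (Unit V) X)) \<cdot>\<^bsub>E\<^esub> t (Unit V) (FObj F X)
       = AUnit N (FObj G (FObj F X))"
      using G.strength_unit[of "FObj F X"] by (simp only: F.functor_simps(1) \<open>X \<in> Obj C\<close>)
    then show "FArr (comp_funct G F) (AUnit L X) \<cdot>\<^bsub>E\<^esub> FArr G (s (Unit V) X) \<cdot>\<^bsub>E\<^esub> t (Unit V) (FObj F X)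
       = AUnit N (FObj (comp_funct G F) X)"
      by simp
  qed simp_all
qed


lemma weak_equivalence_comp:
  assumes F: "weak_equivalence K C D F" and G: "weak_equivalence K D E G" and GF: "linear_functor K C E (comp_funct G F)"
  shows "weak_equivalence K C E (comp_funct G F)"
proof -
  interpret F: weak_equivalence K C D F by fact
  interpret G: weak_equivalence K D E G by fact
  interpret GF: linear_functor K C E "comp_funct G F" by fact
  show ?thesis
  proof
    fix X Y h assume XY: "X \<in> Obj C" "Y \<in> Obj C" and "h \<in> arr E (FObj (comp_funct G F) X) (FObj (comp_funct G F) Y)"
    then show "\<exists>f\<in>arr C X Y. FArr (comp_funct G F) f = h"
      using G.full[of "FObj F X" "FObj F Y" h] F.full[OF XY] by (force simp: comp_funct_def)
  next
    fix X Y f g assume XY: "X \<in> Obj C" "Y \<in> Obj C" and fg: "f \<in> arr C X Y" "g \<in> arr C X Y"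
      and "FArr (comp_funct G F) f = FArr (comp_funct G F) g"
    then show "f = g"
      using G.faithful[of "FObj F X" "FObj F Y" "FArr F f" "FArr F g"] F.faithful[OF XY fg]
      by (simp add: comp_funct_def F.farr)
  next
    fix Z assume Z: "Z \<in> Obj E"
    show "\<exists>X\<in>Obj C. \<exists>q. is_iso E (FObj (comp_funct G F) X) Z q"
      by (intro bexI[of _ "F.pre (G.pre Z)"] exI[of _ "G.qi Z \<cdot>\<^bsub>E\<^esub> FArr G (F.qi (G.pre Z))"])
        (use Z in \<open>simp_all add: comp_funct_def G.target.is_iso_iff\<close>)
  qed
qed

section \<open>Transport of an action along a weak equivalence\<close>

locale action_transport = weak_equivalence K C D J + module_category K V C L
  for K :: "('k, 'r) ring_scheme" and V :: "('k, 'v, 'w, 'x) moncat_scheme"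
    and C :: "('k, 'o, 'm, 'y) kcat_scheme" and L :: "('v, 'w, 'o, 'm) action"
    and D :: "('k, 'p, 'n, 'z) kcat_scheme" and J :: "('o, 'm, 'p, 'n) funct"
begin

text \<open>An object is pulled back by \<open>pre\<close>, acted on there, and sent forward by
  \<open>J\<close>. An iterated action meets \<open>pre\<close> after \<open>J\<close>, which the
  inverse of \<open>th\<close> in the associator accounts for.\<close>

definition transported :: "('v, 'w, 'p, 'n) action" where
  "transported =
    \<lparr>Act = (\<lambda>W Y. FObj J (Act L W (pre Y))),
     ActA = (\<lambda>g f. FArr J (ActA L g (FArr G f))),
     AAssoc = (\<lambda>W W' Y. FArr J (ActA L (Ident V W) (inv_arr C (th (Act L W' (pre Y)))) \<cdot>\<^bsub>C\<^esub> AAssoc L W W' (pre Y))),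
     AUnit = (\<lambda>Y. qi Y \<cdot>\<^bsub>D\<^esub> FArr J (AUnit L (pre Y)))\<rparr>"

lemma transported_simps [simp]:
  "Act transported = (\<lambda>W Y. FObj J (Act L W (pre Y)))"
  "ActA transported = (\<lambda>g f. FArr J (ActA L g (FArr G f)))"
  "AAssoc transported = (\<lambda>W W' Y. FArr J (ActA L (Ident V W) (inv_arr C (th (Act L W' (pre Y)))) \<cdot>\<^bsub>C\<^esub> AAssoc L W W' (pre Y)))"
  "AUnit transported = (\<lambda>Y. qi Y \<cdot>\<^bsub>D\<^esub> FArr J (AUnit L (pre Y)))"
  by (simp_all add: transported_def)

lemma transported_bifunctor: "linear_bifunctor K V D D (Act transported) (ActA transported)"
proof (rule linear_bifunctorI)
  show "linear_category K V" "linear_category K D" "linear_category K D" by unfold_locales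
next
  fix W W' X X' g f
  assume O: "W \<in> Obj V" "W' \<in> Obj V" "X \<in> Obj D" "X' \<in> Obj D" and g: "g \<in> arr V W W'" and f: "f \<in> arr D X X'"
  have O': "pre X \<in> Obj C" "pre X' \<in> Obj C" and Gf: "FArr G f \<in> arr C (pre X) (pre X')"
    using O G.farr[OF O(3,4) f] by simp_all
  have P: "Act L W (pre X) \<in> Obj C" "Act L W' (pre X') \<in> Obj C" using O by simp_all
  note arrs = act.barr[OF O(1,2) O' g Gf]
  show "ActA transported (g \<oplus>\<^bsub>Hom V W W'\<^esub> g') f = ActA transported g f
      \<oplus>\<^bsub>Hom D (Act transported W X) (Act transported W' X')\<^esub> ActA transported g' f" if g': "g' \<in> arr V W W'" for g'
    using act.badd_left[OF O(1,2) O' g g' Gf] fadd[OF P arrs act.barr[OF O(1,2) O' g' Gf]] by simp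
  show "ActA transported g (f \<oplus>\<^bsub>Hom D X X'\<^esub> f') = ActA transported g f
      \<oplus>\<^bsub>Hom D (Act transported W X) (Act transported W' X')\<^esub> ActA transported g f'" if f': "f' \<in> arr D X X'" for f'
  proof -
    have Gf': "FArr G f' \<in> arr C (pre X) (pre X')" using G.farr[OF O(3,4) f'] by simp
    show ?thesis
      using G.fadd[OF O(3,4) f f'] act.badd_right[OF O(1,2) O' g Gf Gf'] fadd[OF P arrs act.barr[OF O(1,2) O' g Gf']] by simp
  qed
  show "ActA transported (a \<odot>\<^bsub>Hom V W W'\<^esub> g) f =
      a \<odot>\<^bsub>Hom D (Act transported W X) (Act transported W' X')\<^esub> ActA transported g f" if a: "a \<in> carrier K" for a
    using act.bsmult_left[OF O(1,2) O' a g Gf] fsmult[OF P a arrs] by simp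
  show "ActA transported g (a \<odot>\<^bsub>Hom D X X'\<^esub> f) =
      a \<odot>\<^bsub>Hom D (Act transported W X) (Act transported W' X')\<^esub> ActA transported g f" if a: "a \<in> carrier K" for a
    using G.fsmult[OF O(3,4) a f] act.bsmult_right[OF O(1,2) O' a g Gf] fsmult[OF P a arrs] by simp
qed (simp_all add: functor_merge G.functor_comp)

lemma transported_module_category: "module_category K V D transported"
proof (rule module_categoryI[OF _ _ transported_bifunctor])
  show "monoidal_category K V" "linear_category K D" by unfold_locales
next
  fix f g h assume [simp]: "is_arr V f" "is_arr V g" "is_arr D h"
  show "AAssoc transported (Cod V f) (Cod V g) (Cod D h) \<cdot>\<^bsub>D\<^esub> ActA transported (TensA V f g) h
            = ActA transported f (ActA transported g h) \<cdot>\<^bsub>D\<^esub> AAssoc transported (Dom V f) (Dom V g) (Dom D h)"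
    by (simp add: functor_merge)
next
  fix h assume [simp]: "is_arr D h"
  have "h \<cdot>\<^bsub>D\<^esub> qi (Dom D h) \<cdot>\<^bsub>D\<^esub> k = qi (Cod D h) \<cdot>\<^bsub>D\<^esub> FArr J (FArr G h) \<cdot>\<^bsub>D\<^esub> k"
    if "is_arr D k" "Cod D k = FObj J (pre (Dom D h))" for k
    using that by simp
  then show "AUnit transported (Cod D h) \<cdot>\<^bsub>D\<^esub> ActA transported (Ident V (Unit V)) h = h \<cdot>\<^bsub>D\<^esub> AUnit transported (Dom D h)"
    by (simp add: functor_merge del: G_arr(4))
next
  fix U W W' Y assume [simp]: "U \<in> Obj V" "W \<in> Obj V" "W' \<in> Obj V" "Y \<in> Obj D"
  show "ActA transported (Ident V U) (AAssoc transported W W' Y) \<cdot>\<^bsub>D\<^esub>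
                (AAssoc transported U (Tens V W W') Y \<cdot>\<^bsub>D\<^esub> ActA transported (Assoc V U W W') (Ident D Y))
            = AAssoc transported U W (Act transported W' Y) \<cdot>\<^bsub>D\<^esub> AAssoc transported (Tens V U W) W' Y"
    by (simp add: functor_merge flip: action_pentagon)
next
  fix W Y assume [simp]: "W \<in> Obj V" "Y \<in> Obj D"
  show "ActA transported (Ident V W) (AUnit transported Y) \<cdot>\<^bsub>D\<^esub> AAssoc transported W (Unit V) Y
     = ActA transported (RUnit V W) (Ident D Y)"
    using action_triangle[of W "pre Y"]
    by (simp add: functor_merge G.functor_comp)
qed (simp_all add: functor_comp)

text \<open>Acting on \<open>FObj J X\<close> means acting on \<open>pre (FObj J X)\<close>, so the
  strength is the action on the comparison \<open>th X\<close>, sent forward by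
  \<open>J\<close>.\<close>

lemma transported_strong:
  "strong_module_functor K V C L D transported J (\<lambda>W X. FArr J (ActA L (Ident V W) (th X)))"
proof (rule strong_module_functorI[OF _ transported_module_category])
  show "module_category K V C L" "linear_functor K C D J" by unfold_locales
next
  fix X assume [simp]: "X \<in> Obj C"
  have "FArr J (AUnit L X) \<cdot>\<^bsub>D\<^esub> FArr J (ActA L (Ident V (Unit V)) (th X)) = FArr J (th X \<cdot>\<^bsub>C\<^esub> AUnit L (pre (FObj J X)))"
    by (simp add: functor_merge)
  then show "FArr J (AUnit L X) \<cdot>\<^bsub>D\<^esub> FArr J (ActA L (Ident V (Unit V)) (th X)) = AUnit transported (FObj J X)"
    by (simp add: functor_comp)
qed (simp_all add: functor_merge)

end

section \<open>Semisimplicity and module structures reflected by weak equivalences\<close>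

text \<open>A zero arrow is zero times itself, and composition commutes with scalars.\<close>

lemma (in linear_category) comp_zero:
  assumes O: "X \<in> Obj C" "Y \<in> Obj C" "Z \<in> Obj C"
  shows "f \<in> arr C X Y \<Longrightarrow> \<zero>\<^bsub>Hom C Y Z\<^esub> \<cdot>\<^bsub>C\<^esub> f = \<zero>\<^bsub>Hom C X Z\<^esub>"
    and "g \<in> arr C Y Z \<Longrightarrow> g \<cdot>\<^bsub>C\<^esub> \<zero>\<^bsub>Hom C X Y\<^esub> = \<zero>\<^bsub>Hom C X Z\<^esub>"
proof -
  interpret XY: module K "Hom C X Y" by (rule hom_module[OF O(1,2)])
  interpret YZ: module K "Hom C Y Z" by (rule hom_module[OF O(2,3)])
  interpret XZ: module K "Hom C X Z" by (rule hom_module[OF O(1,3)])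
  note zero = zero_arr[OF O(1,2)] zero_arr[OF O(2,3)]
  show "\<zero>\<^bsub>Hom C Y Z\<^esub> \<cdot>\<^bsub>C\<^esub> f = \<zero>\<^bsub>Hom C X Z\<^esub>" if f: "f \<in> arr C X Y"
    using comp_smult_left[OF O _ f zero(2), of "\<zero>\<^bsub>K\<^esub>"] comp_arr[OF O f zero(2)]
    by (simp add: arr_def)
  show "g \<cdot>\<^bsub>C\<^esub> \<zero>\<^bsub>Hom C X Y\<^esub> = \<zero>\<^bsub>Hom C X Z\<^esub>" if g: "g \<in> arr C Y Z"
    using comp_smult_right[OF O _ zero(1) g, of "\<zero>\<^bsub>K\<^esub>"] comp_arr[OF O zero(1) g]
    by (simp add: arr_def)
qed

lemma (in linear_functor) functor_zero:
  assumes O: "X \<in> Obj C" "Y \<in> Obj C"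
  shows "FArr F \<zero>\<^bsub>Hom C X Y\<^esub> = \<zero>\<^bsub>Hom D (FObj F X) (FObj F Y)\<^esub>"
proof -
  interpret XY: module K "Hom C X Y" by (rule source.hom_module[OF O])
  interpret FXY: module K "Hom D (FObj F X) (FObj F Y)" by (rule target.hom_module[OF fobj[OF O(1)] fobj[OF O(2)]])
  show ?thesis
    using fsmult[OF O _ source.zero_arr[OF O], of "\<zero>\<^bsub>K\<^esub>"] farr[OF O source.zero_arr[OF O]] by (simp add: arr_def)
qed

text \<open>A decomposition of the image of \<open>X\<close> is lifted: the summands by
  \<open>pre\<close>, the injections by fullness, the universal property by full faithfulness. The
  decomposition is indexed in a type of its own, and \<open>em\<close> moves the indices into the
  type of arrows of \<open>C\<close>, where \<open>semisimple\<close> expects them.\<close>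

lemma (in weak_equivalence) semisimple_reflected:
  fixes em :: "'i \<Rightarrow> 'm"
  assumes inj: "inj em"
    and ss: "\<And>Y. Y \<in> Obj D \<Longrightarrow> \<exists>(I :: 'i set) S inc. (\<forall>i \<in> I. simple_object D (S i)) \<and> is_direct_sum D I S inc Y"
  shows "semisimple C"
  unfolding semisimple_def
proof
  fix X assume X [simp]: "X \<in> Obj C"
  from ss[of "FObj J X"] obtain I :: "'i set" and S inc where
    simple: "\<And>i. i \<in> I \<Longrightarrow> simple_object D (S i)" and ds: "is_direct_sum D I S inc (FObj J X)" by auto
  have S: "i \<in> I \<Longrightarrow> S i \<in> Obj D" for i using simple by (simp add: simple_object_def)
  have incs: "i \<in> I \<Longrightarrow> is_arr D (inc i)" "i \<in> I \<Longrightarrow> Dom D (inc i) = S i" "i \<in> I \<Longrightarrow> Cod D (inc i) = FObj J X" for i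
    using ds S[of i] by (auto simp: is_direct_sum_def target.arr_iff)
  note [simp] = S incs
  define S' where "S' j = pre (S (inv_into UNIV em j))" for j
  define inc' where "inc' j = lift_arr (pre (S (inv_into UNIV em j))) X (inc (inv_into UNIV em j) \<cdot>\<^bsub>D\<^esub> qi (S (inv_into UNIV em j)))" for j
  have [simp]: "inv_into UNIV em (em i) = i" for i using inj by simp
  have "simple_object C (S' j)" if j': "j \<in> em ` I" for j
  proof -
    obtain i where i [simp]: "i \<in> I" and j: "j = em i" using j' by auto
    show ?thesis
      unfolding simple_object_def
    proof (intro conjI ballI impI)
      show O: "S' j \<in> Obj C" by (simp add: S'_def j)
      fix f assume f: "f \<in> arr C (S' j) (S' j)" and nz: "f \<noteq> \<zero>\<^bsub>Hom C (S' j) (S' j)\<^esub>"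
      have fs: "is_arr C f" "Dom C f = pre (S i)" "Cod C f = pre (S i)" and Sj: "S' j = pre (S i)"
        using source.is_arrI[OF f O O] by (simp_all add: S'_def j)
      \<comment> \<open>An endomorphism of \<open>pre (S i)\<close> becomes, by conjugation, an
        endomorphism of \<open>S i\<close>, where simplicity is known.\<close>
      let ?e = "qi (S i) \<cdot>\<^bsub>D\<^esub> FArr J f \<cdot>\<^bsub>D\<^esub> inv_arr D (qi (S i))"
      have e: "?e \<in> arr D (S i) (S i)" using fs by (simp add: target.arr_iff)
      have "?e \<noteq> \<zero>\<^bsub>Hom D (S i) (S i)\<^esub>"
      proof
        assume z: "?e = \<zero>\<^bsub>Hom D (S i) (S i)\<^esub>"
        let ?P = "pre (S i)"
        have P: "?P \<in> Obj C" "FObj J ?P \<in> Obj D" by simp_all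
        have q: "qi (S i) \<in> arr D (FObj J ?P) (S i)" "inv_arr D (qi (S i)) \<in> arr D (S i) (FObj J ?P)"
          by (simp_all add: target.arr_iff)
        have "FArr J f = inv_arr D (qi (S i)) \<cdot>\<^bsub>D\<^esub> \<zero>\<^bsub>Hom D (S i) (S i)\<^esub> \<cdot>\<^bsub>D\<^esub> qi (S i)"
          using fs by (simp flip: z)
        also have "\<zero>\<^bsub>Hom D (S i) (S i)\<^esub> \<cdot>\<^bsub>D\<^esub> qi (S i) = \<zero>\<^bsub>Hom D (FObj J ?P) (S i)\<^esub>"
          by (rule target.comp_zero(1)[OF P(2) S[OF i] S[OF i] q(1)])
        also have "inv_arr D (qi (S i)) \<cdot>\<^bsub>D\<^esub> \<zero>\<^bsub>Hom D (FObj J ?P) (S i)\<^esub> = \<zero>\<^bsub>Hom D (FObj J ?P) (FObj J ?P)\<^esub>"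
          by (rule target.comp_zero(2)[OF P(2) S[OF i] P(2) q(2)])
        also have "\<dots> = FArr J \<zero>\<^bsub>Hom C ?P ?P\<^esub>" using functor_zero[OF P(1) P(1)] by simp
        finally have "f = \<zero>\<^bsub>Hom C ?P ?P\<^esub>"
          using faithful[OF P(1) P(1), of f "\<zero>\<^bsub>Hom C ?P ?P\<^esub>"] f source.zero_arr[OF P(1) P(1)] Sj by simp
        then show False using nz Sj by simp
      qed
      then have "is_iso D (S i) (S i) ?e" using simple[OF i] e by (auto simp: simple_object_def)
      then have e': "iso_arr D ?e" by (simp add: target.is_iso_iff)
      have "iso_arr D (inv_arr D (qi (S i)) \<cdot>\<^bsub>D\<^esub> ?e \<cdot>\<^bsub>D\<^esub> qi (S i))"
        by (intro target.iso_arr_comp e') (use fs in simp_all)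
      then have "iso_arr D (FArr J f)" using fs by simp
      then show "is_iso C (S' j) (S' j) f"
        using fs reflects_iso[of f] by (simp add: Sj source.is_iso_iff)
    qed
  qed
  moreover have "is_direct_sum C (em ` I) S' inc' X"
    unfolding is_direct_sum_def
  proof (intro conjI ballI allI impI X)
    fix j assume "j \<in> em ` I"
    then show "S' j \<in> Obj C" "inc' j \<in> arr C (S' j) X"
      by (auto simp: S'_def inc'_def source.arr_iff)
  next
    fix Y f assume Y [simp]: "Y \<in> Obj C" and f: "\<forall>j\<in>em ` I. f j \<in> arr C (S' j) Y"
    then have fs [simp]: "is_arr C (f (em i))" "Dom C (f (em i)) = pre (S i)" "Cod C (f (em i)) = Y" if "i \<in> I" for i
      using that by (auto simp: S'_def source.arr_iff)
    \<comment> \<open>The given family, transported to the summands of the image of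
      \<open>X\<close>, where the universal property is at hand.\<close>
    let ?f = "\<lambda>i. FArr J (f (em i)) \<cdot>\<^bsub>D\<^esub> inv_arr D (qi (S i))"
    have "\<exists>!g. g \<in> arr D (FObj J X) (FObj J Y) \<and> (\<forall>i \<in> I. g \<cdot>\<^bsub>D\<^esub> inc i = ?f i)"
      using ds unfolding is_direct_sum_def by (simp add: target.arr_iff)
    then obtain g where g': "g \<in> arr D (FObj J X) (FObj J Y) \<and> (\<forall>i \<in> I. g \<cdot>\<^bsub>D\<^esub> inc i = ?f i)"
      and uniq': "\<forall>g'. g' \<in> arr D (FObj J X) (FObj J Y) \<and> (\<forall>i \<in> I. g' \<cdot>\<^bsub>D\<^esub> inc i = ?f i) \<longrightarrow> g' = g"
      by (elim ex1E) (rule that)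
    have g: "is_arr D g" "Dom D g = FObj J X" "Cod D g = FObj J Y"
      using target.is_arrI[of g "FObj J X" "FObj J Y"] g' by simp_all
    have gi: "g \<cdot>\<^bsub>D\<^esub> inc i = ?f i" if "i \<in> I" for i using g' that by blast
    have uniq: "g' = g" if "g' \<in> arr D (FObj J X) (FObj J Y)" "\<And>i. i \<in> I \<Longrightarrow> g' \<cdot>\<^bsub>D\<^esub> inc i = ?f i" for g'
      using uniq' that by blast
    show "\<exists>!g. g \<in> arr C X Y \<and> (\<forall>j\<in>em ` I. g \<cdot>\<^bsub>C\<^esub> inc' j = f j)"
    proof (intro ex1I[of _ "lift_arr X Y g"] conjI ballI)
      show "lift_arr X Y g \<in> arr C X Y" using g by (simp add: source.arr_iff)
      fix j assume "j \<in> em ` I"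
      then obtain i where i [simp]: "i \<in> I" and j: "j = em i" by blast
      have "g \<cdot>\<^bsub>D\<^esub> inc i \<cdot>\<^bsub>D\<^esub> qi (S i) = FArr J (f (em i))"
      proof -
        have "g \<cdot>\<^bsub>D\<^esub> inc i \<cdot>\<^bsub>D\<^esub> qi (S i) = FArr J (f (em i)) \<cdot>\<^bsub>D\<^esub> inv_arr D (qi (S i)) \<cdot>\<^bsub>D\<^esub> qi (S i)"
          by (rule target.comp_reassoc[OF gi[OF i]]) (use g in simp_all)
        then show ?thesis by simp
      qed
      then show "lift_arr X Y g \<cdot>\<^bsub>C\<^esub> inc' j = f j"
        by (intro faithful_eqI) (use g in \<open>simp_all add: inc'_def j functor_comp\<close>)
    next
      fix g' assume g': "g' \<in> arr C X Y \<and> (\<forall>j\<in>em ` I. g' \<cdot>\<^bsub>C\<^esub> inc' j = f j)"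
      then have gs: "is_arr C g'" "Dom C g' = X" "Cod C g' = Y" by (auto simp: source.arr_iff)
      have "FArr J g' = g"
      proof (rule uniq)
        show "FArr J g' \<in> arr D (FObj J X) (FObj J Y)" using gs by (simp add: target.arr_iff)
        fix i assume i [simp]: "i \<in> I"
        have "FArr J (g' \<cdot>\<^bsub>C\<^esub> inc' (em i)) = FArr J (f (em i))" using g' by auto
        then have eq: "FArr J g' \<cdot>\<^bsub>D\<^esub> inc i \<cdot>\<^bsub>D\<^esub> qi (S i) = FArr J (f (em i))"
          using gs by (simp add: inc'_def functor_comp)
        show "FArr J g' \<cdot>\<^bsub>D\<^esub> inc i = ?f i"
          by (rule target.iso_cancel_right[where p="qi (S i)"]) (use gs eq in simp_all)
      qed
      then show "g' = lift_arr X Y g" by (intro faithful_eqI) (use g gs in simp_all)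
    qed
  qed
  ultimately show "\<exists>(I :: 'm set) S inc. (\<forall>i\<in>I. simple_object C (S i)) \<and> is_direct_sum C I S inc X" by blast
qed


text \<open>\<open>P\<close> preserves the operations of \<open>L\<close> on the nose. Every
  equation therefore holds after \<open>P\<close>, hence before it by faithfulness, and the
  structure arrows are isomorphisms because \<open>P\<close> reflects these. The strength of
  \<open>P\<close> consists of identities.\<close>

lemma module_category_reflected:
  fixes P :: "('o, 'm, 'p, 'n) funct"
  assumes P: "weak_equivalence K C E P" and M: "module_category K V E M"
    and act: "\<And>W X. \<lbrakk>W \<in> Obj V; X \<in> Obj C\<rbrakk> \<Longrightarrow> Act L W X \<in> Obj C \<and> FObj P (Act L W X) = Act M W (FObj P X)"
    and actA: "\<And>g f. \<lbrakk>is_arr V g; is_arr C f\<rbrakk> \<Longrightarrow> is_arr C (ActA L g f) \<and> Dom C (ActA L g f) = Act L (Dom V g) (Dom C f) \<and>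
          Cod C (ActA L g f) = Act L (Cod V g) (Cod C f) \<and> FArr P (ActA L g f) = ActA M g (FArr P f)"
    and assoc: "\<And>W W' X. \<lbrakk>W \<in> Obj V; W' \<in> Obj V; X \<in> Obj C\<rbrakk> \<Longrightarrow> is_arr C (AAssoc L W W' X) \<and>
          Dom C (AAssoc L W W' X) = Act L (Tens V W W') X \<and> Cod C (AAssoc L W W' X) = Act L W (Act L W' X) \<and>
          FArr P (AAssoc L W W' X) = AAssoc M W W' (FObj P X)"
    and unit: "\<And>X. X \<in> Obj C \<Longrightarrow> is_arr C (AUnit L X) \<and> Dom C (AUnit L X) = Act L (Unit V) X \<and> Cod C (AUnit L X) = X \<and>
          FArr P (AUnit L X) = AUnit M (FObj P X)"
  shows "module_category K V C L"
    and "strong_module_functor K V C L E M P (\<lambda>W X. Ident E (Act M W (FObj P X)))"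
proof -
  interpret P: weak_equivalence K C E P by fact
  interpret M: module_category K V E M by fact
  note [simp] = act actA assoc unit
  have bif: "linear_bifunctor K V C C (Act L) (ActA L)"
  proof (rule linear_bifunctorI)
    show "linear_category K V" "linear_category K C" "linear_category K C" by unfold_locales
  next
    fix W X assume "W \<in> Obj V" "X \<in> Obj C"
    then show "ActA L (Ident V W) (Ident C X) = Ident C (Act L W X)"
      by (intro P.faithful_eqI) simp_all
  next
    fix g g' f f' assume "is_arr V g" "is_arr V g'" "is_arr C f" "is_arr C f'" "Dom V g' = Cod V g" "Dom C f' = Cod C f"
    then show "ActA L (g' \<cdot>\<^bsub>V\<^esub> g) (f' \<cdot>\<^bsub>C\<^esub> f) = ActA L g' f' \<cdot>\<^bsub>C\<^esub> ActA L g f"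
      by (intro P.faithful_eqI) (simp_all add: P.functor_comp)
  next
    fix W W' X X' g f
    assume O: "W \<in> Obj V" "W' \<in> Obj V" "X \<in> Obj C" "X' \<in> Obj C" and g: "g \<in> arr V W W'" and f: "f \<in> arr C X X'"
    have PO: "FObj P X \<in> Obj E" "FObj P X' \<in> Obj E" and Pf: "FArr P f \<in> arr E (FObj P X) (FObj P X')"
      using O P.farr[OF O(3,4) f] by simp_all
    have A: "Act L W X \<in> Obj C" "Act L W' X' \<in> Obj C" using O by simp_all
    have arrA: "ActA L g f \<in> arr C (Act L W X) (Act L W' X')" if "g \<in> arr V W W'" "f \<in> arr C X X'" for g f
      using that O A M.left.is_arrI[OF that(1) O(1,2)] P.source.is_arrI[OF that(2) O(3,4)] by (simp add: P.source.arr_iff)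
    have PA: "FArr P (ActA L g f) = ActA M g (FArr P f)" if "g \<in> arr V W W'" "f \<in> arr C X X'" for g f
      using M.left.is_arrI[OF that(1) O(1,2)] P.source.is_arrI[OF that(2) O(3,4)] by simp
    have eqI: "h = k" if "h \<in> arr C (Act L W X) (Act L W' X')" "k \<in> arr C (Act L W X) (Act L W' X')" "FArr P h = FArr P k" for h k
      using P.faithful[OF A that] .
    have PAct: "FObj P (Act L W X) = Act M W (FObj P X)" "FObj P (Act L W' X') = Act M W' (FObj P X')" using O by simp_all
    show "ActA L (g \<oplus>\<^bsub>Hom V W W'\<^esub> g') f = ActA L g f \<oplus>\<^bsub>Hom C (Act L W X) (Act L W' X')\<^esub> ActA L g' f"
      if g': "g' \<in> arr V W W'" for g'
      by (rule eqI) (simp_all add: arrA PA PAct g g' f P.source.add_arr[OF A] M.left.add_arr[OF O(1,2)]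
          P.fadd[OF A] M.act.badd_left[OF O(1,2) PO _ _ Pf])
    show "ActA L g (f \<oplus>\<^bsub>Hom C X X'\<^esub> f') = ActA L g f \<oplus>\<^bsub>Hom C (Act L W X) (Act L W' X')\<^esub> ActA L g f'"
      if f': "f' \<in> arr C X X'" for f'
      by (rule eqI) (simp_all add: arrA PA PAct g f f' P.source.add_arr[OF A] P.source.add_arr[OF O(3,4)]
          P.fadd[OF A] P.fadd[OF O(3,4)] M.act.badd_right[OF O(1,2) PO g Pf P.farr[OF O(3,4) f']])
    show "ActA L (a \<odot>\<^bsub>Hom V W W'\<^esub> g) f = a \<odot>\<^bsub>Hom C (Act L W X) (Act L W' X')\<^esub> ActA L g f"
      if a: "a \<in> carrier K" for a
      by (rule eqI) (simp_all add: arrA PA PAct g f a P.source.smult_arr[OF A] M.left.smult_arr[OF O(1,2)]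
          P.fsmult[OF A] M.act.bsmult_left[OF O(1,2) PO _ _ Pf])
    show "ActA L g (a \<odot>\<^bsub>Hom C X X'\<^esub> f) = a \<odot>\<^bsub>Hom C (Act L W X) (Act L W' X')\<^esub> ActA L g f"
      if a: "a \<in> carrier K" for a
      by (rule eqI) (simp_all add: arrA PA PAct g f a P.source.smult_arr[OF A] P.source.smult_arr[OF O(3,4)]
          P.fsmult[OF A] P.fsmult[OF O(3,4)] M.act.bsmult_right[OF O(1,2) PO a g Pf])
  qed simp_all
  show L: "module_category K V C L"
  proof (rule module_categoryI[OF _ _ bif])
    show "monoidal_category K V" "linear_category K C" by unfold_locales
    show "iso_arr C (AAssoc L W W' X) \<and> Dom C (AAssoc L W W' X) = Act L (Tens V W W') X \<and>
        Cod C (AAssoc L W W' X) = Act L W (Act L W' X)" if "W \<in> Obj V" "W' \<in> Obj V" "X \<in> Obj C" for W W' X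
      using that by (simp add: P.reflects_iso)
    show "iso_arr C (AUnit L X) \<and> Dom C (AUnit L X) = Act L (Unit V) X \<and> Cod C (AUnit L X) = X" if "X \<in> Obj C" for X
      using that by (simp add: P.reflects_iso)
  next
    fix f g h assume "is_arr V f" "is_arr V g" "is_arr C h"
    then show "AAssoc L (Cod V f) (Cod V g) (Cod C h) \<cdot>\<^bsub>C\<^esub> ActA L (TensA V f g) h
            = ActA L f (ActA L g h) \<cdot>\<^bsub>C\<^esub> AAssoc L (Dom V f) (Dom V g) (Dom C h)"
      by (intro P.faithful_eqI) (simp_all add: P.functor_comp)
  next
    fix h assume "is_arr C h"
    then show "AUnit L (Cod C h) \<cdot>\<^bsub>C\<^esub> ActA L (Ident V (Unit V)) h = h \<cdot>\<^bsub>C\<^esub> AUnit L (Dom C h)"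
      by (intro P.faithful_eqI) (simp_all add: P.functor_comp)
  next
    fix U W W' X assume "U \<in> Obj V" "W \<in> Obj V" "W' \<in> Obj V" "X \<in> Obj C"
    then show "ActA L (Ident V U) (AAssoc L W W' X) \<cdot>\<^bsub>C\<^esub>
                (AAssoc L U (Tens V W W') X \<cdot>\<^bsub>C\<^esub> ActA L (Assoc V U W W') (Ident C X))
            = AAssoc L U W (Act L W' X) \<cdot>\<^bsub>C\<^esub> AAssoc L (Tens V U W) W' X"
      by (intro P.faithful_eqI) (simp_all add: P.functor_comp M.action_pentagon)
  next
    fix W X assume "W \<in> Obj V" "X \<in> Obj C"
    then show "ActA L (Ident V W) (AUnit L X) \<cdot>\<^bsub>C\<^esub> AAssoc L W (Unit V) X = ActA L (RUnit V W) (Ident C X)"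
      by (intro P.faithful_eqI) (simp_all add: P.functor_comp M.action_triangle)
  qed
  show "strong_module_functor K V C L E M P (\<lambda>W X. Ident E (Act M W (FObj P X)))"
  proof (rule strong_module_functorI[OF L M])
    show "linear_functor K C E P" by unfold_locales
  qed simp_all
qed

section \<open>Linear categories of concrete linear maps\<close>

lemma arrow_module_simps [simp]:
  "carrier (arrow_module X Y H) = Arrow X Y ` carrier H" "zero (arrow_module X Y H) = Arrow X Y \<zero>\<^bsub>H\<^esub>"
  "f \<oplus>\<^bsub>arrow_module X Y H\<^esub> g = Arrow X Y (mor f \<oplus>\<^bsub>H\<^esub> mor g)"
  "a \<odot>\<^bsub>arrow_module X Y H\<^esub> f = Arrow X Y (a \<odot>\<^bsub>H\<^esub> mor f)"
  by (simp_all add: arrow_module_def)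

lemma arrow_module_module:
  assumes "module K H" shows "module K (arrow_module X Y H)"
proof (rule moduleI)
  interpret H: module K H by fact
  show "cring K" by unfold_locales
  show "abelian_group (arrow_module X Y H)"
  proof (rule abelian_groupI)
    fix f assume "f \<in> carrier (arrow_module X Y H)"
    then show "\<exists>g\<in>carrier (arrow_module X Y H). g \<oplus>\<^bsub>arrow_module X Y H\<^esub> f = \<zero>\<^bsub>arrow_module X Y H\<^esub>"
      by (auto intro!: bexI[of _ "\<ominus>\<^bsub>H\<^esub> mor f"] simp: H.l_neg)
  qed (auto simp: H.a_ac)
qed (use assms in \<open>auto simp: module.smult_l_distr module.smult_r_distr module.smult_assoc1 module.smult_one
     intro!: imageI module.smult_closed\<close>)

lemma concrete_category_simps [simp]:
  "Obj (concrete_category Ob H) = Ob" "Dom (concrete_category Ob H) = src" "Cod (concrete_category Ob H) = tgt"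
  "Comp (concrete_category Ob H) g f = Arrow (src f) (tgt g) (compose (carrier (src f)) (mor g) (mor f))"
  "Ident (concrete_category Ob H) V = Arrow V V (\<lambda>x \<in> carrier V. x)"
  by (simp_all add: concrete_category_def)

lemma arr_concrete_category [simp]:
  "arr (concrete_category Ob H) V W = Arrow V W ` (H V W \<inter> extensional (carrier V))"
  by (simp add: arr_def concrete_category_def)

lemma Hom_concrete_category:
  "\<zero>\<^bsub>Hom (concrete_category Ob H) V W\<^esub> = Arrow V W (\<lambda>x \<in> carrier V. \<zero>\<^bsub>W\<^esub>)"
  "f \<oplus>\<^bsub>Hom (concrete_category Ob H) V W\<^esub> g = Arrow V W (\<lambda>x \<in> carrier V. mor f x \<oplus>\<^bsub>W\<^esub> mor g x)"
  "a \<odot>\<^bsub>Hom (concrete_category Ob H) V W\<^esub> f = Arrow V W (\<lambda>x \<in> carrier V. a \<odot>\<^bsub>W\<^esub> mor f x)"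
  by (simp_all add: concrete_category_def)

context scalars
begin

lemma lin_restrict [simp]: "module K V \<Longrightarrow> restrict f (carrier V) \<in> lin K V W \<longleftrightarrow> f \<in> lin K V W"
  by (auto intro: lin_cong[where f=f] lin_cong[where f="restrict f (carrier V)"])

lemma lin_compose': "\<lbrakk>module K U; f \<in> lin K U V; g \<in> lin K V W\<rbrakk> \<Longrightarrow> compose (carrier U) g f \<in> lin K U W"
  using lin_compose[of g V W f U] by (simp add: compose_def)

lemma lin_pointwise:
  assumes "module K V" "module K W"
  shows "(\<lambda>x. \<zero>\<^bsub>W\<^esub>) \<in> lin K V W"
    and "\<lbrakk>f \<in> lin K V W; g \<in> lin K V W\<rbrakk> \<Longrightarrow> (\<lambda>x. f x \<oplus>\<^bsub>W\<^esub> g x) \<in> lin K V W"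
proof -
  interpret W: module K W by fact
  show "(\<lambda>x. \<zero>\<^bsub>W\<^esub>) \<in> lin K V W" by (rule linI) simp_all
  show "(\<lambda>x. f x \<oplus>\<^bsub>W\<^esub> g x) \<in> lin K V W" if f: "f \<in> lin K V W" and g: "g \<in> lin K V W"
    by (rule linI) (simp_all add: lin_closed[OF f] lin_closed[OF g] lin_add[OF f] lin_add[OF g]
        lin_smult[OF f] lin_smult[OF g] W.smult_r_distr W.a_ac)
qed

lemma lin_module:
  assumes mods [simp]: "module K V" "module K W" and H: "H \<subseteq> lin K V W"
    and zero: "(\<lambda>x \<in> carrier V. \<zero>\<^bsub>W\<^esub>) \<in> H"
    and add: "\<And>f g. \<lbrakk>f \<in> H; g \<in> H\<rbrakk> \<Longrightarrow> (\<lambda>x \<in> carrier V. f x \<oplus>\<^bsub>W\<^esub> g x) \<in> H"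
    and smult: "\<And>a f. \<lbrakk>a \<in> carrier K; f \<in> H\<rbrakk> \<Longrightarrow> (\<lambda>x \<in> carrier V. a \<odot>\<^bsub>W\<^esub> f x) \<in> H"
  shows "module K \<lparr>carrier = H \<inter> extensional (carrier V), mult = undefined, one = undefined,
         zero = (\<lambda>x \<in> carrier V. \<zero>\<^bsub>W\<^esub>),
         add = (\<lambda>f g. \<lambda>x \<in> carrier V. f x \<oplus>\<^bsub>W\<^esub> g x),
         smult = (\<lambda>a f. \<lambda>x \<in> carrier V. a \<odot>\<^bsub>W\<^esub> f x)\<rparr>" (is "module K ?M")
proof (rule moduleI)
  interpret W: module K W by fact
  have cl: "f x \<in> carrier W" if "f \<in> H" "x \<in> carrier V" for f x using lin_closed H that by blast
  show "cring K" by unfold_locales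
  show "abelian_group ?M"
  proof (rule abelian_groupI)
    fix f assume f: "f \<in> carrier ?M"
    let ?g = "\<lambda>x \<in> carrier V. (\<ominus>\<^bsub>K\<^esub> \<one>\<^bsub>K\<^esub>) \<odot>\<^bsub>W\<^esub> f x"
    have "(\<ominus>\<^bsub>K\<^esub> \<one>\<^bsub>K\<^esub>) \<odot>\<^bsub>W\<^esub> y \<oplus>\<^bsub>W\<^esub> y = \<zero>\<^bsub>W\<^esub>" if "y \<in> carrier W" for y
      using W.smult_l_distr[of "\<ominus>\<^bsub>K\<^esub> \<one>\<^bsub>K\<^esub>" "\<one>\<^bsub>K\<^esub>" y] that by (simp add: l_neg)
    then show "\<exists>g\<in>carrier ?M. g \<oplus>\<^bsub>?M\<^esub> f = \<zero>\<^bsub>?M\<^esub>"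
      using f smult[of "\<ominus>\<^bsub>K\<^esub> \<one>\<^bsub>K\<^esub>" f] by (intro bexI[of _ ?g]) (auto simp: cl fun_eq_iff restrict_def extensional_def)
  qed (auto simp: zero[unfolded restrict_def] add[unfolded restrict_def] cl W.a_ac fun_eq_iff restrict_def extensional_def)
  show "a \<odot>\<^bsub>?M\<^esub> f \<in> carrier ?M" if "a \<in> carrier K" "f \<in> carrier ?M" for a f
    using that smult by auto
  show "(a \<oplus>\<^bsub>K\<^esub> b) \<odot>\<^bsub>?M\<^esub> f = (a \<odot>\<^bsub>?M\<^esub> f) \<oplus>\<^bsub>?M\<^esub> (b \<odot>\<^bsub>?M\<^esub> f)"
    if "a \<in> carrier K" "b \<in> carrier K" "f \<in> carrier ?M" for a b f
    using that by (auto simp: cl W.smult_l_distr)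
  show "a \<odot>\<^bsub>?M\<^esub> (f \<oplus>\<^bsub>?M\<^esub> g) = (a \<odot>\<^bsub>?M\<^esub> f) \<oplus>\<^bsub>?M\<^esub> (a \<odot>\<^bsub>?M\<^esub> g)"
    if "a \<in> carrier K" "f \<in> carrier ?M" "g \<in> carrier ?M" for a f g
    using that by (auto simp: cl W.smult_r_distr)
  show "a \<otimes>\<^bsub>K\<^esub> b \<odot>\<^bsub>?M\<^esub> f = a \<odot>\<^bsub>?M\<^esub> (b \<odot>\<^bsub>?M\<^esub> f)"
    if "a \<in> carrier K" "b \<in> carrier K" "f \<in> carrier ?M" for a b f
    using that by (auto simp: cl W.smult_assoc1)
  show "\<one>\<^bsub>K\<^esub> \<odot>\<^bsub>?M\<^esub> f = f" if "f \<in> carrier ?M" for f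
    using that by (auto simp: cl fun_eq_iff restrict_def extensional_def)
qed

text \<open>A single construction for vector spaces with linear maps and for comodules with colinear
  maps.\<close>

lemma concrete_linear_category:
  assumes Ob: "\<And>V. V \<in> Ob \<Longrightarrow> module K V"
    and H: "\<And>V W. \<lbrakk>V \<in> Ob; W \<in> Ob\<rbrakk> \<Longrightarrow> H V W \<subseteq> lin K V W"
    and zero: "\<And>V W. \<lbrakk>V \<in> Ob; W \<in> Ob\<rbrakk> \<Longrightarrow> (\<lambda>x \<in> carrier V. \<zero>\<^bsub>W\<^esub>) \<in> H V W"
    and add: "\<And>V W f g. \<lbrakk>V \<in> Ob; W \<in> Ob; f \<in> H V W; g \<in> H V W\<rbrakk> \<Longrightarrow> (\<lambda>x \<in> carrier V. f x \<oplus>\<^bsub>W\<^esub> g x) \<in> H V W"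
    and smult: "\<And>V W a f. \<lbrakk>V \<in> Ob; W \<in> Ob; a \<in> carrier K; f \<in> H V W\<rbrakk> \<Longrightarrow> (\<lambda>x \<in> carrier V. a \<odot>\<^bsub>W\<^esub> f x) \<in> H V W"
    and ident: "\<And>V. V \<in> Ob \<Longrightarrow> (\<lambda>x \<in> carrier V. x) \<in> H V V"
    and comp: "\<And>U V W f g. \<lbrakk>U \<in> Ob; V \<in> Ob; W \<in> Ob; f \<in> H U V; g \<in> H V W\<rbrakk> \<Longrightarrow> compose (carrier U) g f \<in> H U W"
  shows "linear_category K (concrete_category Ob H)"
proof -
  have L: "f \<in> lin K V W" if "f \<in> H V W" "V \<in> Ob" "W \<in> Ob" for f V W using H that by blast
  have mod: "module K (Hom (concrete_category Ob H) V W)" if "V \<in> Ob" "W \<in> Ob" for V W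
    unfolding concrete_category_def kcat.select_convs
    by (intro arrow_module_module lin_module) (use that Ob H zero add smult in auto)
  show ?thesis
    by (rule linear_category.intro)
      (auto simp: mod ident comp Hom_concrete_category compose_def fun_eq_iff restrict_def extensional_def
        lin_closed[OF L] lin_add[OF L] lin_smult[OF L] comp[unfolded compose_def restrict_def] ident[unfolded restrict_def])
qed

text \<open>Carries the category laws from a concrete category to the monoidal record that extends
  it.\<close>

lemma linear_category_cong:
  assumes "linear_category K C"
    and "Obj D = Obj C" "Dom D = Dom C" "Cod D = Cod C" "Hom D = Hom C" "Comp D = Comp C" "Ident D = Ident C"
  shows "linear_category K D"
proof -
  have "arr D = arr C" by (simp add: fun_eq_iff arr_def assms)
  then show ?thesis using assms(1) unfolding linear_category_def assms(2-) by simp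
qed

lemma lin_of_maps [simp]:
  "\<lbrakk>h \<in> lin K X (tensor K V W); f \<in> lin K V V'; g \<in> lin K W W'; module K V; module K W; module K V'; module K W'\<rbrakk>
    \<Longrightarrow> (\<lambda>x. tmap K V W V' W' f g (h x)) \<in> lin K X (tensor K V' W')"
  "\<lbrakk>h \<in> lin K X (tensor K (tensor K U V) W); module K U; module K V; module K W\<rbrakk>
    \<Longrightarrow> (\<lambda>x. tassoc K U V W (h x)) \<in> lin K X (tensor K U (tensor K V W))"
  "\<lbrakk>h \<in> lin K X (tensor K (ground K) V); module K V\<rbrakk> \<Longrightarrow> (\<lambda>x. tlunit K V (h x)) \<in> lin K X V"
  "\<lbrakk>h \<in> lin K X (tensor K V (ground K)); module K V\<rbrakk> \<Longrightarrow> (\<lambda>x. trunit K V (h x)) \<in> lin K X V"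
  by (rule lin_compose; simp)+

lemma maps_closed [simp]:
  "\<lbrakk>x \<in> carrier (tensor K V W); f \<in> lin K V V'; g \<in> lin K W W'; module K V; module K W; module K V'; module K W'\<rbrakk>
    \<Longrightarrow> tmap K V W V' W' f g x \<in> carrier (tensor K V' W')"
  "\<lbrakk>x \<in> carrier (tensor K (tensor K U V) W); module K U; module K V; module K W\<rbrakk>
    \<Longrightarrow> tassoc K U V W x \<in> carrier (tensor K U (tensor K V W))"
  "\<lbrakk>x \<in> carrier (tensor K U (tensor K V W)); module K U; module K V; module K W\<rbrakk>
    \<Longrightarrow> tassoc_inv U V W x \<in> carrier (tensor K (tensor K U V) W)"
  "\<lbrakk>x \<in> carrier (tensor K (ground K) V); module K V\<rbrakk> \<Longrightarrow> tlunit K V x \<in> carrier V"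
  "\<lbrakk>x \<in> carrier (tensor K V (ground K)); module K V\<rbrakk> \<Longrightarrow> trunit K V x \<in> carrier V"
proof -
  show "\<lbrakk>x \<in> carrier (tensor K V W); f \<in> lin K V V'; g \<in> lin K W W'; module K V; module K W; module K V'; module K W'\<rbrakk>
    \<Longrightarrow> tmap K V W V' W' f g x \<in> carrier (tensor K V' W')"
    by (rule lin_closed[OF tmap_lin])
  show "\<lbrakk>x \<in> carrier (tensor K (tensor K U V) W); module K U; module K V; module K W\<rbrakk>
    \<Longrightarrow> tassoc K U V W x \<in> carrier (tensor K U (tensor K V W))"
    by (rule lin_closed[OF tassoc_lin])
  show "\<lbrakk>x \<in> carrier (tensor K U (tensor K V W)); module K U; module K V; module K W\<rbrakk>
    \<Longrightarrow> tassoc_inv U V W x \<in> carrier (tensor K (tensor K U V) W)"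
    by (rule lin_closed[OF tassoc_inv_lin])
  show "\<lbrakk>x \<in> carrier (tensor K (ground K) V); module K V\<rbrakk> \<Longrightarrow> tlunit K V x \<in> carrier V"
    by (rule lin_closed[OF tlunit_lin])
  show "\<lbrakk>x \<in> carrier (tensor K V (ground K)); module K V\<rbrakk> \<Longrightarrow> trunit K V x \<in> carrier V"
    by (rule lin_closed[OF trunit_lin])
qed

lemma maps_extensional [simp]:
  "tmap K V W V' W' f g \<in> extensional (carrier (tensor K V W))"
  "tassoc K U V W \<in> extensional (carrier (tensor K (tensor K U V) W))"
  "tassoc_inv U V W \<in> extensional (carrier (tensor K U (tensor K V W)))"
  "tlunit K V \<in> extensional (carrier (tensor K (ground K) V))"
  "trunit K V \<in> extensional (carrier (tensor K V (ground K)))"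
  by (simp_all add: tmap_def tassoc_def tassoc_inv_def tlunit_def trunit_def Let_def)

lemma lin_eq_on_tensor4:
  assumes "f \<in> lin K (tensor K (tensor K (tensor K N P) Q) R) U" "g \<in> lin K (tensor K (tensor K (tensor K N P) Q) R) U"
    and mods [simp]: "module K N" "module K P" "module K Q" "module K R" "module K U"
    and eq: "\<And>n p q r. \<lbrakk>n \<in> carrier N; p \<in> carrier P; q \<in> carrier Q; r \<in> carrier R\<rbrakk>
          \<Longrightarrow> f (pure K (tensor K (tensor K N P) Q) R (pure K (tensor K N P) Q (pure K N P n p) q) r)
            = g (pure K (tensor K (tensor K N P) Q) R (pure K (tensor K N P) Q (pure K N P n p) q) r)"
    and x: "x \<in> carrier (tensor K (tensor K (tensor K N P) Q) R)"
  shows "f x = g x"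
proof (rule lin_eq_on_tensor[OF _ _ assms(1,2) _ _ x])
  fix y r assume r: "r \<in> carrier R" and y: "y \<in> carrier (tensor K (tensor K N P) Q)"
  show "f (pure K (tensor K (tensor K N P) Q) R y r) = g (pure K (tensor K (tensor K N P) Q) R y r)"
    by (rule lin_eq_on_tensor3'[where f="\<lambda>y. f (pure K (tensor K (tensor K N P) Q) R y r)"
          and g="\<lambda>y. g (pure K (tensor K (tensor K N P) Q) R y r)" and U=U, OF _ _ _ _ _ _ _ y])
      (use r eq in \<open>auto intro!: lin_compose[OF assms(1)] lin_compose[OF assms(2)]\<close>)
qed simp_all

lemma Vec_linear: "linear_category K (Vec K)"
  unfolding Vec_def by (rule concrete_linear_category) (auto simp: lin_pointwise intro: lin_compose')

lemma Vec_simps [simp]: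
  "Obj (Vec K) = {V. module K V}" "Dom (Vec K) = src" "Cod (Vec K) = tgt"
  "Comp (Vec K) g f = Arrow (src f) (tgt g) (compose (carrier (src f)) (mor g) (mor f))"
  "Ident (Vec K) V = Arrow V V (\<lambda>x \<in> carrier V. x)"
  by (simp_all add: Vec_def)

lemma is_arr_Vec [simp]: "is_arr (Vec K) f \<longleftrightarrow> module K (src f) \<and> module K (tgt f) \<and>
    mor f \<in> lin K (src f) (tgt f) \<and> mor f \<in> extensional (carrier (src f))"
  by (cases f) (auto simp: is_arr_def Vec_def)

end

lemma arrow_eqI:
  "\<lbrakk>src f = src g; tgt f = tgt g; \<And>x. x \<in> carrier (src g) \<Longrightarrow> mor f x = mor g x;
     mor f \<in> extensional (carrier (src f)); mor g \<in> extensional (carrier (src g))\<rbrakk> \<Longrightarrow> f = g"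
  by (cases f; cases g) (auto intro: extensionalityI)

lemma compose_extensional' [simp]: "compose A g f \<in> extensional A"
  by (simp add: compose_def)

section \<open>The monoidal category of comodules and its action on vector spaces\<close>

lemma monoidal_categoryI:
  assumes V: "linear_category K V" and bif: "linear_bifunctor K V V V (Tens V) (TensA V)"
    and "Unit V \<in> Obj V"
    and "\<And>X Y Z. \<lbrakk>X \<in> Obj V; Y \<in> Obj V; Z \<in> Obj V\<rbrakk> \<Longrightarrow> iso_arr V (Assoc V X Y Z) \<and>
          Dom V (Assoc V X Y Z) = Tens V (Tens V X Y) Z \<and> Cod V (Assoc V X Y Z) = Tens V X (Tens V Y Z)"
    and "\<And>X. X \<in> Obj V \<Longrightarrow> iso_arr V (LUnit V X) \<and> Dom V (LUnit V X) = Tens V (Unit V) X \<and> Cod V (LUnit V X) = X"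
    and "\<And>X. X \<in> Obj V \<Longrightarrow> iso_arr V (RUnit V X) \<and> Dom V (RUnit V X) = Tens V X (Unit V) \<and> Cod V (RUnit V X) = X"
    and n: "\<And>f g h. \<lbrakk>is_arr V f; is_arr V g; is_arr V h\<rbrakk>
          \<Longrightarrow> Assoc V (Cod V f) (Cod V g) (Cod V h) \<cdot>\<^bsub>V\<^esub> TensA V (TensA V f g) h
            = TensA V f (TensA V g h) \<cdot>\<^bsub>V\<^esub> Assoc V (Dom V f) (Dom V g) (Dom V h)"
    and l: "\<And>f. is_arr V f \<Longrightarrow> LUnit V (Cod V f) \<cdot>\<^bsub>V\<^esub> TensA V (Ident V (Unit V)) f = f \<cdot>\<^bsub>V\<^esub> LUnit V (Dom V f)"
    and r: "\<And>f. is_arr V f \<Longrightarrow> RUnit V (Cod V f) \<cdot>\<^bsub>V\<^esub> TensA V f (Ident V (Unit V)) = f \<cdot>\<^bsub>V\<^esub> RUnit V (Dom V f)"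
    and "\<And>W X Y Z. \<lbrakk>W \<in> Obj V; X \<in> Obj V; Y \<in> Obj V; Z \<in> Obj V\<rbrakk>
          \<Longrightarrow> TensA V (Ident V W) (Assoc V X Y Z) \<cdot>\<^bsub>V\<^esub>
                (Assoc V W (Tens V X Y) Z \<cdot>\<^bsub>V\<^esub> TensA V (Assoc V W X Y) (Ident V Z))
            = Assoc V W X (Tens V Y Z) \<cdot>\<^bsub>V\<^esub> Assoc V (Tens V W X) Y Z"
    and "\<And>X Y. \<lbrakk>X \<in> Obj V; Y \<in> Obj V\<rbrakk>
          \<Longrightarrow> TensA V (Ident V X) (LUnit V Y) \<cdot>\<^bsub>V\<^esub> Assoc V X (Unit V) Y = TensA V (RUnit V X) (Ident V Y)"
  shows "monoidal_category K V"
proof -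
  interpret V: linear_category K V by fact
  interpret linear_bifunctor K V V V "Tens V" "TensA V" by fact
  show ?thesis
  proof
    fix X X' Y Y' Z Z' f g h
    assume O: "X \<in> Obj V" "X' \<in> Obj V" "Y \<in> Obj V" "Y' \<in> Obj V" "Z \<in> Obj V" "Z' \<in> Obj V"
      and f: "f \<in> arr V X X'" and g: "g \<in> arr V Y Y'" and h: "h \<in> arr V Z Z'"
    show "Assoc V X' Y' Z' \<cdot>\<^bsub>V\<^esub> TensA V (TensA V f g) h = TensA V f (TensA V g h) \<cdot>\<^bsub>V\<^esub> Assoc V X Y Z"
      using n[of f g h] V.is_arrI[OF f O(1,2)] V.is_arrI[OF g O(3,4)] V.is_arrI[OF h O(5,6)] by simp
  next
    fix X X' f assume O: "X \<in> Obj V" "X' \<in> Obj V" and f: "f \<in> arr V X X'"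
    show "LUnit V X' \<cdot>\<^bsub>V\<^esub> TensA V (Ident V (Unit V)) f = f \<cdot>\<^bsub>V\<^esub> LUnit V X"
      using l[of f] V.is_arrI[OF f O] by simp
    show "RUnit V X' \<cdot>\<^bsub>V\<^esub> TensA V f (Ident V (Unit V)) = f \<cdot>\<^bsub>V\<^esub> RUnit V X"
      using r[of f] V.is_arrI[OF f O] by simp
  qed (use assms in \<open>auto simp: V.is_iso_iff\<close>)
qed

lemma Comod_simps [simp]:
  "Obj (Comod K B) = {M. left_comodule K B M}" "Dom (Comod K B) = src" "Cod (Comod K B) = tgt"
  "Comp (Comod K B) g f = Arrow (src f) (tgt g) (compose (carrier (src f)) (mor g) (mor f))"
  "Ident (Comod K B) V = Arrow V V (\<lambda>x \<in> carrier V. x)"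
  "Tens (Comod K B) = comod_tensor K B" "Unit (Comod K B) = comod_unit K B"
  "TensA (Comod K B) f g = Arrow (comod_tensor K B (src f) (src g)) (comod_tensor K B (tgt f) (tgt g))
          (tmap K (src f) (src g) (tgt f) (tgt g) (mor f) (mor g))"
  "Assoc (Comod K B) M N P = Arrow (comod_tensor K B (comod_tensor K B M N) P)
          (comod_tensor K B M (comod_tensor K B N P)) (tassoc K M N P)"
  "LUnit (Comod K B) M = Arrow (comod_tensor K B (comod_unit K B) M) M (tlunit K M)"
  "RUnit (Comod K B) M = Arrow (comod_tensor K B M (comod_unit K B)) M (trunit K M)"
  "Hom (Comod K B) = Hom (concrete_category {M. left_comodule K B M} (colin K B))"
  "arr (Comod K B) M N = Arrow M N ` (colin K B M N \<inter> extensional (carrier M))"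
  by (simp_all add: Comod_def concrete_category_def kcat.defs moncat.defs arr_def)

context bialgebra
begin

lemma pure_zero [simp]:
  assumes "module K V" "module K W" "v \<in> carrier V"
  shows "pure K V W v \<zero>\<^bsub>W\<^esub> = \<zero>\<^bsub>tensor K V W\<^esub>"
  by (rule lin_zero[where f="pure K V W v"]) (use assms lin_pure_right[OF lin_ident, of v V W] in simp_all)

lemma colin_restrictI:
  assumes [simp]: "comodule M" "comodule N" and f: "f \<in> colin K B M N"
  shows "restrict f (carrier M) \<in> colin K B M N"
  using f by (simp add: colin_iff)

text \<open>Sums and scalar multiples of colinear maps are colinear because coactions are
  linear.\<close>

lemma Comod_linear: "linear_category K (Comod K B)"
proof -
  interpret C: linear_category K "concrete_category {M. comodule M} (colin K B)"
  proof (rule concrete_linear_category)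
    show "colin K B M N \<subseteq> lin K M N" for M N by (auto simp: colin_lin)
    show "compose (carrier L) g f \<in> colin K B L N"
      if "L \<in> {M. comodule M}" "M \<in> {M. comodule M}" "N \<in> {M. comodule M}" "f \<in> colin K B L M" "g \<in> colin K B M N" for L M N f g
      using colin_restrictI[OF _ _ colin_compose[of L M N f g]] that by (simp add: compose_def)
  next
    fix M N assume "M \<in> {M. comodule M}" "N \<in> {M. comodule M}"
    then have MN [simp]: "comodule M" "comodule N" by simp_all
    interpret N: module K N by simp
    interpret T: module K "tensor K B N" by simp
    show "(\<lambda>x\<in>carrier M. \<zero>\<^bsub>N\<^esub>) \<in> colin K B M N"
      by (rule colin_restrictI[OF MN], rule colinI)
        (simp_all add: lin_pointwise lin_zero[OF coact_lin])
    fix f assume f: "f \<in> colin K B M N"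
    note fs [simp] = lin_closed[OF colin_lin[OF f]] colin_lin[OF f]
    have [simp]: "(\<lambda>n. f n) \<in> lin K M N" using colin_lin[OF f] .
    show "(\<lambda>x\<in>carrier M. f x \<oplus>\<^bsub>N\<^esub> g x) \<in> colin K B M N" if g: "g \<in> colin K B M N" for g
    proof (rule colin_restrictI[OF MN], rule colinI)
      note [simp] = lin_closed[OF colin_lin[OF g]] colin_lin[OF g]
      show "(\<lambda>x. f x \<oplus>\<^bsub>N\<^esub> g x) \<in> lin K M N" by (rule lin_pointwise) simp_all
      fix m assume [simp]: "m \<in> carrier M"
      show "coact N (f m \<oplus>\<^bsub>N\<^esub> g m) = sweedler B M (tensor K B N) (coact M m) (\<lambda>b n. pure K B N b (f n \<oplus>\<^bsub>N\<^esub> g n))"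
        by (simp add: pure_add_right sweedler_add_body lin_add[OF coact_lin] colin_coact[OF f] colin_coact[OF g])
    qed simp_all
    show "(\<lambda>x\<in>carrier M. a \<odot>\<^bsub>N\<^esub> f x) \<in> colin K B M N" if a [simp]: "a \<in> carrier K" for a
    proof (rule colin_restrictI[OF MN], rule colinI)
      fix m assume [simp]: "m \<in> carrier M"
      show "coact N (a \<odot>\<^bsub>N\<^esub> f m) = sweedler B M (tensor K B N) (coact M m) (\<lambda>b n. pure K B N b (a \<odot>\<^bsub>N\<^esub> f n))"
        by (simp add: lin_smult[OF coact_lin] colin_coact[OF f] flip: smult_sweedler_right)
    qed simp_all
  qed (auto intro: colin_restrictI colin_ident)
  show ?thesis
    by (rule linear_category_cong[OF C.linear_category_axioms]) (simp_all add: Comod_def kcat.defs fun_eq_iff)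
qed

lemma is_arr_Comod [simp]: "is_arr (Comod K B) f \<longleftrightarrow> comodule (src f) \<and> comodule (tgt f) \<and>
    mor f \<in> colin K B (src f) (tgt f) \<and> mor f \<in> extensional (carrier (src f))"
  by (cases f) (auto simp: is_arr_def)


lemma colin_id_restrict [simp]: "comodule M \<Longrightarrow> (\<lambda>x\<in>carrier M. x) \<in> colin K B M M"
  by (rule colin_restrictI) (simp_all add: colin_ident)

lemma colin_lin' [simp]: "f \<in> colin K B M N \<Longrightarrow> f \<in> lin K M N"
  by (rule colin_lin)

lemma colin_compose':
  "\<lbrakk>comodule L; comodule M; comodule N; f \<in> colin K B L M; g \<in> colin K B M N\<rbrakk> \<Longrightarrow> compose (carrier L) g f \<in> colin K B L N"
  using colin_restrictI[OF _ _ colin_compose[of L M N f g]] by (simp add: compose_def)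

lemma tmap_compose:
  assumes "f \<in> lin K V V'" "g \<in> lin K W W'" "f' \<in> lin K V' V''" "g' \<in> lin K W' W''"
    "module K V" "module K W" "module K V'" "module K W'" "module K V''" "module K W''"
  shows "tmap K V W V'' W'' (compose (carrier V) f' f) (compose (carrier W) g' g)
    = compose (carrier (tensor K V W)) (tmap K V' W' V'' W'' f' g') (tmap K V W V' W' f g)"
proof (rule extensionalityI[where A="carrier (tensor K V W)"])
  fix x assume x: "x \<in> carrier (tensor K V W)"
  note [simp] = assms lin_closed[OF assms(1)] lin_closed[OF assms(2)] lin_closed[OF assms(3)] lin_closed[OF assms(4)]
    lin_comp_simp[OF assms(3)] lin_comp_simp[OF assms(4)]
  show "tmap K V W V'' W'' (compose (carrier V) f' f) (compose (carrier W) g' g) x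
    = compose (carrier (tensor K V W)) (tmap K V' W' V'' W'' f' g') (tmap K V W V' W' f g) x"
    using x by (simp add: compose_def tmap_sweedler cong: sweedler_cong)
qed simp_all

context
  fixes V :: "('a univ, 'a univ, 'x) module_scheme" and W :: "('a univ, 'a univ, 'y) module_scheme"
    and V' :: "('a univ, 'a univ, 'x) module_scheme" and W' :: "('a univ, 'a univ, 'y) module_scheme" and f g
  assumes f: "f \<in> lin K V V'" and g: "g \<in> lin K W W'"
    and mods: "module K V" "module K W" "module K V'" "module K W'"
begin

private lemmas facts = f g lin_closed[OF f] lin_closed[OF g] mods

lemma tmap_add_left:
  assumes f': "f' \<in> lin K V V'"
  shows "tmap K V W V' W' (\<lambda>x \<in> carrier V. f x \<oplus>\<^bsub>V'\<^esub> f' x) g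
      = (\<lambda>x \<in> carrier (tensor K V W). tmap K V W V' W' f g x \<oplus>\<^bsub>tensor K V' W'\<^esub> tmap K V W V' W' f' g x)"
  by (rule extensionalityI[where A="carrier (tensor K V W)"])
    (simp_all add: facts tmap_sweedler pure_add_left sweedler_add_body lin_closed[OF f'])

lemma tmap_add_right:
  assumes g': "g' \<in> lin K W W'"
  shows "tmap K V W V' W' f (\<lambda>x \<in> carrier W. g x \<oplus>\<^bsub>W'\<^esub> g' x)
      = (\<lambda>x \<in> carrier (tensor K V W). tmap K V W V' W' f g x \<oplus>\<^bsub>tensor K V' W'\<^esub> tmap K V W V' W' f g' x)"
  by (rule extensionalityI[where A="carrier (tensor K V W)"])
    (simp_all add: facts tmap_sweedler pure_add_right sweedler_add_body lin_closed[OF g'])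

lemma tmap_smult_left:
  "a \<in> carrier K \<Longrightarrow> tmap K V W V' W' (\<lambda>x \<in> carrier V. a \<odot>\<^bsub>V'\<^esub> f x) g
      = (\<lambda>x \<in> carrier (tensor K V W). a \<odot>\<^bsub>tensor K V' W'\<^esub> tmap K V W V' W' f g x)"
  by (rule extensionalityI[where A="carrier (tensor K V W)"]) (simp_all add: facts tmap_sweedler)

lemma tmap_smult_right:
  "a \<in> carrier K \<Longrightarrow> tmap K V W V' W' f (\<lambda>x \<in> carrier W. a \<odot>\<^bsub>W'\<^esub> g x)
      = (\<lambda>x \<in> carrier (tensor K V W). a \<odot>\<^bsub>tensor K V' W'\<^esub> tmap K V W V' W' f g x)"
  by (rule extensionalityI[where A="carrier (tensor K V W)"]) (simp_all add: facts tmap_sweedler)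

end

lemma tmap_ident:
  assumes [simp]: "module K V" "module K W"
  shows "tmap K V W V W (\<lambda>x \<in> carrier V. x) (\<lambda>x \<in> carrier W. x) = (\<lambda>x \<in> carrier (tensor K V W). x)"
  by (rule extensionalityI[where A="carrier (tensor K V W)"]) (simp_all add: tmap_sweedler)

lemma Vec_Hom:
  "f \<oplus>\<^bsub>Hom (Vec K) V W\<^esub> g = Arrow V W (\<lambda>x \<in> carrier V. mor f x \<oplus>\<^bsub>W\<^esub> mor g x)"
  "a \<odot>\<^bsub>Hom (Vec K) V W\<^esub> f = Arrow V W (\<lambda>x \<in> carrier V. a \<odot>\<^bsub>W\<^esub> mor f x)"
  "arr (Vec K) V W = Arrow V W ` (lin K V W \<inter> extensional (carrier V))"
  unfolding Vec_def Hom_concrete_category arr_concrete_category by (rule HOL.refl)+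

lemma Comod_bifunctor: "linear_bifunctor K (Comod K B) (Comod K B) (Comod K B) (Tens (Comod K B)) (TensA (Comod K B))"
proof (rule linear_bifunctorI)
  fix g g' f f'
  assume a: "is_arr (Comod K B) g" "is_arr (Comod K B) g'" "is_arr (Comod K B) f" "is_arr (Comod K B) f'"
    "Dom (Comod K B) g' = Cod (Comod K B) g" "Dom (Comod K B) f' = Cod (Comod K B) f"
  show "TensA (Comod K B) (g' \<cdot>\<^bsub>Comod K B\<^esub> g) (f' \<cdot>\<^bsub>Comod K B\<^esub> f)
     = TensA (Comod K B) g' f' \<cdot>\<^bsub>Comod K B\<^esub> TensA (Comod K B) g f"
  proof -
    have "mor g \<in> lin K (src g) (tgt g)" "mor f \<in> lin K (src f) (tgt f)" "mor g' \<in> lin K (tgt g) (tgt g')"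
      "mor f' \<in> lin K (tgt f) (tgt f')"
      using a by simp_all
    then have "tmap K (src g) (src f) (tgt g') (tgt f') (compose (carrier (src g)) (mor g') (mor g)) (compose (carrier (src f)) (mor f') (mor f))
      = compose (carrier (tensor K (src g) (src f))) (tmap K (tgt g) (tgt f) (tgt g') (tgt f') (mor g') (mor f'))
         (tmap K (src g) (src f) (tgt g) (tgt f) (mor g) (mor f))"
      by (rule tmap_compose) (use a in simp_all)
    then show ?thesis using a(5,6) by simp
  qed
next
  fix W W' X X' g f
  assume "W \<in> Obj (Comod K B)" "W' \<in> Obj (Comod K B)" "X \<in> Obj (Comod K B)" "X' \<in> Obj (Comod K B)"
    "g \<in> arr (Comod K B) W W'" "f \<in> arr (Comod K B) X X'"
  then obtain g0 f0 where [simp]: "g = Arrow W W' g0" "f = Arrow X X' f0" "g0 \<in> colin K B W W'" "f0 \<in> colin K B X X'"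
    "comodule W" "comodule W'" "comodule X" "comodule X'" by auto
  show "TensA (Comod K B) (g \<oplus>\<^bsub>Hom (Comod K B) W W'\<^esub> g') f = TensA (Comod K B) g f
      \<oplus>\<^bsub>Hom (Comod K B) (Tens (Comod K B) W X) (Tens (Comod K B) W' X')\<^esub> TensA (Comod K B) g' f"
    if g': "g' \<in> arr (Comod K B) W W'" for g'
  proof -
    obtain g0' where [simp]: "g' = Arrow W W' g0'" "g0' \<in> colin K B W W'" using g' by auto
    show ?thesis by (simp add: Hom_concrete_category tmap_add_left)
  qed
  show "TensA (Comod K B) g (f \<oplus>\<^bsub>Hom (Comod K B) X X'\<^esub> f') = TensA (Comod K B) g f
      \<oplus>\<^bsub>Hom (Comod K B) (Tens (Comod K B) W X) (Tens (Comod K B) W' X')\<^esub> TensA (Comod K B) g f'"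
    if f': "f' \<in> arr (Comod K B) X X'" for f'
  proof -
    obtain f0' where [simp]: "f' = Arrow X X' f0'" "f0' \<in> colin K B X X'" using f' by auto
    show ?thesis by (simp add: Hom_concrete_category tmap_add_right)
  qed
  show "TensA (Comod K B) (a \<odot>\<^bsub>Hom (Comod K B) W W'\<^esub> g) f =
      a \<odot>\<^bsub>Hom (Comod K B) (Tens (Comod K B) W X) (Tens (Comod K B) W' X')\<^esub> TensA (Comod K B) g f"
    "TensA (Comod K B) g (a \<odot>\<^bsub>Hom (Comod K B) X X'\<^esub> f) =
      a \<odot>\<^bsub>Hom (Comod K B) (Tens (Comod K B) W X) (Tens (Comod K B) W' X')\<^esub> TensA (Comod K B) g f"
    if "a \<in> carrier K" for a
    using that by (simp_all add: Hom_concrete_category tmap_smult_left tmap_smult_right)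
qed (simp_all add: Comod_linear tmap_colin tmap_ident)

lemma fiber_action_simps [simp]:
  "Act (fiber_action K) = tensor K"
  "ActA (fiber_action K) g f = Arrow (tensor K (src g) (src f)) (tensor K (tgt g) (tgt f))
        (tmap K (src g) (src f) (tgt g) (tgt f) (mor g) (mor f))"
  "AAssoc (fiber_action K) W W' V = Arrow (tensor K (tensor K W W') V) (tensor K W (tensor K W' V)) (tassoc K W W' V)"
  "AUnit (fiber_action K) V = Arrow (tensor K (ground K) V) V (tlunit K V)"
  by (simp_all add: fiber_action_def)

lemma fiber_bifunctor: "linear_bifunctor K (Comod K B) (Vec K) (Vec K) (Act (fiber_action K)) (ActA (fiber_action K))"
proof (rule linear_bifunctorI)
  fix g g' f f'
  assume a: "is_arr (Comod K B) g" "is_arr (Comod K B) g'" "is_arr (Vec K) f" "is_arr (Vec K) f'"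
    "Dom (Comod K B) g' = Cod (Comod K B) g" "Dom (Vec K) f' = Cod (Vec K) f"
  show "ActA (fiber_action K) (g' \<cdot>\<^bsub>Comod K B\<^esub> g) (f' \<cdot>\<^bsub>Vec K\<^esub> f)
     = ActA (fiber_action K) g' f' \<cdot>\<^bsub>Vec K\<^esub> ActA (fiber_action K) g f"
  proof -
    have "mor g \<in> lin K (src g) (tgt g)" "mor f \<in> lin K (src f) (tgt f)" "mor g' \<in> lin K (tgt g) (tgt g')"
      "mor f' \<in> lin K (tgt f) (tgt f')"
      using a by simp_all
    then have "tmap K (src g) (src f) (tgt g') (tgt f') (compose (carrier (src g)) (mor g') (mor g)) (compose (carrier (src f)) (mor f') (mor f))
      = compose (carrier (tensor K (src g) (src f))) (tmap K (tgt g) (tgt f) (tgt g') (tgt f') (mor g') (mor f'))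
         (tmap K (src g) (src f) (tgt g) (tgt f) (mor g) (mor f))"
      by (rule tmap_compose) (use a in simp_all)
    then show ?thesis using a(5,6) by simp
  qed
next
  fix W W' X X' g f
  assume "W \<in> Obj (Comod K B)" "W' \<in> Obj (Comod K B)" "X \<in> Obj (Vec K)" "X' \<in> Obj (Vec K)"
    "g \<in> arr (Comod K B) W W'" "f \<in> arr (Vec K) X X'"
  then obtain g0 f0 where [simp]: "g = Arrow W W' g0" "f = Arrow X X' f0" "g0 \<in> colin K B W W'" "f0 \<in> lin K X X'"
    "comodule W" "comodule W'" "module K X" "module K X'" by (auto simp: Vec_Hom)
  show "ActA (fiber_action K) (g \<oplus>\<^bsub>Hom (Comod K B) W W'\<^esub> g') f = ActA (fiber_action K) g f
      \<oplus>\<^bsub>Hom (Vec K) (Act (fiber_action K) W X) (Act (fiber_action K) W' X')\<^esub> ActA (fiber_action K) g' f"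
    if g': "g' \<in> arr (Comod K B) W W'" for g'
  proof -
    obtain g0' where [simp]: "g' = Arrow W W' g0'" "g0' \<in> colin K B W W'" using g' by (auto simp: Vec_Hom)
    show ?thesis by (simp add: Hom_concrete_category Vec_Hom tmap_add_left)
  qed
  show "ActA (fiber_action K) g (f \<oplus>\<^bsub>Hom (Vec K) X X'\<^esub> f') = ActA (fiber_action K) g f
      \<oplus>\<^bsub>Hom (Vec K) (Act (fiber_action K) W X) (Act (fiber_action K) W' X')\<^esub> ActA (fiber_action K) g f'"
    if f': "f' \<in> arr (Vec K) X X'" for f'
  proof -
    obtain f0' where [simp]: "f' = Arrow X X' f0'" "f0' \<in> lin K X X'" using f' by (auto simp: Vec_Hom)
    show ?thesis by (simp add: Hom_concrete_category Vec_Hom tmap_add_right)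
  qed
  show "ActA (fiber_action K) (a \<odot>\<^bsub>Hom (Comod K B) W W'\<^esub> g) f =
      a \<odot>\<^bsub>Hom (Vec K) (Act (fiber_action K) W X) (Act (fiber_action K) W' X')\<^esub> ActA (fiber_action K) g f"
    "ActA (fiber_action K) g (a \<odot>\<^bsub>Hom (Vec K) X X'\<^esub> f) =
      a \<odot>\<^bsub>Hom (Vec K) (Act (fiber_action K) W X) (Act (fiber_action K) W' X')\<^esub> ActA (fiber_action K) g f"
    if "a \<in> carrier K" for a
    using that by (simp_all add: Hom_concrete_category Vec_Hom tmap_smult_left tmap_smult_right)
qed (simp_all add: Comod_linear Vec_linear tmap_ident)

end

lemma tmap_comod_tensor [simp]:
  "tmap K (comod_tensor K B M N) W (comod_tensor K B M' N') W' f g = tmap K (tensor K M N) W (tensor K M' N') W' f g"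
  "tmap K U (comod_tensor K B M N) U' (comod_tensor K B M' N') f g = tmap K U (tensor K M N) U' (tensor K M' N') f g"
  by (simp_all add: tmap_def)

lemma tmap_comod_unit [simp]:
  "tmap K (comod_unit K B) W (comod_unit K B) W' f g = tmap K (ground K) W (ground K) W' f g"
  "tmap K U (comod_unit K B) U' (comod_unit K B) f g = tmap K U (ground K) U' (ground K) f g"
  by (simp_all add: tmap_def)

lemma tassoc_comod [simp]:
  "tassoc K (comod_tensor K B M N) V W = tassoc K (tensor K M N) V W"
  "tassoc K U (comod_tensor K B M N) W = tassoc K U (tensor K M N) W"
  "tassoc K U V (comod_tensor K B M N) = tassoc K U V (tensor K M N)"
  "tassoc K U (comod_unit K B) W = tassoc K U (ground K) W"
  by (simp_all add: tassoc_def)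

context bialgebra
begin

lemmas [simp] = lin_restrict[unfolded restrict_def]

lemma tassoc_inv_colin:
  assumes [simp]: "comodule L" "comodule M" "comodule N"
  shows "tassoc_inv L M N \<in> colin K B (comod_tensor K B L (comod_tensor K B M N)) (comod_tensor K B (comod_tensor K B L M) N)"
  by (rule colin_inverse[OF _ _ tassoc_colin]) (simp_all add: tassoc_inverse)

lemma lin_unit_left [simp]: "module K V \<Longrightarrow> (\<lambda>x. pure K (ground K) V \<one>\<^bsub>K\<^esub> x) \<in> lin K V (tensor K (ground K) V)"
  and lin_unit_right [simp]: "module K V \<Longrightarrow> (\<lambda>x. pure K V (ground K) x \<one>\<^bsub>K\<^esub>) \<in> lin K V (tensor K V (ground K))"
  by simp_all

lemma unit_colin:
  assumes [simp]: "comodule M"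
  shows "(\<lambda>x \<in> carrier M. pure K (ground K) M \<one>\<^bsub>K\<^esub> x) \<in> colin K B M (comod_tensor K B (comod_unit K B) M)"
    and "(\<lambda>x \<in> carrier M. pure K M (ground K) x \<one>\<^bsub>K\<^esub>) \<in> colin K B M (comod_tensor K B M (comod_unit K B))"
  by (rule colin_inverse[OF _ _ tlunit_colin]; simp add: unit_inverse)
    (rule colin_inverse[OF _ _ trunit_colin]; simp add: unit_inverse)

lemma tassoc_natural:
  assumes "f \<in> lin K U U'" "g \<in> lin K V V'" "h \<in> lin K W W'" and [simp]: "module K U" "module K V" "module K W"
    "module K U'" "module K V'" "module K W'" and x: "x \<in> carrier (tensor K (tensor K U V) W)"
  shows "tassoc K U' V' W' (tmap K (tensor K U V) W (tensor K U' V') W' (tmap K U V U' V' f g) h x) =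
    tmap K U (tensor K V W) U' (tensor K V' W') f (tmap K V W V' W' g h) (tassoc K U V W x)"
proof (rule lin_eq_on_tensor3'[OF _ _ _ _ _ _ _ x, where U="tensor K U' (tensor K V' W')"])
  note [simp] = assms(1-3) lin_closed[OF assms(1)] lin_closed[OF assms(2)] lin_closed[OF assms(3)]
  show "tassoc K U' V' W' (tmap K (tensor K U V) W (tensor K U' V') W' (tmap K U V U' V' f g) h (pure K (tensor K U V) W (pure K U V u v) w)) =
    tmap K U (tensor K V W) U' (tensor K V' W') f (tmap K V W V' W' g h) (tassoc K U V W (pure K (tensor K U V) W (pure K U V u v) w))"
    if "u \<in> carrier U" "v \<in> carrier V" "w \<in> carrier W" for u v w
    using that by simp
qed (simp_all add: assms)

lemma tlunit_natural:
  assumes "f \<in> lin K V V'" and [simp]: "module K V" "module K V'" and x: "x \<in> carrier (tensor K (ground K) V)"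
  shows "tlunit K V' (tmap K (ground K) V (ground K) V' (\<lambda>c \<in> carrier K. c) f x) = f (tlunit K V x)"
proof (rule lin_eq_on_tensor[OF _ _ _ _ _ _ x, where U=V'])
  note [simp] = assms(1) lin_closed[OF assms(1)] lin_smult[OF assms(1)] lin_comp_simp[OF assms(1)]
  have [simp]: "restrict f' (carrier K) \<in> lin K (ground K) (ground K) \<longleftrightarrow> f' \<in> lin K (ground K) (ground K)" for f'
    using lin_restrict[OF module_ground] by simp
  show "(\<lambda>x. tlunit K V' (tmap K (ground K) V (ground K) V' (\<lambda>c \<in> carrier K. c) f x)) \<in> lin K (tensor K (ground K) V) V'"
    "(\<lambda>x. f (tlunit K V x)) \<in> lin K (tensor K (ground K) V) V'"
    by simp_all
  show "tlunit K V' (tmap K (ground K) V (ground K) V' (\<lambda>c\<in>carrier K. c) f (pure K (ground K) V c v)) =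
       f (tlunit K V (pure K (ground K) V c v))" if "c \<in> carrier (ground K)" "v \<in> carrier V" for c v
    using that by simp
qed simp_all

lemma trunit_natural:
  assumes "f \<in> lin K V V'" and [simp]: "module K V" "module K V'" and x: "x \<in> carrier (tensor K V (ground K))"
  shows "trunit K V' (tmap K V (ground K) V' (ground K) f (\<lambda>c \<in> carrier K. c) x) = f (trunit K V x)"
proof (rule lin_eq_on_tensor[OF _ _ _ _ _ _ x, where U=V'])
  note [simp] = assms(1) lin_closed[OF assms(1)] lin_smult[OF assms(1)] lin_comp_simp[OF assms(1)]
  have [simp]: "restrict f' (carrier K) \<in> lin K (ground K) (ground K) \<longleftrightarrow> f' \<in> lin K (ground K) (ground K)" for f'
    using lin_restrict[OF module_ground] by simp
  show "(\<lambda>x. trunit K V' (tmap K V (ground K) V' (ground K) f (\<lambda>c \<in> carrier K. c) x)) \<in> lin K (tensor K V (ground K)) V'"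
    "(\<lambda>x. f (trunit K V x)) \<in> lin K (tensor K V (ground K)) V'"
    by simp_all
  show "trunit K V' (tmap K V (ground K) V' (ground K) f (\<lambda>c\<in>carrier K. c) (pure K V (ground K) v c)) =
       f (trunit K V (pure K V (ground K) v c))" if "c \<in> carrier (ground K)" "v \<in> carrier V" for c v
    using that by simp
qed simp_all

lemma tensor_pentagon:
  assumes [simp]: "module K U" "module K V" "module K W" "module K X"
    and x: "x \<in> carrier (tensor K (tensor K (tensor K U V) W) X)"
  shows "tmap K U (tensor K (tensor K V W) X) U (tensor K V (tensor K W X)) (\<lambda>x\<in>carrier U. x) (tassoc K V W X)
      (tassoc K U (tensor K V W) X (tmap K (tensor K (tensor K U V) W) X (tensor K U (tensor K V W)) X
         (tassoc K U V W) (\<lambda>x\<in>carrier X. x) x))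
    = tassoc K U V (tensor K W X) (tassoc K (tensor K U V) W X x)"
  by (rule lin_eq_on_tensor4[OF _ _ _ _ _ _ _ _ x, where U="tensor K U (tensor K V (tensor K W X))"]) simp_all

text \<open>\<open>W\<close> shares with the tensor product of the ground field and \<open>V\<close>
  its operations, but may have further fields. In this form the identity covers the triangle for
  comodules and the triangle for the action on plain spaces.\<close>

lemma comod_triangle:
  fixes V :: "('a univ, 'a univ, 'y) module_scheme"
  assumes [simp]: "comodule U" "module K V" and W: "carrier W = carrier (tensor K (ground K) V)"
    "add W = add (tensor K (ground K) V)" "zero W = zero (tensor K (ground K) V)" "smult W = smult (tensor K (ground K) V)"
    and x: "x \<in> carrier (tensor K (tensor K U (ground K)) V)"
  shows "tmap K U W U V (\<lambda>x\<in>carrier U. x) (tlunit K V) (tassoc K U (ground K) V x)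
    = tmap K (comod_tensor K B U (comod_unit K B)) V U V (trunit K U) (\<lambda>x\<in>carrier V. x) x"
proof -
  let ?r = "tmap K (comod_tensor K B U (comod_unit K B)) V U V (trunit K U) (\<lambda>x\<in>carrier V. x)"
  let ?l = "tmap K U W U V (\<lambda>x\<in>carrier U. x) (tlunit K V)"
  have W' [simp]: "tensor K U W = tensor K U (tensor K (ground K) V)" "pure K U W = pure K U (tensor K (ground K) V)"
    by (rule tensor_cong; simp add: W)+
  have W'' [simp]: "lin K W V = lin K (tensor K (ground K) V) V" by (rule lin_cong_module) (simp_all add: W)
  have mW [simp]: "module K W" by (rule module_cong[of _ "tensor K (ground K) V"]) (simp_all add: W)
  have r [simp]: "?r \<in> lin K (tensor K (tensor K U (ground K)) V) (tensor K U V)"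
    using tmap_lin[of "trunit K U" "comod_tensor K B U (comod_unit K B)" U "\<lambda>x\<in>carrier V. x" V V] by simp
  have r_pure: "?r (pure K (tensor K U (ground K)) V y v) = pure K U V (trunit K U y) v"
    if "y \<in> carrier (tensor K U (ground K))" "v \<in> carrier V" for y v
    using tmap_pure[of "trunit K U" "comod_tensor K B U (comod_unit K B)" U "\<lambda>x\<in>carrier V. x" V V y v] that by simp
  have l: "?l \<in> lin K (tensor K U (tensor K (ground K) V)) (tensor K U V)"
    using tmap_lin[of "\<lambda>x\<in>carrier U. x" U U "tlunit K V" W V] by simp
  have l_pure: "?l (pure K U (tensor K (ground K) V) u y) = pure K U V u (tlunit K V y)"
    if "u \<in> carrier U" "y \<in> carrier (tensor K (ground K) V)" for u y
    using tmap_pure[of "\<lambda>x\<in>carrier U. x" U U "tlunit K V" W V u y] that by (simp add: W)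
  define r where "r = ?r"
  define l where "l = ?l"
  note r = r[folded r_def] and r_pure [simp] = r_pure[folded r_def] and l = l[folded l_def] and l_pure [simp] = l_pure[folded l_def]
  have "l (tassoc K U (ground K) V x) = r x"
    by (rule lin_eq_on_tensor3'[OF _ _ _ _ _ _ _ x, where U="tensor K U V"])
      (simp_all add: r lin_comp_simp[OF l])
  then show ?thesis by (simp add: r_def l_def)
qed

lemma tmap_closed_colin [simp]:
  "\<lbrakk>x \<in> carrier (tensor K V W); f \<in> colin K B V V'; g \<in> colin K B W W'; comodule V; comodule W; comodule V'; comodule W'\<rbrakk>
    \<Longrightarrow> tmap K V W V' W' f g x \<in> carrier (tensor K V' W')"
  by simp

text \<open>The structure maps are those of vector spaces, so the diagrams commute on pure tensors.
  Colinearity of the inverses follows from \<open>colin_inverse\<close>.\<close>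

lemma Comod_monoidal: "monoidal_category K (Comod K B)"
proof -
  interpret V: linear_category K "Comod K B" by (rule Comod_linear)
  have unit_id [simp]: "(\<lambda>x\<in>carrier K. x) \<in> colin K B (comod_unit K B) (comod_unit K B)"
    using colin_id_restrict[OF comodule_unit] by simp
  show ?thesis
  proof (rule monoidal_categoryI[OF Comod_linear Comod_bifunctor])
    show "Unit (Comod K B) \<in> Obj (Comod K B)" by simp
  next
    fix X Y Z assume "X \<in> Obj (Comod K B)" "Y \<in> Obj (Comod K B)" "Z \<in> Obj (Comod K B)"
    then have [simp]: "comodule X" "comodule Y" "comodule Z" by simp_all
    have "iso_arr (Comod K B) (Assoc (Comod K B) X Y Z)"
      by (rule V.iso_arrI[where g="Arrow (comod_tensor K B X (comod_tensor K B Y Z)) (comod_tensor K B (comod_tensor K B X Y) Z) (tassoc_inv X Y Z)"])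
        (simp_all add: tassoc_colin tassoc_inv_colin tassoc_inverse compose_def cong: restrict_cong)
    then show "iso_arr (Comod K B) (Assoc (Comod K B) X Y Z) \<and>
          Dom (Comod K B) (Assoc (Comod K B) X Y Z) = Tens (Comod K B) (Tens (Comod K B) X Y) Z \<and>
          Cod (Comod K B) (Assoc (Comod K B) X Y Z) = Tens (Comod K B) X (Tens (Comod K B) Y Z)"
      by simp
  next
    fix X assume "X \<in> Obj (Comod K B)"
    then have [simp]: "comodule X" by simp
    have "iso_arr (Comod K B) (LUnit (Comod K B) X)"
      by (rule V.iso_arrI[where g="Arrow X (comod_tensor K B (comod_unit K B) X) (\<lambda>x \<in> carrier X. pure K (ground K) X \<one>\<^bsub>K\<^esub> x)"])
        (simp_all add: tlunit_colin unit_colin unit_inverse compose_def cong: restrict_cong)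
    then show "iso_arr (Comod K B) (LUnit (Comod K B) X) \<and> Dom (Comod K B) (LUnit (Comod K B) X) = Tens (Comod K B) (Unit (Comod K B)) X \<and>
        Cod (Comod K B) (LUnit (Comod K B) X) = X" by simp
    have "iso_arr (Comod K B) (RUnit (Comod K B) X)"
      by (rule V.iso_arrI[where g="Arrow X (comod_tensor K B X (comod_unit K B)) (\<lambda>x \<in> carrier X. pure K X (ground K) x \<one>\<^bsub>K\<^esub>)"])
        (simp_all add: trunit_colin unit_colin unit_inverse compose_def cong: restrict_cong)
    then show "iso_arr (Comod K B) (RUnit (Comod K B) X) \<and> Dom (Comod K B) (RUnit (Comod K B) X) = Tens (Comod K B) X (Unit (Comod K B)) \<and>
        Cod (Comod K B) (RUnit (Comod K B) X) = X" by simp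
  next
    fix f g h assume "is_arr (Comod K B) f" "is_arr (Comod K B) g" "is_arr (Comod K B) h"
    then show "Assoc (Comod K B) (Cod (Comod K B) f) (Cod (Comod K B) g) (Cod (Comod K B) h) \<cdot>\<^bsub>Comod K B\<^esub> TensA (Comod K B) (TensA (Comod K B) f g) h
            = TensA (Comod K B) f (TensA (Comod K B) g h) \<cdot>\<^bsub>Comod K B\<^esub> Assoc (Comod K B) (Dom (Comod K B) f) (Dom (Comod K B) g) (Dom (Comod K B) h)"
      by (intro arrow_eqI) (simp_all add: compose_def tassoc_natural)
  next
    fix f assume "is_arr (Comod K B) f"
    then show "LUnit (Comod K B) (Cod (Comod K B) f) \<cdot>\<^bsub>Comod K B\<^esub> TensA (Comod K B) (Ident (Comod K B) (Unit (Comod K B))) f = f \<cdot>\<^bsub>Comod K B\<^esub> LUnit (Comod K B) (Dom (Comod K B) f)"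
      and "RUnit (Comod K B) (Cod (Comod K B) f) \<cdot>\<^bsub>Comod K B\<^esub> TensA (Comod K B) f (Ident (Comod K B) (Unit (Comod K B))) = f \<cdot>\<^bsub>Comod K B\<^esub> RUnit (Comod K B) (Dom (Comod K B) f)"
      by (intro arrow_eqI; simp add: compose_def tlunit_natural trunit_natural)+
  next
    fix W X Y Z assume "W \<in> Obj (Comod K B)" "X \<in> Obj (Comod K B)" "Y \<in> Obj (Comod K B)" "Z \<in> Obj (Comod K B)"
    then show "TensA (Comod K B) (Ident (Comod K B) W) (Assoc (Comod K B) X Y Z) \<cdot>\<^bsub>Comod K B\<^esub>
                (Assoc (Comod K B) W (Tens (Comod K B) X Y) Z \<cdot>\<^bsub>Comod K B\<^esub> TensA (Comod K B) (Assoc (Comod K B) W X Y) (Ident (Comod K B) Z))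
            = Assoc (Comod K B) W X (Tens (Comod K B) Y Z) \<cdot>\<^bsub>Comod K B\<^esub> Assoc (Comod K B) (Tens (Comod K B) W X) Y Z"
      by (intro arrow_eqI) (simp_all add: compose_def tensor_pentagon)
  next
    fix X Y assume "X \<in> Obj (Comod K B)" "Y \<in> Obj (Comod K B)"
    moreover from this have "tmap K (comod_tensor K B X (comod_unit K B)) Y X Y (trunit K X) (\<lambda>x\<in>carrier Y. x)
        \<in> extensional (carrier (tensor K (tensor K X (ground K)) Y))"
      using maps_extensional(1)[where V="comod_tensor K B X (comod_unit K B)" and W=Y] by simp
    ultimately show "TensA (Comod K B) (Ident (Comod K B) X) (LUnit (Comod K B) Y) \<cdot>\<^bsub>Comod K B\<^esub> Assoc (Comod K B) X (Unit (Comod K B)) Y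
       = TensA (Comod K B) (RUnit (Comod K B) X) (Ident (Comod K B) Y)"
      by (intro arrow_eqI) (simp_all add: compose_def comod_triangle)
  qed
qed

lemma unit_lin: "module K V \<Longrightarrow> (\<lambda>x\<in>carrier V. pure K (ground K) V \<one>\<^bsub>K\<^esub> x) \<in> lin K V (tensor K (ground K) V)"
  by simp

text \<open>The diagrams express the same identities of linear maps as those of the monoidal
  category, with a plain space as the last factor.\<close>

lemma fiber_module_category: "module_category K (Comod K B) (Vec K) (fiber_action K)"
proof -
  interpret V: linear_category K "Vec K" by (rule Vec_linear)
  have unit_id [simp]: "(\<lambda>x\<in>carrier K. x) \<in> colin K B (comod_unit K B) (comod_unit K B)"
    using colin_id_restrict[OF comodule_unit] by simp
  show ?thesis
  proof (rule module_categoryI[OF Comod_monoidal Vec_linear fiber_bifunctor])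
    fix W W' X assume "W \<in> Obj (Comod K B)" "W' \<in> Obj (Comod K B)" "X \<in> Obj (Vec K)"
    then have [simp]: "comodule W" "comodule W'" "module K X" by simp_all
    have "iso_arr (Vec K) (AAssoc (fiber_action K) W W' X)"
      by (rule V.iso_arrI[where g="Arrow (tensor K W (tensor K W' X)) (tensor K (tensor K W W') X) (tassoc_inv W W' X)"])
        (simp_all add: tassoc_inverse compose_def cong: restrict_cong)
    then show "iso_arr (Vec K) (AAssoc (fiber_action K) W W' X) \<and>
          Dom (Vec K) (AAssoc (fiber_action K) W W' X) = Act (fiber_action K) (Tens (Comod K B) W W') X \<and>
          Cod (Vec K) (AAssoc (fiber_action K) W W' X) = Act (fiber_action K) W (Act (fiber_action K) W' X)"
      by simp
  next
    fix X assume "X \<in> Obj (Vec K)"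
    then have [simp]: "module K X" by simp
    have "iso_arr (Vec K) (AUnit (fiber_action K) X)"
      by (rule V.iso_arrI[where g="Arrow X (tensor K (ground K) X) (\<lambda>x \<in> carrier X. pure K (ground K) X \<one>\<^bsub>K\<^esub> x)"])
        (simp_all add: unit_inverse compose_def cong: restrict_cong)
    then show "iso_arr (Vec K) (AUnit (fiber_action K) X) \<and>
        Dom (Vec K) (AUnit (fiber_action K) X) = Act (fiber_action K) (Unit (Comod K B)) X \<and>
        Cod (Vec K) (AUnit (fiber_action K) X) = X" by simp
  next
    fix f g h assume "is_arr (Comod K B) f" "is_arr (Comod K B) g" "is_arr (Vec K) h"
    then show "AAssoc (fiber_action K) (Cod (Comod K B) f) (Cod (Comod K B) g) (Cod (Vec K) h) \<cdot>\<^bsub>Vec K\<^esub>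
            ActA (fiber_action K) (TensA (Comod K B) f g) h
          = ActA (fiber_action K) f (ActA (fiber_action K) g h) \<cdot>\<^bsub>Vec K\<^esub>
            AAssoc (fiber_action K) (Dom (Comod K B) f) (Dom (Comod K B) g) (Dom (Vec K) h)"
      by (intro arrow_eqI) (simp_all add: compose_def tassoc_natural)
  next
    fix h assume "is_arr (Vec K) h"
    then show "AUnit (fiber_action K) (Cod (Vec K) h) \<cdot>\<^bsub>Vec K\<^esub> ActA (fiber_action K) (Ident (Comod K B) (Unit (Comod K B))) h
        = h \<cdot>\<^bsub>Vec K\<^esub> AUnit (fiber_action K) (Dom (Vec K) h)"
      by (intro arrow_eqI) (simp_all add: compose_def tlunit_natural)
  next
    fix U W W' X assume "U \<in> Obj (Comod K B)" "W \<in> Obj (Comod K B)" "W' \<in> Obj (Comod K B)" "X \<in> Obj (Vec K)"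
    then show "ActA (fiber_action K) (Ident (Comod K B) U) (AAssoc (fiber_action K) W W' X) \<cdot>\<^bsub>Vec K\<^esub>
                (AAssoc (fiber_action K) U (Tens (Comod K B) W W') X \<cdot>\<^bsub>Vec K\<^esub>
                  ActA (fiber_action K) (Assoc (Comod K B) U W W') (Ident (Vec K) X))
            = AAssoc (fiber_action K) U W (Act (fiber_action K) W' X) \<cdot>\<^bsub>Vec K\<^esub>
              AAssoc (fiber_action K) (Tens (Comod K B) U W) W' X"
      by (intro arrow_eqI) (simp_all add: compose_def tensor_pentagon)
  next
    fix W X assume "W \<in> Obj (Comod K B)" "X \<in> Obj (Vec K)"
    moreover from this have "tmap K (comod_tensor K B W (comod_unit K B)) X W X (trunit K W) (\<lambda>x\<in>carrier X. x)
        \<in> extensional (carrier (tensor K (tensor K W (ground K)) X))"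
      using maps_extensional(1)[where V="comod_tensor K B W (comod_unit K B)" and W=X] by simp
    ultimately show "ActA (fiber_action K) (Ident (Comod K B) W) (AUnit (fiber_action K) X) \<cdot>\<^bsub>Vec K\<^esub>
          AAssoc (fiber_action K) W (Unit (Comod K B)) X
        = ActA (fiber_action K) (RUnit (Comod K B) W) (Ident (Vec K) X)"
      by (intro arrow_eqI) (simp_all add: compose_def comod_triangle)
  qed
qed

end

section \<open>The Eilenberg-Moore category and the free modules of a linear monad\<close>

lemma EM_simps [simp]:
  "Dom (EM C T) = src" "Cod (EM C T) = tgt"
  "Ident (EM C T) P = Arrow P P (Ident C (fst P))"
  "Comp (EM C T) g f = Arrow (src f) (tgt g) (mor g \<cdot>\<^bsub>C\<^esub> mor f)"
  "arr (EM C T) P Q = Arrow P Q ` {f \<in> arr C (fst P) (fst Q). f \<cdot>\<^bsub>C\<^esub> snd P = snd Q \<cdot>\<^bsub>C\<^esub> FArr (MFun T) f}"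
  "\<zero>\<^bsub>Hom (EM C T) P Q\<^esub> = Arrow P Q \<zero>\<^bsub>Hom C (fst P) (fst Q)\<^esub>"
  "f \<oplus>\<^bsub>Hom (EM C T) P Q\<^esub> g = Arrow P Q (mor f \<oplus>\<^bsub>Hom C (fst P) (fst Q)\<^esub> mor g)"
  "a \<odot>\<^bsub>Hom (EM C T) P Q\<^esub> f = Arrow P Q (a \<odot>\<^bsub>Hom C (fst P) (fst Q)\<^esub> mor f)"
  by (simp_all add: EM_def arr_def)

lemma Free_simps [simp]:
  "Obj (Free C T) = Obj C" "Dom (Free C T) = src" "Cod (Free C T) = tgt"
  "Ident (Free C T) X = Arrow X X (Ident (EM C T) (free_module T X))"
  "Comp (Free C T) g f = Arrow (src f) (tgt g) (mor g \<cdot>\<^bsub>EM C T\<^esub> mor f)"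
  "arr (Free C T) X Y = Arrow X Y ` arr (EM C T) (free_module T X) (free_module T Y)"
  "f \<oplus>\<^bsub>Hom (Free C T) X Y\<^esub> g = Arrow X Y (mor f \<oplus>\<^bsub>Hom (EM C T) (free_module T X) (free_module T Y)\<^esub> mor g)"
  "a \<odot>\<^bsub>Hom (Free C T) X Y\<^esub> f = Arrow X Y (a \<odot>\<^bsub>Hom (EM C T) (free_module T X) (free_module T Y)\<^esub> mor f)"
  by (simp_all only: Free_def arr_def kcat.simps arrow_module_simps)

lemma free_inclusion_simps [simp]: "FObj (free_inclusion T) = free_module T" "FArr (free_inclusion T) = mor"
  by (simp_all add: free_inclusion_def)

lemma free_module_simps [simp]: "fst (free_module T X) = FObj (MFun T) X" "snd (free_module T X) = Mu T X"
  by (simp_all add: free_module_def)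

context linear_monad
begin

lemma Obj_EM: "P \<in> Obj (EM C T) \<longleftrightarrow> fst P \<in> Obj C \<and> is_arr C (snd P) \<and> Dom C (snd P) = FObj (MFun T) (fst P) \<and>
    Cod C (snd P) = fst P \<and> snd P \<cdot>\<^bsub>C\<^esub> Eta T (fst P) = Ident C (fst P) \<and>
    snd P \<cdot>\<^bsub>C\<^esub> FArr (MFun T) (snd P) = snd P \<cdot>\<^bsub>C\<^esub> Mu T (fst P)"
  by (auto simp: EM_def source.arr_iff case_prod_beta)

lemma monad_simps [simp]:
  "X \<in> Obj C \<Longrightarrow> is_arr C (Eta T X)" "X \<in> Obj C \<Longrightarrow> Dom C (Eta T X) = X"
  "X \<in> Obj C \<Longrightarrow> Cod C (Eta T X) = FObj (MFun T) X"
  "X \<in> Obj C \<Longrightarrow> is_arr C (Mu T X)" "X \<in> Obj C \<Longrightarrow> Dom C (Mu T X) = FObj (MFun T) (FObj (MFun T) X)"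
  "X \<in> Obj C \<Longrightarrow> Cod C (Mu T X) = FObj (MFun T) X"
  using eta_natural mu_natural
  by (simp_all add: natural_trans_def ident_funct_def comp_funct_def source.arr_iff)

lemma is_arr_EM: "is_arr (EM C T) f \<longleftrightarrow> src f \<in> Obj (EM C T) \<and> tgt f \<in> Obj (EM C T) \<and> is_arr C (mor f) \<and>
    Dom C (mor f) = fst (src f) \<and> Cod C (mor f) = fst (tgt f) \<and>
    mor f \<cdot>\<^bsub>C\<^esub> snd (src f) = snd (tgt f) \<cdot>\<^bsub>C\<^esub> FArr (MFun T) (mor f)"
proof (cases f)
  case (Arrow P Q g)
  show ?thesis
    unfolding Arrow is_arr_def[of "EM C T"] EM_simps arrow.sel
    using source.arr_iff[of "fst P" "fst Q" g] by (auto simp: Obj_EM)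
qed

lemma free_module_EM [simp]: "X \<in> Obj C \<Longrightarrow> free_module T X \<in> Obj (EM C T)"
  by (simp add: Obj_EM mu_eta_left mu_assoc)

text \<open>The condition on a module morphism is linear in the morphism, as the functor of the
  monad is linear. So the module morphisms form a submodule of the arrows of
  \<open>C\<close>.\<close>

lemma EM_linear: "linear_category K (EM C T)"
proof (rule linear_category.intro)
  fix P Q assume P: "P \<in> Obj (EM C T)" and Q: "Q \<in> Obj (EM C T)"
  then have O: "fst P \<in> Obj C" "fst Q \<in> Obj C" and
    p: "snd P \<in> arr C (FObj (MFun T) (fst P)) (fst P)" and q: "snd Q \<in> arr C (FObj (MFun T) (fst Q)) (fst Q)"
    by (simp_all add: Obj_EM source.arr_iff)
  have TO: "FObj (MFun T) (fst P) \<in> Obj C" "FObj (MFun T) (fst Q) \<in> Obj C" using O by (simp_all add: fobj)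
  interpret H: module K "Hom C (fst P) (fst Q)" using source.hom_module O .
  let ?H = "{f \<in> arr C (fst P) (fst Q). f \<cdot>\<^bsub>C\<^esub> snd P = snd Q \<cdot>\<^bsub>C\<^esub> FArr (MFun T) f}"
  have sm: "a \<odot>\<^bsub>Hom C (fst P) (fst Q)\<^esub> f \<in> ?H" if "a \<in> carrier K" "f \<in> ?H" for a f
    using that by (simp add: source.smult_arr O source.comp_smult_left[OF TO(1) O _ p]
        fsmult[OF O] source.comp_smult_right[OF TO O(2) _ farr[OF O] q])
  have "module K ((Hom C (fst P) (fst Q))\<lparr>carrier := ?H\<rparr>)"
  proof (rule submodule.submodule_is_module[where R=K])
    show "submodule ?H K (Hom C (fst P) (fst Q))"
    proof (rule H.submoduleI[OF _ _ _ _ sm])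
      show "?H \<subseteq> carrier (Hom C (fst P) (fst Q))" by (auto simp: arr_def)
      show "\<zero>\<^bsub>Hom C (fst P) (fst Q)\<^esub> \<in> ?H"
        by (simp add: source.zero_arr O source.comp_zero(1)[OF TO(1) O p] functor_zero[OF O] source.comp_zero(2)[OF TO O(2) q])
      show "f \<oplus>\<^bsub>Hom C (fst P) (fst Q)\<^esub> g \<in> ?H" if "f \<in> ?H" "g \<in> ?H" for f g
        using that by (simp add: source.add_arr O source.comp_add_left[OF TO(1) O p]
            fadd[OF O] source.comp_add_right[OF TO O(2) farr[OF O] farr[OF O] q])
      show "\<ominus>\<^bsub>Hom C (fst P) (fst Q)\<^esub> f \<in> ?H" if "f \<in> ?H" for f
        using sm[of "\<ominus>\<^bsub>K\<^esub> \<one>\<^bsub>K\<^esub>" f] that by (simp add: arr_def H.smult_l_minus)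
    qed
  qed unfold_locales
  then show "module K (Hom (EM C T) P Q)"
    by (simp only: EM_def kcat.simps arrow_module_module)
next
  fix P Q f assume "P \<in> Obj (EM C T)" "Q \<in> Obj (EM C T)" "f \<in> arr (EM C T) P Q"
  then show "Dom (EM C T) f = P \<and> Cod (EM C T) f = Q" by auto
next
  fix P assume "P \<in> Obj (EM C T)"
  then show "Ident (EM C T) P \<in> arr (EM C T) P P" by (auto simp: Obj_EM source.ident_arr)
next
  fix P Q R f g assume O: "P \<in> Obj (EM C T)" "Q \<in> Obj (EM C T)" "R \<in> Obj (EM C T)" and fg: "f \<in> arr (EM C T) P Q" "g \<in> arr (EM C T) Q R"
  then obtain f0 g0 where [simp]: "f = Arrow P Q f0" "g = Arrow Q R g0" by auto
  have fs: "is_arr C f0" "Dom C f0 = fst P" "Cod C f0 = fst Q" "f0 \<cdot>\<^bsub>C\<^esub> snd P = snd Q \<cdot>\<^bsub>C\<^esub> FArr (MFun T) f0"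
    and gs: "is_arr C g0" "Dom C g0 = fst Q" "Cod C g0 = fst R" "g0 \<cdot>\<^bsub>C\<^esub> snd Q = snd R \<cdot>\<^bsub>C\<^esub> FArr (MFun T) g0"
    using fg O by (auto simp: Obj_EM source.arr_iff)
  have "(g0 \<cdot>\<^bsub>C\<^esub> f0) \<cdot>\<^bsub>C\<^esub> snd P = (g0 \<cdot>\<^bsub>C\<^esub> snd Q) \<cdot>\<^bsub>C\<^esub> FArr (MFun T) f0"
    using O fs gs(1-3) by (simp add: Obj_EM)
  also have "\<dots> = snd R \<cdot>\<^bsub>C\<^esub> FArr (MFun T) (g0 \<cdot>\<^bsub>C\<^esub> f0)"
    unfolding gs(4) using O fs gs(1-3) by (simp add: Obj_EM functor_comp)
  finally have "(g0 \<cdot>\<^bsub>C\<^esub> f0) \<cdot>\<^bsub>C\<^esub> snd P = snd R \<cdot>\<^bsub>C\<^esub> FArr (MFun T) (g0 \<cdot>\<^bsub>C\<^esub> f0)" .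
  moreover have "g0 \<cdot>\<^bsub>C\<^esub> f0 \<in> arr C (fst P) (fst R)"
    using O fs gs by (simp add: Obj_EM source.arr_iff)
  ultimately show "g \<cdot>\<^bsub>EM C T\<^esub> f \<in> arr (EM C T) P R" by (simp add: image_iff)
qed (auto simp: Obj_EM source.comp_ident_left source.comp_ident_right source.comp_assoc source.comp_add_left
    source.comp_add_right source.comp_smult_left source.comp_smult_right)

lemma Free_linear: "linear_category K (Free C T)"
proof -
  interpret EM: linear_category K "EM C T" by (rule EM_linear)
  note closed = free_module_EM
  note [simp del] = EM_simps
  show ?thesis
  proof (rule linear_category.intro)
    fix X Y assume "X \<in> Obj (Free C T)" "Y \<in> Obj (Free C T)"
    then show "module K (Hom (Free C T) X Y)"
      by (simp add: Free_def arrow_module_module EM.hom_module)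
  next
    fix W X Y Z f g h
    assume "W \<in> Obj (Free C T)" "X \<in> Obj (Free C T)" "Y \<in> Obj (Free C T)" "Z \<in> Obj (Free C T)"
      "f \<in> arr (Free C T) W X" "g \<in> arr (Free C T) X Y" "h \<in> arr (Free C T) Y Z"
    then show "(h \<cdot>\<^bsub>Free C T\<^esub> g) \<cdot>\<^bsub>Free C T\<^esub> f = h \<cdot>\<^bsub>Free C T\<^esub> (g \<cdot>\<^bsub>Free C T\<^esub> f)"
      using EM.comp_assoc[of "free_module T W" "free_module T X" "free_module T Y" "free_module T Z" "mor f" "mor g" "mor h"]
      by auto
  qed (auto simp: EM.ident_arr EM.comp_add_left EM.comp_add_right EM.comp_smult_left EM.comp_smult_right
      intro!: imageI
      intro: EM.comp_arr[OF free_module_EM free_module_EM free_module_EM]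
        EM.comp_ident_left[OF free_module_EM free_module_EM] EM.comp_ident_right[OF free_module_EM free_module_EM])
qed

text \<open>Full and faithful by construction, as the morphisms of \<open>Free\<close> are all
  module morphisms between free modules. What depends on the monad is essential surjectivity, which
  is left as the hypothesis.\<close>

lemma free_inclusion_weak_equivalence:
  assumes "\<And>Z. Z \<in> Obj (EM C T) \<Longrightarrow> \<exists>X\<in>Obj C. \<exists>q. is_iso (EM C T) (free_module T X) Z q"
  shows "weak_equivalence K (Free C T) (EM C T) (free_inclusion T)"
proof -
  note [simp del] = EM_simps
  interpret EM: linear_category K "EM C T" by (rule EM_linear)
  interpret Free: linear_category K "Free C T" by (rule Free_linear)
  show ?thesis
    by unfold_locales (auto simp: assms)
qed

end

section \<open>The monad of B \<bullet> B\<close>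

context bialgebra
begin

abbreviation "TT \<equiv> cotensor_monad K B (bullet K B)"
abbreviation "CC \<equiv> Comod K B"

lemma ext_extensional [simp]: "ext M N g \<in> extensional (carrier M)"
  by (simp add: ext_def)

lemmas [simp] = ext_colin lin_closed[OF ext_lin]

lemma lin_after_eps [simp]: "\<lbrakk>f \<in> lin K M N; comodule M\<rbrakk> \<Longrightarrow> (\<lambda>z. f (eps M z)) \<in> lin K (T M) N"
  using lin_compose[OF _ eps_lin] by blast

lemma lin_if_closed [simp]:
  assumes "f \<in> lin K U W" "module K U" "g \<in> lin K U V"
  shows "(\<lambda>z. if f z \<in> carrier W then g z else undefined) \<in> lin K U V"
  by (rule lin_cong[where f=g]) (simp_all add: assms lin_closed[OF assms(1)])

lemma MFun_FObj [simp]: "FObj (MFun TT) = T"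
  by (simp add: cotensor_monad_def)

text \<open>This rule and the next two replace the structure of the monad by \<open>ext\<close>.
  They exhibit it as the monad of the adjunction between the forgetful functor and the cofree
  comodule.\<close>

lemma MFun_FArr [simp]: "\<lbrakk>comodule (src f); comodule (tgt f); mor f \<in> colin K B (src f) (tgt f)\<rbrakk>
  \<Longrightarrow> FArr (MFun TT) f = Arrow (T (src f)) (T (tgt f)) (ext (T (src f)) (tgt f) (\<lambda>z. mor f (eps (src f) z)))"
  by (simp add: cotensor_monad_def cotensor_comod_simps cotensor_map_ext cong: restrict_cong)
     (simp add: ext_def)

lemma Eta_simp [simp]: "comodule N \<Longrightarrow> Eta TT N = Arrow N (T N) (ext N N (\<lambda>n. n))"
  by (simp add: cotensor_monad_def cotensor_unit_ext cong: restrict_cong)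
     (simp add: ext_def)

lemma Mu_simp [simp]: "comodule N \<Longrightarrow> Mu TT N = Arrow (T (T N)) (T N) (ext (T (T N)) N (\<lambda>z. eps N (eps (T N) z)))"
proof -
  assume N: "comodule N"
  have "cotensor_mult K B (bullet K B) N = ext (T (T N)) N (\<lambda>z. eps N (eps (T N) z))"
  proof (rule extensionalityI[where A="carrier (T (T N))"])
    show "cotensor_mult K B (bullet K B) N \<in> extensional (carrier (T (T N)))"
      by (simp add: cotensor_mult_def Let_def cotensor_comod_simps)
  qed (simp_all add: cotensor_mult_ext N)
  then show ?thesis by (simp add: cotensor_monad_def)
qed

lemma T_arrow_eqI:
  assumes "is_arr CC f" "is_arr CC g" "src f = src g" "tgt f = T N" "tgt g = T N" "comodule N"
    and "\<And>m. m \<in> carrier (src g) \<Longrightarrow> eps N (mor f m) = eps N (mor g m)"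
  shows "f = g"
proof (rule arrow_eqI)
  fix m assume "m \<in> carrier (src g)"
  then show "mor f m = mor g m"
    using cofree_eqI[of "src g" N "mor f" "mor g" m] assms by auto
qed (use assms in simp_all)

lemma colin_closed [simp]: "\<lbrakk>f \<in> colin K B M N; x \<in> carrier M\<rbrakk> \<Longrightarrow> f x \<in> carrier N"
  by (rule lin_closed[OF colin_lin])

lemmas [simp] = compose_eq

lemma cotensor_functor: "linear_functor K CC CC (MFun TT)"
proof (rule linear_functorI)
  show "linear_category K CC" "linear_category K CC" by (rule Comod_linear)+
next
  fix f g assume "is_arr CC f" "is_arr CC g" "Dom CC g = Cod CC f"
  then show "FArr (MFun TT) (g \<cdot>\<^bsub>CC\<^esub> f) = FArr (MFun TT) g \<cdot>\<^bsub>CC\<^esub> FArr (MFun TT) f"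
    by (intro T_arrow_eqI[where N="tgt g"])
      (simp_all add: colin_compose'[where M="tgt f"] colin_compose'[where M="T (tgt f)"])
next
  fix X assume "X \<in> Obj CC"
  then show "FArr (MFun TT) (Ident CC X) = Ident CC (FObj (MFun TT) X)"
    by (intro T_arrow_eqI[where N=X]) simp_all
next
  fix X Y f g assume O: "X \<in> Obj CC" "Y \<in> Obj CC" and fg: "f \<in> arr CC X Y" "g \<in> arr CC X Y"
  then obtain f0 g0 where [simp]: "f = Arrow X Y f0" "g = Arrow X Y g0" "f0 \<in> colin K B X Y" "g0 \<in> colin K B X Y"
    "comodule X" "comodule Y" by auto
  interpret V: linear_category K CC by (rule Comod_linear)
  have Tfg: "FArr (MFun TT) f \<in> arr CC (T X) (T Y)" "FArr (MFun TT) g \<in> arr CC (T X) (T Y)" "T X \<in> Obj CC" "T Y \<in> Obj CC"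
    by simp_all
  have *: "is_arr CC f" if "f \<in> arr CC X Y" "X \<in> Obj CC" "Y \<in> Obj CC" for f X Y using V.is_arrI that by blast
  show "FArr (MFun TT) (f \<oplus>\<^bsub>Hom CC X Y\<^esub> g) = FArr (MFun TT) f \<oplus>\<^bsub>Hom CC (FObj (MFun TT) X) (FObj (MFun TT) Y)\<^esub> FArr (MFun TT) g"
    using *[OF V.add_arr[OF O fg] O] *[OF V.add_arr[OF Tfg(3,4,1,2)] Tfg(3,4)]
    by (intro T_arrow_eqI[where N=Y]) (simp_all add: Hom_concrete_category lin_pointwise lin_add[OF eps_lin])
  show "FArr (MFun TT) (a \<odot>\<^bsub>Hom CC X Y\<^esub> f) = a \<odot>\<^bsub>Hom CC (FObj (MFun TT) X) (FObj (MFun TT) Y)\<^esub> FArr (MFun TT) f"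
    if a: "a \<in> carrier K" for a
    using *[OF V.smult_arr[OF O a fg(1)] O] *[OF V.smult_arr[OF Tfg(3,4) a Tfg(1)] Tfg(3,4)] a
    by (intro T_arrow_eqI[where N=Y]) (simp_all add: Hom_concrete_category)
qed simp_all

text \<open>Every equation is between comodule maps into some \<open>T N\<close> and is compared
  after \<open>eps\<close>, where multiplication is \<open>eps\<close> twice and the unit cancels
  one \<open>eps\<close>.\<close>

lemma cotensor_linear_monad: "linear_monad K CC TT"
proof -
  interpret linear_functor K CC CC "MFun TT" by (rule cotensor_functor)
  show ?thesis
  proof
    show "natural_trans CC CC ident_funct (MFun TT) (Eta TT)"
      unfolding natural_trans_def ident_funct_def
    proof (intro conjI ballI)
      fix X Y f assume "X \<in> Obj CC" "Y \<in> Obj CC" "f \<in> arr CC X Y"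
      then show "Eta TT Y \<cdot>\<^bsub>CC\<^esub> FArr \<lparr>FObj = \<lambda>X. X, FArr = \<lambda>f. f\<rparr> f = FArr (MFun TT) f \<cdot>\<^bsub>CC\<^esub> Eta TT X"
        by (intro T_arrow_eqI[where N=Y])
          (auto simp: colin_compose'[where M=Y] colin_compose'[where M="T X"])
    qed simp
    show "natural_trans CC CC (comp_funct (MFun TT) (MFun TT)) (MFun TT) (Mu TT)"
      unfolding natural_trans_def comp_funct_def
    proof (intro conjI ballI)
      fix X Y f assume "X \<in> Obj CC" "Y \<in> Obj CC" "f \<in> arr CC X Y"
      then show "Mu TT Y \<cdot>\<^bsub>CC\<^esub> FArr \<lparr>FObj = \<lambda>X. FObj (MFun TT) (FObj (MFun TT) X), FArr = \<lambda>f. FArr (MFun TT) (FArr (MFun TT) f)\<rparr> f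
          = FArr (MFun TT) f \<cdot>\<^bsub>CC\<^esub> Mu TT X"
        by (intro T_arrow_eqI[where N=Y])
          (auto simp: colin_compose'[where M="T (T Y)"] colin_compose'[where M="T X"])
    qed simp
  next
    fix X assume "X \<in> Obj CC"
    then show "Mu TT X \<cdot>\<^bsub>CC\<^esub> Eta TT (FObj (MFun TT) X) = Ident CC (FObj (MFun TT) X)"
       "Mu TT X \<cdot>\<^bsub>CC\<^esub> FArr (MFun TT) (Eta TT X) = Ident CC (FObj (MFun TT) X)"
       "Mu TT X \<cdot>\<^bsub>CC\<^esub> FArr (MFun TT) (Mu TT X) = Mu TT X \<cdot>\<^bsub>CC\<^esub> Mu TT (FObj (MFun TT) X)"
      by (intro T_arrow_eqI[where N=X]; simp add: colin_compose'[where M="T (T X)"])+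
  qed
qed

end

section \<open>Free modules as vector spaces\<close>

context bialgebra
begin

text \<open>The formula for the functor \<open>T\<close> on a colinear map, now for a map
  \<open>g\<close> that is merely linear: on B \<otimes> N it is id \<otimes>
  \<open>g\<close>.\<close>

definition free_map :: "'a comod \<Rightarrow> 'a comod \<Rightarrow> 'a fn \<Rightarrow> ('a comod, ('a comod \<times> 'a comod_arrow, 'a comod_arrow) arrow) arrow" where
  "free_map N N' g = free_arrow TT N N' (Arrow (T N) (T N') (ext (T N) N' (\<lambda>z. g (eps N z))))"

lemma free_map_simps [simp]: "src (free_map N N' g) = N" "tgt (free_map N N' g) = N'"
  "mor (mor (free_map N N' g)) = Arrow (T N) (T N') (ext (T N) N' (\<lambda>z. g (eps N z)))"
  by (simp_all add: free_map_def free_arrow_def)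

lemma free_map_cong: "\<lbrakk>\<And>n. n \<in> carrier N \<Longrightarrow> g n = g' n; comodule N\<rbrakk> \<Longrightarrow> free_map N N' g = free_map N N' g'"
  by (simp add: free_map_def ext_def cong: sweedler_cong restrict_cong)

text \<open>By the unit law, \<open>z\<close> is the product of \<open>w\<close>, the image of
  \<open>z\<close> under T of the unit. The morphism \<open>F\<close> commutes with multiplication,
  and \<open>eps\<close> after multiplication is \<open>eps\<close> twice. So \<open>F\<close> after
  \<open>eps\<close> is visible only through its values on the unit.\<close>

lemma module_morphism_eps:
  assumes N [simp]: "comodule N" and N' [simp]: "comodule N'" and F: "F \<in> colin K B (T N) (T N')"
    and eq: "\<And>w. w \<in> carrier (T (T N)) \<Longrightarrow> F (ext (T (T N)) N (\<lambda>z. eps N (eps (T N) z)) w)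
       = ext (T (T N')) N' (\<lambda>z. eps N' (eps (T N') z)) (ext (T (T N)) (T N') (\<lambda>z. F (eps (T N) z)) w)"
    and z: "z \<in> carrier (T N)"
  shows "eps N' (F z) = eps N' (F (ext N N (\<lambda>n. n) (eps N z)))"
proof -
  interpret linear_monad K CC TT by (rule cotensor_linear_monad)
  note [simp] = z F
  define w where "w = ext (T N) (T N) (\<lambda>z. ext N N (\<lambda>n. n) (eps N z)) z"
  have w: "w \<in> carrier (T (T N))" by (simp add: w_def)
  have "mor (Mu TT N \<cdot>\<^bsub>CC\<^esub> FArr (MFun TT) (Eta TT N)) z = mor (Ident CC (T N)) z"
    using mu_eta_right[of N] by simp
  then have "ext (T (T N)) N (\<lambda>z. eps N (eps (T N) z)) w = z"
    by (simp add: w_def)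
  with eq[OF w] w show ?thesis by (simp add: w_def)
qed

text \<open>A morphism between free modules is determined by a comodule map from \<open>N\<close> to
  \<open>T N'\<close>, and by cofreeness this is a linear map from \<open>N\<close> to
  \<open>N'\<close>. Explicitly, \<open>g\<close> is \<open>eps\<close> after \<open>F\<close> after
  the unit.\<close>

lemma arr_Free:
  assumes N [simp]: "comodule N" and N' [simp]: "comodule N'"
  shows "f \<in> arr (Free CC TT) N N' \<longleftrightarrow> (\<exists>g \<in> lin K N N' \<inter> extensional (carrier N). f = free_map N N' g)"
proof
  assume "f \<in> arr (Free CC TT) N N'"
  then obtain F where f: "f = Arrow N N' (Arrow (free_module TT N) (free_module TT N') (Arrow (T N) (T N') F))"
    and F [simp]: "F \<in> colin K B (T N) (T N')" "F \<in> extensional (carrier (T N))"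
    and eq: "Arrow (T N) (T N') F \<cdot>\<^bsub>CC\<^esub> Mu TT N = Mu TT N' \<cdot>\<^bsub>CC\<^esub> FArr (MFun TT) (Arrow (T N) (T N') F)"
    by (simp only: Free_simps(6) EM_simps(5) free_module_simps MFun_FObj Comod_simps(13)) blast
  have eq': "F (ext (T (T N)) N (\<lambda>z. eps N (eps (T N) z)) w)
       = ext (T (T N')) N' (\<lambda>z. eps N' (eps (T N') z)) (ext (T (T N)) (T N') (\<lambda>z. F (eps (T N) z)) w)"
    if "w \<in> carrier (T (T N))" for w
    using arg_cong[OF eq, of "\<lambda>h. mor h w"] that by simp
  define g where "g = (\<lambda>n \<in> carrier N. eps N' (F (ext N N (\<lambda>n. n) n)))"
  have g: "g \<in> lin K N N' \<inter> extensional (carrier N)"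
    using lin_compose[OF colin_lin[OF F(1)] ext_lin[OF N N lin_ident]] by (simp add: g_def)
  have "F = ext (T N) N' (\<lambda>z. g (eps N z))"
  proof (rule extensionalityI[where A="carrier (T N)"])
    fix z assume z [simp]: "z \<in> carrier (T N)"
    show "F z = ext (T N) N' (\<lambda>z. g (eps N z)) z"
    proof (rule cofree_eqI[OF comodule_T[OF N] N' F(1) _ _ z])
      show "ext (T N) N' (\<lambda>z. g (eps N z)) \<in> colin K B (T N) (T N')" using g by simp
      fix z assume z: "z \<in> carrier (T N)"
      have "eps N' (ext (T N) N' (\<lambda>z. g (eps N z)) z) = g (eps N z)"
        using g z by simp
      then have "eps N' (ext (T N) N' (\<lambda>z. g (eps N z)) z) = eps N' (F (ext N N (\<lambda>n. n) (eps N z)))"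
        using z by (simp add: g_def)
      with module_morphism_eps[OF N N' F(1) eq' z]
      show "eps N' (F z) = eps N' (ext (T N) N' (\<lambda>z. g (eps N z)) z)" by (simp only:)
    qed
  qed simp_all
  then show "\<exists>g \<in> lin K N N' \<inter> extensional (carrier N). f = free_map N N' g"
    using g by (auto simp: f free_map_def free_arrow_def)
next
  assume "\<exists>g \<in> lin K N N' \<inter> extensional (carrier N). f = free_map N N' g"
  then obtain g where g [simp]: "g \<in> lin K N N'" and f: "f = free_map N N' g" by blast
  have "Arrow (T N) (T N') (ext (T N) N' (\<lambda>z. g (eps N z))) \<cdot>\<^bsub>CC\<^esub> Mu TT N =
    Mu TT N' \<cdot>\<^bsub>CC\<^esub> FArr (MFun TT) (Arrow (T N) (T N') (ext (T N) N' (\<lambda>z. g (eps N z))))"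
    by (intro T_arrow_eqI[where N=N'])
      (simp_all add: colin_compose'[where M="T N"] colin_compose'[where M="T (T N')"])
  then show "f \<in> arr (Free CC TT) N N'"
    by (simp add: f free_map_def free_arrow_def)
qed

lemma free_map_arr [simp]:
  "\<lbrakk>comodule N; comodule N'; g \<in> lin K N N'\<rbrakk> \<Longrightarrow> is_arr (Free CC TT) (free_map N N' g)"
  using free_map_cong[of N g "restrict g (carrier N)" N']
  by (auto simp: is_arr_def[of "Free CC TT"] arr_Free simp del: Free_simps(6) intro!: bexI[of _ "restrict g (carrier N)"])

lemma is_arr_FreeE:
  assumes "is_arr (Free CC TT) f"
  obtains g where "f = free_map (src f) (tgt f) g" "g \<in> lin K (src f) (tgt f)" "g \<in> extensional (carrier (src f))"
    "comodule (src f)" "comodule (tgt f)"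
  using assms arr_Free[of "src f" "tgt f" f] by (auto simp: is_arr_def[of "Free CC TT"] simp del: Free_simps(6))

lemma free_map_comp [simp]:
  assumes [simp]: "comodule N" "comodule N'" "comodule N''" "g \<in> lin K N N'" "g' \<in> lin K N' N''"
  shows "free_map N' N'' g' \<cdot>\<^bsub>Free CC TT\<^esub> free_map N N' g = free_map N N'' (compose (carrier N) g' g)"
proof -
  note [simp] = lin_comp_simp[OF assms(5)] lin_closed[OF assms(4)] lin_comp_simp[OF assms(4)]
  have *: "compose (carrier N) g' g \<in> lin K N N''" by (rule lin_compose'[where V=N']) simp_all
  have "Arrow (T N') (T N'') (ext (T N') N'' (\<lambda>z. g' (eps N' z))) \<cdot>\<^bsub>CC\<^esub> Arrow (T N) (T N') (ext (T N) N' (\<lambda>z. g (eps N z)))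
     = Arrow (T N) (T N'') (ext (T N) N'' (\<lambda>z. compose (carrier N) g' g (eps N z)))"
    by (intro T_arrow_eqI[where N=N''])
      (simp_all add: colin_compose'[where M="T N'"] lin_after_eps[OF *])
  then show ?thesis by (simp add: free_map_def free_arrow_def)
qed

lemma free_map_ident [simp]: "comodule N \<Longrightarrow> Ident (Free CC TT) N = free_map N N (\<lambda>n \<in> carrier N. n)"
proof -
  assume [simp]: "comodule N"
  have "Ident CC (T N) = Arrow (T N) (T N) (ext (T N) N (\<lambda>z. (\<lambda>n \<in> carrier N. n) (eps N z)))"
    by (intro T_arrow_eqI[where N=N]) simp_all
  then show ?thesis by (simp add: free_map_def free_arrow_def)
qed

lemma free_map_linear:
  assumes [simp]: "comodule N" "comodule N'" "g \<in> lin K N N'" 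
  shows "h \<in> lin K N N' \<Longrightarrow> free_map N N' g \<oplus>\<^bsub>Hom (Free CC TT) N N'\<^esub> free_map N N' h = free_map N N' (\<lambda>x\<in>carrier N. g x \<oplus>\<^bsub>N'\<^esub> h x)"
    and "a \<in> carrier K \<Longrightarrow> a \<odot>\<^bsub>Hom (Free CC TT) N N'\<^esub> free_map N N' g = free_map N N' (\<lambda>x\<in>carrier N. a \<odot>\<^bsub>N'\<^esub> g x)"
proof -
  interpret V: linear_category K CC by (rule Comod_linear)
  let ?f = "\<lambda>g. Arrow (T N) (T N') (ext (T N) N' (\<lambda>z. g (eps N z)))"
  have *: "is_arr CC f" if "f \<in> arr CC (T N) (T N')" for f using V.is_arrI[OF that] by simp
  have O: "T N \<in> Obj CC" "T N' \<in> Obj CC" by simp_all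
  have f: "?f g \<in> arr CC (T N) (T N')" if "g \<in> lin K N N'" for g using that by simp
  note [simp] = Hom_concrete_category
  have "?f g \<oplus>\<^bsub>Hom CC (T N) (T N')\<^esub> ?f h = ?f (\<lambda>x\<in>carrier N. g x \<oplus>\<^bsub>N'\<^esub> h x)" if h: "h \<in> lin K N N'"
    using *[OF V.add_arr[OF O f f], of g h] h
    by (intro T_arrow_eqI[where N=N']) (simp_all add: lin_pointwise lin_add[OF eps_lin])
  then show "h \<in> lin K N N' \<Longrightarrow> free_map N N' g \<oplus>\<^bsub>Hom (Free CC TT) N N'\<^esub> free_map N N' h = free_map N N' (\<lambda>x\<in>carrier N. g x \<oplus>\<^bsub>N'\<^esub> h x)"
    by (simp add: free_map_def free_arrow_def)
  have "a \<odot>\<^bsub>Hom CC (T N) (T N')\<^esub> ?f g = ?f (\<lambda>x\<in>carrier N. a \<odot>\<^bsub>N'\<^esub> g x)" if a: "a \<in> carrier K"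
    using *[OF V.smult_arr[OF O a f], of g] a
    by (intro T_arrow_eqI[where N=N']) simp_all
  then show "a \<in> carrier K \<Longrightarrow> a \<odot>\<^bsub>Hom (Free CC TT) N N'\<^esub> free_map N N' g = free_map N N' (\<lambda>x\<in>carrier N. a \<odot>\<^bsub>N'\<^esub> g x)"
    by (simp add: free_map_def free_arrow_def)
qed

text \<open>On objects \<open>P\<close> forgets the coaction. On arrows it inverts
  \<open>free_map\<close>, as \<open>eps\<close> after the morphism after the unit; the three
  \<open>mor\<close> remove the wrappers of \<open>Free\<close>, \<open>EM\<close> and
  \<open>Comod\<close>.\<close>

definition P :: "('a comod, ('a comod, ('a comod \<times> 'a comod_arrow, 'a comod_arrow) arrow) arrow, 'a space, ('a space, 'a fn) arrow) funct" where
  "P = \<lparr>FObj = module.truncate, FArr = (\<lambda>f. Arrow (module.truncate (src f)) (module.truncate (tgt f))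
     (\<lambda>n \<in> carrier (src f). eps (tgt f) (mor (mor (mor f)) (ext (src f) (src f) (\<lambda>n. n) n))))\<rparr>"

lemma FObj_P [simp]: "FObj P = module.truncate"
  by (simp add: P_def)

lemma P_free_map [simp]:
  assumes [simp]: "comodule N" "comodule N'" "g \<in> lin K N N'"
  shows "FArr P (free_map N N' g) = Arrow (module.truncate N) (module.truncate N') (restrict g (carrier N))"
  by (simp add: P_def cong: restrict_cong)

lemma P_functor: "linear_functor K (Free CC TT) (Vec K) P"
proof (rule linear_functorI)
  show "linear_category K (Free CC TT)" by (rule linear_monad.Free_linear[OF cotensor_linear_monad])
  show "linear_category K (Vec K)" by (rule Vec_linear)
next
  fix f assume f: "is_arr (Free CC TT) f"
  then obtain N N' g where f: "f = free_map N N' g" and [simp]: "comodule N" "comodule N'" "g \<in> lin K N N'" "g \<in> extensional (carrier N)"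
    by (rule is_arr_FreeE)
  show "is_arr (Vec K) (FArr P f) \<and> Dom (Vec K) (FArr P f) = FObj P (Dom (Free CC TT) f)
      \<and> Cod (Vec K) (FArr P f) = FObj P (Cod (Free CC TT) f)"
    by (simp add: f)
  fix f' assume "is_arr (Free CC TT) f'" and c: "Dom (Free CC TT) f' = Cod (Free CC TT) f"
  then obtain N'' g' where f': "f' = free_map N' N'' g'" and [simp]: "comodule N''" "g' \<in> lin K N' N''" "g' \<in> extensional (carrier N')"
    by (elim is_arr_FreeE) (simp add: f)
  have "compose (carrier N) g' g \<in> lin K N N''" by (rule lin_compose'[where V=N']) simp_all
  then show "FArr P (f' \<cdot>\<^bsub>Free CC TT\<^esub> f) = FArr P f' \<cdot>\<^bsub>Vec K\<^esub> FArr P f"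
    unfolding f f' by (subst free_map_comp) (simp_all add: extensional_restrict)
next
  fix X Y f g assume O: "X \<in> Obj (Free CC TT)" "Y \<in> Obj (Free CC TT)" and f: "f \<in> arr (Free CC TT) X Y" and g: "g \<in> arr (Free CC TT) X Y"
  then obtain f0 g0 where fg: "f = free_map X Y f0" "g = free_map X Y g0" and [simp]: "comodule X" "comodule Y"
    "f0 \<in> lin K X Y" "g0 \<in> lin K X Y"
    by (auto simp: arr_Free simp del: Free_simps(6))
  show "FArr P (f \<oplus>\<^bsub>Hom (Free CC TT) X Y\<^esub> g) = FArr P f \<oplus>\<^bsub>Hom (Vec K) (FObj P X) (FObj P Y)\<^esub> FArr P g"
    unfolding fg by (subst free_map_linear) (simp_all add: Vec_Hom lin_pointwise cong: restrict_cong)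
  show "FArr P (a \<odot>\<^bsub>Hom (Free CC TT) X Y\<^esub> f) = a \<odot>\<^bsub>Hom (Vec K) (FObj P X) (FObj P Y)\<^esub> FArr P f"
    if "a \<in> carrier K" for a
    unfolding fg by (subst free_map_linear) (use that in \<open>simp_all add: Vec_Hom cong: restrict_cong\<close>)
next
  fix X assume "X \<in> Obj (Free CC TT)"
  then have [simp]: "comodule X" by simp
  show "FArr P (Ident (Free CC TT) X) = Ident (Vec K) (FObj P X)" 
    by (subst free_map_ident) (simp_all cong: restrict_cong)
qed simp

text \<open>\<open>arr_Free\<close> makes \<open>P\<close> full and faithful. Every vector space is
  the underlying space of the trivial comodule on it, so the isomorphism required for essential
  surjectivity can be an identity.\<close>

lemma P_weak_equivalence: "weak_equivalence K (Free CC TT) (Vec K) P"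
proof -
  interpret linear_functor K "Free CC TT" "Vec K" P by (rule P_functor)
  show ?thesis
  proof
    fix X Y h assume "X \<in> Obj (Free CC TT)" "Y \<in> Obj (Free CC TT)" "h \<in> arr (Vec K) (FObj P X) (FObj P Y)"
    then obtain g where h: "h = Arrow (module.truncate X) (module.truncate Y) g" and [simp]: "comodule X" "comodule Y" "g \<in> lin K X Y"
      "g \<in> extensional (carrier X)" by (auto simp: Vec_Hom)
    show "\<exists>f\<in>arr (Free CC TT) X Y. FArr P f = h"
      by (rule bexI[of _ "free_map X Y g"]) (auto simp: h arr_Free extensional_restrict simp del: Free_simps(6))
  next
    fix X Y f g assume "X \<in> Obj (Free CC TT)" "Y \<in> Obj (Free CC TT)" "f \<in> arr (Free CC TT) X Y" "g \<in> arr (Free CC TT) X Y"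
      and eq: "FArr P f = FArr P g"
    then obtain f0 g0 where fg: "f = free_map X Y f0" "g = free_map X Y g0" and [simp]: "comodule X" "comodule Y"
      "f0 \<in> lin K X Y" "g0 \<in> lin K X Y" "f0 \<in> extensional (carrier X)" "g0 \<in> extensional (carrier X)"
      by (auto simp: arr_Free simp del: Free_simps(6))
    show "f = g" using eq by (simp add: fg extensional_restrict)
  next
    fix V assume "V \<in> Obj (Vec K)"
    then have [simp]: "module K V" by simp
    have "iso_arr (Vec K) (Ident (Vec K) V)" by (rule target.iso_arr_ident) simp
    then show "\<exists>X\<in>Obj (Free CC TT). \<exists>q. is_iso (Vec K) (FObj P X) V q"
      by (intro bexI[of _ "with_coact V (\<lambda>v. pure K B V \<one>\<^bsub>B\<^esub> v)"] exI[of _ "Ident (Vec K) V"])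
        (simp_all add: target.is_iso_iff comodule_trivial)
  qed
qed

section \<open>The action on free modules\<close>

abbreviation "FA \<equiv> free_action CC TT (cotensor_lax K B (bullet K B))"

lemma cotensor_lax_simp [simp]:
  "\<lbrakk>comodule M; comodule N\<rbrakk> \<Longrightarrow> cotensor_lax K B (bullet K B) M N =
     Arrow (comod_tensor K B M (T N)) (T (comod_tensor K B M N))
       (ext (comod_tensor K B M (T N)) (comod_tensor K B M N) (tmap K M (T N) M N (\<lambda>m. m) (eps N)))"
  by (simp add: cotensor_lax_def Let_def cotensor_comod_simps cotensor_lax_ext cong: restrict_cong)
    (simp add: ext_def)

lemma maps_truncate [simp]:
  "tmap K W (module.truncate N) W' (module.truncate N') f g = tmap K W N W' N' f g"
  "tassoc K W W' (module.truncate N) = tassoc K W W' N" "tlunit K (module.truncate N) = tlunit K N"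
  by (simp_all add: tmap_def tassoc_def tlunit_def)

lemma tmap_eps:
  assumes g: "g \<in> lin K W W'" and k: "k \<in> lin K N (T N')" and h: "\<And>n. n \<in> carrier N \<Longrightarrow> eps N' (k n) = h n"
    and [simp]: "module K W" "module K W'" "module K N" "comodule N'" "x \<in> carrier (tensor K W N)"
  shows "tmap K W' (T N') W' N' (\<lambda>m. m) (eps N') (tmap K W N W' (T N') g k x) = tmap K W N W' N' g h x"
proof -
  have h': "h \<in> lin K N N'"
    by (rule lin_cong[OF lin_compose[OF eps_lin k]]) (simp_all add: h)
  note [simp] = g k h' lin_closed[OF g] lin_closed[OF k] lin_comp_simp[OF g] lin_comp_simp[OF k]
  show ?thesis by (simp add: tmap_sweedler h cong: sweedler_cong)
qed

text \<open>After \<open>eps\<close>, the lax structure is id \<otimes> \<open>eps\<close> and the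
  extension to the free module is undone, so that only \<open>g\<close> \<otimes> \<open>h\<close>
  remains. By cofreeness this determines the morphism.\<close>

lemma ActA_free_map:
  assumes g: "g \<in> colin K B W W'" and h: "h \<in> lin K N N'"
    and [simp]: "comodule W" "comodule W'" "comodule N" "comodule N'"
  shows "ActA FA (Arrow W W' g) (free_map N N' h) = free_map (comod_tensor K B W N) (comod_tensor K B W' N') (tmap K W N W' N' g h)"
proof -
  note [simp] = g h
  let ?W = "comod_tensor K B W N" and ?W' = "comod_tensor K B W' N'"
  \<comment> \<open>The morphism of \<open>h\<close> after the unit, which is the form in which the
    action on morphisms receives it. Under cofreeness it corresponds to \<open>h\<close>.\<close>
  define k where "k = compose (carrier N) (ext (T N) N' (\<lambda>z. h (eps N z))) (ext N N (\<lambda>n. n))"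
  have k: "k \<in> colin K B N (T N')" "eps N' (k n) = h n" if "n \<in> carrier N" for n
    using that by (simp_all add: k_def colin_compose'[where M="T N"])
  have k' [simp]: "k \<in> colin K B N (T N')" by (simp add: k_def colin_compose'[where M="T N"])
  have [simp]: "tmap K W N W' (T N') g k \<in> colin K B (comod_tensor K B W N) (comod_tensor K B W' (T N'))"
    by (rule tmap_colin) simp_all
  \<comment> \<open>The lax structure after \<open>g\<close> \<otimes> \<open>k\<close>; it
    corresponds to \<open>g\<close> \<otimes> \<open>h\<close> under cofreeness.\<close>
  define q where "q = compose (carrier (tensor K W N)) (ext (comod_tensor K B W' (T N')) ?W' (tmap K W' (T N') W' N' (\<lambda>m. m) (eps N')))
      (tmap K W N W' (T N') g k)"
  have q [simp]: "q \<in> colin K B ?W (T ?W')"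
    using colin_compose'[of ?W "comod_tensor K B W' (T N')" "T ?W'"] by (simp add: q_def)
  have eps_closed [simp]: "eps ?W z \<in> carrier (tensor K W N)" if "z \<in> carrier (T ?W)" for z
    using lin_closed[OF eps_lin, of ?W z] that by simp
  have q_eps [simp]: "(\<lambda>z. q (eps ?W z)) \<in> lin K (T ?W) (T ?W')"
    by (rule lin_after_eps[OF colin_lin[OF q]]) simp
  have eps_q [simp]: "eps ?W' (q x) = tmap K W N W' N' g h x" if "x \<in> carrier (tensor K W N)" for x
    using that k by (simp add: q_def tmap_eps)
  have [simp]: "(\<lambda>z. eps ?W' (eps (T ?W') z)) \<in> lin K (T (T ?W')) (tensor K W' N')"
    using lin_after_eps[OF eps_lin, of ?W'] by simp
  have "Mu TT ?W' \<cdot>\<^bsub>CC\<^esub> FArr (MFun TT) (Arrow ?W (T ?W') q)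
    = Arrow (T ?W) (T ?W') (ext (T ?W) ?W' (\<lambda>z. tmap K W N W' N' g h (eps ?W z)))"
    by (intro T_arrow_eqI[where N="?W'"])
      (simp_all add: colin_compose'[where M="T (T ?W')"])
  moreover have "cotensor_lax K B (bullet K B) W' N' \<cdot>\<^bsub>CC\<^esub> TensA CC (Arrow W W' g) (Arrow N (T N') k) = Arrow ?W (T ?W') q"
    by (simp add: q_def)
  moreover have "mor (mor (free_map N N' h)) \<cdot>\<^bsub>CC\<^esub> Eta TT N = Arrow N (T N') k"
    by (simp add: k_def)
  moreover have "ActA FA (Arrow W W' g) (free_map N N' h) = free_arrow TT ?W ?W' (Mu TT ?W' \<cdot>\<^bsub>CC\<^esub> FArr (MFun TT)
      (cotensor_lax K B (bullet K B) W' N' \<cdot>\<^bsub>CC\<^esub> TensA CC (Arrow W W' g) (mor (mor (free_map N N' h)) \<cdot>\<^bsub>CC\<^esub> Eta TT N)))"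
    by (simp only: free_action_def action.simps free_map_simps Comod_simps arrow.sel)
  ultimately show ?thesis by (simp only: free_map_def)
qed

lemma free_action_simps [simp]:
  "Act FA = comod_tensor K B"
  "\<lbrakk>comodule W; comodule W'; comodule X\<rbrakk> \<Longrightarrow> AAssoc FA W W' X =
    free_map (comod_tensor K B (comod_tensor K B W W') X) (comod_tensor K B W (comod_tensor K B W' X)) (tassoc K W W' X)"
  "comodule X \<Longrightarrow> AUnit FA X = free_map (comod_tensor K B (comod_unit K B) X) X (tlunit K X)"
  by (simp_all add: free_action_def free_map_def tassoc_colin tlunit_colin)

text \<open>\<open>P\<close> preserves the action, the associator and the unit exactly, so coherence
  on free modules is inherited from vector spaces through
  \<open>module_category_reflected\<close>.\<close>

lemma free_module_category: "module_category K CC (Free CC TT) FA"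
  and P_strong: "strong_module_functor K CC (Free CC TT) FA (Vec K) (fiber_action K) P
     (\<lambda>W X. Ident (Vec K) (Act (fiber_action K) W (FObj P X)))"
proof -
  have a: "Act FA W X \<in> Obj (Free CC TT) \<and> FObj P (Act FA W X) = Act (fiber_action K) W (FObj P X)"
    if "W \<in> Obj CC" "X \<in> Obj (Free CC TT)" for W X using that by simp
  have b: "is_arr (Free CC TT) (ActA FA g f) \<and> Dom (Free CC TT) (ActA FA g f) = Act FA (Dom CC g) (Dom (Free CC TT) f) \<and>
          Cod (Free CC TT) (ActA FA g f) = Act FA (Cod CC g) (Cod (Free CC TT) f) \<and> FArr P (ActA FA g f) = ActA (fiber_action K) g (FArr P f)"
    if g: "is_arr CC g" and f: "is_arr (Free CC TT) f" for g f
  proof -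
    obtain N N' h where f: "f = free_map N N' h" and [simp]: "comodule N" "comodule N'" "h \<in> lin K N N'" "h \<in> extensional (carrier N)"
      using f by (rule is_arr_FreeE)
    obtain W W' g0 where gd: "g = Arrow W W' g0" by (cases g)
    have [simp]: "comodule W" "comodule W'" "g0 \<in> colin K B W W'" using g by (simp_all add: gd)
    show ?thesis
      unfolding f gd ActA_free_map[OF \<open>g0 \<in> colin K B W W'\<close> \<open>h \<in> lin K N N'\<close> \<open>comodule W\<close> \<open>comodule W'\<close> \<open>comodule N\<close> \<open>comodule N'\<close>]
      by (simp add: extensional_restrict)
  qed
  have c: "is_arr (Free CC TT) (AAssoc FA W W' X) \<and>
          Dom (Free CC TT) (AAssoc FA W W' X) = Act FA (Tens CC W W') X \<and> Cod (Free CC TT) (AAssoc FA W W' X) = Act FA W (Act FA W' X) \<and>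
          FArr P (AAssoc FA W W' X) = AAssoc (fiber_action K) W W' (FObj P X)"
    if "W \<in> Obj CC" "W' \<in> Obj CC" "X \<in> Obj (Free CC TT)" for W W' X
    using that by (simp add: extensional_restrict)
  have d: "is_arr (Free CC TT) (AUnit FA X) \<and> Dom (Free CC TT) (AUnit FA X) = Act FA (Unit CC) X \<and> Cod (Free CC TT) (AUnit FA X) = X \<and>
          FArr P (AUnit FA X) = AUnit (fiber_action K) (FObj P X)" if "X \<in> Obj (Free CC TT)" for X
    using that by (simp add: extensional_restrict)
  show "module_category K CC (Free CC TT) FA"
    "strong_module_functor K CC (Free CC TT) FA (Vec K) (fiber_action K) P
     (\<lambda>W X. Ident (Vec K) (Act (fiber_action K) W (FObj P X)))"
    by (rule module_category_reflected[OF P_weak_equivalence fiber_module_category a b c d]; assumption)+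
qed

end

section \<open>Every module is free\<close>

context linear_monad
begin

lemma EM_isoI:
  assumes P: "P \<in> Obj (EM C T)" and Q: "Q \<in> Obj (EM C T)" and f: "iso_arr C f" "Dom C f = fst P" "Cod C f = fst Q"
    and eq: "f \<cdot>\<^bsub>C\<^esub> snd P = snd Q \<cdot>\<^bsub>C\<^esub> FArr (MFun T) f"
  shows "is_iso (EM C T) P Q (Arrow P Q f)"
proof -
  interpret EM: linear_category K "EM C T" by (rule EM_linear)
  let ?g = "inv_arr C f"
  note PQ = P[unfolded Obj_EM] Q[unfolded Obj_EM] and f [simp] = f
  have "?g \<cdot>\<^bsub>C\<^esub> snd Q = snd P \<cdot>\<^bsub>C\<^esub> FArr (MFun T) ?g"
  proof (rule source.iso_cancel_right[where p="FArr (MFun T) f"])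
    have "?g \<cdot>\<^bsub>C\<^esub> snd Q \<cdot>\<^bsub>C\<^esub> FArr (MFun T) f = snd P" using PQ by (simp flip: eq)
    moreover have "snd P \<cdot>\<^bsub>C\<^esub> FArr (MFun T) ?g \<cdot>\<^bsub>C\<^esub> FArr (MFun T) f = snd P" using PQ by (simp add: functor_merge)
    ultimately show "(?g \<cdot>\<^bsub>C\<^esub> snd Q) \<cdot>\<^bsub>C\<^esub> FArr (MFun T) f = (snd P \<cdot>\<^bsub>C\<^esub> FArr (MFun T) ?g) \<cdot>\<^bsub>C\<^esub> FArr (MFun T) f"
      using PQ by simp
  qed (use PQ in simp_all)
  then have "iso_arr (EM C T) (Arrow P Q f)"
    using P Q eq by (intro EM.iso_arrI[where g="Arrow Q P ?g"]) (simp_all add: is_arr_EM)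
  then show ?thesis using P Q by (simp add: EM.is_iso_iff)
qed

text \<open>The universal property of the free module on \<open>X\<close>: the arrow
  \<open>i\<close> extends to the action after T of \<open>i\<close>, and this extension is a module
  morphism by naturality of the multiplication and associativity of the action.\<close>

lemma free_extension:
  assumes P: "P \<in> Obj (EM C T)" and i: "is_arr C i" "Dom C i = X" "Cod C i = fst P"
  shows "(snd P \<cdot>\<^bsub>C\<^esub> FArr (MFun T) i) \<cdot>\<^bsub>C\<^esub> Mu T X = snd P \<cdot>\<^bsub>C\<^esub> FArr (MFun T) (snd P \<cdot>\<^bsub>C\<^esub> FArr (MFun T) i)"
proof -
  note P = P[unfolded Obj_EM] and [simp] = i
  have X [simp]: "X \<in> Obj C" using source.is_arr_obj(1)[OF i(1)] by simp
  have "\<forall>X \<in> Obj C. \<forall>Y \<in> Obj C. \<forall>f \<in> arr C X Y. Mu T Y \<cdot>\<^bsub>C\<^esub> FArr (MFun T) (FArr (MFun T) f) = FArr (MFun T) f \<cdot>\<^bsub>C\<^esub> Mu T X"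
    using mu_natural by (simp add: natural_trans_def comp_funct_def)
  then have n: "Mu T (fst P) \<cdot>\<^bsub>C\<^esub> FArr (MFun T) (FArr (MFun T) i) = FArr (MFun T) i \<cdot>\<^bsub>C\<^esub> Mu T X"
    using P by (simp add: source.arr_iff)
  have hh: "snd P \<cdot>\<^bsub>C\<^esub> FArr (MFun T) (snd P) \<cdot>\<^bsub>C\<^esub> FArr (MFun T) (FArr (MFun T) i)
     = snd P \<cdot>\<^bsub>C\<^esub> Mu T (fst P) \<cdot>\<^bsub>C\<^esub> FArr (MFun T) (FArr (MFun T) i)"
    by (rule source.comp_reassoc) (use P in simp_all)
  show ?thesis using P by (simp add: functor_comp hh n)
qed

end

context bialgebra
begin

text \<open>As \<Delta>(1) = 1 \<otimes> 1, the coaction of 1 \<otimes> n is 1 \<otimes> (1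
  \<otimes> n). So an \<open>ext\<close> acts on 1 \<otimes> n by applying its linear map behind the
  1.\<close>

lemma ext_pure_one:
  assumes "comodule N" "comodule N'" "g \<in> lin K (T N) N'" "n \<in> carrier N"
  shows "ext (T N) N' g (phi N (pure K B N \<one>\<^bsub>B\<^esub> n)) = phi N' (pure K B N' \<one>\<^bsub>B\<^esub> (g (phi N (pure K B N \<one>\<^bsub>B\<^esub> n))))"
proof -
  note [simp] = assms lin_closed[OF assms(3)] lin_comp_simp[OF assms(3)]
  show ?thesis by (simp add: ext_def del: phi_sweedler_T)
qed

text \<open>For the action h on \<open>M\<close>, the map e(m) = h(1 \<otimes> m) is an idempotent.
  Its image, with the trivial coaction, generates the module freely: b \<otimes> v \<mapsto> h(b
  \<otimes> v) and m \<mapsto> m_{-1} \<otimes> e(m_0) are inverse to each other.\<close>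

lemma free_essentially_surjective:
  assumes Z: "Z \<in> Obj (EM CC TT)"
  shows "\<exists>X\<in>Obj CC. \<exists>q. is_iso (EM CC TT) (free_module TT X) Z q"
proof -
  interpret linear_monad K CC TT by (rule cotensor_linear_monad)
  note Z' = Z[unfolded Obj_EM]
  obtain M h where M_def: "Z = (M, h)" by (cases Z)
  have M [simp]: "comodule M" using Z' by (simp add: M_def)
  obtain H where h: "h = Arrow (T M) M H" using Z' by (cases h) (simp add: M_def)
  have H [simp]: "H \<in> colin K B (T M) M" "H \<in> extensional (carrier (T M))"
    and H1: "Arrow (T M) M H \<cdot>\<^bsub>CC\<^esub> Eta TT M = Ident CC M"
    and H2: "Arrow (T M) M H \<cdot>\<^bsub>CC\<^esub> FArr (MFun TT) (Arrow (T M) M H) = Arrow (T M) M H \<cdot>\<^bsub>CC\<^esub> Mu TT M"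
    using Z' by (simp_all only: M_def h fst_conv snd_conv is_arr_Comod arrow.sel simp_thms)
  have H_eta: "H (ext M M (\<lambda>n. n) m) = m" if "m \<in> carrier M" for m
    using arg_cong[OF H1, of "\<lambda>f. mor f m"] that by simp
  have H_mu: "H (ext (T (T M)) M (\<lambda>z. H (eps (T M) z)) w) = H (ext (T (T M)) M (\<lambda>z. eps M (eps (T M) z)) w)"
    if "w \<in> carrier (T (T M))" for w
    using arg_cong[OF H2, of "\<lambda>f. mor f w"] that by simp
  note [simp] = lin_comp_simp[OF colin_lin[OF H(1)]] lin_closed[OF colin_lin[OF H(1)]] colin_lin[OF H(1)]
  define j where "j m = phi M (pure K B M \<one>\<^bsub>B\<^esub> m)" for m
  define e where "e m = H (j m)" for m
  have j_lin [simp]: "j \<in> lin K M (T M)" unfolding j_def by simp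
  have j_closed [simp]: "m \<in> carrier M \<Longrightarrow> j m \<in> carrier (T M)" for m by (rule lin_closed[OF j_lin])
  have eps_j [simp]: "m \<in> carrier M \<Longrightarrow> eps M (j m) = m" for m by (simp add: j_def)
  have e_lin [simp]: "e \<in> lin K M M" unfolding e_def using lin_compose[OF colin_lin[OF H(1)] j_lin] by simp
  have e_closed [simp]: "m \<in> carrier M \<Longrightarrow> e m \<in> carrier M" for m by (rule lin_closed[OF e_lin])
  \<comment> \<open>Associativity of the action at the element 1 \<otimes> t of
    \<open>T (T M)\<close>: one side is h(1 \<otimes> h(t)), and the other is h(1 \<otimes> s) with
    s = \<open>eps M t\<close>.\<close>
  have e_H: "e (H t) = e (eps M t)" if [simp]: "t \<in> carrier (T M)" for t
  proof -
    have "H (ext (T (T M)) M (\<lambda>z. H (eps (T M) z)) (phi (T M) (pure K B (T M) \<one>\<^bsub>B\<^esub> t))) = e (H t)"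
      by (subst ext_pure_one) (simp_all add: e_def j_def)
    moreover have "H (ext (T (T M)) M (\<lambda>z. eps M (eps (T M) z)) (phi (T M) (pure K B (T M) \<one>\<^bsub>B\<^esub> t))) = e (eps M t)"
      by (subst ext_pure_one) (simp_all add: e_def j_def)
    ultimately show ?thesis using H_mu[of "phi (T M) (pure K B (T M) \<one>\<^bsub>B\<^esub> t)"] by simp
  qed
  \<comment> \<open>\<open>e_H\<close> at t = 1 \<otimes> m.\<close>
  have e_idem: "e (e m) = e m" if "m \<in> carrier M" for m
    using e_H[of "j m"] that by (simp add: e_def[of m])
  \<comment> \<open>h is colinear and the coaction of 1 \<otimes> m is 1 \<otimes> (1 \<otimes>
    m).\<close>
  have e_coact: "coact M (e m) = pure K B M \<one>\<^bsub>B\<^esub> (e m)" if "m \<in> carrier M" for m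
    using that colin_coact[OF H(1), of "j m"] by (simp add: e_def j_def)
  \<comment> \<open>The image of the idempotent, described by its fixed points so that
    \<open>equalizer_module\<close> applies.\<close>
  define V where "V = (module.truncate M)\<lparr>carrier := {m \<in> carrier M. e m = m}\<rparr>"
  have V_simps [simp]: "carrier V = {m \<in> carrier M. e m = m}" "add V = add M" "zero V = zero M" "smult V = smult M"
    by (simp_all add: V_def)
  have V [simp]: "module K V"
    using equalizer_module[of "module.truncate M" M e "\<lambda>m. m"] by (simp add: V_def)
  define N where "N = with_coact V (\<lambda>v. pure K B V \<one>\<^bsub>B\<^esub> v)"
  have N [simp]: "comodule N" by (simp add: N_def comodule_trivial)
  have N_simps [simp]: "carrier N = {m \<in> carrier M. e m = m}" by (simp add: N_def)
  have i_lin [simp]: "(\<lambda>n. n) \<in> lin K N M" and e_lin' [simp]: "e \<in> lin K M N"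
    using e_lin by (auto simp: lin_def N_def e_idem)
  have [simp]: "(\<lambda>n. n) \<in> lin K V M" by (auto simp: lin_def)
  have i [simp]: "(\<lambda>n. n) \<in> colin K B N M"
  proof (rule colinI[OF N M i_lin])
    fix m assume "m \<in> carrier N"
    then show "coact M m = sweedler B N (tensor K B M) (coact N m) (\<lambda>b n. pure K B M b n)"
      using e_coact[of m] by (simp add: N_def)
  qed
  \<comment> \<open>The inclusion of \<open>N\<close> into \<open>M\<close>, restricted to the
    carrier because arrows consist of extensional functions. It is colinear by
    \<open>e_coact\<close>.\<close>
  define ii where "ii = (\<lambda>n \<in> carrier N. n)"
  have ii: "ii n = n" if "n \<in> carrier N" for n using that by (simp add: ii_def)
  have ii_ext [simp]: "ii \<in> extensional (carrier N)" by (simp add: ii_def)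
  have ir [simp]: "ii \<in> colin K B N M"
    unfolding ii_def using i by (rule colin_restrictI[OF N M])
  \<comment> \<open>The extension of the inclusion to the free module, b \<otimes> n \<mapsto> h(b
    \<otimes> n).\<close>
  define a where "a = compose (carrier (T N)) H (ext (T N) M (\<lambda>z. ii (eps N z)))"
  have a [simp]: "a \<in> colin K B (T N) M" by (simp add: a_def colin_compose'[where M="T M"])
  have b [simp]: "ext M N e \<in> colin K B M (T N)" by simp
  have e_eps: "e (eps N z) = eps N z" "eps N z \<in> carrier M" if "z \<in> carrier (T N)" for z
    using lin_closed[OF eps_lin[OF N] that] by simp_all
  let ?i = "ext (T N) M (\<lambda>z. ii (eps N z))"
  have i_eps [simp]: "(\<lambda>z. ii (eps N z)) \<in> lin K (T N) M"
    by (rule lin_after_eps[OF colin_lin[OF ir] N])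
  have Ti: "?i \<in> colin K B (T N) (T M)" by (rule ext_colin) simp_all
  have eps_i: "eps M (?i z) = eps N z" if z: "z \<in> carrier (T N)" for z
    by (subst eps_ext[OF comodule_T[OF N] M i_eps z]) (use e_eps[OF z] in \<open>simp add: ii\<close>)
  \<comment> \<open>After \<open>eps\<close> the left side is e(a(z)). By \<open>e_H\<close> this is
    \<open>e\<close> applied to \<open>eps N z\<close>, which lies in the image of \<open>e\<close>
    and is fixed.\<close>
  have ba: "ext M N e (a z) = z" if z: "z \<in> carrier (T N)" for z
  proof (rule cofree_eqI[OF comodule_T[OF N] N _ colin_ident[OF comodule_T[OF N]] _ z])
    show "(\<lambda>z. ext M N e (a z)) \<in> colin K B (T N) (T N)"
      by (rule colin_compose[where M=M]) simp_all
    fix z assume z: "z \<in> carrier (T N)"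
    have "eps N (ext M N e (a z)) = e (a z)" using z by (simp add: lin_closed[OF colin_lin[OF a]])
    also have "\<dots> = e (eps M (?i z))"
      using z e_H[OF lin_closed[OF colin_lin[OF Ti] z]] by (simp only: a_def compose_eq)
    finally show "eps N (ext M N e (a z)) = eps N z" using z by (simp only: eps_i e_eps)
  qed
  have ab: "a (ext M N e m) = m" if m: "m \<in> carrier M" for m
  proof -
    have b_m: "ext M N e m \<in> carrier (T N)" using m by simp
    \<comment> \<open>This element of \<open>T (T M)\<close> is m_{-1} \<otimes> (1 \<otimes> m_0).
      T of the action sends it to m_{-1} \<otimes> e(m_0), the multiplication sends it to the unit
      at m. Associativity and the unit law of the action then give \<open>ab\<close>.\<close>
    have w: "ext M (T M) j m \<in> carrier (T (T M))" using m by simp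
    have "?i (ext M N e m) = ext (T (T M)) M (\<lambda>z. H (eps (T M) z)) (ext M (T M) j m)"
    proof (rule cofree_eqI[OF M M _ _ _ m, where f="\<lambda>m. ?i (ext M N e m)"])
      show "(\<lambda>m. ?i (ext M N e m)) \<in> colin K B M (T M)"
        by (rule colin_compose[OF M _ _ b Ti]) simp_all
      show "(\<lambda>m. ext (T (T M)) M (\<lambda>z. H (eps (T M) z)) (ext M (T M) j m)) \<in> colin K B M (T M)"
        by (rule colin_compose[where M="T (T M)"]) simp_all
      fix m assume m: "m \<in> carrier M"
      show "eps M (?i (ext M N e m)) = eps M (ext (T (T M)) M (\<lambda>z. H (eps (T M) z)) (ext M (T M) j m))"
        by (subst eps_i) (use m in \<open>simp_all add: e_def\<close>)
    qed
    moreover have "ext (T (T M)) M (\<lambda>z. eps M (eps (T M) z)) (ext M (T M) j m) = ext M M (\<lambda>n. n) m"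
    proof (rule cofree_eqI[OF M M _ _ _ m])
      show "(\<lambda>m. ext (T (T M)) M (\<lambda>z. eps M (eps (T M) z)) (ext M (T M) j m)) \<in> colin K B M (T M)"
        by (rule colin_compose[where M="T (T M)"]) simp_all
    qed simp_all
    ultimately have "H (?i (ext M N e m)) = m" using H_mu[OF w] H_eta[OF m] by simp
    then show ?thesis using b_m by (simp only: a_def compose_eq)
  qed
  have ai: "Arrow (T M) M H \<cdot>\<^bsub>CC\<^esub> FArr (MFun TT) (Arrow N M ii) = Arrow (T N) M a"
    by (simp add: a_def)
  have "is_iso (EM CC TT) (free_module TT N) Z (Arrow (free_module TT N) Z (Arrow (T N) M a))"
  proof (rule EM_isoI[OF _ Z])
    show "free_module TT N \<in> Obj (EM CC TT)" by simp
    have "a \<in> extensional (carrier (T N))" by (simp add: a_def)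
    then show "iso_arr CC (Arrow (T N) M a)"
      by (intro source.iso_arrI[where g="Arrow M (T N) (ext M N e)"])
        (simp_all add: compose_def ba ab cong: restrict_cong)
    show "Arrow (T N) M a \<cdot>\<^bsub>CC\<^esub> snd (free_module TT N) = snd Z \<cdot>\<^bsub>CC\<^esub> FArr (MFun TT) (Arrow (T N) M a)"
      using free_extension[OF Z, of "Arrow N M ii" N]
      unfolding M_def h snd_conv fst_conv ai free_module_simps by (simp only: is_arr_Comod Comod_simps arrow.sel N M ir ii_ext simp_thms)
  qed (simp_all add: M_def)
  then show ?thesis by (intro bexI[of _ N] exI) simp_all
qed

end

section \<open>Bases of vector spaces\<close>

text \<open>Linear combinations grow by one term at a time, so that facts about spans are proved by
  rule induction and not through finite sums over index sets.\<close>

inductive_set lin_span :: "('k, 'r) ring_scheme \<Rightarrow> ('k, 'a, 'x) module_scheme \<Rightarrow> 'a set \<Rightarrow> 'a set"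
  for K V I where
  zero: "\<zero>\<^bsub>V\<^esub> \<in> lin_span K V I"
| step: "\<lbrakk>x \<in> lin_span K V I; a \<in> carrier K; i \<in> I\<rbrakk> \<Longrightarrow> x \<oplus>\<^bsub>V\<^esub> a \<odot>\<^bsub>V\<^esub> i \<in> lin_span K V I"

lemma lin_span_mono: "I \<subseteq> J \<Longrightarrow> lin_span K V I \<subseteq> lin_span K V J"
proof
  fix x assume "I \<subseteq> J" "x \<in> lin_span K V I"
  from this(2,1) show "x \<in> lin_span K V J" by induction (auto intro: lin_span.intros)
qed

text \<open>A linear combination involves finitely many vectors, and in a chain finitely many
  vectors lie in one member.\<close>

lemma lin_span_chain:
  assumes C: "subset.chain A C" "C \<noteq> {}" and x: "x \<in> lin_span K V (\<Union>C)"
  shows "\<exists>J\<in>C. x \<in> lin_span K V J"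
  using x
proof induction
  case zero
  then show ?case using C(2) by (auto intro: lin_span.zero)
next
  case (step x a i)
  then obtain J J' where J: "J \<in> C" "x \<in> lin_span K V J" "J' \<in> C" "i \<in> J'" by blast
  then consider "J \<subseteq> J'" | "J' \<subseteq> J" using C(1) by (auto simp: subset.chain_def)
  then show ?case
  proof cases
    case 1
    then show ?thesis using J step.hyps(2) lin_span_mono[OF 1] by (blast intro: lin_span.step)
  next
    case 2
    then show ?thesis using J step.hyps(2) by (blast intro: lin_span.step)
  qed
qed

context
  fixes K :: "'a univ ring" and V :: "'a space"
  assumes K: "field K" and V: "module K V"
begin

interpretation K: field K by (rule K)
interpretation V: module K V by (rule V)

abbreviation (input) "sp \<equiv> lin_span K V"

text \<open>Linear independence, expressed by what a basis is wanted for: maps on \<open>I\<close>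
  extend linearly to the span. The target spaces have their elements in the same type, as the
  objects of \<open>Vec\<close> do.\<close>

definition extendable :: "'a univ set \<Rightarrow> bool" where
  "extendable I \<longleftrightarrow> I \<subseteq> carrier V \<and> (\<forall>(W :: 'a space) f. module K W \<longrightarrow> (\<forall>i\<in>I. f i \<in> carrier W) \<longrightarrow>
     (\<exists>g \<in> lin K (V\<lparr>carrier := lin_span K V I\<rparr>) W. \<forall>i\<in>I. g i = f i))"

context
  fixes I assumes I: "I \<subseteq> carrier V"
begin

lemma span_closed: "x \<in> sp I \<Longrightarrow> x \<in> carrier V"
  by (induction rule: lin_span.induct) (use I in auto)

lemma span_add: "\<lbrakk>y \<in> sp I; x \<in> sp I\<rbrakk> \<Longrightarrow> x \<oplus>\<^bsub>V\<^esub> y \<in> sp I"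
proof (induction rule: lin_span.induct)
  case (step y a i)
  then have "(x \<oplus>\<^bsub>V\<^esub> y) \<oplus>\<^bsub>V\<^esub> a \<odot>\<^bsub>V\<^esub> i \<in> sp I" by (auto intro: lin_span.step)
  moreover have "x \<in> carrier V" "y \<in> carrier V" "i \<in> carrier V" using step I span_closed by auto
  ultimately show ?case using step by (simp add: V.a_assoc)
qed (simp add: span_closed)

lemma span_smult: "\<lbrakk>x \<in> sp I; a \<in> carrier K\<rbrakk> \<Longrightarrow> a \<odot>\<^bsub>V\<^esub> x \<in> sp I"
proof (induction rule: lin_span.induct)
  case (step x b i)
  then have "a \<odot>\<^bsub>V\<^esub> x \<oplus>\<^bsub>V\<^esub> (a \<otimes>\<^bsub>K\<^esub> b) \<odot>\<^bsub>V\<^esub> i \<in> sp I" by (auto intro: lin_span.step)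
  moreover have "x \<in> carrier V" "i \<in> carrier V" using step I span_closed by auto
  ultimately show ?case using step by (simp add: V.smult_r_distr V.smult_assoc1)
qed (simp add: lin_span.zero)

lemma span_base: "i \<in> I \<Longrightarrow> i \<in> sp I"
  using lin_span.step[OF lin_span.zero[of V K I] K.one_closed, of i] I by (auto simp: V.smult_one)

lemma lin_span_eqI:
  assumes "g \<in> lin K (V\<lparr>carrier := sp I\<rparr>) W" "g' \<in> lin K (V\<lparr>carrier := sp I\<rparr>) W" "module K W"
    and "\<And>i. i \<in> I \<Longrightarrow> g i = g' i" and "x \<in> sp I"
  shows "g x = g' x"
proof -
  interpret W: module K W by fact
  have z: "h \<zero>\<^bsub>V\<^esub> = \<zero>\<^bsub>W\<^esub>" if h: "h \<in> lin K (V\<lparr>carrier := sp I\<rparr>) W" for h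
  proof -
    have "h (\<zero>\<^bsub>K\<^esub> \<odot>\<^bsub>V\<^esub> \<zero>\<^bsub>V\<^esub>) = \<zero>\<^bsub>K\<^esub> \<odot>\<^bsub>W\<^esub> h \<zero>\<^bsub>V\<^esub>" "h \<zero>\<^bsub>V\<^esub> \<in> carrier W"
      using h lin_span.zero[of V K I] K.zero_closed
      by (auto simp: lin_def simp del: V.smult_l_null V.smult_r_null W.smult_l_null)
    then show ?thesis by simp
  qed
  show ?thesis
    using \<open>x \<in> sp I\<close>
  proof induction
    case (step x a i)
    then have "i \<in> sp I" "a \<odot>\<^bsub>V\<^esub> i \<in> sp I" by (simp_all add: span_base span_smult)
    then show ?case using assms(1,2,4) step by (simp add: lin_def)
  qed (simp add: z assms)
qed

end

text \<open>A linear map on a span is determined by its values on the generators, so the extensions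
  chosen for the members of the chain agree where they overlap. They glue to a map on the span of
  the union.\<close>

lemma extendable_chain:
  assumes C: "subset.chain {I. extendable I} C" "C \<noteq> {}"
  shows "extendable (\<Union>C)"
  unfolding extendable_def
proof (intro conjI allI impI)
  have ext: "extendable J" if "J \<in> C" for J using C(1) that by (auto simp: subset.chain_def)
  then have sub: "J \<subseteq> carrier V" if "J \<in> C" for J using that by (auto simp: extendable_def)
  then show UC: "\<Union>C \<subseteq> carrier V" by blast
  fix W :: "'a space" and f assume W: "module K W" and f: "\<forall>i\<in>\<Union>C. f i \<in> carrier W"
  have "\<forall>J\<in>C. \<exists>g \<in> lin K (V\<lparr>carrier := sp J\<rparr>) W. \<forall>i\<in>J. g i = f i"
    using ext W f unfolding extendable_def by blast
  then obtain g where g: "\<And>J. J \<in> C \<Longrightarrow> g J \<in> lin K (V\<lparr>carrier := sp J\<rparr>) W"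
    and gf: "\<And>J i. \<lbrakk>J \<in> C; i \<in> J\<rbrakk> \<Longrightarrow> g J i = f i" by metis
  have le: "g J x = g J' x" if "J \<in> C" "J' \<in> C" "J \<subseteq> J'" "x \<in> sp J" for J J' x
  proof (rule lin_span_eqI[OF sub[OF that(1)] g[OF that(1)] _ W _ that(4)])
    show "g J' \<in> lin K (V\<lparr>carrier := sp J\<rparr>) W"
      using g[OF that(2)] lin_span_mono[OF that(3), of K V] by (auto simp: lin_def Pi_def subset_iff)
  qed (use that gf in auto)
  have compat: "g J x = g J' x" if "J \<in> C" "J' \<in> C" "x \<in> sp J" "x \<in> sp J'" for J J' x
  proof -
    have "J \<subseteq> J' \<or> J' \<subseteq> J" using C(1) that(1,2) by (auto simp: subset.chain_def)
    then show ?thesis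
      by (elim disjE) (rule le[OF that(1,2) _ that(3)], assumption, rule le[OF that(2,1) _ that(4), symmetric])
  qed
  \<comment> \<open>By \<open>compat\<close> the value does not depend on the member chosen.\<close>
  define G where "G x = g (SOME J. J \<in> C \<and> x \<in> sp J) x" for x
  have G: "G x = g J x" if "J \<in> C" "x \<in> sp J" for J x
    unfolding G_def using someI[of "\<lambda>J. J \<in> C \<and> x \<in> sp J" J] that by (intro compat) auto
  have join: "\<exists>J\<in>C. x \<in> sp J \<and> y \<in> sp J" if xy: "x \<in> sp (\<Union>C)" "y \<in> sp (\<Union>C)" for x y
  proof -
    obtain J J' where J: "J \<in> C" "x \<in> sp J" "J' \<in> C" "y \<in> sp J'" using lin_span_chain[OF C] xy by metis
    then consider "J \<subseteq> J'" | "J' \<subseteq> J" using C(1) by (auto simp: subset.chain_def)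
    then show ?thesis using J lin_span_mono[of J J' K V] lin_span_mono[of J' J K V] by cases auto
  qed
  have "G \<in> lin K (V\<lparr>carrier := sp (\<Union>C)\<rparr>) W"
    unfolding lin_def
  proof (intro CollectI conjI ballI Pi_I; simp)
    fix x assume x: "x \<in> sp (\<Union>C)"
    then obtain J where J: "J \<in> C" "x \<in> sp J" using join by blast
    then show "G x \<in> carrier W" using g[OF J(1)] by (auto simp: G lin_def)
    show "G (a \<odot>\<^bsub>V\<^esub> x) = a \<odot>\<^bsub>W\<^esub> G x" if "a \<in> carrier K" for a
      using g[OF J(1)] J that span_smult[OF sub[OF J(1)] J(2) that] by (simp add: G lin_def)
    fix y assume y: "y \<in> sp (\<Union>C)"
    then obtain J where J: "J \<in> C" "x \<in> sp J" "y \<in> sp J" using join x by blast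
    show "G (x \<oplus>\<^bsub>V\<^esub> y) = G x \<oplus>\<^bsub>W\<^esub> G y"
      using g[OF J(1)] J span_add[OF sub[OF J(1)] J(3,2)] by (simp add: G lin_def)
  qed
  moreover have "G i = f i" if i: "i \<in> \<Union>C" for i
  proof -
    obtain J where J: "J \<in> C" "i \<in> J" using i by blast
    then show ?thesis using G[OF J(1) span_base[OF sub[OF J(1)] J(2)]] gf by simp
  qed
  ultimately show "\<exists>g\<in>lin K (V\<lparr>carrier := sp (\<Union>C)\<rparr>) W. \<forall>i\<in>\<Union>C. g i = f i" by blast
qed

text \<open>A vector in the new span is y + a v for a unique y in the old span and a unique scalar
  a, so y + a v \<mapsto> g(y) + a f(v) is a well-defined linear map. Uniqueness combines
  invertibility of nonzero scalars with the choice of \<open>v\<close> outside the old span.\<close>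

lemma extendable_insert:
  assumes I: "extendable I" and v: "v \<in> carrier V" "v \<notin> sp I"
  shows "extendable (insert v I)"
  unfolding extendable_def
proof (intro conjI allI impI)
  have sub: "I \<subseteq> carrier V" using I by (simp add: extendable_def)
  then show "insert v I \<subseteq> carrier V" using v by simp
  fix W :: "'a space" and f assume W: "module K W" and f: "\<forall>i\<in>insert v I. f i \<in> carrier W"
  then have "\<exists>g \<in> lin K (V\<lparr>carrier := sp I\<rparr>) W. \<forall>i\<in>I. g i = f i"
    using I W unfolding extendable_def by blast
  then obtain g where g: "g \<in> lin K (V\<lparr>carrier := sp I\<rparr>) W" and gf: "\<And>i. i \<in> I \<Longrightarrow> g i = f i"
    by blast
  interpret W: module K W by fact
  have fv [simp]: "f v \<in> carrier W" using f by simp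
  have gs: "x \<in> sp I \<Longrightarrow> g x \<in> carrier W" "\<lbrakk>x \<in> sp I; y \<in> sp I\<rbrakk> \<Longrightarrow> g (x \<oplus>\<^bsub>V\<^esub> y) = g x \<oplus>\<^bsub>W\<^esub> g y"
    "\<lbrakk>a \<in> carrier K; x \<in> sp I\<rbrakk> \<Longrightarrow> g (a \<odot>\<^bsub>V\<^esub> x) = a \<odot>\<^bsub>W\<^esub> g x" for x y a
    using g by (auto simp: lin_def)
  note cl = span_closed[OF sub] and [simp] = v(1)
  have dec: "\<exists>y\<in>sp I. \<exists>a\<in>carrier K. x = y \<oplus>\<^bsub>V\<^esub> a \<odot>\<^bsub>V\<^esub> v" if "x \<in> sp (insert v I)" for x
    using that
  proof induction
    case zero
    show ?case by (rule bexI[OF _ lin_span.zero], rule bexI[of _ "\<zero>\<^bsub>K\<^esub>"]) simp_all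
  next
    case (step x b i)
    then obtain y a where y: "y \<in> sp I" "a \<in> carrier K" "x = y \<oplus>\<^bsub>V\<^esub> a \<odot>\<^bsub>V\<^esub> v" by blast
    show ?case
    proof (cases "i = v")
      case True
      then have "x \<oplus>\<^bsub>V\<^esub> b \<odot>\<^bsub>V\<^esub> i = y \<oplus>\<^bsub>V\<^esub> (a \<oplus>\<^bsub>K\<^esub> b) \<odot>\<^bsub>V\<^esub> v"
        using y cl[OF y(1)] step by (simp add: V.smult_l_distr V.a_assoc)
      then show ?thesis using y step by (intro bexI[OF _ y(1)] bexI[of _ "a \<oplus>\<^bsub>K\<^esub> b"]) auto
    next
      case False
      then have i: "i \<in> I" "i \<in> carrier V" using step sub by auto
      have "x \<oplus>\<^bsub>V\<^esub> b \<odot>\<^bsub>V\<^esub> i = (y \<oplus>\<^bsub>V\<^esub> b \<odot>\<^bsub>V\<^esub> i) \<oplus>\<^bsub>V\<^esub> a \<odot>\<^bsub>V\<^esub> v"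
        using y cl[OF y(1)] step i by (simp add: V.a_ac)
      then show ?thesis by (rule bexI[OF bexI[OF _ y(2)] lin_span.step[OF y(1) step.hyps(2) i(1)]])
    qed
  qed
  have uniq: "a = a' \<and> y = y'" if y: "y \<in> sp I" "y' \<in> sp I" and a: "a \<in> carrier K" "a' \<in> carrier K"
    and eq: "y \<oplus>\<^bsub>V\<^esub> a \<odot>\<^bsub>V\<^esub> v = y' \<oplus>\<^bsub>V\<^esub> a' \<odot>\<^bsub>V\<^esub> v" for a a' y y'
  proof -
    have yc: "y \<in> carrier V" "y' \<in> carrier V" using cl y by auto
    have "a = a'"
    proof (rule ccontr)
      assume "a \<noteq> a'"
      define d where "d = a \<ominus>\<^bsub>K\<^esub> a'"
      have "d \<oplus>\<^bsub>K\<^esub> a' = a" using a by (simp add: d_def a_minus_def K.a_assoc K.l_neg)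
      then have d: "d \<in> carrier K" "d \<noteq> \<zero>\<^bsub>K\<^esub>" using a \<open>a \<noteq> a'\<close> by (auto simp: d_def)
      have "d \<odot>\<^bsub>V\<^esub> v = a \<odot>\<^bsub>V\<^esub> v \<ominus>\<^bsub>V\<^esub> a' \<odot>\<^bsub>V\<^esub> v"
        using a by (simp add: d_def a_minus_def V.smult_l_distr V.smult_l_minus)
      also have "\<dots> = y' \<ominus>\<^bsub>V\<^esub> y"
      proof -
        have "a \<odot>\<^bsub>V\<^esub> v = (y' \<oplus>\<^bsub>V\<^esub> a' \<odot>\<^bsub>V\<^esub> v) \<ominus>\<^bsub>V\<^esub> y"
          using yc a by (simp flip: eq add: a_minus_def V.a_ac V.r_neg1 V.r_neg2)
        then show ?thesis using yc a by (simp add: a_minus_def V.a_ac V.r_neg V.r_neg1 V.r_neg2)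
      qed
      also have "\<dots> = y' \<oplus>\<^bsub>V\<^esub> (\<ominus>\<^bsub>K\<^esub> \<one>\<^bsub>K\<^esub>) \<odot>\<^bsub>V\<^esub> y"
        using yc by (simp add: a_minus_def V.smult_l_minus)
      also have "\<dots> \<in> sp I" by (rule span_add[OF sub span_smult[OF sub y(1)] y(2)]) simp
      finally have dv: "d \<odot>\<^bsub>V\<^esub> v \<in> sp I" .
      \<comment> \<open>The difference d of the two scalars is nonzero and d v lies in the span.
        Multiplying by the inverse of d would put \<open>v\<close> itself into the span.\<close>
      have i: "inv\<^bsub>K\<^esub> d \<in> carrier K" "inv\<^bsub>K\<^esub> d \<otimes>\<^bsub>K\<^esub> d = \<one>\<^bsub>K\<^esub>"
        using d by (simp_all add: K.field_Units)
      have "inv\<^bsub>K\<^esub> d \<odot>\<^bsub>V\<^esub> (d \<odot>\<^bsub>V\<^esub> v) \<in> sp I" by (rule span_smult[OF sub dv i(1)])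
      moreover have "inv\<^bsub>K\<^esub> d \<odot>\<^bsub>V\<^esub> (d \<odot>\<^bsub>V\<^esub> v) = v"
        using V.smult_assoc1[OF i(1) d(1) v(1)] i v by (simp add: V.smult_one)
      ultimately show False using v by simp
    qed
    then show ?thesis using eq yc a by simp
  qed
  define G where "G x = (let p = SOME p. fst p \<in> sp I \<and> snd p \<in> carrier K \<and> x = fst p \<oplus>\<^bsub>V\<^esub> snd p \<odot>\<^bsub>V\<^esub> v
      in g (fst p) \<oplus>\<^bsub>W\<^esub> snd p \<odot>\<^bsub>W\<^esub> f v)" for x
  have G: "G (y \<oplus>\<^bsub>V\<^esub> a \<odot>\<^bsub>V\<^esub> v) = g y \<oplus>\<^bsub>W\<^esub> a \<odot>\<^bsub>W\<^esub> f v" if ya: "y \<in> sp I" "a \<in> carrier K" for y a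
  proof -
    have ex: "\<exists>p. fst p \<in> sp I \<and> snd p \<in> carrier K \<and> y \<oplus>\<^bsub>V\<^esub> a \<odot>\<^bsub>V\<^esub> v = fst p \<oplus>\<^bsub>V\<^esub> snd p \<odot>\<^bsub>V\<^esub> v"
      using ya by (intro exI[of _ "(y, a)"]) simp
    define p where "p = (SOME p. fst p \<in> sp I \<and> snd p \<in> carrier K \<and> y \<oplus>\<^bsub>V\<^esub> a \<odot>\<^bsub>V\<^esub> v = fst p \<oplus>\<^bsub>V\<^esub> snd p \<odot>\<^bsub>V\<^esub> v)"
    have p: "fst p \<in> sp I" "snd p \<in> carrier K" "y \<oplus>\<^bsub>V\<^esub> a \<odot>\<^bsub>V\<^esub> v = fst p \<oplus>\<^bsub>V\<^esub> snd p \<odot>\<^bsub>V\<^esub> v"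
      using someI_ex[OF ex] unfolding p_def by simp_all
    show ?thesis
      unfolding G_def Let_def p_def[symmetric] using uniq[OF ya(1) p(1) ya(2) p(2,3)] by simp
  qed
  have "G \<in> lin K (V\<lparr>carrier := sp (insert v I)\<rparr>) W"
    unfolding lin_def
  proof (intro CollectI conjI ballI Pi_I; simp)
    fix x assume "x \<in> sp (insert v I)"
    then obtain y a where y: "y \<in> sp I" "a \<in> carrier K" "x = y \<oplus>\<^bsub>V\<^esub> a \<odot>\<^bsub>V\<^esub> v" using dec by blast
    note yc = cl[OF y(1)]
    show "G x \<in> carrier W" using y by (simp add: G gs)
    show "G (b \<odot>\<^bsub>V\<^esub> x) = b \<odot>\<^bsub>W\<^esub> G x" if b: "b \<in> carrier K" for b
    proof -
      have "b \<odot>\<^bsub>V\<^esub> x = b \<odot>\<^bsub>V\<^esub> y \<oplus>\<^bsub>V\<^esub> (b \<otimes>\<^bsub>K\<^esub> a) \<odot>\<^bsub>V\<^esub> v"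
        using y yc b by (simp add: V.smult_r_distr V.smult_assoc1)
      then show ?thesis using y b
        by (simp add: G gs span_smult[OF sub] W.smult_r_distr W.smult_assoc1)
    qed
    fix x' assume "x' \<in> sp (insert v I)"
    then obtain y' a' where y': "y' \<in> sp I" "a' \<in> carrier K" "x' = y' \<oplus>\<^bsub>V\<^esub> a' \<odot>\<^bsub>V\<^esub> v" using dec by blast
    have "x \<oplus>\<^bsub>V\<^esub> x' = (y \<oplus>\<^bsub>V\<^esub> y') \<oplus>\<^bsub>V\<^esub> (a \<oplus>\<^bsub>K\<^esub> a') \<odot>\<^bsub>V\<^esub> v"
      using y y' yc cl[OF y'(1)] by (simp add: V.smult_l_distr V.a_ac)
    then show "G (x \<oplus>\<^bsub>V\<^esub> x') = G x \<oplus>\<^bsub>W\<^esub> G x'"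
      using y y' by (simp add: G gs span_add[OF sub] W.smult_l_distr W.a_ac)
  qed
  moreover have "G i = f i" if i: "i \<in> insert v I" for i
  proof (cases "i = v")
    case True
    then show ?thesis using G[OF lin_span.zero K.one_closed] gs(3)[OF K.zero_closed lin_span.zero] gs(1)[OF lin_span.zero]
      by (simp add: V.smult_one W.smult_one)
  next
    case False
    then have "i \<in> I" "i \<in> carrier V" using i sub by auto
    then show ?thesis using G[OF span_base[OF sub] K.zero_closed, of i] f by (simp add: gf)
  qed
  ultimately show "\<exists>g\<in>lin K (V\<lparr>carrier := sp (insert v I)\<rparr>) W. \<forall>i\<in>insert v I. g i = f i" by blast
qed

text \<open>Zorn's lemma provides a maximal extendable set, and by \<open>extendable_insert\<close>
  it spans the space. The basis is delivered as existence and uniqueness of linear extensions, which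
  is the universal property of a coproduct of copies of the field.\<close>

lemma basis_exists:
  obtains I where "I \<subseteq> carrier V"
    and "\<And>(W :: 'a space) f. \<lbrakk>module K W; \<And>i. i \<in> I \<Longrightarrow> f i \<in> carrier W\<rbrakk> \<Longrightarrow> \<exists>g \<in> lin K V W. \<forall>i\<in>I. g i = f i"
    and "\<And>(W :: 'a space) g g' x. \<lbrakk>module K W; g \<in> lin K V W; g' \<in> lin K V W; \<And>i. i \<in> I \<Longrightarrow> g i = g' i; x \<in> carrier V\<rbrakk> \<Longrightarrow> g x = g' x"
proof -
  have e: "extendable {}"
    unfolding extendable_def
  proof (intro conjI allI impI)
    fix W :: "'a space" and f assume W: "module K W"
    interpret W: module K W by fact
    have "x = \<zero>\<^bsub>V\<^esub>" if "x \<in> sp {}" for x using that by induction auto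
    then show "\<exists>g\<in>lin K (V\<lparr>carrier := sp {}\<rparr>) W. \<forall>i\<in>{}. g i = f i"
      by (intro bexI[of _ "\<lambda>_. \<zero>\<^bsub>W\<^esub>"]) (auto simp: lin_def)
  qed simp
  have "\<exists>I\<in>{I. extendable I}. \<forall>J\<in>{I. extendable I}. I \<subseteq> J \<longrightarrow> J = I"
    by (rule subset_Zorn_nonempty) (use e extendable_chain in auto)
  then obtain I where I: "extendable I" and max: "\<And>J. extendable J \<Longrightarrow> I \<subseteq> J \<Longrightarrow> J = I" by auto
  have sub: "I \<subseteq> carrier V" using I by (simp add: extendable_def)
  have "v \<in> sp I" if "v \<in> carrier V" for v
    using extendable_insert[OF I that] max[of "insert v I"] span_base[OF sub, of v] by blast
  then have sp: "sp I = carrier V" using span_closed[OF sub] by blast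
  then have VI: "V\<lparr>carrier := sp I\<rparr> = V" by simp
  show ?thesis
  proof (rule that[OF sub])
    show "\<exists>g \<in> lin K V W. \<forall>i\<in>I. g i = f i" if "module K W" "\<And>i. i \<in> I \<Longrightarrow> f i \<in> carrier W" for W :: "'a space" and f
      using I that by (auto simp: extendable_def VI)
    show "g x = g' x" if "module K W" "g \<in> lin K V W" "g' \<in> lin K V W" "\<And>i. i \<in> I \<Longrightarrow> g i = g' i" "x \<in> carrier V"
      for W :: "'a space" and g g' x
      using lin_span_eqI[OF sub, of g W g' x] that by (simp add: VI sp)
  qed
qed

end

section \<open>Semisimplicity and the equivalence with vector spaces\<close>

context bialgebra
begin

text \<open>An endomorphism of the one-dimensional space is multiplication by its value at 1, and
  this scalar is invertible unless the endomorphism is zero.\<close>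

lemma ground_simple: "simple_object (Vec K) (ground K)"
  unfolding simple_object_def
proof (intro conjI ballI impI)
  interpret field K by (rule base_field)
  interpret Vec: linear_category K "Vec K" by (rule Vec_linear)
  show "ground K \<in> Obj (Vec K)" by simp
  fix f assume "f \<in> arr (Vec K) (ground K) (ground K)" and nz: "f \<noteq> \<zero>\<^bsub>Hom (Vec K) (ground K) (ground K)\<^esub>"
  then obtain f0 where f: "f = Arrow (ground K) (ground K) f0" and f0: "f0 \<in> lin K (ground K) (ground K)" "f0 \<in> extensional (carrier K)"
    by (auto simp: Vec_Hom)
  define u where "u = f0 \<one>\<^bsub>K\<^esub>"
  have u: "u \<in> carrier K" using lin_closed[OF f0(1), of "\<one>\<^bsub>K\<^esub>"] by (simp add: u_def)
  have f0_eq: "f0 c = c \<otimes>\<^bsub>K\<^esub> u" if "c \<in> carrier K" for c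
    using lin_smult[OF f0(1), of c "\<one>\<^bsub>K\<^esub>"] that by (simp add: u_def)
  have "u \<noteq> \<zero>\<^bsub>K\<^esub>"
  proof
    assume "u = \<zero>\<^bsub>K\<^esub>"
    then have "f0 = (\<lambda>x \<in> carrier K. \<zero>\<^bsub>K\<^esub>)"
      using f0(2) by (intro extensionalityI[where A="carrier K"]) (simp_all add: f0_eq)
    then show False using nz by (simp add: f Vec_def Hom_concrete_category)
  qed
  then have ui: "inv\<^bsub>K\<^esub> u \<in> carrier K" "u \<otimes>\<^bsub>K\<^esub> inv\<^bsub>K\<^esub> u = \<one>\<^bsub>K\<^esub>" "inv\<^bsub>K\<^esub> u \<otimes>\<^bsub>K\<^esub> u = \<one>\<^bsub>K\<^esub>" using u by (simp_all add: field_Units)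
  have g: "(\<lambda>c \<in> carrier K. c \<otimes>\<^bsub>K\<^esub> inv\<^bsub>K\<^esub> u) \<in> lin K (ground K) (ground K)"
    by (rule linI) (use ui in \<open>simp_all add: l_distr m_assoc\<close>)
  have "iso_arr (Vec K) f"
  proof (rule Vec.iso_arrI[where g="Arrow (ground K) (ground K) (\<lambda>c \<in> carrier K. c \<otimes>\<^bsub>K\<^esub> inv\<^bsub>K\<^esub> u)"])
  qed (use f0 u ui g in \<open>simp_all add: f compose_def f0_eq m_assoc cong: restrict_cong\<close>)
  then show "is_iso (Vec K) (ground K) (ground K) f" by (simp add: Vec.is_iso_iff f)
qed

text \<open>A basis presents the space as a coproduct of copies of the ground field, indexed by the
  basis vectors themselves. The injection at i is c \<mapsto> c i.\<close>

lemma Vec_direct_sum: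
  fixes V :: "'a space"
  assumes [simp]: "module K V"
  shows "\<exists>I :: 'a univ set. \<exists>S inc. (\<forall>i\<in>I. simple_object (Vec K) (S i)) \<and> is_direct_sum (Vec K) I S inc V"
proof -
  obtain I where I: "I \<subseteq> carrier V"
    and ex: "\<And>(W :: 'a space) f. \<lbrakk>module K W; \<And>i. i \<in> I \<Longrightarrow> f i \<in> carrier W\<rbrakk> \<Longrightarrow> \<exists>g \<in> lin K V W. \<forall>i\<in>I. g i = f i"
    and uniq: "\<And>(W :: 'a space) g g' x. \<lbrakk>module K W; g \<in> lin K V W; g' \<in> lin K V W; \<And>i. i \<in> I \<Longrightarrow> g i = g' i; x \<in> carrier V\<rbrakk> \<Longrightarrow> g x = g' x"
    by (rule basis_exists[OF base_field assms]) blast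
  interpret V: module K V by fact
  define inc where "inc i = Arrow (ground K) V (\<lambda>c \<in> carrier K. c \<odot>\<^bsub>V\<^esub> i)" for i
  have inc_lin: "(\<lambda>c \<in> carrier K. c \<odot>\<^bsub>V\<^esub> i) \<in> lin K (ground K) V" if "i \<in> carrier V" for i
    using lin_restrict[OF module_ground, of "\<lambda>c. c \<odot>\<^bsub>V\<^esub> i" V] that by simp
  have "is_direct_sum (Vec K) I (\<lambda>_. ground K) inc V"
    unfolding is_direct_sum_def
  proof (intro conjI ballI allI impI)
    fix i assume "i \<in> I"
    then show "inc i \<in> arr (Vec K) (ground K) V" using I inc_lin[of i] by (auto simp: inc_def Vec_Hom)
  next
    fix W f assume "W \<in> Obj (Vec K)" and f: "\<forall>i\<in>I. f i \<in> arr (Vec K) (ground K) W"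
    then have [simp]: "module K W" by simp
    interpret W: module K W by fact
    have f': "f i = Arrow (ground K) W (mor (f i))" "mor (f i) \<in> lin K (ground K) W" "mor (f i) \<in> extensional (carrier K)"
      if "i \<in> I" for i using bspec[OF f that] by (auto simp: Vec_Hom)
    have f_mor: "mor (f i) c = c \<odot>\<^bsub>W\<^esub> mor (f i) \<one>\<^bsub>K\<^esub>" if "i \<in> I" "c \<in> carrier K" for i c
      using lin_smult[OF f'(2)[OF that(1)], of c "\<one>\<^bsub>K\<^esub>"] that by simp
    \<comment> \<open>A map out of the ground field is determined by its value at 1. Hence the
      condition on the summand at \<open>i\<close> only prescribes the value of \<open>g\<close> at
      the basis vector \<open>i\<close>.\<close>
    have comp: "Arrow V W g \<cdot>\<^bsub>Vec K\<^esub> inc i = f i \<longleftrightarrow> g i = mor (f i) \<one>\<^bsub>K\<^esub>" if g: "g \<in> lin K V W" and i: "i \<in> I" for g i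
    proof -
      have iV: "i \<in> carrier V" using I i by auto
      have "Arrow V W g \<cdot>\<^bsub>Vec K\<^esub> inc i = Arrow (ground K) W (\<lambda>c \<in> carrier K. c \<odot>\<^bsub>W\<^esub> g i)"
        using iV by (simp add: inc_def compose_def lin_smult[OF g] cong: restrict_cong)
      moreover have "(\<lambda>c \<in> carrier K. c \<odot>\<^bsub>W\<^esub> g i) = mor (f i) \<longleftrightarrow> g i = mor (f i) \<one>\<^bsub>K\<^esub>"
      proof
        assume "(\<lambda>c \<in> carrier K. c \<odot>\<^bsub>W\<^esub> g i) = mor (f i)"
        then have "(\<lambda>c \<in> carrier K. c \<odot>\<^bsub>W\<^esub> g i) \<one>\<^bsub>K\<^esub> = mor (f i) \<one>\<^bsub>K\<^esub>" by simp
        then show "g i = mor (f i) \<one>\<^bsub>K\<^esub>" using lin_closed[OF g iV] by (simp add: W.smult_one)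
      next
        assume "g i = mor (f i) \<one>\<^bsub>K\<^esub>"
        then show "(\<lambda>c \<in> carrier K. c \<odot>\<^bsub>W\<^esub> g i) = mor (f i)"
        proof (intro extensionalityI[where A="carrier K"])
          fix c assume "c \<in> carrier K"
          with f_mor[OF i this] \<open>g i = _\<close> show "(\<lambda>c \<in> carrier K. c \<odot>\<^bsub>W\<^esub> g i) c = mor (f i) c" by simp
        qed (simp_all add: f'(3)[OF i])
      qed
      ultimately show ?thesis using f'(1)[OF i] by (metis arrow.inject)
    qed
    obtain g0 where g0: "g0 \<in> lin K V W" "\<And>i. i \<in> I \<Longrightarrow> g0 i = mor (f i) \<one>\<^bsub>K\<^esub>"
      using ex[of W "\<lambda>i. mor (f i) \<one>\<^bsub>K\<^esub>"] lin_closed[OF f'(2)] by auto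
    define g where "g = restrict g0 (carrier V)"
    have g: "g \<in> lin K V W" "g \<in> extensional (carrier V)" "\<And>i. i \<in> I \<Longrightarrow> g i = mor (f i) \<one>\<^bsub>K\<^esub>"
      using g0 I by (auto simp: g_def)
    show "\<exists>!g. g \<in> arr (Vec K) V W \<and> (\<forall>i\<in>I. g \<cdot>\<^bsub>Vec K\<^esub> inc i = f i)"
    proof (rule ex1I[of _ "Arrow V W g"])
      show "Arrow V W g \<in> arr (Vec K) V W \<and> (\<forall>i\<in>I. Arrow V W g \<cdot>\<^bsub>Vec K\<^esub> inc i = f i)"
        using g by (auto simp: comp Vec_Hom simp del: Vec_simps(4))
      fix g' assume g': "g' \<in> arr (Vec K) V W \<and> (\<forall>i\<in>I. g' \<cdot>\<^bsub>Vec K\<^esub> inc i = f i)"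
      then obtain h where h: "g' = Arrow V W h" "h \<in> lin K V W" "h \<in> extensional (carrier V)" by (auto simp: Vec_Hom)
      have "h i = g i" if "i \<in> I" for i
        using g' comp[OF h(2) that] g(3)[OF that] that by (auto simp: h(1) simp del: Vec_simps(4))
      then have "h = g"
        using h(3) g(2) uniq[OF \<open>module K W\<close> h(2) g(1)] by (intro extensionalityI[where A="carrier V"]) auto
      then show "g' = Arrow V W g" by (simp add: h)
    qed
  qed simp_all
  then show ?thesis
    by (intro exI[of _ I] exI[of _ "\<lambda>_. ground K"] exI[of _ inc] conjI ballI ground_simple)
qed

lemma free_inclusion_weak_equivalence: "weak_equivalence K (Free CC TT) (EM CC TT) (free_inclusion TT)"
  by (rule linear_monad.free_inclusion_weak_equivalence[OF cotensor_linear_monad free_essentially_surjective])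

text \<open>Transport of the action along the inclusion of the free modules, which is an equivalence
  because every module is free.\<close>

lemma extended_action_exists: "\<exists>L. extends_free_action K CC TT (cotensor_lax K B (bullet K B)) L"
proof -
  interpret action_transport K CC "Free CC TT" FA "EM CC TT" "free_inclusion TT"
    by (rule action_transport.intro[OF free_inclusion_weak_equivalence free_module_category])
  show ?thesis
    unfolding extends_free_action_def using transported_module_category transported_strong by blast
qed

text \<open>By assumption the inclusion of the free modules is strong for \<open>L\<close>. Its
  quasi-inverse is then strong too, and is followed by \<open>P\<close>.\<close>

lemma extended_action_fiber:
  assumes "extends_free_action K CC TT (cotensor_lax K B (bullet K B)) L"
  obtains F s where "strong_module_functor K CC (EM CC TT) L (Vec K) (fiber_action K) F s"
    "weak_equivalence K (EM CC TT) (Vec K) F"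
proof -
  obtain s where s: "strong_module_functor K CC (Free CC TT) FA (EM CC TT) L (free_inclusion TT) s"
    using assms by (auto simp: extends_free_action_def)
  interpret J: weak_module_equivalence K CC "Free CC TT" FA "EM CC TT" L "free_inclusion TT" s
    by (rule weak_module_equivalence.intro[OF s free_inclusion_weak_equivalence])
  note strong = strong_module_functor_comp[OF J.G_strong P_strong]
  interpret F: strong_module_functor K CC "EM CC TT" L "Vec K" "fiber_action K" "comp_funct P J.G"
    "\<lambda>W X. FArr P (J.inverse_strength W X) \<cdot>\<^bsub>Vec K\<^esub> Ident (Vec K) (Act (fiber_action K) W (FObj P (FObj J.G X)))"
    by (rule strong)
  have "linear_functor K (EM CC TT) (Vec K) (comp_funct P J.G)" by unfold_locales
  then show ?thesis
    using strong weak_equivalence_comp[OF J.G_weak_equivalence P_weak_equivalence] that by blast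
qed

text \<open>Read off from vector spaces along the equivalence that belongs to some extension of the
  action.\<close>

lemma EM_semisimple: "semisimple (EM CC TT)"
proof -
  obtain L where "extends_free_action K CC TT (cotensor_lax K B (bullet K B)) L" using extended_action_exists by blast
  then obtain F where F: "weak_equivalence K (EM CC TT) (Vec K) F" by (rule extended_action_fiber)
  show ?thesis
  proof (rule weak_equivalence.semisimple_reflected[OF F])
    \<comment> \<open>The summands of a vector space are indexed by vectors, but
      \<open>semisimple\<close> asks for indices among the arrows. A vector is encoded in an arrow
      by a constant function; the end points are arbitrary, since the arrow serves as a label
      only.\<close>
    show "inj (\<lambda>v :: 'a univ. Arrow undefined undefined (Arrow undefined undefined (\<lambda>_. v)))"
      by (auto intro!: injI dest: fun_cong)
    fix V assume "V \<in> Obj (Vec K)"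
    then show "\<exists>I :: 'a univ set. \<exists>S inc. (\<forall>i\<in>I. simple_object (Vec K) (S i)) \<and> is_direct_sum (Vec K) I S inc V"
      by (simp only: Vec_simps mem_Collect_eq Vec_direct_sum)
  qed
qed

end

text \<open>The module structure on all modules is specified by a property, that it extends the one
  on free modules. The second conjunct shows that such a structure exists, so that the third, which
  treats all of them, is not vacuous.\<close>

theorem corollary8p5:
  fixes K :: "'a univ ring" and B :: "'a bialg"
  assumes "field K" and "bialgebra K B"
  shows "semisimple_monad K (Comod K B) (cotensor_monad K B (bullet K B)) \<and>
    (\<exists>L. extends_free_action K (Comod K B) (cotensor_monad K B (bullet K B))
            (cotensor_lax K B (bullet K B)) L) \<and>
    (\<forall>L. extends_free_action K (Comod K B) (cotensor_monad K B (bullet K B))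
            (cotensor_lax K B (bullet K B)) L \<longrightarrow>
         module_category_equivalence K (Comod K B)
            (EM (Comod K B) (cotensor_monad K B (bullet K B))) L
            (Vec K) (fiber_action K))"
proof (intro conjI allI impI)
  interpret bialgebra K B by fact
  show "semisimple_monad K CC TT"
    by (simp add: semisimple_monad_def cotensor_linear_monad EM_semisimple)
  show "\<exists>L. extends_free_action K CC TT (cotensor_lax K B (bullet K B)) L" by (rule extended_action_exists)
  fix L assume "extends_free_action K CC TT (cotensor_lax K B (bullet K B)) L"
  then obtain F s where "strong_module_functor K CC (EM CC TT) L (Vec K) (fiber_action K) F s"
    "weak_equivalence K (EM CC TT) (Vec K) F" by (rule extended_action_fiber)
  then show "module_category_equivalence K CC (EM CC TT) L (Vec K) (fiber_action K)"
    unfolding module_category_equivalence_def using weak_equivalence.equivalence by blast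
qed

end
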